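(* Let $F|K$ be a one-dimensional separable function field over a field $K$ of characteristic $p>0$, and let $\mathfrak{p}$ be a singular prime of $F|K$. Then: (i) The restriction $\mathfrak{p}_n$ of $\mathfrak{p}$ to the $n$th Frobenius pullback $F_n|K = F^{p^n}K|K$ is separable for all integers $n \geq \log_p \big( 2 \, \frac{\delta(\mathfrak{p})}{[\kappa(\mathfrak{p}):K]_{sep}} + 1 \big)$; moreover, if the integer $\frac 2{p-1} \frac{\delta(\mathfrak{p})}{[\kappa(\mathfrak{p}):K]_{sep}}$ is not a sum of consecutive powers of $p$ (i.e. not of the form $p^j+p^{j+1}+\dots+p^i$ with $0\le j\le i$), then $\mathfrak{p}_n$ is separable for all $n \geq \log_p \big( 2 \, \frac{\delta(\mathfrak{p})}{[\kappa(\mathfrak{p}):K]_{sep}} + 1 \big) - 1$. (ii) If in addition $\mathfrak{p}$ is non-decomposed, then $\mathfrak{p}_n$ is rational for all $n \geq \log_p ( 2\delta(\mathfrak{p}) + 1 )$; moreover, if the integer $\frac 2{p-1}\delta(\mathfrak{p})$ is not a sum of consecutive powers of $p$, then $\mathfrak{p}_n$ is rational for all $n \geq \log_p ( 2\delta(\mathfrak{p}) + 1 ) - 1$.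
   Context: A one-dimensional separable function field $F|K$ is a finitely generated separable field extension of transcendence degree $1$ such that $K$ is algebraically closed in $F$. A prime $\mathfrak p$ of $F|K$ is (the maximal ideal of) a discrete valuation ring $\mathcal O_{\mathfrak p}\subset F$ containing $K$ with fraction field $F$; $\kappa(\mathfrak p)$ is its residue field, $\deg\mathfrak p=[\kappa(\mathfrak p):K]$, $\mathfrak p$ is rational if $\deg\mathfrak p=1$ and separable if $\kappa(\mathfrak p)|K$ is separable; $[\kappa(\mathfrak p):K]_{sep}$ denotes the separable degree. For an algebraic extension $K'|K$ put $K'\cdot\mathcal O_{\mathfrak p}=K'\otimes_K\mathcal O_{\mathfrak p}$, a domain with fraction field $K'\otimes_K F$. The geometric singularity degree $\delta(\mathfrak p)$ is $\dim_{\overline K}\widetilde{\overline K\cdot\mathcal O_{\mathfrak p}}/\overline K\cdot\mathcal O_{\mathfrak p}$, where $\overline K$ is an algebraic closure and the tilde denotes integral closure in $\overline K\otimes_K F$; $\mathfrak p$ is singular if $\delta(\mathfrak p)>0$. The $n$th Frobenius pullback is $F_n=KF^{p^n}$, and $\mathfrak p_n$ denotes the restriction of $\mathfrak p$ to $F_n$ (a prime of $F_n|K$). The prime $\mathfrak p$ is decomposed if more than one prime of the function field $\overline K F|\overline K$ lies over $\mathfrak p$, and non-decomposed otherwise. *)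

theory Defs
  imports Complex_Main "HOL-Computational_Algebra.Polynomial_Factorial"
begin

text \<open>All fields considered live inside an ambient field of type 'a (a type of class field).
  Subfields / subrings are represented as subsets of 'a.\<close>

definition is_subring :: "'a::field set \<Rightarrow> bool" where
  "is_subring R \<longleftrightarrow> 0 \<in> R \<and> 1 \<in> R \<and> (\<forall>x\<in>R. \<forall>y\<in>R. x + y \<in> R \<and> x * y \<in> R) \<and> (\<forall>x\<in>R. - x \<in> R)"

definition is_subfield :: "'a::field set \<Rightarrow> bool" where
  "is_subfield S \<longleftrightarrow> is_subring S \<and> (\<forall>x\<in>S. inverse x \<in> S)"

definition gen_ring :: "'a::field set \<Rightarrow> 'a set" where
  "gen_ring X = \<Inter>{R. is_subring R \<and> X \<subseteq> R}"

definition gen_field :: "'a::field set \<Rightarrow> 'a set" where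
  "gen_field X = \<Inter>{S. is_subfield S \<and> X \<subseteq> S}"

definition poly_over :: "'a::field set \<Rightarrow> 'a poly \<Rightarrow> bool" where
  "poly_over R f \<longleftrightarrow> (\<forall>i. coeff f i \<in> R)"

definition algebraic_over :: "'a::field set \<Rightarrow> 'a \<Rightarrow> bool" where
  "algebraic_over K x \<longleftrightarrow> (\<exists>f. f \<noteq> 0 \<and> poly_over K f \<and> poly f x = 0)"

definition integral_over :: "'a::field set \<Rightarrow> 'a \<Rightarrow> bool" where
  "integral_over R x \<longleftrightarrow> (\<exists>f. lead_coeff f = 1 \<and> poly_over R f \<and> poly f x = 0)"

definition separable_over :: "'a::field set \<Rightarrow> 'a \<Rightarrow> bool" where
  "separable_over K x \<longleftrightarrow> (\<exists>f. poly_over K f \<and> coprime f (pderiv f) \<and> poly f x = 0)"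

definition lin_indep_mod :: "'a::field set \<Rightarrow> 'a set \<Rightarrow> 'a list \<Rightarrow> bool" where
  "lin_indep_mod k B xs \<longleftrightarrow>
     (\<forall>cs. length cs = length xs \<and> set cs \<subseteq> k \<and> (\<Sum>i<length xs. cs ! i * xs ! i) \<in> B
        \<longrightarrow> (\<forall>c\<in>set cs. c = 0))"

text \<open>Dimension over the subfield k of the quotient A/B (A, B k-subspaces with B \<subseteq> A).
  Only meaningful when finite, which is the case in all uses below.\<close>
definition qdim :: "'a::field set \<Rightarrow> 'a set \<Rightarrow> 'a set \<Rightarrow> nat" where
  "qdim k A B = (GREATEST n. \<exists>xs. length xs = n \<and> set xs \<subseteq> A \<and> lin_indep_mod k B xs)"

definition one_dim_sep_function_field :: "'a::field set \<Rightarrow> 'a set \<Rightarrow> bool" where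
  "one_dim_sep_function_field K F \<longleftrightarrow>
     is_subfield K \<and> is_subfield F \<and> K \<subseteq> F \<and>
     (\<exists>X. finite X \<and> X \<subseteq> F \<and> F = gen_field (K \<union> X)) \<and>
     (\<exists>t\<in>F. \<not> algebraic_over K t \<and> (\<forall>x\<in>F. separable_over (gen_field (K \<union> {t})) x)) \<and>
     (\<forall>x\<in>F. algebraic_over K x \<longrightarrow> x \<in> K)"

text \<open>A prime of F|K: a discrete valuation ring Op with K \<subseteq> Op \<subseteq> F and fraction field F,
  i.e. there is a uniformizer t (a non-unit of Op) such that every nonzero x of F is u * t^k
  with u a unit of Op and k an integer.\<close>
definition is_prime_of :: "'a::field set \<Rightarrow> 'a set \<Rightarrow> 'a set \<Rightarrow> bool" where
  "is_prime_of K F Op \<longleftrightarrow> is_subring Op \<and> K \<subseteq> Op \<and> Op \<subseteq> F \<and>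
     (\<exists>t\<in>Op. inverse t \<notin> Op \<and>
        (\<forall>x\<in>F. x \<noteq> 0 \<longrightarrow> (\<exists>u k. u \<in> Op \<and> inverse u \<in> Op \<and> x = u * t powi k)))"

definition pmax :: "'a::field set \<Rightarrow> 'a set" where
  "pmax Op = {x\<in>Op. x = 0 \<or> inverse x \<notin> Op}"

definition prime_deg :: "'a::field set \<Rightarrow> 'a set \<Rightarrow> nat" where
  "prime_deg K Op = qdim K Op (pmax Op)"

definition rational_prime :: "'a::field set \<Rightarrow> 'a set \<Rightarrow> bool" where
  "rational_prime K Op \<longleftrightarrow> prime_deg K Op = 1"

text \<open>Elements of Op whose residue class is separable algebraic over K.\<close>
definition sep_part :: "'a::field set \<Rightarrow> 'a set \<Rightarrow> 'a set" where
  "sep_part K Op = {x\<in>Op. \<exists>f. poly_over K f \<and> coprime f (pderiv f) \<and> poly f x \<in> pmax Op}"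

definition separable_prime :: "'a::field set \<Rightarrow> 'a set \<Rightarrow> bool" where
  "separable_prime K Op \<longleftrightarrow> sep_part K Op = Op"

definition sep_deg :: "'a::field set \<Rightarrow> 'a set \<Rightarrow> nat" where
  "sep_deg K Op = qdim K (sep_part K Op) (pmax Op)"

definition is_alg_closure_in :: "'a::field set \<Rightarrow> 'a set \<Rightarrow> bool" where
  "is_alg_closure_in K Kbar \<longleftrightarrow> is_subfield Kbar \<and> K \<subseteq> Kbar \<and>
     (\<forall>x\<in>Kbar. algebraic_over K x) \<and>
     (\<forall>f. poly_over Kbar f \<and> degree f > 0 \<longrightarrow> (\<exists>x\<in>Kbar. poly f x = 0))"

text \<open>Kbar and F linearly disjoint over K: then Kbar \<otimes>_K F is identified with the ring
  generated by Kbar and F (which is the compositum field), and Kbar \<otimes>_K Op with gen_ring (Kbar \<union> Op).\<close>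
definition lin_disjoint :: "'a::field set \<Rightarrow> 'a set \<Rightarrow> 'a set \<Rightarrow> bool" where
  "lin_disjoint K Kbar F \<longleftrightarrow>
     (\<forall>xs. set xs \<subseteq> F \<and> lin_indep_mod K {0} xs \<longrightarrow> lin_indep_mod Kbar {0} xs)"

definition sing_deg :: "'a::field set \<Rightarrow> 'a set \<Rightarrow> 'a set \<Rightarrow> nat" where
  "sing_deg Kbar F Op =
     qdim Kbar {x \<in> gen_field (Kbar \<union> F). integral_over (gen_ring (Kbar \<union> Op)) x}
          (gen_ring (Kbar \<union> Op))"

text \<open>Non-decomposed: at most one prime of Kbar F | Kbar lies over p (there is always one).\<close>
definition non_decomposed :: "'a::field set \<Rightarrow> 'a set \<Rightarrow> 'a set \<Rightarrow> bool" where
  "non_decomposed Kbar F Op \<longleftrightarrow>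
     (\<forall>Op1 Op2. is_prime_of Kbar (gen_field (Kbar \<union> F)) Op1 \<and> Op1 \<inter> F = Op \<and>
              is_prime_of Kbar (gen_field (Kbar \<union> F)) Op2 \<and> Op2 \<inter> F = Op \<longrightarrow> Op1 = Op2)"

definition frob_pullback :: "nat \<Rightarrow> 'a::field set \<Rightarrow> 'a set \<Rightarrow> nat \<Rightarrow> 'a set" where
  "frob_pullback p K F n = gen_field (K \<union> (\<lambda>x. x ^ (p ^ n)) ` F)"

definition cons_pow_sum :: "nat \<Rightarrow> real \<Rightarrow> bool" where
  "cons_pow_sum p r \<longleftrightarrow> (\<exists>j i. j \<le> i \<and> r = (\<Sum>k=j..i. real p ^ k))"

end

theory Submission imports Defs begin

text \<open>
  Let \<open>O\<^sub>n\<close> be the valuation ring of \<open>\<pp>\<^sub>n\<close>. For some \<open>N\<close> the residue field of \<open>\<pp>\<^sub>N\<close> is spanned over \<open>K\<close> by its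
  \<open>p\<close>-th powers. Mac Lane's criterion then makes \<open>\<pp>\<^sub>N\<close> separable with \<open>[\<kappa>(\<pp>\<^sub>N) : K] = [\<kappa>(\<pp>) : K]\<^sub>s\<^sub>e\<^sub>p = s\<close> and the ring generated
  by \<open>O\<^sub>N\<close> and the algebraic closure integrally closed. Extracting \<open>q\<close>-th roots for \<open>q = p\<^sup>N\<close> turns \<open>\<delta>(\<pp>)\<close> into the
  \<open>K\<close>-dimension of \<open>O\<^sub>N\<close> modulo the \<open>K\<close>-span of the \<open>q\<close>-th powers of \<open>O\<^sub>0\<close>, which is a question about discrete valuation
  rings inside \<open>F\<close>.

  Each \<open>O\<^sub>i\<close> is free over \<open>O\<^sub>i\<^sub>+\<^sub>1\<close> on the powers \<open>1, z\<^sub>i, \<dots>, z\<^sub>i\<^sup>p\<^sup>-\<^sup>1\<close> of one element. Comparing the bases of powers of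
  \<open>z\<^sub>i\<^sup>q\<close> with the valuation gives \<open>2 \<delta>(\<pp>) = (p - 1) s \<Sum>\<^sub>i c\<^sub>i p\<^sup>i\<close>, where \<open>c\<^sub>i + 1\<close> is the order of the best approximation of
  \<open>z\<^sub>i\<^sup>q\<close> from the next field of the tower. Differentiating \<open>z\<^sub>i\<^sup>p\<close> as a polynomial in \<open>z\<^sub>i\<^sub>+\<^sub>1\<close> shows that
  \<open>c\<^sub>i - c\<^sub>i\<^sub>+\<^sub>1\<close> is a nonnegative multiple of \<open>[\<kappa>(\<pp>\<^sub>i\<^sub>+\<^sub>1) : K] / s\<close>, a power of \<open>p\<close>; the bounds in (i) are then arithmetic.
  For (ii), if \<open>s > 1\<close> then two localizations of the ring generated by \<open>O\<^sub>N\<close> and the algebraic closure yield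
  two primes over \<open>\<pp>\<close>.
\<close>

section \<open>Spans and dimensions\<close>

text \<open>Residue fields are not subsets of the ambient field and are never formed: statements
  about them are congruences modulo \<open>I n 1\<close>. Tensor products with the closure are
  spans, and linear disjointness is what lets a span be cut back to \<open>F\<close>; through it the
  Frobenius, although only semilinear over a possibly imperfect \<open>K\<close>, preserves
  colengths. The existence of \<open>N\<close> is not formal: the span of the
  \<open>p\<^sup>n\<close>-th powers of \<open>O\<^sub>0\<close> must have bounded colength in
  \<open>O\<^sub>n\<close>, and the uniform denominators behind this come from separability of the
  function field. With \<open>W\<close> the sum of the \<open>c\<^sub>i p\<^sup>i\<close>, the
  bounds arise as follows. If \<open>\<pp>\<^sub>n\<close> is not separable, then
  \<open>p\<^sup>n \<le> W \<le> (p - 1) W = 2 \<delta>(\<pp>) / s\<close>, so \<open>n\<close> is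
  below the stated logarithm. If moreover \<open>(p - 1) W < p\<^sup>n\<^sup>+\<^sup>1\<close>, the
  digits are as small as possible, and \<open>W\<close>, the integer in the statement, is a sum of
  consecutive powers of \<open>p\<close>. Singularity gives \<open>W > 0\<close>; otherwise the
  residue degree could drop while all digits are 0.\<close>

locale char_p =
  fixes p :: nat and ty :: "'a::field itself"
  assumes prime_p: "prime p" and char_p0: "of_nat p = (0::'a)"
begin

lemma p_pos: "p > 0" and p_gt1: "p > 1"
  using prime_p prime_gt_1_nat prime_gt_0_nat by auto

lemma CHAR_p: "CHAR('a) = p"
  using prime_p char_p0 by (metis CHAR_not_1 One_nat_def of_nat_eq_0_iff_char_dvd prime_nat_iff)

lemma freshman: "(x + y) ^ (p ^ n) = x ^ (p ^ n) + (y::'a) ^ (p ^ n)"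
  by (rule freshmans_dream') (simp_all add: CHAR_p prime_p)

lemma frob_sum: "(\<Sum>i\<in>A. f i) ^ (p ^ n) = (\<Sum>i\<in>A. (f i :: 'a) ^ (p ^ n))"
  by (induction A rule: infinite_finite_induct) (simp_all add: freshman p_pos)

lemma frob_uminus: "(- x) ^ (p ^ n) = - ((x::'a) ^ (p ^ n))"
proof -
  have "x ^ (p ^ n) + (- x) ^ (p ^ n) = 0" using freshman[of x "- x" n] p_pos by (simp add: power_0_left)
  then show ?thesis by (simp add: eq_neg_iff_add_eq_0 add.commute)
qed

lemma frob_diff: "(x - y) ^ (p ^ n) = x ^ (p ^ n) - (y::'a) ^ (p ^ n)"
  using freshman[of x "- y" n] by (simp add: frob_uminus)

lemma frob_inj: "x ^ (p ^ n) = (y::'a) ^ (p ^ n) \<longleftrightarrow> x = y"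
proof
  assume "x ^ (p ^ n) = y ^ (p ^ n)"
  then have "(x - y) ^ (p ^ n) = 0" by (simp add: frob_diff)
  then show "x = y" by simp
qed simp

lemma of_nat_nonzero: "0 < j \<Longrightarrow> j < p \<Longrightarrow> of_nat j \<noteq> (0::'a)"
  by (simp add: of_nat_eq_0_iff_char_dvd CHAR_p nat_dvd_not_less)

end

section \<open>Subfields, subrings and spans\<close>

lemma subfieldD:
  assumes "is_subfield K"
  shows "0 \<in> K" "1 \<in> K" "x \<in> K \<Longrightarrow> y \<in> K \<Longrightarrow> x + y \<in> K" "x \<in> K \<Longrightarrow> y \<in> K \<Longrightarrow> x * y \<in> K"
    "x \<in> K \<Longrightarrow> - x \<in> K" "x \<in> K \<Longrightarrow> inverse x \<in> K" "x \<in> K \<Longrightarrow> y \<in> K \<Longrightarrow> x - y \<in> K"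
    "x \<in> K \<Longrightarrow> y \<in> K \<Longrightarrow> x / y \<in> K" "x \<in> K \<Longrightarrow> x ^ n \<in> K"
proof -
  show *: "0 \<in> K" "1 \<in> K" "\<And>x y. x \<in> K \<Longrightarrow> y \<in> K \<Longrightarrow> x + y \<in> K"
    "\<And>x y. x \<in> K \<Longrightarrow> y \<in> K \<Longrightarrow> x * y \<in> K"
    "\<And>x. x \<in> K \<Longrightarrow> - x \<in> K" "\<And>x. x \<in> K \<Longrightarrow> inverse x \<in> K"
    using assms by (auto simp: is_subfield_def is_subring_def)
  show "\<And>x y. x \<in> K \<Longrightarrow> y \<in> K \<Longrightarrow> x - y \<in> K" using *(3,5) by (metis uminus_add_conv_diff add.commute)
  show "\<And>x y. x \<in> K \<Longrightarrow> y \<in> K \<Longrightarrow> x / y \<in> K" using *(4,6) by (simp add: divide_inverse)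
  show "x \<in> K \<Longrightarrow> x ^ n \<in> K" by (induction n) (auto intro: *)
qed

lemma subringD:
  assumes "is_subring R"
  shows "0 \<in> R" "1 \<in> R" "x \<in> R \<Longrightarrow> y \<in> R \<Longrightarrow> x + y \<in> R" "x \<in> R \<Longrightarrow> y \<in> R \<Longrightarrow> x * y \<in> R"
    "x \<in> R \<Longrightarrow> - x \<in> R" "x \<in> R \<Longrightarrow> y \<in> R \<Longrightarrow> x - y \<in> R" "x \<in> R \<Longrightarrow> x ^ n \<in> R"
    "of_nat n \<in> R" "(\<And>i. i \<in> A \<Longrightarrow> f i \<in> R) \<Longrightarrow> sum f A \<in> R"
proof -
  show *: "0 \<in> R" "1 \<in> R" "\<And>x y. x \<in> R \<Longrightarrow> y \<in> R \<Longrightarrow> x + y \<in> R"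
    "\<And>x y. x \<in> R \<Longrightarrow> y \<in> R \<Longrightarrow> x * y \<in> R" "\<And>x. x \<in> R \<Longrightarrow> - x \<in> R"
    using assms by (auto simp: is_subring_def)
  show "\<And>x y. x \<in> R \<Longrightarrow> y \<in> R \<Longrightarrow> x - y \<in> R" using *(3,5) by (metis uminus_add_conv_diff add.commute)
  show "x \<in> R \<Longrightarrow> x ^ n \<in> R" by (induction n) (auto intro: *)
  show "of_nat n \<in> R" by (induction n) (auto intro: *)
  show "(\<And>i. i \<in> A \<Longrightarrow> f i \<in> R) \<Longrightarrow> sum f A \<in> R"
    by (induction A rule: infinite_finite_induct) (auto intro: *)
qed

lemma subfield_subring: "is_subfield K \<Longrightarrow> is_subring K"
  by (simp add: is_subfield_def)

text \<open>Also used over a ring: an ideal of \<open>R\<close> is a \<open>subsp R\<close>, and so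
  are the modules over \<open>Lam\<close> that occur in the bound on denominators.\<close>

definition subsp :: "'a::field set \<Rightarrow> 'a set \<Rightarrow> bool" where
  "subsp K B \<longleftrightarrow> 0 \<in> B \<and> (\<forall>x\<in>B. \<forall>y\<in>B. x + y \<in> B) \<and> (\<forall>c\<in>K. \<forall>x\<in>B. c * x \<in> B)"

lemma subspD:
  assumes "is_subring K" "subsp K B"
  shows "0 \<in> B" "x \<in> B \<Longrightarrow> y \<in> B \<Longrightarrow> x + y \<in> B" "c \<in> K \<Longrightarrow> x \<in> B \<Longrightarrow> c * x \<in> B"
    "x \<in> B \<Longrightarrow> - x \<in> B" "x \<in> B \<Longrightarrow> y \<in> B \<Longrightarrow> x - y \<in> B"
    "(\<And>i. i \<in> A \<Longrightarrow> f i \<in> B) \<Longrightarrow> sum f A \<in> B"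
proof -
  show *: "0 \<in> B" "\<And>x y. x \<in> B \<Longrightarrow> y \<in> B \<Longrightarrow> x + y \<in> B" "\<And>c x. c \<in> K \<Longrightarrow> x \<in> B \<Longrightarrow> c * x \<in> B"
    using assms by (auto simp: subsp_def)
  have "- 1 \<in> K" using subringD[OF assms(1)] by blast
  from *(3)[OF this] show **: "\<And>x. x \<in> B \<Longrightarrow> - x \<in> B" by simp
  show "\<And>x y. x \<in> B \<Longrightarrow> y \<in> B \<Longrightarrow> x - y \<in> B" using *(2) ** by (metis uminus_add_conv_diff add.commute)
  show "(\<And>i. i \<in> A \<Longrightarrow> f i \<in> B) \<Longrightarrow> sum f A \<in> B"
    by (induction A rule: infinite_finite_induct) (auto intro: *(1,2))
qed

lemma subsp_subring: "is_subring K \<Longrightarrow> is_subring R \<Longrightarrow> K \<subseteq> R \<Longrightarrow> subsp K R"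
  unfolding subsp_def using subringD(1,3,4)[of R] by blast

text \<open>\<open>B\<close> is any set. Over the algebraic closure \<open>k\<close>, linear
  disjointness makes the span of a \<open>K\<close>-subspace of \<open>F\<close> a model of its
  tensor product with \<open>k\<close> over \<open>K\<close>.\<close>

inductive_set ksp :: "'a::field set \<Rightarrow> 'a set \<Rightarrow> 'a set" for K B where
  ksp_0: "0 \<in> ksp K B"
| ksp_step: "a \<in> ksp K B \<Longrightarrow> c \<in> K \<Longrightarrow> b \<in> B \<Longrightarrow> a + c * b \<in> ksp K B"

lemma ksp_add: "b \<in> ksp K B \<Longrightarrow> a \<in> ksp K B \<Longrightarrow> a + b \<in> ksp K B"
proof (induction b rule: ksp.induct)
  case (ksp_step b c d)
  then show ?case using ksp.ksp_step[of "a + b" K B c d] by (simp add: add.assoc)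
qed simp

lemma ksp_gen: "c \<in> K \<Longrightarrow> b \<in> B \<Longrightarrow> c * b \<in> ksp K B"
  using ksp_step[OF ksp_0] by force

lemma ksp_gen1: "is_subring K \<Longrightarrow> b \<in> B \<Longrightarrow> b \<in> ksp K B"
  using ksp_gen[of 1 K b B] subringD(2) by force

lemma ksp_scale: "a \<in> ksp K B \<Longrightarrow> is_subring K \<Longrightarrow> c \<in> K \<Longrightarrow> c * a \<in> ksp K B"
proof (induction a rule: ksp.induct)
  case (ksp_step a d b)
  then have "c * a + (c * d) * b \<in> ksp K B" by (intro ksp.ksp_step) (auto intro: subringD(4))
  then show ?case by (simp add: algebra_simps)
qed (auto intro: ksp_0)

lemma subsp_ksp: "is_subring K \<Longrightarrow> subsp K (ksp K B)"
  by (auto simp: subsp_def ksp_0 ksp_add ksp_scale)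

lemma ksp_least: "subsp K C \<Longrightarrow> B \<subseteq> C \<Longrightarrow> ksp K B \<subseteq> C"
proof
  fix x assume C: "subsp K C" "B \<subseteq> C" "x \<in> ksp K B"
  from C(3) show "x \<in> C" by (induction) (use C in \<open>auto simp: subsp_def\<close>)
qed

lemma ksp_mono: "K \<subseteq> K' \<Longrightarrow> B \<subseteq> C \<Longrightarrow> ksp K B \<subseteq> ksp K' C"
proof
  fix x assume C: "K \<subseteq> K'" "B \<subseteq> C" "x \<in> ksp K B"
  from C(3) show "x \<in> ksp K' C"
    by (induction) (use C in \<open>auto intro: ksp.intros\<close>)
qed

lemma ksp_subsp: "is_subring K \<Longrightarrow> subsp K B \<Longrightarrow> ksp K B = B"
  using ksp_least[of K B B] ksp_gen1[of K] by blast

lemma ksp_mult: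
  assumes "is_subring K" "\<And>x y. x \<in> B \<Longrightarrow> y \<in> C \<Longrightarrow> x * y \<in> D" "a \<in> ksp K B" "b \<in> ksp K C"
  shows "a * b \<in> ksp K D"
  using assms(3)
proof (induction a rule: ksp.induct)
  case (ksp_step a c x)
  have "x * b \<in> ksp K D" using assms(4)
  proof (induction b rule: ksp.induct)
    case (ksp_step b d y)
    then have "x * b + d * (x * y) \<in> ksp K D" using assms(2) ksp_step(4) \<open>x \<in> B\<close> by (intro ksp.ksp_step) auto
    then show ?case by (simp add: algebra_simps)
  qed (simp add: ksp_0)
  then have "a * b + c * (x * b) \<in> ksp K D" using ksp_step by (metis ksp_add ksp_scale assms(1))
  then show ?case by (simp add: algebra_simps)
qed (simp add: ksp_0)

lemma subring_ksp:
  assumes "is_subring K" "is_subring R"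
  shows "is_subring (ksp K R)"
proof -
  have "subsp K (ksp K R)" by (rule subsp_ksp[OF assms(1)])
  note s = subspD[OF assms(1) this]
  have "1 \<in> ksp K R" using ksp_gen1[OF assms(1)] subringD(2)[OF assms(2)] by blast
  moreover have "x * y \<in> ksp K R" if "x \<in> ksp K R" "y \<in> ksp K R" for x y
    using ksp_mult[OF assms(1) _ that, of R] subringD(4)[OF assms(2)] by blast
  ultimately show ?thesis unfolding is_subring_def using s(1,2,4) by blast
qed

definition adj :: "'a::field set \<Rightarrow> 'a set \<Rightarrow> 'a \<Rightarrow> 'a set" where
  "adj K B x = {b + c * x | b c. b \<in> B \<and> c \<in> K}"

lemma adjI: "b \<in> B \<Longrightarrow> c \<in> K \<Longrightarrow> b + c * x \<in> adj K B x"
  by (auto simp: adj_def)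

lemma adj_sub: "is_subfield K \<Longrightarrow> B \<subseteq> adj K B x"
  using adjI[of _ B 0 K x] subfieldD(1) by force

lemma adj_self: "is_subfield K \<Longrightarrow> subsp K B \<Longrightarrow> x \<in> adj K B x"
  using adjI[of 0 B 1 K x] subfieldD(2)[of K] by (auto simp: subsp_def)

lemma subsp_adj: "is_subfield K \<Longrightarrow> subsp K B \<Longrightarrow> subsp K (adj K B x)"
proof -
  assume K: "is_subfield K" and B: "subsp K B"
  note f = subfieldD[OF K] and b = subspD[OF subfield_subring[OF K] B]
  show "subsp K (adj K B x)" unfolding subsp_def
  proof (intro conjI ballI)
    show "0 \<in> adj K B x" using adjI[of 0 B 0 K x] b(1) f(1) by simp
  next
    fix y z assume "y \<in> adj K B x" "z \<in> adj K B x"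
    then obtain b1 c1 b2 c2 where "y = b1 + c1 * x" "z = b2 + c2 * x" and m: "b1 \<in> B" "c1 \<in> K" "b2 \<in> B" "c2 \<in> K"
      by (auto simp: adj_def)
    then have "y + z = (b1 + b2) + (c1 + c2) * x" by (simp add: algebra_simps)
    then show "y + z \<in> adj K B x" using adjI b(2) f(3) m by metis
  next
    fix c y assume c: "c \<in> K" "y \<in> adj K B x"
    then obtain b1 c1 where "y = b1 + c1 * x" and m: "b1 \<in> B" "c1 \<in> K" by (auto simp: adj_def)
    then have "c * y = c * b1 + (c * c1) * x" by (simp add: algebra_simps)
    then show "c * y \<in> adj K B x" using adjI b(3) f(4) m c by metis
  qed
qed

lemma adj_least: "is_subfield K \<Longrightarrow> subsp K C \<Longrightarrow> B \<subseteq> C \<Longrightarrow> x \<in> C \<Longrightarrow> adj K B x \<subseteq> C"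
  unfolding adj_def subsp_def by blast

lemma adj_absorb: "is_subfield K \<Longrightarrow> subsp K B \<Longrightarrow> x \<in> B \<Longrightarrow> adj K B x = B"
  using adj_least[of K B B x] adj_sub[of K B x] by blast

lemma adj_commute: "adj K (adj K B x) y = adj K (adj K B y) x"
proof -
  have "adj K (adj K B x) y \<subseteq> adj K (adj K B y) x" for x y
  proof
    fix z assume "z \<in> adj K (adj K B x) y"
    then obtain b c d where "b \<in> B" "c \<in> K" "d \<in> K" "z = (b + c * x) + d * y" by (auto simp: adj_def)
    then have "z = (b + d * y) + c * x" "b + d * y \<in> adj K B y" "c \<in> K" by (auto intro: adjI)
    then show "z \<in> adj K (adj K B y) x" by (auto intro: adjI)
  qed
  then show ?thesis by blast
qed

text \<open>Steinitz exchange, the single fact behind the invariance of flag lengths.\<close>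

lemma adj_exchange:
  assumes "is_subfield K" "subsp K B" "x \<in> adj K B y" "x \<notin> B"
  shows "adj K B x = adj K B y"
proof -
  note f = subfieldD[OF assms(1)] and b = subspD[OF subfield_subring[OF assms(1)] assms(2)]
  obtain b c where x: "x = b + c * y" "b \<in> B" "c \<in> K" using assms(3) by (auto simp: adj_def)
  have c: "c \<noteq> 0" using x assms(4) by auto
  have "y = (- inverse c * b) + inverse c * x" using c x by (simp add: field_simps)
  then have "y \<in> adj K B x" using x b(3) f(5,6) by (metis adjI)
  then show ?thesis using assms adj_least[of K "adj K B x" B y] adj_least[of K "adj K B y" B x]
    by (simp add: subset_antisym subsp_adj adj_sub)
qed

text \<open>The dimension of \<open>A / B\<close> is the length of a flag from \<open>B\<close> up to \<open>A\<close>, which avoids quotient spaces.\<close>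

inductive fdim :: "'a::field set \<Rightarrow> 'a set \<Rightarrow> 'a set \<Rightarrow> nat \<Rightarrow> bool" for K A where
  fdim_0: "fdim K A A 0"
| fdim_Suc: "x \<notin> B \<Longrightarrow> fdim K A (adj K B x) n \<Longrightarrow> fdim K A B (Suc n)"

context
  fixes K :: "'a::field set"
  assumes K: "is_subfield K"
begin

lemma fdim_sub: "fdim K A B n \<Longrightarrow> B \<subseteq> A"
  by (induction rule: fdim.induct) (use adj_sub[OF K] in blast)+

lemma fdim_subsp: "fdim K A B n \<Longrightarrow> subsp K B \<Longrightarrow> subsp K A"
  by (induction rule: fdim.induct) (auto simp: subsp_adj K)

lemma fdim_add: "fdim K C B n \<Longrightarrow> fdim K A C m \<Longrightarrow> fdim K A B (m + n)"
  by (induction rule: fdim.induct) (auto intro: fdim.intros)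

text \<open>Any vector of \<open>A\<close> outside \<open>B\<close> may be moved to the bottom of a
  flag, at the cost of one step. Uniqueness of the length and refinement through an intermediate
  space both follow from this by induction.\<close>

lemma fdim_step: "fdim K A B n \<Longrightarrow> subsp K B \<Longrightarrow> x \<in> A \<Longrightarrow> x \<notin> B \<Longrightarrow> n > 0 \<and> fdim K A (adj K B x) (n - 1)"
proof (induction rule: fdim.induct)
  case (fdim_Suc y B n)
  show ?case
  proof (cases "x \<in> adj K B y")
    case True
    then have "adj K B x = adj K B y" using adj_exchange[OF K] fdim_Suc by blast
    then show ?thesis using fdim_Suc by simp
  next
    case False
    then have IH: "n > 0" "fdim K A (adj K (adj K B x) y) (n - 1)"
      using fdim_Suc subsp_adj[OF K] by (auto simp: adj_commute[of K B x])
    have "y \<notin> adj K B x"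
    proof
      assume "y \<in> adj K B x"
      then have "adj K B y = adj K B x" using adj_exchange[OF K] fdim_Suc by blast
      then show False using False adj_self[OF K] fdim_Suc(4) by metis
    qed
    then have "fdim K A (adj K B x) (Suc (n - 1))" using IH by (intro fdim.fdim_Suc)
    then show ?thesis using IH by simp
  qed
qed simp

lemma fdim_unique: "fdim K A B n \<Longrightarrow> fdim K A B m \<Longrightarrow> subsp K B \<Longrightarrow> n = m"
proof (induction arbitrary: m rule: fdim.induct)
  case fdim_0
  from fdim_0(1) show ?case
  proof cases
    case (fdim_Suc x k)
    then show ?thesis using fdim_sub[OF fdim_Suc(3)] adj_self[OF K fdim_0(2)] by blast
  qed simp
next
  case (fdim_Suc x B n)
  have "x \<in> A" using fdim_sub[OF fdim_Suc(2)] adj_self[OF K fdim_Suc(5)] by blast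
  then have "m > 0" "fdim K A (adj K B x) (m - 1)" using fdim_step[OF fdim_Suc(4,5)] fdim_Suc by auto
  then show ?case using fdim_Suc(3)[of "m-1"] subsp_adj[OF K fdim_Suc(5)] by simp
qed

lemma fdim_0_iff: "subsp K B \<Longrightarrow> fdim K A B 0 \<longleftrightarrow> A = B"
  using fdim.cases fdim_0 by blast

lemma fdim_mid: "fdim K A B n \<Longrightarrow> subsp K B \<Longrightarrow> subsp K C \<Longrightarrow> B \<subseteq> C \<Longrightarrow> C \<subseteq> A
  \<Longrightarrow> \<exists>m l. fdim K A C m \<and> fdim K C B l \<and> m + l = n"
proof (induction n arbitrary: B)
  case 0
  then have "A = B" using fdim_0_iff by blast
  then show ?case using 0 fdim_0[of K A] by auto
next
  case (Suc n)
  show ?case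
  proof (cases "C = B")
    case True
    then show ?thesis using Suc fdim_0[of K C] by force
  next
    case False
    then obtain x where x: "x \<in> C" "x \<notin> B" using Suc by blast
    then have "fdim K A (adj K B x) n" using fdim_step[OF Suc(2,3), of x] Suc by auto
    then obtain m l where "fdim K A C m" "fdim K C (adj K B x) l" "m + l = n"
      using Suc(1)[of "adj K B x"] subsp_adj[OF K] adj_least[OF K] Suc x by meson
    then show ?thesis using fdim_Suc[OF x(2)] by (metis add_Suc_right)
  qed
qed

text \<open>Finiteness by maximality: among the subspaces of \<open>A\<close> reached by a flag from
  \<open>B\<close>, one with the longest flag must be \<open>A\<close>, since otherwise a further
  vector could be added.\<close>

lemma fdim_bound_ex: 
  assumes "subsp K B" "subsp K A" "B \<subseteq> A"
    and bd: "\<And>C l. subsp K C \<Longrightarrow> C \<subseteq> A \<Longrightarrow> fdim K C B l \<Longrightarrow> l \<le> N"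
  shows "\<exists>n\<le>N. fdim K A B n"
proof -
  let ?P = "\<lambda>l. \<exists>C. subsp K C \<and> C \<subseteq> A \<and> fdim K C B l"
  have P0: "?P 0" using assms fdim_0 by blast
  define l where "l = (GREATEST l. ?P l)"
  have "?P l" unfolding l_def by (rule GreatestI_nat[where P = ?P, OF P0, of N]) (use bd in blast)
  then obtain C where C: "subsp K C" "C \<subseteq> A" "fdim K C B l" by blast
  have mx: "m \<le> l" if "?P m" for m unfolding l_def by (rule Greatest_le_nat[where P = ?P, OF that, of N]) (use bd in blast)
  have "C = A"
  proof (rule ccontr)
    assume "C \<noteq> A"
    then obtain x where x: "x \<in> A" "x \<notin> C" using C by blast
    have "fdim K (adj K C x) C (Suc 0)" using x fdim.intros by blast
    then have "fdim K (adj K C x) B (Suc 0 + l)" using fdim_add[OF C(3)] by blast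
    then have "?P (Suc 0 + l)" using subsp_adj[OF K C(1)] adj_least[OF K assms(2) C(2) x(1)] by blast
    then show False using mx by force
  qed
  then show ?thesis using C mx bd[OF C(1,2,3)] by blast
qed

end

section \<open>Sums of subspaces and the second isomorphism theorem\<close>

definition msum :: "'a::field set \<Rightarrow> 'a set \<Rightarrow> 'a set" where
  "msum A B = {a + b | a b. a \<in> A \<and> b \<in> B}"

lemma msumI: "a \<in> A \<Longrightarrow> b \<in> B \<Longrightarrow> a + b \<in> msum A B"
  by (auto simp: msum_def)

lemma msumE: "x \<in> msum A B \<Longrightarrow> (\<And>a b. x = a + b \<Longrightarrow> a \<in> A \<Longrightarrow> b \<in> B \<Longrightarrow> thesis) \<Longrightarrow> thesis"
  by (auto simp: msum_def)

lemma subsp_msum: "subsp K A \<Longrightarrow> subsp K B \<Longrightarrow> subsp K (msum A B)"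
  unfolding subsp_def
proof (intro conjI ballI; (elim conjE)?)
  assume "0 \<in> A" "0 \<in> B"
  then show "0 \<in> msum A B" using msumI[of 0 A 0 B] by simp
next
  fix x y assume *: "\<forall>x\<in>A. \<forall>y\<in>A. x + y \<in> A" "\<forall>x\<in>B. \<forall>y\<in>B. x + y \<in> B"
    and "x \<in> msum A B" "y \<in> msum A B"
  then obtain a b c d where "x = a + b" "y = c + d" "a \<in> A" "b \<in> B" "c \<in> A" "d \<in> B" by (auto simp: msum_def)
  then have "x + y = (a + c) + (b + d)" "a + c \<in> A" "b + d \<in> B" using * by auto
  then show "x + y \<in> msum A B" by (auto simp: msum_def)
next
  fix c x assume *: "\<forall>c\<in>K. \<forall>x\<in>A. c * x \<in> A" "\<forall>c\<in>K. \<forall>x\<in>B. c * x \<in> B" "c \<in> K" "x \<in> msum A B"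
  then obtain a b where "x = a + b" "a \<in> A" "b \<in> B" by (auto simp: msum_def)
  then have "c * x = c * a + c * b" "c * a \<in> A" "c * b \<in> B" using * by (auto simp: algebra_simps)
  then show "c * x \<in> msum A B" by (auto simp: msum_def)
qed

lemma msum_sub1: "0 \<in> B \<Longrightarrow> A \<subseteq> msum A B" and msum_sub2: "0 \<in> A \<Longrightarrow> B \<subseteq> msum A B"
  using msumI[of _ A 0 B] msumI[of 0 A _ B] by auto

lemma msum_absorb: "is_subring K \<Longrightarrow> subsp K B \<Longrightarrow> A \<subseteq> B \<Longrightarrow> 0 \<in> A \<Longrightarrow> msum A B = B"
  using msum_sub2[of A B] subspD(2)[of K B] by (auto elim!: msumE)

lemma msum_least: "subsp K C \<Longrightarrow> A \<subseteq> C \<Longrightarrow> B \<subseteq> C \<Longrightarrow> msum A B \<subseteq> C"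
  by (auto simp: msum_def subsp_def)

text \<open>This compares \<open>C / (C \<inter> M)\<close> with \<open>(C + M) / M\<close>: adding
  \<open>M\<close> to every member of the flag keeps its steps proper, because a vector of
  \<open>C\<close> outside \<open>C \<inter> M\<close> is outside \<open>M\<close>.\<close>

lemma fdim_iso2:
  assumes "is_subfield K" "fdim K C B n"
  shows "subsp K B \<Longrightarrow> subsp K M \<Longrightarrow> C \<inter> M = B \<Longrightarrow> fdim K (msum C M) M n"
  using assms(2)
proof (induction arbitrary: M rule: fdim.induct)
  case fdim_0
  then have "msum C M = M" by (intro msum_absorb[OF subfield_subring[OF assms(1)]]) (auto simp: subsp_def)
  then show ?case using fdim.fdim_0[of K M] by simp
next
  case (fdim_Suc x B n)
  have C: "subsp K C" using fdim_subsp[OF assms(1) fdim_Suc(2)] subsp_adj[OF assms(1) fdim_Suc(4)] by blast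
  have x: "x \<in> C" using fdim_sub[OF assms(1) fdim_Suc(2)] adj_self[OF assms(1) fdim_Suc(4)] by blast
  note c = subspD[OF subfield_subring[OF assms(1)] C] and m = subspD[OF subfield_subring[OF assms(1)] fdim_Suc(5)]
  have "C \<inter> adj K M x = adj K B x"
  proof
    show "C \<inter> adj K M x \<subseteq> adj K B x"
    proof
      fix z assume "z \<in> C \<inter> adj K M x"
      then obtain b d where z: "z = b + d * x" "b \<in> M" "d \<in> K" "z \<in> C" by (auto simp: adj_def)
      then have "b = z - d * x" by simp
      then have "b \<in> C" using c(5)[OF z(4) c(3)[OF z(3) x]] by simp
      then show "z \<in> adj K B x" using z fdim_Suc(6) by (auto intro: adjI)
    qed
    show "adj K B x \<subseteq> C \<inter> adj K M x"
      using fdim_Suc(6) fdim_sub[OF assms(1) fdim_Suc(2)] by (auto simp: adj_def)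
  qed
  then have "fdim K (msum C (adj K M x)) (adj K M x) n"
    using fdim_Suc subsp_adj[OF assms(1)] by blast
  moreover have "msum C (adj K M x) = msum C M"
  proof
    show "msum C (adj K M x) \<subseteq> msum C M"
      by (intro msum_least[of K] subsp_msum C fdim_Suc adj_least[OF assms(1)] msum_sub1 msum_sub2)
        (use m(1) c(1) x msum_sub1[of M C] in auto)
    show "msum C M \<subseteq> msum C (adj K M x)" using adj_sub[OF assms(1), of M x] by (auto simp: msum_def)
  qed
  moreover have "x \<notin> M" using fdim_Suc x by blast
  ultimately show ?case using fdim.fdim_Suc by metis
qed

section \<open>Scaling, and sums over the powers of one element\<close>

lemma subsp_times:
  assumes "subsp K B" shows "subsp K ((*) y ` B)"
  unfolding subsp_def
proof (intro conjI ballI)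
  show "0 \<in> (*) y ` B" using assms by (auto simp: subsp_def image_iff intro!: bexI[of _ 0])
next
  fix u w assume "u \<in> (*) y ` B" "w \<in> (*) y ` B"
  then obtain a b where "u = y * a" "w = y * b" "a \<in> B" "b \<in> B" by blast
  then have "u + w = y * (a + b)" "a + b \<in> B" using assms by (auto simp: subsp_def algebra_simps)
  then show "u + w \<in> (*) y ` B" by blast
next
  fix c u assume "c \<in> K" "u \<in> (*) y ` B"
  then obtain a where "u = y * a" "a \<in> B" by blast
  then have "c * u = y * (c * a)" "c * a \<in> B" using assms \<open>c \<in> K\<close> by (auto simp: subsp_def)
  then show "c * u \<in> (*) y ` B" by blast
qed

lemma adj_times: "adj K ((*) y ` B) (y * x) = (*) y ` adj K B x"
proof -
  have *: "y * b + c * (y * x) = y * (b + c * x)" for b c by (simp add: algebra_simps)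
  show ?thesis
  proof
    show "adj K ((*) y ` B) (y * x) \<subseteq> (*) y ` adj K B x"
      unfolding adj_def using * by blast
    show "(*) y ` adj K B x \<subseteq> adj K ((*) y ` B) (y * x)"
    proof
      fix z assume "z \<in> (*) y ` adj K B x"
      then obtain b c where "z = y * b + c * (y * x)" "b \<in> B" "c \<in> K" unfolding adj_def * by blast
      then show "z \<in> adj K ((*) y ` B) (y * x)" using adjI[of "y * b" "(*) y ` B" c K "y * x"] by blast
    qed
  qed
qed

lemma fdim_times: "fdim K A B n \<Longrightarrow> y \<noteq> 0 \<Longrightarrow> fdim K ((*) y ` A) ((*) y ` B) n"
proof (induction rule: fdim.induct)
  case (fdim_Suc x B n)
  have "y * x \<notin> (*) y ` B" using fdim_Suc by auto
  then show ?case using fdim_Suc by (auto intro!: fdim.fdim_Suc[of "y * x"] simp: adj_times)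
qed (rule fdim.fdim_0)

text \<open>The coefficient sets may vary with the power: on a valuation ring the coefficient of
  \<open>y ^ j\<close> runs through a fractional ideal depending on \<open>j\<close>.\<close>

definition dsum :: "nat \<Rightarrow> (nat \<Rightarrow> 'a::field set) \<Rightarrow> 'a \<Rightarrow> 'a set" where
  "dsum r A y = {\<Sum>j<r. a j * y ^ j | a. \<forall>j<r. a j \<in> A j}"

lemma dsumI: "(\<And>j. j < r \<Longrightarrow> a j \<in> A j) \<Longrightarrow> (\<Sum>j<r. a j * y ^ j) \<in> dsum r A y"
  by (auto simp: dsum_def)

lemma dsumE: "x \<in> dsum r A y \<Longrightarrow> (\<And>a. x = (\<Sum>j<r. a j * y ^ j) \<Longrightarrow> \<forall>j<r. a j \<in> A j \<Longrightarrow> thesis) \<Longrightarrow> thesis"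
  by (auto simp: dsum_def)

lemma dsum_mono: "(\<And>j. j < r \<Longrightarrow> A j \<subseteq> B j) \<Longrightarrow> dsum r A y \<subseteq> dsum r B y"
  unfolding dsum_def by blast

lemma dsum_0: "dsum 0 A y = {0}"
  by (auto simp: dsum_def)

lemma dsum_Suc: "dsum (Suc r) A y = msum (dsum r A y) ((*) (y ^ r) ` A r)"
proof
  show "dsum (Suc r) A y \<subseteq> msum (dsum r A y) ((*) (y ^ r) ` A r)"
  proof
    fix x assume "x \<in> dsum (Suc r) A y"
    then obtain a where a: "x = (\<Sum>j<Suc r. a j * y ^ j)" "\<forall>j<Suc r. a j \<in> A j" by (rule dsumE)
    then have "x = (\<Sum>j<r. a j * y ^ j) + y ^ r * a r" by (simp add: mult.commute)
    then show "x \<in> msum (dsum r A y) ((*) (y ^ r) ` A r)" using a by (auto intro!: msumI dsumI)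
  qed
  show "msum (dsum r A y) ((*) (y ^ r) ` A r) \<subseteq> dsum (Suc r) A y"
  proof
    fix x assume "x \<in> msum (dsum r A y) ((*) (y ^ r) ` A r)"
    then obtain a b where x: "x = (\<Sum>j<r. a j * y ^ j) + y ^ r * b" "\<forall>j<r. a j \<in> A j" "b \<in> A r"
      by (auto elim!: msumE dsumE)
    then have "x = (\<Sum>j<Suc r. (if j = r then b else a j) * y ^ j)" by (simp add: mult.commute)
    also have "\<dots> \<in> dsum (Suc r) A y" using x by (intro dsumI) (auto simp: less_Suc_eq)
    finally show "x \<in> dsum (Suc r) A y" .
  qed
qed

lemma subsp_dsum: "(\<And>j. j < r \<Longrightarrow> subsp K (A j)) \<Longrightarrow> subsp K (dsum r A y)"
  by (induction r) (auto simp: dsum_0 dsum_Suc subsp_def[of K "{0}"] intro!: subsp_msum subsp_times)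

text \<open>The powers of \<open>y\<close> are independent over a ring \<open>E\<close> containing
  all coefficients, so the sum is direct. The induction enlarges first the summands below
  \<open>r\<close> and then the last one, each time by the second isomorphism theorem.\<close>

lemma fdim_dsum:
  assumes K: "is_subfield K"
    and E: "is_subring E" "\<And>a. (\<And>j. j < r \<Longrightarrow> a j \<in> E) \<Longrightarrow> (\<Sum>j<r. a j * y ^ j) = 0 \<Longrightarrow> (\<forall>j<r. a j = 0)"
    and A: "\<And>j. j < r \<Longrightarrow> A j \<subseteq> E" "\<And>j. j < r \<Longrightarrow> subsp K (B j)"
      "\<And>j. j < r \<Longrightarrow> fdim K (A j) (B j) (n j)" and y: "y \<noteq> 0"
  shows "fdim K (dsum r A y) (dsum r B y) (\<Sum>j<r. n j)"
  using E(2) A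
proof (induction r)
  case 0
  then show ?case by (simp add: dsum_0 fdim_0)
next
  case (Suc r)
  note Kr = subfield_subring[OF K]
  note e = subringD[OF E(1)]
  have ind: "a j = 0" if "\<And>j. j < Suc r \<Longrightarrow> a j \<in> E" "(\<Sum>j<Suc r. a j * y ^ j) = 0" "j < Suc r" for a j
    using Suc.prems(1)[of a] that by blast
  have ind': "\<forall>j<r. a j = 0" if "\<And>j. j < r \<Longrightarrow> a j \<in> E" "(\<Sum>j<r. a j * y ^ j) = 0" for a
  proof -
    have "(\<Sum>j<Suc r. (if j = r then 0 else a j) * y ^ j) = 0" using that by simp
    then have "(if j = r then 0 else a j) = 0" if "j < Suc r" for j
      by (intro ind[of "\<lambda>j. if j = r then 0 else a j"]) (use that \<open>\<And>j. j < r \<Longrightarrow> a j \<in> E\<close> e(1) in \<open>auto simp: less_Suc_eq\<close>)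
    then show ?thesis by (metis less_SucI nat_less_le)
  qed
  have IH: "fdim K (dsum r A y) (dsum r B y) (\<Sum>j<r. n j)"
    by (rule Suc.IH) (use ind' Suc.prems in auto)
  have BA: "B j \<subseteq> A j" if "j < Suc r" for j using fdim_sub[OF K Suc.prems(4)[OF that]] .
  have sA: "subsp K (A j)" if "j < Suc r" for j using fdim_subsp[OF K Suc.prems(4)[OF that] Suc.prems(3)[OF that]] .
  define Br where "Br = (*) (y ^ r) ` B r"
  define Ar where "Ar = (*) (y ^ r) ` A r"
  have sBr: "subsp K Br" "subsp K Ar" unfolding Br_def Ar_def using Suc.prems(3) sA by (auto intro: subsp_times)
  have sd: "subsp K (dsum r A y)" "subsp K (dsum r B y)" using sA Suc.prems(3) by (auto intro: subsp_dsum)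
  have z: "0 \<in> Br" "0 \<in> dsum r A y" "0 \<in> dsum r B y" using sBr sd by (auto simp: subsp_def)
  have BrAr: "Br \<subseteq> Ar" unfolding Br_def Ar_def using BA by blast
  have f2: "fdim K Ar Br (n r)" unfolding Ar_def Br_def using Suc.prems(4) y by (intro fdim_times) auto
  have split: "u = 0 \<and> w = 0" if uw: "u + w = 0" "u \<in> dsum r A y" "w \<in> Ar" for u w
  proof -
    obtain a where a: "u = (\<Sum>j<r. a j * y ^ j)" "\<forall>j<r. a j \<in> A j" using dsumE[OF uw(2)] by metis
    obtain b where b: "w = y ^ r * b" "b \<in> A r" using uw by (auto simp: Ar_def)
    have "(\<Sum>j<Suc r. (if j = r then b else a j) * y ^ j) = 0" using uw a b by (simp add: mult.commute)
    then have "(if r = r then b else a r) = 0"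
      by (intro ind[of "\<lambda>j. if j = r then b else a j" r]) (use a b Suc.prems(2) in \<open>auto simp: less_Suc_eq\<close>)
    then show ?thesis using b uw by simp
  qed
  have dBA: "dsum r B y \<subseteq> dsum r A y" using BA by (intro dsum_mono) auto
  have i1: "dsum r A y \<inter> msum (dsum r B y) Br = dsum r B y"
  proof
    show "dsum r A y \<inter> msum (dsum r B y) Br \<subseteq> dsum r B y"
    proof
      fix x assume "x \<in> dsum r A y \<inter> msum (dsum r B y) Br"
      then obtain u w where x: "x \<in> dsum r A y" "x = u + w" "u \<in> dsum r B y" "w \<in> Br" by (auto elim!: msumE)
      have "(u - x) + w = 0" "u - x \<in> dsum r A y" "w \<in> Ar"
        using x subspD(5)[OF Kr sd(1), of u x] dBA BrAr by auto
      then have "w = 0" using split by blast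
      then show "x \<in> dsum r B y" using x by simp
    qed
    show "dsum r B y \<subseteq> dsum r A y \<inter> msum (dsum r B y) Br" using dBA msum_sub1[OF z(1)] by blast
  qed
  have "fdim K (msum (dsum r A y) (msum (dsum r B y) Br)) (msum (dsum r B y) Br) (\<Sum>j<r. n j)"
    by (rule fdim_iso2[OF K IH sd(2) _ i1]) (intro subsp_msum sd sBr)
  moreover have "msum (dsum r A y) (msum (dsum r B y) Br) = msum (dsum r A y) Br"
  proof
    show "msum (dsum r A y) (msum (dsum r B y) Br) \<subseteq> msum (dsum r A y) Br"
      by (intro msum_least[of K] subsp_msum sd sBr) (use dBA msum_sub1[OF z(1)] msum_sub2[OF z(2)] in blast)+
    show "msum (dsum r A y) Br \<subseteq> msum (dsum r A y) (msum (dsum r B y) Br)"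
      using msum_sub2[OF z(3), of Br] unfolding msum_def[of "dsum r A y"] by blast
  qed
  ultimately have g1: "fdim K (msum (dsum r A y) Br) (msum (dsum r B y) Br) (\<Sum>j<r. n j)" by simp
  have i2: "Ar \<inter> msum (dsum r A y) Br = Br"
  proof
    show "Ar \<inter> msum (dsum r A y) Br \<subseteq> Br"
    proof
      fix x assume "x \<in> Ar \<inter> msum (dsum r A y) Br"
      then obtain u w where x: "x \<in> Ar" "x = u + w" "u \<in> dsum r A y" "w \<in> Br" by (auto elim!: msumE)
      have "u + (w - x) = 0" "w - x \<in> Ar"
        using x subspD(5)[OF Kr sBr(2), of w x] BrAr by auto
      then have "u = 0" using split x by blast
      then show "x \<in> Br" using x by simp
    qed
    show "Br \<subseteq> Ar \<inter> msum (dsum r A y) Br" using BrAr msum_sub2[OF z(2)] by blast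
  qed
  have "fdim K (msum Ar (msum (dsum r A y) Br)) (msum (dsum r A y) Br) (n r)"
    by (rule fdim_iso2[OF K f2 sBr(1) _ i2]) (intro subsp_msum sd sBr)
  moreover have "msum Ar (msum (dsum r A y) Br) = msum (dsum r A y) Ar"
  proof
    have "0 \<in> Ar" using sBr(2) by (auto simp: subsp_def)
    then show "msum Ar (msum (dsum r A y) Br) \<subseteq> msum (dsum r A y) Ar"
      by (intro msum_least[of K] subsp_msum sd sBr) (use BrAr msum_sub1[of Ar] msum_sub2[OF z(2)] in blast)+
    show "msum (dsum r A y) Ar \<subseteq> msum Ar (msum (dsum r A y) Br)"
    proof
      fix x assume "x \<in> msum (dsum r A y) Ar"
      then obtain u w where "x = w + u" "u \<in> dsum r A y" "w \<in> Ar" by (auto elim!: msumE simp: add.commute)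
      then show "x \<in> msum Ar (msum (dsum r A y) Br)" using msum_sub1[OF z(1)] by (auto intro!: msumI)
    qed
  qed
  ultimately have "fdim K (msum (dsum r A y) Ar) (msum (dsum r A y) Br) (n r)" by simp
  then have "fdim K (msum (dsum r A y) Ar) (msum (dsum r B y) Br) (n r + (\<Sum>j<r. n j))"
    using fdim_add[OF K g1] by blast
  then show ?case by (simp add: dsum_Suc Ar_def Br_def add.commute)
qed

text \<open>Independence modulo \<open>B\<close> is expressed throughout by
  \<open>w j \<notin> gspan K B w j\<close> for \<open>j < n\<close>: no vector lies in the span of
  \<open>B\<close> and its predecessors. This fits flags, which grow by one vector at a
  time.\<close>

definition gspan :: "'a::field set \<Rightarrow> 'a set \<Rightarrow> (nat \<Rightarrow> 'a) \<Rightarrow> nat \<Rightarrow> 'a set" where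
  "gspan K B w n = {b + (\<Sum>i<n. c i * w i) | b c. b \<in> B \<and> (\<forall>i<n. c i \<in> K)}"

lemma gspanI: "b \<in> B \<Longrightarrow> (\<And>i. i < n \<Longrightarrow> c i \<in> K) \<Longrightarrow> b + (\<Sum>i<n. c i * w i) \<in> gspan K B w n"
  by (auto simp: gspan_def)

lemma gspanE: "x \<in> gspan K B w n \<Longrightarrow> (\<And>b c. x = b + (\<Sum>i<n. c i * w i) \<Longrightarrow> b \<in> B \<Longrightarrow> (\<forall>i<n. c i \<in> K) \<Longrightarrow> thesis) \<Longrightarrow> thesis"
  by (auto simp: gspan_def)

lemma gspan_0: "gspan K B w 0 = B"
  by (auto simp: gspan_def)

lemma gspan_Suc: "gspan K B w (Suc n) = adj K (gspan K B w n) (w n)"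
proof
  show "gspan K B w (Suc n) \<subseteq> adj K (gspan K B w n) (w n)"
  proof
    fix x assume "x \<in> gspan K B w (Suc n)"
    then obtain b c where x: "x = (b + (\<Sum>i<n. c i * w i)) + c n * w n" "b \<in> B" "\<forall>i<Suc n. c i \<in> K"
      by (auto elim!: gspanE simp: add.assoc)
    then show "x \<in> adj K (gspan K B w n) (w n)" by (auto intro!: adjI gspanI)
  qed
  show "adj K (gspan K B w n) (w n) \<subseteq> gspan K B w (Suc n)"
  proof
    fix x assume "x \<in> adj K (gspan K B w n) (w n)"
    then obtain b c d where x: "x = (b + (\<Sum>i<n. c i * w i)) + d * w n" "b \<in> B" "\<forall>i<n. c i \<in> K" "d \<in> K"
      by (auto elim!: gspanE simp: adj_def)
    then have "x = b + (\<Sum>i<Suc n. (if i = n then d else c i) * w i)" by (simp add: add.assoc)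
    also have "\<dots> \<in> gspan K B w (Suc n)" using x by (intro gspanI) auto
    finally show "x \<in> gspan K B w (Suc n)" .
  qed
qed

lemma lin_indep_modD:
  "lin_indep_mod k B xs \<Longrightarrow> length cs = length xs \<Longrightarrow> set cs \<subseteq> k \<Longrightarrow>
    (\<Sum>i<length xs. cs ! i * xs ! i) \<in> B \<Longrightarrow> \<forall>c\<in>set cs. c = 0"
  unfolding lin_indep_mod_def by blast

section \<open>Bases modulo a subspace\<close>

context
  fixes K :: "'a::field set"
  assumes K: "is_subfield K"
begin

lemma fdim_1: "x \<notin> B \<Longrightarrow> fdim K (adj K B x) B (Suc 0)"
  by (rule fdim_Suc[OF _ fdim_0])

lemma subsp_gspan: "subsp K B \<Longrightarrow> subsp K (gspan K B w n)"
  by (induction n) (auto simp: gspan_0 gspan_Suc subsp_adj K)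

lemma gspan_sub: "subsp K A \<Longrightarrow> B \<subseteq> A \<Longrightarrow> (\<And>i. i < n \<Longrightarrow> w i \<in> A) \<Longrightarrow> gspan K B w n \<subseteq> A"
proof (induction n)
  case (Suc n)
  then show ?case unfolding gspan_Suc by (intro adj_least[OF K]) auto
qed (simp add: gspan_0)

lemma gspan_base: "B \<subseteq> gspan K B w n"
  by (induction n) (use adj_sub[OF K] in \<open>auto simp: gspan_0 gspan_Suc\<close>)

lemma gspan_gen: "subsp K B \<Longrightarrow> i < n \<Longrightarrow> w i \<in> gspan K B w n"
  by (induction n) (use adj_sub[OF K] in \<open>auto simp: gspan_Suc less_Suc_eq intro!: adj_self[OF K] subsp_gspan\<close>)

lemma fdim_gspan: "subsp K B \<Longrightarrow> \<exists>m\<le>n. fdim K (gspan K B w n) B m"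
proof (induction n)
  case 0
  then show ?case using fdim_0 by (auto simp: gspan_0)
next
  case (Suc n)
  then obtain m where m: "m \<le> n" "fdim K (gspan K B w n) B m" by blast
  show ?case
  proof (cases "w n \<in> gspan K B w n")
    case True
    then show ?thesis using m adj_absorb[OF K subsp_gspan[OF Suc(2)]] by (auto simp: gspan_Suc intro: le_SucI)
  next
    case False
    then have "fdim K (gspan K B w (Suc n)) (gspan K B w n) (Suc 0)"
      unfolding gspan_Suc by (intro fdim_1)
    then have "fdim K (gspan K B w (Suc n)) B (Suc 0 + m)" by (rule fdim_add[OF K m(2)])
    then show ?thesis using m by (intro exI[of _ "Suc m"]) auto
  qed
qed

lemma fdim_gspan_indep:
  assumes B: "subsp K B"
  shows "fdim K (gspan K B w n) B n \<Longrightarrow> j < n \<Longrightarrow> w j \<notin> gspan K B w j"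
proof (induction n)
  case (Suc n)
  obtain m where m: "m \<le> n" "fdim K (gspan K B w n) B m" using fdim_gspan[OF B] by blast
  have nin: "w n \<notin> gspan K B w n"
  proof
    assume "w n \<in> gspan K B w n"
    then have "gspan K B w (Suc n) = gspan K B w n" using adj_absorb[OF K subsp_gspan[OF B]] by (simp add: gspan_Suc)
    then show False using m fdim_unique[OF K m(2) _ B, of "Suc n"] Suc by simp
  qed
  then have "fdim K (gspan K B w (Suc n)) (gspan K B w n) (Suc 0)"
    unfolding gspan_Suc by (intro fdim_1)
  then have "fdim K (gspan K B w (Suc n)) B (Suc 0 + m)" by (rule fdim_add[OF K m(2)])
  then have "m = n" using fdim_unique[OF K _ Suc(2) B] by force
  then show ?case using Suc m nin by (auto simp: less_Suc_eq)
qed simp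

lemma gspan_indepD:
  assumes B: "subsp K B" and w: "\<And>j. j < n \<Longrightarrow> w j \<notin> gspan K B w j"
    and c: "\<And>j. j < n \<Longrightarrow> c j \<in> K" "(\<Sum>i<n. c i * w i) \<in> B"
  shows "j < n \<Longrightarrow> c j = 0"
  using w c
proof (induction n)
  case (Suc n)
  note f = subfieldD[OF K] and b = subspD[OF subfield_subring[OF K]]
  have cn: "c n = 0"
  proof (rule ccontr)
    assume nz: "c n \<noteq> 0"
    define s where "s = (\<Sum>i<n. c i * w i) + c n * w n"
    have "s \<in> B" using Suc(5) by (simp add: s_def)
    have "w n = inverse (c n) * s + (\<Sum>i<n. (- inverse (c n) * c i) * w i)"
      using nz by (simp add: s_def sum_distrib_left algebra_simps sum_negf)
    also have "\<dots> \<in> gspan K B w n" using b(3)[OF B] \<open>s \<in> B\<close> Suc(4) f(4,5,6) by (intro gspanI) auto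
    finally show False using Suc(3)[of n] by simp
  qed
  then show ?case using Suc by (auto simp: less_Suc_eq)
qed simp

lemma fdim_gspan_n: "subsp K B \<Longrightarrow> (\<And>j. j < n \<Longrightarrow> w j \<notin> gspan K B w j) \<Longrightarrow> fdim K (gspan K B w n) B n"
proof (induction n)
  case (Suc n)
  have "fdim K (gspan K B w (Suc n)) (gspan K B w n) (Suc 0)"
    unfolding gspan_Suc using Suc(3) by (intro fdim_1) auto
  then have "fdim K (gspan K B w (Suc n)) B (Suc 0 + n)" using Suc by (intro fdim_add[OF K]) auto
  then show ?case by simp
qed (simp add: gspan_0 fdim_0)

lemma fdim_basis: "fdim K A B n \<Longrightarrow> subsp K B \<Longrightarrow> \<exists>w. A = gspan K B w n \<and> (\<forall>j<n. w j \<notin> gspan K B w j)"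
proof (induction n arbitrary: A)
  case 0
  then show ?case using fdim_0_iff[OF K] by (auto simp: gspan_0)
next
  case (Suc n)
  \<comment> \<open>\<open>fdim\<close> adds its vectors next to \<open>B\<close>,
    \<open>gspan\<close> adds them at the top, so the flag is first split at its upper end.\<close>
  have "\<exists>C y. fdim K C B n \<and> A = adj K C y \<and> y \<notin> C \<and> subsp K C"
    using Suc(2,3)
  proof (induction "Suc n" arbitrary: n rule: fdim.induct)
    case (fdim_Suc x B n)
    show ?case
    proof (cases n)
      case 0
      then have "A = adj K B x" using fdim_Suc(2) fdim_0_iff[OF K subsp_adj[OF K fdim_Suc(4)]] by simp
      then show ?thesis using fdim_Suc(1,4) fdim.fdim_0[of K B] 0 by (intro exI[of _ B] exI[of _ x]) simp
    next
      case (Suc n')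
      then obtain C y where "fdim K C (adj K B x) n'" "A = adj K C y" "y \<notin> C" "subsp K C"
        using fdim_Suc(3)[OF Suc subsp_adj[OF K fdim_Suc(4)]] by blast
      then show ?thesis using fdim.fdim_Suc[OF fdim_Suc(1)] Suc by blast
    qed
  qed
  then obtain C y where C: "fdim K C B n" "A = adj K C y" "y \<notin> C" "subsp K C" by blast
  then obtain w where w: "C = gspan K B w n" "\<forall>j<n. w j \<notin> gspan K B w j" using Suc by blast
  have eq: "gspan K B (w(n := y)) j = gspan K B w j" if "j \<le> n" for j
    using that unfolding gspan_def by (intro Collect_cong ex_cong1) auto
  have "A = gspan K B (w(n := y)) (Suc n)" using C w eq[of n] by (simp add: gspan_Suc)
  moreover have "\<forall>j<Suc n. (w(n := y)) j \<notin> gspan K B (w(n := y)) j"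
    using w C eq by (auto simp: less_Suc_eq)
  ultimately show ?case by blast
qed

lemma lin_indep_mod_Cons:
  assumes B: "subsp K B"
  shows "lin_indep_mod K B (x # xs) \<longleftrightarrow> x \<notin> B \<and> lin_indep_mod K (adj K B x) xs"
proof -
  note f = subfieldD[OF K] and b = subspD[OF subfield_subring[OF K] B]
  have sum: "(\<Sum>i<length (x # xs). (c # cs) ! i * (x # xs) ! i) = c * x + (\<Sum>i<length xs. cs ! i * xs ! i)" for c cs
    by (simp add: lessThan_Suc_eq_insert_0 sum.reindex del: sum.lessThan_Suc)
  show ?thesis
  proof (intro iffI conjI)
    assume L: "lin_indep_mod K B (x # xs)"
    show "x \<notin> B"
    proof
      assume "x \<in> B"
      let ?cs = "(1::'a) # replicate (length xs) 0"
      have "(\<Sum>i<length xs. replicate (length xs) 0 ! i * xs ! i) = 0" by (intro sum.neutral) auto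
      then have 1: "(\<Sum>i<length (x # xs). ?cs ! i * (x # xs) ! i) \<in> B" unfolding sum using \<open>x \<in> B\<close> by simp
      have 2: "length ?cs = length (x # xs)" "set ?cs \<subseteq> K" using f(1,2) by auto
      have "\<forall>c\<in>set ?cs. c = 0" by (rule lin_indep_modD[OF L 2 1])
      then show False by simp
    qed
    show "lin_indep_mod K (adj K B x) xs" unfolding lin_indep_mod_def
    proof (intro allI impI, elim conjE)
      fix cs assume cs: "length cs = length xs" "set cs \<subseteq> K" "(\<Sum>i<length xs. cs ! i * xs ! i) \<in> adj K B x"
      then obtain b c where bc: "(\<Sum>i<length xs. cs ! i * xs ! i) = b + c * x" "b \<in> B" "c \<in> K" by (auto simp: adj_def)
      have 1: "(\<Sum>i<length (x # xs). ((- c) # cs) ! i * (x # xs) ! i) \<in> B" unfolding sum using bc by simp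
      have 2: "length ((- c) # cs) = length (x # xs)" "set ((- c) # cs) \<subseteq> K" using cs bc f(5) by auto
      have "\<forall>c\<in>set ((- c) # cs). c = 0" by (rule lin_indep_modD[OF L 2 1])
      then show "\<forall>c\<in>set cs. c = 0" by simp
    qed
  next
    assume L: "x \<notin> B \<and> lin_indep_mod K (adj K B x) xs"
    show "lin_indep_mod K B (x # xs)" unfolding lin_indep_mod_def
    proof (intro allI impI, elim conjE)
      fix cs assume cs: "length cs = length (x # xs)" "set cs \<subseteq> K" "(\<Sum>i<length (x # xs). cs ! i * (x # xs) ! i) \<in> B"
      then obtain c ds where ds: "cs = c # ds" by (cases cs) auto
      then have in_B: "c * x + (\<Sum>i<length xs. ds ! i * xs ! i) \<in> B" using cs(3) sum by simp
      have cK: "c \<in> K" "set ds \<subseteq> K" using cs ds by auto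
      have "(\<Sum>i<length xs. ds ! i * xs ! i) = (c * x + (\<Sum>i<length xs. ds ! i * xs ! i)) + (- c) * x" by simp
      then have "(\<Sum>i<length xs. ds ! i * xs ! i) \<in> adj K B x" using adjI[OF in_B f(5)[OF cK(1)], of x] by simp
      then have z: "\<forall>d\<in>set ds. d = 0" using cs(1) ds cK by (intro lin_indep_modD[OF conjunct2[OF L]]) auto
      then have "(\<Sum>i<length xs. ds ! i * xs ! i) = 0" using cs ds by (intro sum.neutral) auto
      then have "c * x \<in> B" using in_B by simp
      then have "c = 0" using L b(3)[OF f(6)[OF cK(1)], of "c * x"] by (cases "c = 0") (simp_all add: mult.assoc[symmetric])
      then show "\<forall>c\<in>set cs. c = 0" using z ds by simp
    qed
  qed
qed

text \<open>The link between flags and the dimension used in the statement: each vector of an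
  independent list takes one step off the flag, so no list is longer than the flag.\<close>

lemma qdim_eq: 
  assumes B: "subsp K B" and n: "fdim K A B n"
  shows "qdim K A B = n"
proof -
  have 1: "\<exists>xs. length xs = n \<and> set xs \<subseteq> A \<and> lin_indep_mod K B xs" using n B
  proof (induction rule: fdim.induct)
    case fdim_0
    show ?case by (intro exI[of _ "[]"]) (auto simp: lin_indep_mod_def)
  next
    case (fdim_Suc x B n)
    then obtain xs where "length xs = n" "set xs \<subseteq> A" "lin_indep_mod K (adj K B x) xs" using subsp_adj[OF K] by blast
    moreover have "x \<in> A" using fdim_sub[OF K fdim_Suc(2)] adj_self[OF K fdim_Suc(4)] by blast
    ultimately show ?case using fdim_Suc by (intro exI[of _ "x # xs"]) (auto simp: lin_indep_mod_Cons)
  qed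
  have 2: "length xs \<le> n" if "set xs \<subseteq> A" "lin_indep_mod K B xs" for xs using that B n
  proof (induction xs arbitrary: B n)
    case (Cons x xs)
    then have "x \<notin> B" "lin_indep_mod K (adj K B x) xs" using lin_indep_mod_Cons by auto
    then have "n > 0" "fdim K A (adj K B x) (n - 1)" using fdim_step[OF K Cons(5,4), of x] Cons by auto
    then have "length xs \<le> n - 1" using Cons subsp_adj[OF K] \<open>lin_indep_mod K (adj K B x) xs\<close> by auto
    then show ?case using \<open>n > 0\<close> by simp
  qed simp
  show ?thesis unfolding qdim_def by (rule Greatest_equality) (use 1 2 in blast)+
qed

end

section \<open>Base change to the algebraic closure, and spans of Frobenius powers\<close>

locale cfield = char_p p "TYPE('a)" for p :: nat and K k F :: "'a::field set" +
  assumes K: "is_subfield K" and F: "is_subfield F" and KF: "K \<subseteq> F"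
    and ac: "is_alg_closure_in K k" and ld: "lin_disjoint K k F"
begin

lemma kf: "is_subfield k" and Kk: "K \<subseteq> k"
  using ac by (auto simp: is_alg_closure_in_def)

lemmas Kr = subfield_subring[OF K]
lemmas kr = subfield_subring[OF kf]

text \<open>The closure is perfect. Hence the coefficients of a combination of \<open>q\<close>-th
  powers have \<open>q\<close>-th roots, and so has the combination itself.\<close>

lemma k_root: assumes "c \<in> k" shows "\<exists>d\<in>k. d ^ (p ^ n) = c"
proof -
  let ?f = "monom 1 (p ^ n) + [:- c:]"
  have "0 < p ^ n" using p_pos by simp
  have "poly_over k ?f" unfolding poly_over_def
    using subfieldD[OF kf] assms by (auto simp: coeff_pCons split: nat.splits)
  moreover have "degree ?f = p ^ n"
    using p_pos \<open>0 < p ^ n\<close> by (subst degree_add_eq_left) (auto simp: degree_monom_eq)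
  ultimately obtain d where "d \<in> k" "poly ?f d = 0" using ac \<open>0 < p ^ n\<close> unfolding is_alg_closure_in_def by metis
  then show ?thesis by (auto simp: poly_monom)
qed

text \<open>Linear disjointness speaks of \<open>K\<close>-independent lists. Before it can be
  applied, a dependent vector has to be eliminated by expressing it through the earlier
  ones.\<close>

lemma ksp_indep_rep:
  assumes "a \<in> ksp k B"
  shows "\<exists>bs cs. length cs = length bs \<and> set bs \<subseteq> B \<and> set cs \<subseteq> k \<and> lin_indep_mod K {0} bs \<and>
     a = (\<Sum>i<length bs. cs ! i * bs ! i)"
  using assms
proof (induction rule: ksp.induct)
  case ksp_0
  show ?case by (intro exI[of _ "[]"]) (auto simp: lin_indep_mod_def)
next
  case (ksp_step a c b)
  then obtain bs cs where bs: "length cs = length bs" "set bs \<subseteq> B" "set cs \<subseteq> k" "lin_indep_mod K {0} bs"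
     "a = (\<Sum>i<length bs. cs ! i * bs ! i)" by blast
  note f = subfieldD[OF kf]
  show ?case
  proof (cases "lin_indep_mod K {0} (bs @ [b])")
    case True
    have "a + c * b = (\<Sum>i<length (bs @ [b]). (cs @ [c]) ! i * (bs @ [b]) ! i)"
      using bs by (simp add: nth_append)
    then show ?thesis using True bs ksp_step by (intro exI[of _ "bs @ [b]"] exI[of _ "cs @ [c]"]) auto
  next
    case False
    define n where "n = length bs"
    obtain ds where ds: "length ds = Suc n" "set ds \<subseteq> K" "(\<Sum>i<Suc n. ds ! i * (bs @ [b]) ! i) = 0" "\<exists>d\<in>set ds. d \<noteq> 0"
      using False unfolding lin_indep_mod_def by (auto simp: n_def)
    have s: "(\<Sum>i<n. ds ! i * bs ! i) + ds ! n * b = 0" using ds(3) by (simp add: n_def nth_append)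
    have dn: "ds ! n \<noteq> 0"
    proof
      assume 0: "ds ! n = 0"
      have "(\<Sum>i<length bs. take n ds ! i * bs ! i) = 0" using s 0 by (simp add: n_def)
      moreover have "length (take n ds) = length bs" "set (take n ds) \<subseteq> K" using ds by (auto simp: n_def dest: in_set_takeD)
      ultimately have z: "\<forall>d\<in>set (take n ds). d = 0" by (intro lin_indep_modD[OF bs(4)]) simp_all
      have "ds = take n ds @ [ds ! n]" using ds(1) by (metis le_refl lessI take_Suc_conv_app_nth take_all)
      then show False using z 0 ds(4) by (metis Un_iff empty_iff empty_set insert_iff list.simps(15) set_append)
    qed
    have dk: "ds ! i \<in> k" if "i < Suc n" for i using ds Kk that nth_mem by (metis subsetD)
    have "b = (\<Sum>i<n. (- (ds ! i / ds ! n)) * bs ! i)"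
    proof -
      have "ds ! n * (\<Sum>i<n. (- (ds ! i / ds ! n)) * bs ! i) = - (\<Sum>i<n. ds ! i * bs ! i)"
        using dn by (simp add: sum_distrib_left sum_negf field_simps)
      also have "\<dots> = ds ! n * b" using s by (metis add.commute minus_unique)
      finally show ?thesis using dn by simp
    qed
    then have "a + c * b = (\<Sum>i<n. (cs ! i + c * (- (ds ! i / ds ! n))) * bs ! i)"
      unfolding bs(5) n_def by (simp add: sum_distrib_left algebra_simps sum.distrib sum_negf sum_subtractf)
    also have "\<dots> = (\<Sum>i<length bs. map (\<lambda>i. cs ! i + c * (- (ds ! i / ds ! n))) [0..<n] ! i * bs ! i)"
      by (simp add: n_def)
    finally have eq: "a + c * b = (\<Sum>i<length bs. map (\<lambda>i. cs ! i + c * (- (ds ! i / ds ! n))) [0..<n] ! i * bs ! i)" .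
    have "cs ! i + c * (- (ds ! i / ds ! n)) \<in> k" if "i < n" for i
      using that bs(1,3) dk ksp_step(2) by (intro f(3,4,5,8)) (auto simp: n_def)
    then have "set (map (\<lambda>i. cs ! i + c * (- (ds ! i / ds ! n))) [0..<n]) \<subseteq> k" by auto
    then show ?thesis using bs eq by (intro exI[of _ bs] exI[of _ "map (\<lambda>i. cs ! i + c * (- (ds ! i / ds ! n))) [0..<n]"]) (auto simp: n_def)
  qed
qed

text \<open>If \<open>y\<close> were not in \<open>B\<close>, it could be added to a
  \<open>K\<close>-independent list from \<open>B\<close> over which it is a combination with
  coefficients in \<open>k\<close>. The longer list would still be \<open>K\<close>-independent,
  hence \<open>k\<close>-independent, contrary to that combination.\<close>

lemma descent:
  assumes B: "subsp K B" "B \<subseteq> F" and y: "y \<in> F" "y \<in> ksp k B"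
  shows "y \<in> B"
proof (rule ccontr)
  assume nin: "y \<notin> B"
  obtain bs cs where bs: "length cs = length bs" "set bs \<subseteq> B" "set cs \<subseteq> k" "lin_indep_mod K {0} bs"
     "y = (\<Sum>i<length bs. cs ! i * bs ! i)" using ksp_indep_rep[OF y(2)] by blast
  note f = subfieldD[OF K] and b = subspD[OF Kr B(1)]
  have sum: "(\<Sum>i<length (x # xs). (c # cs) ! i * (x # xs) ! i) = c * x + (\<Sum>i<length xs. cs ! i * xs ! i)" for c x :: 'a and cs xs
    by (simp add: lessThan_Suc_eq_insert_0 sum.reindex del: sum.lessThan_Suc)
  have "lin_indep_mod K {0} (y # bs)" unfolding lin_indep_mod_def
  proof (intro allI impI, elim conjE)
    fix es assume es: "length es = length (y # bs)" "set es \<subseteq> K" "(\<Sum>i<length (y # bs). es ! i * (y # bs) ! i) \<in> {0}"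
    then obtain e ds where ds: "es = e # ds" by (cases es) auto
    have e0: "e * y + (\<Sum>i<length bs. ds ! i * bs ! i) = 0" using es(3) ds sum by simp
    have inB: "(\<Sum>i<length bs. ds ! i * bs ! i) \<in> B"
      by (intro b(6) b(3)) (use es ds bs(2) in auto)
    have "e = 0"
    proof (rule ccontr)
      assume "e \<noteq> 0"
      then have "y = inverse e * - (\<Sum>i<length bs. ds ! i * bs ! i)" using e0
        by (metis (no_types, lifting) add.commute minus_unique mult.assoc mult_1 left_inverse)
      then show False using nin inB b(3,4) f(6) es ds by (metis list.set_intros(1) subsetD)
    qed
    then have "\<forall>d\<in>set ds. d = 0" using e0 es ds by (intro lin_indep_modD[OF bs(4)]) auto
    then show "\<forall>c\<in>set es. c = 0" using \<open>e = 0\<close> ds by simp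
  qed
  then have L: "lin_indep_mod k {0} (y # bs)" using ld y(1) bs(2) B(2) unfolding lin_disjoint_def
    by (metis insert_subset list.simps(15) order_trans)
  have "(\<Sum>i<length (y # bs). ((- 1) # cs) ! i * (y # bs) ! i) = 0" unfolding sum using bs(5) by simp
  moreover have "- 1 \<in> k" using subfieldD[OF kf] by blast
  ultimately have "\<forall>c\<in>set ((- 1) # cs). c = (0::'a)" using bs by (intro lin_indep_modD[OF L]) auto
  then show False by simp
qed

lemma ksp_adj:
  assumes "subsp K B" shows "ksp k (adj K B x) = adj k (ksp k B) x"
proof
  have s: "subsp k (adj k (ksp k B) x)" by (intro subsp_adj kf subsp_ksp kr)
  show "ksp k (adj K B x) \<subseteq> adj k (ksp k B) x"
    by (rule ksp_least[OF s]) (use ksp_gen1[OF kr, of _ B] Kk in \<open>auto simp: adj_def\<close>)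
  have "B \<subseteq> ksp k (adj K B x)" "x \<in> ksp k (adj K B x)" 
    using ksp_gen1[OF kr] adj_sub[OF K, of B x] adj_self[OF K assms, of x] by blast+
  then show "adj k (ksp k B) x \<subseteq> ksp k (adj K B x)"
    by (intro adj_least[OF kf] subsp_ksp kr ksp_least) auto
qed

lemma fdim_ksp: "fdim K A B n \<Longrightarrow> subsp K B \<Longrightarrow> A \<subseteq> F \<Longrightarrow> fdim k (ksp k A) (ksp k B) n"
proof (induction rule: fdim.induct)
  case (fdim_Suc x B n)
  have "B \<subseteq> A" "x \<in> A" 
    using fdim_sub[OF K fdim_Suc(2)] adj_sub[OF K, of B x] adj_self[OF K fdim_Suc(4), of x] by blast+
  then have "x \<notin> ksp k B" using descent[of B x] fdim_Suc by blast
  then show ?case using fdim_Suc by (intro fdim.fdim_Suc) (auto simp: ksp_adj[symmetric] subsp_adj K)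
qed (rule fdim_0)

text \<open>For \<open>A = F\<close> this is the Frobenius pullback; for the valuation ring
  \<open>O\<^sub>0\<close> it is a subring of \<open>O\<^sub>n\<close>, in general a smaller one.
  Its colength at a separable level is \<delta>.\<close>

definition S :: "nat \<Rightarrow> 'a set \<Rightarrow> 'a set" where
  "S n A = ksp K ((\<lambda>x. x ^ (p ^ n)) ` A)"

lemma subsp_S: "subsp K (S n A)"
  unfolding S_def by (rule subsp_ksp[OF Kr])

lemma S_pow: "x \<in> A \<Longrightarrow> x ^ (p ^ n) \<in> S n A"
  unfolding S_def by (rule ksp_gen1[OF Kr]) auto

lemma S_least: "subsp K C \<Longrightarrow> (\<And>x. x \<in> A \<Longrightarrow> x ^ (p ^ n) \<in> C) \<Longrightarrow> S n A \<subseteq> C"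
  unfolding S_def by (rule ksp_least) auto

lemma S_mono: "A \<subseteq> B \<Longrightarrow> S n A \<subseteq> S n B"
  unfolding S_def by (rule ksp_mono) auto

lemma S_0: "subsp K A \<Longrightarrow> S 0 A = A"
  unfolding S_def by (simp add: ksp_subsp[OF Kr])

lemma S_root: "x \<in> S n A \<Longrightarrow> \<exists>y\<in>ksp k A. y ^ (p ^ n) = x"
  unfolding S_def
proof (induction rule: ksp.induct)
  case ksp_0
  show ?case using ksp.ksp_0 p_pos by (auto intro!: bexI[of _ 0] simp: power_0_left)
next
  case (ksp_step a c b)
  then obtain y b' where y: "y \<in> ksp k A" "y ^ (p ^ n) = a" "b' \<in> A" "b = b' ^ (p ^ n)" by blast
  obtain d where d: "d \<in> k" "d ^ (p ^ n) = c" using k_root[of c n] ksp_step(2) Kk by blast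
  have "(y + d * b') ^ (p ^ n) = a + c * b" using y d by (simp add: freshman power_mult_distrib)
  then show ?case using ksp.ksp_step[OF y(1) d(1) y(3)] by blast
qed

lemma ksp_pow: "y \<in> ksp k A \<Longrightarrow> y ^ (p ^ n) \<in> ksp k (S n A)"
proof (induction rule: ksp.induct)
  case ksp_0
  show ?case using ksp.ksp_0 p_pos by (simp add: power_0_left)
next
  case (ksp_step a c b)
  then show ?case using subfieldD(9)[OF kf] S_pow[of b A n] by (auto simp: freshman power_mult_distrib intro!: ksp.ksp_step)
qed

text \<open>The root of \<open>x ^ (p ^ n)\<close> found in the \<open>k\<close>-span of
  \<open>B\<close> must be \<open>x\<close> itself, and \<open>descent\<close> brings it back to
  \<open>B\<close>. So the Frobenius is injective on quotients even if \<open>K\<close> is not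
  perfect.\<close>

lemma frob_descent:
  assumes "subsp K B" "B \<subseteq> F" "x \<in> F" "x ^ (p ^ n) \<in> S n B" shows "x \<in> B"
  using S_root[OF assms(4)] descent[OF assms(1-3)] by (auto simp: frob_inj)

lemma S_adj: assumes "subsp K B" shows "S n (adj K B x) = adj K (S n B) (x ^ (p ^ n))"
proof
  show "S n (adj K B x) \<subseteq> adj K (S n B) (x ^ (p ^ n))"
    by (rule S_least[OF subsp_adj[OF K subsp_S]])
      (auto simp: adj_def[of K B] freshman power_mult_distrib intro!: adjI S_pow subfieldD(9)[OF K])
  show "adj K (S n B) (x ^ (p ^ n)) \<subseteq> S n (adj K B x)"
    by (intro adj_least[OF K] subsp_S S_mono S_pow adj_sub[OF K] adj_self[OF K] assms)
qed

lemma fdim_S: "fdim K A B m \<Longrightarrow> subsp K B \<Longrightarrow> A \<subseteq> F \<Longrightarrow> fdim K (S n A) (S n B) m"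
proof (induction rule: fdim.induct)
  case (fdim_Suc x B m)
  have "B \<subseteq> A" "x \<in> A" 
    using fdim_sub[OF K fdim_Suc(2)] adj_sub[OF K, of B x] adj_self[OF K fdim_Suc(4), of x] by blast+
  then have "x ^ (p ^ n) \<notin> S n B" using frob_descent[of B x] fdim_Suc by blast
  then show ?case using fdim_Suc by (intro fdim.fdim_Suc) (auto simp: S_adj[symmetric] subsp_adj K)
qed (rule fdim_0)

lemma S_ring: assumes "is_subring A" shows "is_subring (S n A)"
  unfolding S_def
proof (rule subring_ksp[OF Kr])
  note r = subringD[OF assms]
  show "is_subring ((\<lambda>x. x ^ (p ^ n)) ` A)" unfolding is_subring_def
  proof (intro conjI ballI)
    show "0 \<in> (\<lambda>x. x ^ p ^ n) ` A" using r(1) p_pos by (intro image_eqI[of _ _ 0]) (auto simp: power_0_left)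
    show "1 \<in> (\<lambda>x. x ^ p ^ n) ` A" using r(2) by (intro image_eqI[of _ _ 1]) auto
  next
    fix x y assume "x \<in> (\<lambda>x. x ^ p ^ n) ` A" "y \<in> (\<lambda>x. x ^ p ^ n) ` A"
    then obtain a b where ab: "x = a ^ p ^ n" "y = b ^ p ^ n" "a \<in> A" "b \<in> A" by blast
    show "x + y \<in> (\<lambda>x. x ^ p ^ n) ` A" using ab r(3) by (intro image_eqI[of _ _ "a + b"]) (auto simp: freshman)
    show "x * y \<in> (\<lambda>x. x ^ p ^ n) ` A" using ab r(4) by (intro image_eqI[of _ _ "a * b"]) (auto simp: power_mult_distrib)
  next
    fix x assume "x \<in> (\<lambda>x. x ^ p ^ n) ` A"
    then obtain a where ab: "x = a ^ p ^ n" "a \<in> A" by blast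
    show "- x \<in> (\<lambda>x. x ^ p ^ n) ` A" using ab r(5) by (intro image_eqI[of _ _ "- a"]) (auto simp: frob_uminus)
  qed
qed

lemma K_sub_S: "is_subring A \<Longrightarrow> K \<subseteq> S n A"
proof
  fix c assume A: "is_subring A" "c \<in> K"
  have "c * 1 \<in> S n A" using S_pow[OF subringD(2)[OF A(1)], of n] subspD(3)[OF Kr subsp_S[of n A] A(2), of 1] by simp
  then show "c \<in> S n A" by simp
qed

lemma S_sub: "is_subring A \<Longrightarrow> K \<subseteq> A \<Longrightarrow> S n A \<subseteq> A"
  by (intro S_least subsp_subring Kr) (auto intro: subringD)

lemma S_S: "S m (S n A) = S (m + n) A"
proof
  have pw: "x ^ p ^ (m + n) = (x ^ p ^ n) ^ p ^ m" for x :: 'a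
    by (simp add: power_add power_mult[symmetric] mult.commute)
  show "S m (S n A) \<subseteq> S (m + n) A"
  proof (rule S_least[OF subsp_S])
    fix x assume "x \<in> S n A"
    then show "x ^ p ^ m \<in> S (m + n) A" unfolding S_def[of n]
    proof (induction rule: ksp.induct)
      case ksp_0
      show ?case using subsp_S[of "m + n" A] p_pos by (simp add: power_0_left subsp_def)
    next
      case (ksp_step a c b)
      then obtain b' where b: "b = b' ^ p ^ n" "b' \<in> A" by blast
      have "c ^ p ^ m * b' ^ p ^ (m + n) \<in> S (m + n) A"
        using S_pow[OF b(2)] subsp_S subfieldD(9)[OF K] ksp_step by (auto simp: subsp_def)
      then show ?case using ksp_step b subsp_S[of "m + n" A] by (simp add: freshman power_mult_distrib pw subsp_def)
    qed
  qed
  show "S (m + n) A \<subseteq> S m (S n A)"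
    by (rule S_least[OF subsp_S]) (auto simp: pw intro!: S_pow)
qed

lemma S_inverse:
  assumes "is_subring A" "K \<subseteq> A" "x \<in> S n A" "inverse x \<in> A" shows "inverse x \<in> S n A"
proof (cases "x = 0")
  case True
  then show ?thesis using assms by simp
next
  case False
  obtain q where q: "p ^ n = Suc q" using p_pos by (metis gr0_conv_Suc zero_less_power)
  have "inverse x = x ^ q * (inverse x) ^ (p ^ n)" using False by (simp add: q field_simps)
  also have "\<dots> \<in> S n A" using subringD(4,7)[OF S_ring[OF assms(1)]] S_pow[OF assms(4)] assms(3) by blast
  finally show ?thesis .
qed

lemma S_field: assumes "is_subfield A" "K \<subseteq> A" shows "is_subfield (S n A)"
  using S_inverse[OF subfield_subring[OF assms(1)] assms(2)] S_ring[OF subfield_subring[OF assms(1)]]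
    S_sub[OF subfield_subring[OF assms(1)] assms(2)] subfieldD(6)[OF assms(1)]
  unfolding is_subfield_def by blast

lemma frob_pullback_eq: "frob_pullback p K F n = S n F"
proof -
  have 1: "is_subfield (S n F)" "K \<union> (\<lambda>x. x ^ (p ^ n)) ` F \<subseteq> S n F"
    using S_field[OF F KF] K_sub_S[OF subfield_subring[OF F]] S_pow by auto
  have "S n F \<subseteq> M" if "is_subfield M" "K \<union> (\<lambda>x. x ^ (p ^ n)) ` F \<subseteq> M" for M
    using that by (intro S_least subsp_subring Kr subfield_subring) auto
  then show ?thesis unfolding frob_pullback_def gen_field_def using 1 by blast
qed

end

section \<open>Polynomials and purely inseparable generators\<close>

lemma poly_over_add: "is_subring S \<Longrightarrow> poly_over S f \<Longrightarrow> poly_over S g \<Longrightarrow> poly_over S (f + g)"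
  by (simp add: poly_over_def subringD)

lemma poly_over_diff: "is_subring S \<Longrightarrow> poly_over S f \<Longrightarrow> poly_over S g \<Longrightarrow> poly_over S (f - g)"
  by (simp add: poly_over_def subringD)

lemma poly_over_mult: "is_subring S \<Longrightarrow> poly_over S f \<Longrightarrow> poly_over S g \<Longrightarrow> poly_over S (f * g)"
  by (auto simp: poly_over_def coeff_mult intro!: subringD(9) subringD(4))

lemma poly_over_smult: "is_subring S \<Longrightarrow> c \<in> S \<Longrightarrow> poly_over S f \<Longrightarrow> poly_over S (smult c f)"
  by (simp add: poly_over_def subringD)

lemma poly_over_pCons: "poly_over S (pCons a f) \<longleftrightarrow> a \<in> S \<and> poly_over S f"
  unfolding poly_over_def by (auto simp: coeff_pCons split: nat.splits)

lemma poly_over_0: "is_subring S \<Longrightarrow> poly_over S 0"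
  by (simp add: poly_over_def subringD)

lemma poly_over_1: "is_subring S \<Longrightarrow> poly_over S 1"
  by (simp add: poly_over_def subringD)

lemma poly_over_monom: "is_subring S \<Longrightarrow> c \<in> S \<Longrightarrow> poly_over S (monom c n)"
  by (simp add: poly_over_def subringD)

lemma poly_over_pderiv: "is_subring S \<Longrightarrow> poly_over S f \<Longrightarrow> poly_over S (pderiv f)"
  by (simp only: poly_over_def coeff_pderiv) (auto intro: subringD(4) subringD(8) simp del: of_nat_Suc)

lemma poly_over_mono: "S \<subseteq> T \<Longrightarrow> poly_over S f \<Longrightarrow> poly_over T f"
  by (auto simp: poly_over_def)

lemma poly_over_eval: "is_subring S \<Longrightarrow> poly_over S f \<Longrightarrow> x \<in> S \<Longrightarrow> poly f x \<in> S"
  by (auto simp: poly_over_def poly_altdef intro!: subringD(9) subringD(4) subringD(7))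

lemma poly_over_pcompose: "is_subring S \<Longrightarrow> poly_over S f \<Longrightarrow> poly_over S g \<Longrightarrow> poly_over S (pcompose f g)"
proof (induction f)
  case (pCons a f)
  then show ?case unfolding pcompose_pCons
    by (auto simp: poly_over_pCons poly_over_0 intro!: poly_over_add poly_over_mult)
qed (simp add: poly_over_0)

lemma pcompose_pow: "pcompose (f ^ n) g = pcompose (f :: 'a::comm_ring_1 poly) g ^ n"
  by (induction n) (simp_all add: pcompose_1 pcompose_mult)

lemma monic_div:
  assumes S: "is_subring S" and g: "poly_over S g" "coeff g r = 1" "\<And>i. i > r \<Longrightarrow> coeff g i = 0"
  shows "poly_over S f \<Longrightarrow> \<exists>q s. poly_over S q \<and> poly_over S s \<and> f = g * q + s \<and> (\<forall>i\<ge>r. coeff s i = 0)"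
proof (induction f)
  case 0
  show ?case by (intro exI[of _ 0]) (auto simp: poly_over_0 S)
next
  case (pCons a f)
  then obtain q s where q: "poly_over S q" "poly_over S s" "f = g * q + s" "\<forall>i\<ge>r. coeff s i = 0"
    by (auto simp: poly_over_pCons)
  define c where "c = coeff (pCons a s) r"
  have "pCons a f = g * (pCons 0 q + [:c:]) + (pCons a s - smult c g)"
    using q(3) by (simp add: algebra_simps)
  moreover have "poly_over S (pCons a s)" using pCons q by (auto simp: poly_over_pCons)
  moreover from this have "c \<in> S" by (simp add: c_def poly_over_def)
  moreover have "\<forall>i\<ge>r. coeff (pCons a s - smult c g) i = 0"
  proof (intro allI impI)
    fix i assume "i \<ge> r"
    show "coeff (pCons a s - smult c g) i = 0"
    proof (cases "i = r")
      case False
      then have "i > r" "i > 0" using \<open>i \<ge> r\<close> by auto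
      then have "coeff (pCons a s) i = 0" using q(4) by (cases i) auto
      then show ?thesis using g(3)[OF \<open>i > r\<close>] by simp
    qed (simp add: c_def g)
  qed
  ultimately show ?case using q g(1) S
    by (intro exI[of _ "pCons 0 q + [:c:]"] exI[of _ "pCons a s - smult c g"])
      (auto intro!: poly_over_add poly_over_diff poly_over_smult simp: poly_over_pCons poly_over_0 subringD)
qed

text \<open>Polynomials have coefficients in the whole ambient field, so an ambient gcd gives no
  control over coefficients. A combination of \<open>f\<close> and \<open>g\<close> of least degree
  among those over \<open>K\<close> is a gcd defined over \<open>K\<close>.\<close>

lemma bezout_over:
  assumes K: "is_subfield K" and f: "poly_over K f" "f \<noteq> 0" and g: "poly_over K g"
  obtains e u w f1 g1 where "e \<noteq> 0" "poly_over K e" "poly_over K u" "poly_over K w" "poly_over K f1" "poly_over K g1"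
    "e = u * f + w * g" "f = e * f1" "g = e * g1" "u * f1 + w * g1 = 1"
proof -
  note Kr = subfield_subring[OF K]
  let ?P = "\<lambda>d. \<exists>e u w. poly_over K e \<and> poly_over K u \<and> poly_over K w \<and> e = u * f + w * g \<and> e \<noteq> 0 \<and> degree e = d"
  have "?P (degree f)" using f Kr by (intro exI[of _ f] exI[of _ 1] exI[of _ 0]) (auto simp: poly_over_0 poly_over_1)
  then have L: "?P (LEAST d. ?P d)" by (rule LeastI)
  then obtain e u w where e: "poly_over K e" "poly_over K u" "poly_over K w" "e = u * f + w * g" "e \<noteq> 0" "degree e = (LEAST d. ?P d)" by blast
  define e' where "e' = smult (inverse (lead_coeff e)) e"
  have lk: "inverse (lead_coeff e) \<in> K" using e(1) subfieldD(6)[OF K] by (auto simp: poly_over_def)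
  have e'K: "poly_over K e'" unfolding e'_def using lk e(1) by (intro poly_over_smult Kr)
  have e'm: "coeff e' (degree e) = 1" "\<And>i. i > degree e \<Longrightarrow> coeff e' i = 0"
    using e(5) by (auto simp: e'_def coeff_eq_0)
  have dv: "\<exists>h1. poly_over K h1 \<and> h = e * h1" if h: "poly_over K h" "h = a * f + b * g" "poly_over K a" "poly_over K b" for h a b
  proof -
    obtain q s where q: "poly_over K q" "poly_over K s" "h = e' * q + s" "\<forall>i\<ge>degree e. coeff s i = 0"
      using monic_div[OF Kr e'K e'm h(1)] by blast
    define q' where "q' = smult (inverse (lead_coeff e)) q"
    have q'K: "poly_over K q'" unfolding q'_def using lk q(1) by (intro poly_over_smult Kr)
    have h': "h = e * q' + s" using q(3) by (simp add: e'_def q'_def)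
    have "s = 0"
    proof (rule ccontr)
      assume "s \<noteq> 0"
      have "degree s < degree e" using q(4) \<open>s \<noteq> 0\<close> by (metis leading_coeff_0_iff linorder_not_less)
      moreover have "s = (a - q' * u) * f + (b - q' * w) * g"
        using h' unfolding h(2) e(4) by (simp add: algebra_simps)
      then have "?P (degree s)" using q(2) \<open>s \<noteq> 0\<close> h(3,4) q'K e(2,3) Kr
        by (intro exI[of _ s] exI[of _ "a - q' * u"] exI[of _ "b - q' * w"]) (auto intro!: poly_over_diff poly_over_mult)
      then have "(LEAST d. ?P d) \<le> degree s" by (rule Least_le)
      ultimately show False using e(6) by simp
    qed
    then show ?thesis using h' q'K by auto
  qed
  obtain f1 where f1: "poly_over K f1" "f = e * f1"
    using dv[OF f(1), of 1 0] Kr by (auto simp: poly_over_0 poly_over_1)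
  obtain g1 where g1: "poly_over K g1" "g = e * g1"
    using dv[OF g, of 0 1] Kr by (auto simp: poly_over_0 poly_over_1)
  have "e * (u * f1 + w * g1) = u * (e * f1) + w * (e * g1)" by (simp add: algebra_simps)
  also have "\<dots> = e * 1" using f1(2)[symmetric] g1(2)[symmetric] e(4)[symmetric] by simp
  finally have "u * f1 + w * g1 = 1" using e(5) mult_left_cancel[of e "u * f1 + w * g1" 1] by blast
  then show ?thesis by (rule that[OF e(5,1,2,3) f1(1) g1(1) e(4) f1(2) g1(2)])
qed

lemma bezout_coprime:
  assumes K: "is_subfield K" and f: "poly_over K f" "f \<noteq> 0" and g: "poly_over K g" and cop: "coprime f g"
  obtains u w where "poly_over K u" "poly_over K w" "u * f + w * g = 1"
proof -
  obtain e u w f1 g1 where e: "e \<noteq> 0" "poly_over K e" "poly_over K u" "poly_over K w" and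
    "poly_over K f1" "poly_over K g1" and e': "e = u * f + w * g" "f = e * f1" "g = e * g1" and "u * f1 + w * g1 = 1"
    by (rule bezout_over[OF K f g])
  have "is_unit e" using cop e'(2,3) by (metis coprime_common_divisor dvd_triv_left)
  then have "degree e = 0" using e(1) is_unit_iff_degree by blast
  then obtain c where c: "e = [:c:]" by (rule degree_eq_zeroE)
  have "c \<noteq> 0" using c e(1) by simp
  have cK: "c \<in> K" using e(2) c by (simp add: poly_over_pCons)
  note Kr = subfield_subring[OF K]
  have "smult (inverse c) u * f + smult (inverse c) w * g = smult (inverse c) e"
    unfolding e'(1) by (simp add: smult_add_right)
  also have "\<dots> = 1" using c \<open>c \<noteq> 0\<close> by (simp add: one_pCons)
  finally show ?thesis
    using that[OF poly_over_smult[OF Kr subfieldD(6)[OF K cK] e(3)] poly_over_smult[OF Kr subfieldD(6)[OF K cK] e(4)]] by simp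
qed

section \<open>Purely inseparable extensions of exponent one\<close>

context char_p
begin

text \<open>A \<open>p\<close>-th root generates an extension of degree \<open>p\<close>. Stated modulo a prime ideal \<open>M\<close>, so that it
  applies to subfields (\<open>M = {0}\<close>) and to residue fields, which are not subsets of the ambient field.\<close>

lemma insep_indep:
  fixes R M S :: "'a set"
  assumes R: "is_subring R" and M: "subsp R M" "M \<subseteq> R" "1 \<notin> M"
    and prm: "\<And>x y. x \<in> R \<Longrightarrow> y \<in> R \<Longrightarrow> x * y \<in> M \<Longrightarrow> x \<in> M \<or> y \<in> M"
    and S: "is_subring S" "S \<subseteq> R" and inv: "\<And>c. c \<in> S \<Longrightarrow> c \<notin> M \<Longrightarrow> \<exists>d\<in>S. c * d - 1 \<in> M"
    and z: "z \<in> R" "z ^ p \<in> S" "\<And>s. s \<in> S \<Longrightarrow> z - s \<notin> M"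
    and c: "\<And>j. j < p \<Longrightarrow> c j \<in> S" "(\<Sum>j<p. c j * z ^ j) \<in> M"
  shows "j < p \<Longrightarrow> c j \<in> M"
proof -
  note r = subringD[OF R] and s = subringD[OF S(1)] and m = subspD[OF R M(1)]
  \<comment> \<open>Candidate degrees for a minimal polynomial of \<open>z\<close> modulo
    \<open>M\<close>. By \<open>mk\<close> any relation that is nontrivial modulo \<open>M\<close>
    yields one: terms with coefficients in \<open>M\<close> are dropped and the rest is made
    monic.\<close>
  define P where "P d \<longleftrightarrow> (\<exists>g. poly_over S g \<and> coeff g d = 1 \<and> (\<forall>i>d. coeff g i = 0) \<and> poly g z \<in> M)" for d
  have mk: "\<exists>d\<le>degree f. P d" if f: "poly_over S f" "poly f z \<in> M" "coeff f i0 \<notin> M" for f i0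
  proof -
    define D where "D = {i. coeff f i \<notin> M}"
    have bd: "i \<le> degree f" if "i \<in> D" for i using that m(1) by (metis D_def coeff_eq_0 mem_Collect_eq not_le)
    then have fin: "finite D" by (meson finite_nat_set_iff_bounded_le)
    define d where "d = Max D"
    have dD: "d \<in> D" unfolding d_def using fin f(3) by (intro Max_in) (auto simp: D_def)
    have gt: "coeff f i \<in> M" if "i > d" for i using that Max_ge[OF fin, of i] unfolding d_def by (metis D_def mem_Collect_eq not_less)
    have fS: "coeff f i \<in> S" for i using f(1) by (auto simp: poly_over_def)
    obtain e where e: "e \<in> S" "coeff f d * e - 1 \<in> M" using inv[OF fS, of d] dD by (auto simp: D_def)
    define g where "g = (\<Sum>i<d. monom (e * coeff f i) i) + monom 1 d"
    have cg: "coeff g i = (if i < d then e * coeff f i else if i = d then 1 else 0)" for i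
      by (auto simp: g_def coeff_sum sum.delta cong: if_cong)
    have fz: "poly f z = (\<Sum>i\<le>degree f. coeff f i * z ^ i)" by (simp add: poly_altdef)
    have spl: "{..degree f} = {..<d} \<union> {d} \<union> {d<..degree f}" using bd[OF dD] by auto
    have "poly f z = (\<Sum>i<d. coeff f i * z ^ i) + coeff f d * z ^ d + (\<Sum>i\<in>{d<..degree f}. coeff f i * z ^ i)"
      unfolding fz spl by (subst sum.union_disjoint) (auto simp: sum.union_disjoint)
    then have "poly g z = e * poly f z - (coeff f d * e - 1) * z ^ d - e * (\<Sum>i\<in>{d<..degree f}. coeff f i * z ^ i)"
      by (simp add: g_def poly_sum poly_monom sum_distrib_left algebra_simps)
    also have "\<dots> \<in> M"
    proof (intro m(5))
      have eR: "e \<in> R" using e S by auto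
      show "e * poly f z \<in> M" using m(3)[OF eR f(2)] .
      show "(coeff f d * e - 1) * z ^ d \<in> M" using m(3)[OF r(7)[OF z(1)] e(2)] by (simp add: mult.commute)
      have "coeff f i * z ^ i \<in> M" if "i \<in> {d<..degree f}" for i
        using m(3)[OF r(7)[OF z(1)] gt, of i] that by (simp add: mult.commute)
      then show "e * (\<Sum>i\<in>{d<..degree f}. coeff f i * z ^ i) \<in> M" by (intro m(3)[OF eR] m(6))
    qed
    finally have "P d" unfolding P_def using e fS s by (intro exI[of _ g]) (auto simp: cg poly_over_def)
    then show ?thesis using bd[OF dD] by blast
  qed
  show ?thesis if "j < p"
  proof (rule ccontr)
    assume "c j \<notin> M"
    define f where "f = (\<Sum>i<p. monom (c i) i)"
    have cf: "coeff f i = (if i < p then c i else 0)" for i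
      by (auto simp: f_def coeff_sum sum.delta cong: if_cong)
    have "poly f z \<in> M" using c(2) by (simp add: f_def poly_sum poly_monom)
    moreover have "poly_over S f" using c(1) s(1) by (simp add: poly_over_def cf)
    moreover have "coeff f j \<notin> M" using cf that \<open>c j \<notin> M\<close> by simp
    ultimately obtain d0 where d0: "d0 \<le> degree f" "P d0" using mk by blast
    have "degree f < p" using cf p_pos by (intro degree_lessI) auto
    define l where "l = (LEAST d. P d)"
    have Pl: "P l" and lp: "l < p" and lmin: "\<And>d. P d \<Longrightarrow> l \<le> d"
      using LeastI[of P d0] Least_le[of P] d0 \<open>degree f < p\<close> unfolding l_def by (auto intro: le_less_trans)
    obtain g where g: "poly_over S g" "coeff g l = 1" "\<And>i. i > l \<Longrightarrow> coeff g i = 0" "poly g z \<in> M"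
      using Pl unfolding P_def by blast
    have dg: "degree g = l" using g(2,3) by (metis leI le_antisym le_degree leading_coeff_0_iff less_numeral_extra(3) not_less_iff_gr_or_eq one_neq_zero degree_0 coeff_0)
    have l0: "l > 0"
    proof (rule ccontr)
      assume "\<not> l > 0"
      then have "degree g = 0" "coeff g 0 = 1" using dg g(2) by auto
      then have "g = [:1:]" by (metis degree_eq_zeroE coeff_pCons_0)
      then show False using g(4) M(3) by simp
    qed
    define h where "h = monom 1 p - [:z ^ p:]"
    have hS: "poly_over S h" unfolding h_def using z(2) s S(1) by (intro poly_over_diff poly_over_monom) (auto simp: poly_over_pCons poly_over_0)
    obtain Q t where Q: "poly_over S Q" "poly_over S t" "h = g * Q + t" "\<forall>i\<ge>l. coeff t i = 0"
      using monic_div[OF S(1) g(1,2,3) hS] by blast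
    have "poly t z = poly h z - poly g z * poly Q z" using Q(3) by simp
    also have "poly h z = 0" by (simp add: h_def poly_monom)
    also have "0 - poly g z * poly Q z = - (poly Q z * poly g z)" by simp
    also have "\<dots> \<in> M" using poly_over_eval[OF R poly_over_mono[OF S(2) Q(1)] z(1)] g(4) by (intro m(4) m(3))
    finally have tz: "poly t z \<in> M" .
    have tM: "coeff t i \<in> M" for i
    proof (rule ccontr)
      assume "coeff t i \<notin> M"
      then obtain d where "d \<le> degree t" "P d" using mk[OF Q(2) tz] by blast
      moreover have "degree t < l" using Q(4) l0 by (intro degree_lessI) auto
      ultimately show False using lmin by fastforce
    qed
    \<comment> \<open>Substituting \<open>X + z\<close> turns \<open>X ^ p - z ^ p\<close> into
      \<open>X ^ p\<close>, so modulo \<open>M\<close> the shifted factors multiply to a power of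
      \<open>X\<close>.\<close>
    define L where "L = [:z, 1:]"
    define G where "G = pcompose g L"
    define H where "H = pcompose Q L"
    define T where "T = pcompose t L"
    have LR: "poly_over R L" using z r by (auto simp: L_def poly_over_pCons poly_over_0 R)
    have GR: "poly_over R G" "poly_over R H" unfolding G_def H_def
      by (rule poly_over_pcompose[OF R poly_over_mono[OF S(2) g(1)] LR], rule poly_over_pcompose[OF R poly_over_mono[OF S(2) Q(1)] LR])
    have TM: "coeff T i \<in> M" for i
    proof -
      have "coeff (pcompose t L) i \<in> M" if "\<forall>i. coeff t i \<in> M" for t i
        using that
      proof (induction t arbitrary: i)
        case (pCons a t)
        have "coeff t i \<in> M" for i using pCons(3) by (metis coeff_pCons_Suc)
        then have IH: "coeff (pcompose t L) i \<in> M" for i using pCons by blast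
        have "coeff (L * pcompose t L) i = z * coeff (pcompose t L) i + (case i of 0 \<Rightarrow> 0 | Suc j \<Rightarrow> coeff (pcompose t L) j)"
          by (cases i) (auto simp: L_def)
        then have "coeff (L * pcompose t L) i \<in> M" using IH m z by (auto split: nat.splits)
        moreover have "coeff [:a:] i \<in> M" using pCons(3)[rule_format, of 0] m(1) by (cases i) auto
        ultimately show ?case by (simp add: pcompose_pCons m(2))
      qed (simp add: m(1))
      then show ?thesis using tM unfolding T_def by blast
    qed
    have "([:0, 1:] + [:z:]) ^ p = [:0, 1:] ^ p + [:z:] ^ p"
      by (rule freshmans_dream) (simp_all add: CHAR_p prime_p)
    moreover have "[:0, 1:] + [:z:] = L" by (simp add: L_def)
    moreover have "[:0, 1:] ^ p = (monom 1 p :: 'a poly)" by (simp add: monom_altdef)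
    moreover have "[:z:] ^ p = [:z ^ p:]" by (rule poly_const_pow)
    ultimately have "L ^ p = monom 1 p + [:z ^ p:]" by simp
    then have "pcompose h L = monom 1 p"
      by (simp add: h_def pcompose_diff monom_altdef pcompose_pow pcompose_pCons L_def)
    then have GH: "G * H = monom 1 p - T"
      using Q(3) by (simp add: G_def H_def T_def pcompose_add pcompose_mult algebra_simps)
    have dL: "degree L = 1" by (simp add: L_def)
    have dG: "degree G = l" "degree H = degree Q" unfolding G_def H_def by (simp_all add: degree_pcompose dL dg)
    have dQ: "l + degree Q = p"
    proof -
      have "g * Q = h - t" using Q(3) by simp
      moreover have "degree h = p" unfolding h_def using p_pos
        by (subst diff_conv_add_uminus, subst degree_add_eq_left) (auto simp: degree_monom_eq)
      moreover have "degree t < l" using Q(4) l0 by (intro degree_lessI) auto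
      ultimately have dgq: "degree (g * Q) = p" using lp degree_add_eq_left[of "- t" h] by simp
      have "g \<noteq> 0" "Q \<noteq> 0" using g(2) dgq p_pos by auto
      then show ?thesis using dgq dg by (simp add: degree_mult_eq)
    qed
    have exG: "\<exists>i. coeff G i \<notin> M"
    proof -
      have "lead_coeff G = 1" unfolding G_def using dL by (subst lead_coeff_comp) (auto simp: dg g(2) L_def)
      then show ?thesis using M(3) by metis
    qed
    \<comment> \<open>Lowest terms, as over the domain \<open>R / M\<close>: the orders of vanishing
      of the two factors add up to \<open>p\<close>. Since their degrees do too, the first factor is
      \<open>X ^ l\<close> modulo \<open>M\<close>.\<close>
    define i1 where "i1 = (LEAST i. coeff G i \<notin> M)"
    have i1: "coeff G i1 \<notin> M" "\<And>i. i < i1 \<Longrightarrow> coeff G i \<in> M"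
      unfolding i1_def using LeastI_ex[OF exG] not_less_Least by blast+
    have exH: "\<exists>i. coeff H i \<notin> M"
    proof (rule ccontr)
      assume "\<not> ?thesis"
      then have "coeff (G * H) p \<in> M" unfolding coeff_mult
        using GR by (intro m(6) m(3)) (auto simp: poly_over_def)
      then have "1 - coeff T p \<in> M" unfolding GH by simp
      then have "(1 - coeff T p) + coeff T p \<in> M" using TM by (intro m(2))
      then show False using M(3) by simp
    qed
    define i2 where "i2 = (LEAST i. coeff H i \<notin> M)"
    have i2: "coeff H i2 \<notin> M" "\<And>i. i < i2 \<Longrightarrow> coeff H i \<in> M"
      unfolding i2_def using LeastI_ex[OF exH] not_less_Least by blast+
    have cR: "coeff G i \<in> R" "coeff H i \<in> R" for i using GR by (auto simp: poly_over_def)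
    have "i1 + i2 = p"
    proof (rule ccontr)
      assume ne: "i1 + i2 \<noteq> p"
      have "coeff (G * H) (i1 + i2) = (\<Sum>i\<le>i1 + i2. coeff G i * coeff H (i1 + i2 - i))" by (simp add: coeff_mult)
      also have "\<dots> = coeff G i1 * coeff H i2 + (\<Sum>i\<in>{..i1 + i2} - {i1}. coeff G i * coeff H (i1 + i2 - i))"
        by (subst sum.remove[of _ i1]) auto
      finally have eq: "coeff G i1 * coeff H i2 = coeff (G * H) (i1 + i2) - (\<Sum>i\<in>{..i1 + i2} - {i1}. coeff G i * coeff H (i1 + i2 - i))"
        by simp
      have "coeff (G * H) (i1 + i2) \<in> M" unfolding GH using ne m(4)[OF TM] by simp
      moreover have "coeff G i * coeff H (i1 + i2 - i) \<in> M" if "i \<in> {..i1 + i2} - {i1}" for i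
      proof (cases "i < i1")
        case True
        then show ?thesis using m(3)[OF cR(2) i1(2)] by (simp add: mult.commute)
      next
        case False
        then have "i1 + i2 - i < i2" using that by auto
        then show ?thesis by (intro m(3)[OF cR(1) i2(2)])
      qed
      then have "(\<Sum>i\<in>{..i1 + i2} - {i1}. coeff G i * coeff H (i1 + i2 - i)) \<in> M" by (intro m(6))
      ultimately have "coeff G i1 * coeff H i2 \<in> M" unfolding eq by (rule m(5))
      then show False using prm[OF cR] i1 i2 by blast
    qed
    moreover have "i1 \<le> l" using i1(1) m(1) dG(1) by (metis le_degree)
    moreover have "i2 \<le> degree Q" using i2(1) m(1) dG(2) by (metis le_degree)
    ultimately have "i1 = l" using dQ by linarith
    then have Gl: "coeff G (l - 1) \<in> M" using i1(2) l0 by simp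
    have "G = pcompose (\<Sum>i\<le>l. monom (coeff g i) i) L"
      unfolding G_def using poly_as_sum_of_monoms[of g] by (simp add: dg)
    also have "\<dots> = (\<Sum>i\<le>l. smult (coeff g i) (L ^ i))"
      by (simp add: pcompose_sum monom_altdef pcompose_smult pcompose_pow pcompose_pCons)
    finally have "coeff G (l - 1) = (\<Sum>i\<le>l. coeff g i * coeff (L ^ i) (l - 1))" by (simp add: coeff_sum)
    also have "\<dots> = (\<Sum>i\<in>{l - 1, l}. coeff g i * coeff (L ^ i) (l - 1))"
    proof (rule sum.mono_neutral_right)
      show "\<forall>i\<in>{..l} - {l - 1, l}. coeff g i * coeff (L ^ i) (l - 1) = 0"
      proof
        fix i assume "i \<in> {..l} - {l - 1, l}"
        then have "degree (L ^ i) < l - 1" by (auto simp: L_def degree_linear_power)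
        then show "coeff g i * coeff (L ^ i) (l - 1) = 0" by (simp add: coeff_eq_0)
      qed
    qed auto
    also have "\<dots> = coeff g (l - 1) + of_nat l * z"
    proof -
      obtain l1 where "l = Suc l1" using l0 gr0_conv_Suc by blast
      then show ?thesis using g(2) by (simp add: L_def coeff_linear_poly_power del: power_Suc)
    qed
    finally have lz: "coeff g (l - 1) + of_nat l * z \<in> M" using Gl by simp
    \<comment> \<open>The coefficient of \<open>X ^ (l - 1)\<close> in \<open>(X + z) ^ l\<close> is
      \<open>l z\<close>, and \<open>l\<close> is invertible modulo \<open>p\<close>. Hence
      \<open>z\<close> is congruent to an element of \<open>S\<close>, against the
      hypothesis.\<close>
    have "coprime l p" using l0 lp prime_p by (metis coprime_commute nat_dvd_not_less prime_imp_coprime)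
    then obtain x y where "l * x = p * y + 1" using bezout_nat[of l p] l0 by auto
    then have "of_nat (l * x) = (of_nat (p * y + 1) :: 'a)" by simp
    then have lx: "of_nat x * of_nat l = (1::'a)" using char_p0 by (simp add: mult.commute)
    have "z - - (of_nat x * coeff g (l - 1)) = of_nat x * (coeff g (l - 1) + of_nat l * z)"
      by (simp add: distrib_left mult.assoc[symmetric] lx)
    also have "\<dots> \<in> M" by (intro m(3) lz r(8))
    finally show False using z(3)[of "- (of_nat x * coeff g (l - 1))"] s(4,5,8) g(1) by (auto simp: poly_over_def)

  qed
qed

text \<open>A root of a separable polynomial lies in any intermediate ring over which the extension is purely
  inseparable of exponent one. The polynomial is expanded in the basis \<open>1, x, \<dots>, x^(p-1)\<close>
  over \<open>S\<close>, which makes \<open>f'(x)\<close> vanish if \<open>x\<close> is not in \<open>S\<close>.\<close>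

lemma separable_in:
  fixes R M S :: "'a set"
  assumes R: "is_subring R" and M: "subsp R M" "M \<subseteq> R" "1 \<notin> M"
    and prm: "\<And>x y. x \<in> R \<Longrightarrow> y \<in> R \<Longrightarrow> x * y \<in> M \<Longrightarrow> x \<in> M \<or> y \<in> M"
    and S: "is_subring S" "S \<subseteq> R" and inv: "\<And>c. c \<in> S \<Longrightarrow> c \<notin> M \<Longrightarrow> \<exists>d\<in>S. c * d - 1 \<in> M"
    and z: "z \<in> R" "z ^ p \<in> S"
    and E: "is_subfield E" "E \<subseteq> S" and f: "poly_over E f" "coprime f (pderiv f)" "poly f z \<in> M"
  shows "\<exists>s\<in>S. z - s \<in> M"
proof (rule ccontr)
  note r = subringD[OF R] and s = subringD[OF S(1)] and m = subspD[OF R M(1)] and Er = subfield_subring[OF E(1)]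
  assume "\<not> ?thesis"
  then have nz: "\<And>s. s \<in> S \<Longrightarrow> z - s \<notin> M" by blast
  have f0: "f \<noteq> 0" using f(2) by auto
  define D where "D = degree f"
  define c where "c j = (\<Sum>i<Suc D. coeff f (i * p + j) * (z ^ p) ^ i)" for j
  have cS: "c j \<in> S" for j unfolding c_def using f(1) E(2)
    by (intro s(9) s(4) s(7)[OF z(2)]) (auto simp: poly_over_def)
  have le: "D < Suc D * p" using mult_le_mono2[of 1 p "Suc D"] p_gt1 by simp
  \<comment> \<open>Terms are grouped by exponent modulo \<open>p\<close>. The weight
    \<open>h\<close> is \<open>p\<close>-periodic so that the same grouping serves both
    \<open>f\<close> (weight 1) and \<open>X f'\<close> (weight \<open>of_nat\<close>).\<close>
  have grp: "(\<Sum>n\<le>D. h n * coeff f n * z ^ n) = (\<Sum>j<p. h j * c j * z ^ j)" 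
    if h: "\<And>i j. h (i * p + j) = h j" for h :: "nat \<Rightarrow> 'a"
  proof -
    have "(\<Sum>n\<le>D. h n * coeff f n * z ^ n) = (\<Sum>n<Suc D * p. h n * coeff f n * z ^ n)"
      using le by (intro sum.mono_neutral_left) (auto simp: coeff_eq_0 D_def)
    also have "\<dots> = (\<Sum>i<Suc D. \<Sum>n\<in>{i * p..<i * p + p}. h n * coeff f n * z ^ n)"
      by (rule sum.nat_group[symmetric])
    also have "\<dots> = (\<Sum>i<Suc D. \<Sum>j<p. h j * coeff f (i * p + j) * ((z ^ p) ^ i * z ^ j))"
    proof (rule sum.cong[OF refl])
      fix i
      have "(\<Sum>n\<in>{i * p..<i * p + p}. h n * coeff f n * z ^ n) = (\<Sum>j\<in>{0..<p}. h (j + i * p) * coeff f (j + i * p) * z ^ (j + i * p))"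
        using sum.shift_bounds_nat_ivl[of "\<lambda>n. h n * coeff f n * z ^ n" 0 "i * p" p] by (simp add: add.commute)
      also have "\<dots> = (\<Sum>j<p. h j * coeff f (i * p + j) * ((z ^ p) ^ i * z ^ j))"
        using h by (intro sum.cong) (auto simp: add.commute power_add power_mult[symmetric] mult.commute atLeast0LessThan)
      finally show "(\<Sum>n\<in>{i * p..<i * p + p}. h n * coeff f n * z ^ n) =
        (\<Sum>j<p. h j * coeff f (i * p + j) * ((z ^ p) ^ i * z ^ j))" .
    qed
    also have "\<dots> = (\<Sum>j<p. h j * c j * z ^ j)"
      unfolding c_def by (subst sum.swap) (simp add: sum_distrib_left sum_distrib_right mult_ac del: sum.lessThan_Suc)
    finally show ?thesis .
  qed
  have "poly f z = (\<Sum>n\<le>D. 1 * coeff f n * z ^ n)" by (simp add: poly_altdef D_def)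
  also have "\<dots> = (\<Sum>j<p. 1 * c j * z ^ j)" by (rule grp) simp
  finally have "(\<Sum>j<p. c j * z ^ j) \<in> M" using f(3) by simp
  then have cM: "c j \<in> M" if "j < p" for j
    using that cS by (intro insep_indep[OF R M prm S inv z nz, of c])
  \<comment> \<open>The factor \<open>z\<close> keeps the exponents aligned; it is removed
    afterwards because \<open>M\<close> is prime and \<open>z \<notin> M\<close>.\<close>
  have "z * poly (pderiv f) z = (\<Sum>n\<le>D. of_nat n * coeff f n * z ^ n)"
  proof -
    have "poly (pderiv f) z = (\<Sum>n<D. of_nat (Suc n) * coeff f (Suc n) * z ^ n)"
    proof -
      have "degree (pderiv f) \<le> D" by (rule degree_le) (simp add: coeff_pderiv D_def coeff_eq_0)
      then have "poly (pderiv f) z = (\<Sum>n\<le>D. coeff (pderiv f) n * z ^ n)"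
        unfolding poly_altdef by (intro sum.mono_neutral_left) (auto simp: coeff_eq_0)
      then show ?thesis by (simp add: coeff_pderiv lessThan_Suc_atMost[symmetric] D_def coeff_eq_0)
    qed
    then have "z * poly (pderiv f) z = (\<Sum>n<D. of_nat (Suc n) * coeff f (Suc n) * z ^ Suc n)"
      by (simp add: sum_distrib_left mult_ac del: of_nat_Suc)
    also have "\<dots> = (\<Sum>n\<le>D. of_nat n * coeff f n * z ^ n)"
      unfolding lessThan_Suc_atMost[symmetric] sum.lessThan_Suc_shift by simp
    finally show ?thesis .
  qed
  also have "\<dots> = (\<Sum>j<p. of_nat j * c j * z ^ j)" by (rule grp) (simp add: char_p0)
  also have "\<dots> \<in> M"
  proof (rule m(6))
    fix j assume "j \<in> {..<p}"
    then have "(of_nat j * z ^ j) * c j \<in> M" using cM z r by (intro m(3)) auto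
    then show "of_nat j * c j * z ^ j \<in> M" by (simp add: mult_ac)
  qed
  finally have zf: "z * poly (pderiv f) z \<in> M" .
  have ER: "E \<subseteq> R" using E(2) S(2) by blast
  have evR: "poly h z \<in> R" if "poly_over E h" for h using poly_over_eval[OF R poly_over_mono[OF ER that] z(1)] .
  have "poly (pderiv f) z \<in> M" using prm[OF z(1) evR[OF poly_over_pderiv[OF Er f(1)]] zf] nz[OF s(1)] by auto
  moreover obtain u w where uw: "poly_over E u" "poly_over E w" "u * f + w * pderiv f = 1"
    by (rule bezout_coprime[OF E(1) f(1) f0 poly_over_pderiv[OF Er f(1)] f(2)])
  ultimately have "poly u z * poly f z + poly w z * poly (pderiv f) z \<in> M" using f(3) evR by (intro m(2) m(3)) auto
  also have "poly u z * poly f z + poly w z * poly (pderiv f) z = poly (u * f + w * pderiv f) z" by simp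
  also have "\<dots> = 1" unfolding uw(3) by simp
  finally show False using M(3) by simp
qed

end

section \<open>The tower of Frobenius pullbacks\<close>

text \<open>The vectors of the given flag need not lie in \<open>C\<close>. Its length only bounds
  the flags from \<open>C \<inter> M\<close> inside \<open>C\<close>; a maximal one is then compared
  with it.\<close>

lemma fdim_iso2_rev:
  assumes K: "is_subfield K" and C: "subsp K C" and M: "subsp K M" and f: "fdim K (msum C M) M n"
  shows "fdim K C (C \<inter> M) n"
proof -
  have i: "subsp K (C \<inter> M)" using C M by (auto simp: subsp_def)
  have "\<exists>l\<le>n. fdim K C (C \<inter> M) l"
  proof (rule fdim_bound_ex[OF K i C])
    fix D l assume D: "subsp K D" "D \<subseteq> C" "fdim K D (C \<inter> M) l"
    have "D \<inter> M = C \<inter> M" using D(2) fdim_sub[OF K D(3)] by blast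
    then have g: "fdim K (msum D M) M l" by (rule fdim_iso2[OF K D(3) i M])
    have "msum D M \<subseteq> msum C M" using D(2) by (auto simp: msum_def)
    then obtain m l' where "fdim K (msum D M) M l'" "m + l' = n"
      using fdim_mid[OF K f M subsp_msum[OF D(1) M] fdim_sub[OF K g]] by blast
    then show "l \<le> n" using fdim_unique[OF K g _ M] by fastforce
  qed auto
  then obtain l where l: "fdim K C (C \<inter> M) l" by blast
  have "l = n" using fdim_unique[OF K fdim_iso2[OF K l i M refl] f M] .
  then show ?thesis using l by simp
qed

text \<open>In terms of \<open>\<pp>\<^sub>n\<close>: \<open>Fn n\<close> is \<open>F\<^sub>n\<close>, \<open>I n 0\<close> the valuation ring, \<open>I n 1\<close> its maximal ideal, \<open>E n\<close> the ramification index
  of \<open>\<pp>\<close> over \<open>\<pp>\<^sub>n\<close>, and, in \<open>fftower\<close> below, \<open>dd n\<close> the degree of \<open>\<pp>\<^sub>n\<close>. The valuation \<open>v\<close> is always the one on \<open>F\<close>, and \<open>v 0\<close> is junk.\<close>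

locale vfield = cfield p K k F for p :: nat and K k F :: "'a::field set" +
  fixes v :: "'a \<Rightarrow> int"
  assumes v_mult: "x \<in> F \<Longrightarrow> y \<in> F \<Longrightarrow> x \<noteq> 0 \<Longrightarrow> y \<noteq> 0 \<Longrightarrow> v (x * y) = v x + v y"
    and v_add: "x \<in> F \<Longrightarrow> y \<in> F \<Longrightarrow> x \<noteq> 0 \<Longrightarrow> y \<noteq> 0 \<Longrightarrow> x + y \<noteq> 0 \<Longrightarrow> min (v x) (v y) \<le> v (x + y)"
    and v_K: "c \<in> K \<Longrightarrow> c \<noteq> 0 \<Longrightarrow> v c = 0"
    and v_unif: "\<exists>x\<in>F. x \<noteq> 0 \<and> v x = 1"
begin

lemmas f = subfieldD[OF F]

lemma v_1: "v 1 = 0"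
  using v_mult[of 1 1] f by simp

lemma v_uminus: "x \<in> F \<Longrightarrow> v (- x) = v x"
proof (cases "x = 0")
  case False
  assume x: "x \<in> F"
  have "- 1 \<in> K" using subfieldD[OF K] by blast
  then show ?thesis using v_mult[of "-1" x] v_K[of "-1"] KF x False by auto
qed simp

lemma v_inverse: "x \<in> F \<Longrightarrow> x \<noteq> 0 \<Longrightarrow> v (inverse x) = - v x"
  using v_mult[of x "inverse x"] f v_1 by simp

lemma v_power: "x \<in> F \<Longrightarrow> x \<noteq> 0 \<Longrightarrow> v (x ^ n) = int n * v x"
  by (induction n) (use f v_1 in \<open>auto simp: v_mult algebra_simps\<close>)

lemma v_powi: "x \<in> F \<Longrightarrow> x \<noteq> 0 \<Longrightarrow> v (x powi n) = n * v x"
  by (cases n rule: int_cases3) (auto simp: power_int_def v_power v_inverse f(6,9) v_1)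

definition Fn :: "nat \<Rightarrow> 'a set" where "Fn n = S n F"

lemma Fn_0: "Fn 0 = F"
  unfolding Fn_def by (rule S_0) (rule subsp_subring[OF Kr subfield_subring[OF F] KF])

lemma Fn_field: "is_subfield (Fn n)"
  unfolding Fn_def by (rule S_field[OF F KF])

lemmas Fn_ring = subfield_subring[OF Fn_field]

lemma K_Fn: "K \<subseteq> Fn n"
  unfolding Fn_def by (rule K_sub_S[OF subfield_subring[OF F]])

lemma S_Fn: "S m (Fn n) = Fn (m + n)"
  unfolding Fn_def by (rule S_S)

lemma Fn_Suc_sub: "Fn (Suc n) \<subseteq> Fn n"
  using S_sub[OF Fn_ring K_Fn, of 1 n] by (simp add: S_Fn)

lemma Fn_mono: "n \<le> m \<Longrightarrow> Fn m \<subseteq> Fn n"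
  using S_sub[OF Fn_ring K_Fn, of "m - n" n] by (simp add: S_Fn)

lemma Fn_sub: "Fn n \<subseteq> F"
  using Fn_mono[of 0 n] by (simp add: Fn_0)

lemma FnF: "x \<in> Fn n \<Longrightarrow> x \<in> F"
  using Fn_sub by blast

lemmas fn = subfieldD[OF Fn_field]

lemma Fn_powi: "x \<in> Fn n \<Longrightarrow> x powi m \<in> Fn n"
  by (simp add: power_int_def fn)

lemma Fn_frob: "x \<in> Fn n \<Longrightarrow> x ^ (p ^ m) \<in> Fn (m + n)"
  using S_pow[of x "Fn n" m] by (simp add: S_Fn)

lemma Fn_frob1: "x \<in> Fn n \<Longrightarrow> x ^ p \<in> Fn (Suc n)"
  using Fn_frob[of x n 1] by simp

text \<open>Level and order are separate because ideals of different levels are compared. With the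
  order measured on \<open>F\<close>, passing to a higher level is a plain intersection
  (\<open>I_inter\<close>).\<close>

definition I :: "nat \<Rightarrow> int \<Rightarrow> 'a set" where
  "I n m = {x \<in> Fn n. x = 0 \<or> m \<le> v x}"

lemma I_0: "0 \<in> I n m"
  using fn(1) by (simp add: I_def)

lemma I_sub: "I n m \<subseteq> Fn n" "I n m \<subseteq> F"
  using Fn_sub by (auto simp: I_def)

lemma I_add: "x \<in> I n m \<Longrightarrow> y \<in> I n m \<Longrightarrow> x + y \<in> I n m"
  using v_add[OF FnF[of x n] FnF[of y n]] fn(3)[of x n y] by (fastforce simp: I_def)

lemma I_mult: "x \<in> I n a \<Longrightarrow> y \<in> I n b \<Longrightarrow> x * y \<in> I n (a + b)"
  using v_mult[OF FnF[of x n] FnF[of y n]] fn(4)[of x n y] by (cases "x = 0 \<or> y = 0") (auto simp: I_def)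

lemma I_mono: "a \<le> b \<Longrightarrow> I n b \<subseteq> I n a"
  by (auto simp: I_def)

lemma I_level: "n \<le> m \<Longrightarrow> I m a \<subseteq> I n a"
  using Fn_mono[of n m] by (auto simp: I_def)

lemma I_inter: "n \<le> m \<Longrightarrow> I m a = I n a \<inter> Fn m"
  using Fn_mono[of n m] by (auto simp: I_def)

lemma K_I: "K \<subseteq> I n 0"
  using v_K K_Fn by (fastforce simp: I_def)

lemma subsp_I: "subsp K (I n m)"
  unfolding subsp_def using I_0 I_add I_mult[of _ n 0 _ m] K_I by (metis add_0 subsetD)

lemma I_ring: "is_subring (I n 0)"
proof -
  have "1 \<in> I n 0" using fn(2) v_1 by (auto simp: I_def)
  moreover have "- x \<in> I n 0" if "x \<in> I n 0" for x
    using that fn(5)[of x n] v_uminus[OF FnF[of x n]] by (auto simp: I_def)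
  ultimately show ?thesis unfolding is_subring_def using I_0 I_add I_mult[of _ n 0 _ 0] by simp
qed

lemma subsp_I_I: "m \<ge> 0 \<Longrightarrow> subsp (I n 0) (I n m)"
  unfolding subsp_def using I_0 I_add I_mult[of _ n 0 _ m] by (metis add_0)

lemma I_inverse: "x \<in> I n 0 \<Longrightarrow> x \<notin> I n 1 \<Longrightarrow> inverse x \<in> I n 0"
  using fn(6)[of x n] v_inverse[OF FnF[of x n]] by (auto simp: I_def)

lemma I_times: 
  assumes "a \<in> Fn n" "a \<noteq> 0" shows "(*) a ` I n m = I n (m + v a)"
proof
  show "(*) a ` I n m \<subseteq> I n (m + v a)"
  proof
    fix y assume "y \<in> (*) a ` I n m"
    then obtain x where x: "x \<in> I n m" "y = a * x" by blast
    have "a \<in> I n (v a)" using assms by (simp add: I_def)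
    from I_mult[OF this x(1)] show "y \<in> I n (m + v a)" using x(2) by (simp add: add.commute)
  qed
  show "I n (m + v a) \<subseteq> (*) a ` I n m"
  proof
    fix x assume x: "x \<in> I n (m + v a)"
    have "inverse a \<in> I n (- v a)" using assms fn(6)[of a n] v_inverse[OF FnF[of a n]] by (auto simp: I_def)
    from I_mult[OF this x] have "inverse a * x \<in> I n m" by simp
    moreover have "x = a * (inverse a * x)" using assms by simp
    ultimately show "x \<in> (*) a ` I n m" by blast
  qed
qed

lemma I_prime: "x \<in> I n 0 \<Longrightarrow> y \<in> I n 0 \<Longrightarrow> x * y \<in> I n 1 \<Longrightarrow> x \<in> I n 1 \<or> y \<in> I n 1"
  using v_mult[OF FnF[of x n] FnF[of y n]] by (cases "x = 0 \<or> y = 0") (auto simp: I_def)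

lemma one_notin: "1 \<notin> I n 1"
  by (simp add: I_def v_1)

lemma v_add_lt: "x \<in> F \<Longrightarrow> y \<in> F \<Longrightarrow> x \<noteq> 0 \<Longrightarrow> y = 0 \<or> v x < v y \<Longrightarrow> x + y \<noteq> 0 \<and> v (x + y) = v x"
proof (cases "y = 0")
  case False
  assume *: "x \<in> F" "y \<in> F" "x \<noteq> 0" "y = 0 \<or> v x < v y"
  then have lt: "v x < v y" using False by simp
  have ne: "x + y \<noteq> 0"
  proof
    assume "x + y = 0"
    then have "x = - y" by (simp add: eq_neg_iff_add_eq_0)
    then show False using v_uminus *(2) lt by simp
  qed
  have 1: "v x \<le> v (x + y)" using v_add[OF *(1,2,3) False ne] lt by simp
  have "min (v (x + y)) (v (- y)) \<le> v (x + y + - y)"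
    using * False ne f(3,5) by (intro v_add) auto
  then have "v (x + y) \<le> v x" using lt v_uminus[OF *(2)] by (auto simp: min_def split: if_splits)
  then show ?thesis using 1 ne by simp
qed simp

lemma S_times: "S n ((*) a ` A) = (*) (a ^ (p ^ n)) ` S n A"
proof
  show "S n ((*) a ` A) \<subseteq> (*) (a ^ (p ^ n)) ` S n A"
    by (rule S_least[OF subsp_times[OF subsp_S]]) (auto simp: power_mult_distrib intro: S_pow)
  show "(*) (a ^ (p ^ n)) ` S n A \<subseteq> S n ((*) a ` A)"
  proof
    fix y assume "y \<in> (*) (a ^ (p ^ n)) ` S n A"
    then obtain x where x: "x \<in> S n A" "y = a ^ (p ^ n) * x" by blast
    have "a ^ (p ^ n) * x \<in> S n ((*) a ` A)" using x(1) unfolding S_def[of n A]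
    proof (induction rule: ksp.induct)
      case ksp_0
      show ?case using subspD(1)[OF Kr subsp_S] by simp
    next
      case (ksp_step b c d)
      then obtain d' where d: "d = d' ^ p ^ n" "d' \<in> A" by blast
      have "(a * d') ^ p ^ n \<in> S n ((*) a ` A)" using d by (intro S_pow) auto
      then have "a ^ p ^ n * b + c * (a * d') ^ p ^ n \<in> S n ((*) a ` A)"
        using ksp_step subspD(2,3)[OF Kr subsp_S] by blast
      then show ?case using d by (simp add: power_mult_distrib algebra_simps)
    qed
    then show "y \<in> S n ((*) a ` A)" using x by simp
  qed
qed

lemma S_msum: "S n (msum A B) \<subseteq> msum (S n A) (S n B)"
  by (rule S_least[OF subsp_msum[OF subsp_S subsp_S]]) (auto simp: freshman elim!: msumE intro!: msumI S_pow)

lemma S_I: "m \<ge> 0 \<or> n = 0 \<Longrightarrow> S j (I n m) \<subseteq> I (j + n) (int (p ^ j) * m)"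
proof (rule S_least[OF subsp_I])
  fix x assume x: "x \<in> I n m"
  have "x = 0 \<or> int (p ^ j) * m \<le> int (p ^ j) * v x" using x by (auto simp: I_def mult_left_mono)
  then show "x ^ p ^ j \<in> I (j + n) (int (p ^ j) * m)"
    using x Fn_frob[of x n j] v_power[OF FnF[of x n], of "p ^ j"] p_pos by (cases "x = 0") (auto simp: I_def power_0_left)
qed

section \<open>Ramification indices\<close>

definition E :: "nat \<Rightarrow> int" where
  "E n = int (LEAST e. e > 0 \<and> (\<exists>x\<in>Fn n. x \<noteq> 0 \<and> v x = int e))"

lemma E_ex: "E n > 0 \<and> (\<exists>x\<in>Fn n. x \<noteq> 0 \<and> v x = E n)"
proof -
  obtain x where x: "x \<in> F" "x \<noteq> 0" "v x = 1" using v_unif by blast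
  have "x ^ (p ^ n) \<in> Fn n" using Fn_frob[of x 0 n] x by (simp add: Fn_0)
  then have "p ^ n > 0 \<and> (\<exists>x\<in>Fn n. x \<noteq> 0 \<and> v x = int (p ^ n))"
    using x p_pos v_power[of x "p ^ n"] by (auto intro!: bexI[of _ "x ^ (p ^ n)"])
  from LeastI[of "\<lambda>e. e > 0 \<and> (\<exists>x\<in>Fn n. x \<noteq> 0 \<and> v x = int e)", OF this] show ?thesis
    unfolding E_def by simp
qed

lemma E_pos: "E n > 0" using E_ex by blast

lemma E_unif: obtains a where "a \<in> Fn n" "a \<noteq> 0" "v a = E n" using E_ex by blast

lemma E_least: "x \<in> Fn n \<Longrightarrow> x \<noteq> 0 \<Longrightarrow> v x > 0 \<Longrightarrow> E n \<le> v x"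
proof -
  assume x: "x \<in> Fn n" "x \<noteq> 0" "v x > 0"
  then have "(LEAST e. e > 0 \<and> (\<exists>x\<in>Fn n. x \<noteq> 0 \<and> v x = int e)) \<le> nat (v x)" by (intro Least_le) auto
  then show ?thesis using x by (simp add: E_def)
qed

lemma E_dvd: assumes "x \<in> Fn n" "x \<noteq> 0" shows "E n dvd v x"
proof -
  obtain a where a: "a \<in> Fn n" "a \<noteq> 0" "v a = E n" by (rule E_unif)
  define y where "y = x * a powi (- (v x div E n))"
  have y: "y \<in> Fn n" "y \<noteq> 0" using assms a Fn_powi fn(4) by (auto simp: y_def)
  have "v y = v x + v (a powi (- (v x div E n)))" unfolding y_def
    using assms a Fn_powi FnF[of _ n] by (intro v_mult) auto
  also have "\<dots> = v x mod E n" using a v_powi[OF FnF[of a n]] by (simp add: minus_div_mult_eq_mod[symmetric])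
  finally have "v y = v x mod E n" .
  moreover have "0 \<le> v x mod E n" "v x mod E n < E n" using E_pos by simp_all
  ultimately have "v x mod E n = 0" using E_least[OF y] by fastforce
  then show ?thesis by auto
qed

lemma E_0: "E 0 = 1"
proof -
  obtain x where x: "x \<in> F" "x \<noteq> 0" "v x = 1" using v_unif by blast
  then show ?thesis using E_least[of x 0] E_pos[of 0] by (simp add: Fn_0)
qed

lemma E_val: obtains a where "a \<in> Fn n" "a \<noteq> 0" "v a = E n * j"
proof -
  obtain a where a: "a \<in> Fn n" "a \<noteq> 0" "v a = E n" by (rule E_unif)
  show ?thesis using that[of "a powi j"] a Fn_powi v_powi[OF FnF[of a n], of j] by (auto simp: mult.commute)
qed

lemma E_Suc_dvd: "E n dvd E (Suc n)" "E (Suc n) dvd int p * E n"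
proof -
  obtain a where a: "a \<in> Fn (Suc n)" "a \<noteq> 0" "v a = E (Suc n)" by (rule E_unif)
  then show "E n dvd E (Suc n)" using E_dvd[of a n] Fn_Suc_sub by auto
  obtain b where b: "b \<in> Fn n" "b \<noteq> 0" "v b = E n" by (rule E_unif)
  then show "E (Suc n) dvd int p * E n" using E_dvd[OF Fn_frob1[of b n]] v_power[OF FnF[of b n], of p] by auto
qed

text \<open>\<open>Fn (Suc n)\<close> lies in \<open>Fn n\<close> and contains its
  \<open>p\<close>-th powers, so the index \<open>E (Suc n) / E n\<close> divides the prime
  \<open>p\<close>.\<close>

lemma E_Suc_cases: "E (Suc n) = E n \<or> E (Suc n) = int p * E n"
proof -
  obtain c where c: "E (Suc n) = E n * c" using E_Suc_dvd(1) by (auto simp: dvd_def)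
  have "E n * c dvd E n * int p" using E_Suc_dvd(2)[of n] c by (simp add: mult.commute)
  then have "c dvd int p" using E_pos[of n] by simp
  moreover have "c > 0" using c E_pos[of "Suc n"] E_pos[of n] by (metis zero_less_mult_pos)
  ultimately have "c = 1 \<or> c = int p" using prime_p
    by (metis int_nat_eq int_dvd_int_iff less_imp_le nat_1 of_nat_1 prime_nat_iff)
  then show ?thesis using c by auto
qed

text \<open>Values on \<open>Fn n\<close> are multiples of \<open>E n\<close>, so the filtration
  jumps only there.\<close>

lemma I_round: "0 < m \<Longrightarrow> m \<le> E n \<Longrightarrow> I n (E n * j + m) = I n (E n * (j + 1))"
proof
  assume m: "0 < m" "m \<le> E n"
  show "I n (E n * j + m) \<subseteq> I n (E n * (j + 1))"
  proof
    fix x assume x: "x \<in> I n (E n * j + m)"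
    show "x \<in> I n (E n * (j + 1))"
    proof (cases "x = 0")
      case False
      then obtain c where c: "v x = E n * c" using E_dvd[of x n] x by (auto simp: I_def dvd_def)
      have "E n * j + m \<le> v x" using x False by (simp add: I_def)
      then have "E n * j < E n * c" using c m by linarith
      then have "j + 1 \<le> c" using E_pos[of n] by simp
      then show ?thesis using x c E_pos[of n] by (auto simp: I_def)
    qed (simp add: I_0)
  qed
  show "I n (E n * (j + 1)) \<subseteq> I n (E n * j + m)" using m by (intro I_mono) (simp add: algebra_simps)
qed

end

text \<open>What the tower argument takes from the function field. \<open>gen\<close> bounds the
  degree of each step by \<open>p\<close>. \<open>bnd\<close> bounds the colength of
  \<open>S n (I 0 0)\<close> in \<open>I n 0\<close> independently of \<open>n\<close>, since the
  Frobenius carries the finite colength of \<open>O\<^sub>0\<close> in its multiple by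
  \<open>1 / h\<close> to every level.\<close>

locale fftower = vfield p K k F v for p :: nat and K k F :: "'a::field set" and v :: "'a \<Rightarrow> int" +
  assumes kfin: "\<exists>d. fdim K (I 0 0) (I 0 1) d"
    and gen: "\<exists>t. t \<in> F \<and> F \<subseteq> dsum p (\<lambda>_. Fn 1) t"
    and bnd: "\<exists>h. h \<in> I 0 0 \<and> h \<noteq> 0 \<and> (\<forall>n. \<forall>x\<in>I n 0. h ^ (p ^ n) * x \<in> S n (I 0 0))"
begin

lemma dd_ex: "\<exists>d. fdim K (I n 0) (I n 1) d"
proof -
  obtain d where d: "fdim K (I 0 0) (I 0 1) d" using kfin by blast
  have s: "I 0 1 \<subseteq> msum (I n 0) (I 0 1)" "msum (I n 0) (I 0 1) \<subseteq> I 0 0"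
    using msum_sub2[OF I_0] msum_least[OF subsp_I I_level[of 0 n 0] I_mono[of 0 1 0]] by auto
  obtain l where l: "fdim K (msum (I n 0) (I 0 1)) (I 0 1) l"
    using fdim_mid[OF K d subsp_I subsp_msum[OF subsp_I subsp_I] s] by blast
  have "fdim K (I n 0) (I n 0 \<inter> I 0 1) l" by (rule fdim_iso2_rev[OF K subsp_I subsp_I l])
  moreover have "I n 0 \<inter> I 0 1 = I n 1" using I_sub I_level[of 0 n 1] by (auto simp: I_def)
  ultimately show ?thesis by auto
qed

definition dd :: "nat \<Rightarrow> nat" where "dd n = (SOME d. fdim K (I n 0) (I n 1) d)"

lemma dd: "fdim K (I n 0) (I n 1) (dd n)"
  unfolding dd_def using dd_ex by (rule someI_ex)

lemma ddI: "fdim K (I n 0) (I n 1) d \<Longrightarrow> dd n = d"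
  using fdim_unique[OF K dd _ subsp_I] .

lemma dd_pos: "dd n > 0"
proof (rule ccontr)
  assume "\<not> ?thesis"
  then have "I n 0 = I n 1" using dd[of n] fdim_0_iff[OF K subsp_I] by simp
  then show False using one_notin subringD(2)[OF I_ring] by blast
qed

lemma fdim_I: "fdim K (I n (E n * a)) (I n (E n * (a + int j))) (j * dd n)"
proof (induction j)
  case 0
  show ?case by (simp add: fdim_0)
next
  case (Suc j)
  obtain b where b: "b \<in> Fn n" "b \<noteq> 0" "v b = E n * (a + int j)" by (rule E_val)
  have "fdim K ((*) b ` I n 0) ((*) b ` I n 1) (dd n)" by (rule fdim_times[OF dd b(2)])
  then have "fdim K (I n (E n * (a + int j))) (I n (E n * (a + int j) + 1)) (dd n)"
    using b by (simp add: I_times add.commute)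
  then have "fdim K (I n (E n * (a + int j))) (I n (E n * (a + int (Suc j)))) (dd n)"
    using I_round[of 1 n "a + int j"] E_pos[of n] by (simp add: algebra_simps)
  from fdim_add[OF K this Suc] show ?case by (simp add: add.commute)
qed

text \<open>The residue field of \<open>\<pp>\<^sub>n\<close> is spanned over \<open>K\<close> by its \<open>p\<close>-th powers, i.e. it is separable.\<close>

definition sep_residue :: "nat \<Rightarrow> bool" where
  "sep_residue n \<longleftrightarrow> I n 0 \<subseteq> msum (S 1 (I n 0)) (I n 1)"

section \<open>Residue fields along the tower\<close>

lemma S1_I: "S 1 (I n 0) \<subseteq> I (Suc n) 0" "S 1 (I n 1) \<subseteq> I (Suc n) 1"
  using S_I[of 0 n 1] S_I[of 1 n 1] I_mono[of 1 "int p" "Suc n"] p_pos by auto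

lemma I_Suc_msum: "msum (I (Suc n) 0) (I n 1) \<subseteq> I n 0"
  by (intro msum_least[OF subsp_I] I_level I_mono) auto

lemma I_Suc_inter: "I (Suc n) 0 \<inter> I n 1 = I (Suc n) 1"
  using I_level[of n "Suc n" 1] I_mono[of 0 1 "Suc n"] by (auto simp: I_def)

text \<open>The residue field of \<open>\<pp>\<^sub>n\<^sub>+\<^sub>1\<close> as a subspace of that
  of \<open>\<pp>\<^sub>n\<close>; this is how residue fields of different levels are
  compared.\<close>

lemma fdim_I_Suc: "fdim K (msum (I (Suc n) 0) (I n 1)) (I n 1) (dd (Suc n))"
  by (rule fdim_iso2[OF K dd subsp_I subsp_I I_Suc_inter])

lemma dd_Suc_le: "dd (Suc n) \<le> dd n"
proof -
  obtain m l where "fdim K (msum (I (Suc n) 0) (I n 1)) (I n 1) l" "m + l = dd n"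
    using fdim_mid[OF K dd subsp_I subsp_msum[OF subsp_I subsp_I] fdim_sub[OF K fdim_I_Suc] I_Suc_msum] by blast
  then show ?thesis using fdim_unique[OF K fdim_I_Suc _ subsp_I] by fastforce
qed

lemma dd_Suc_eq_iff: "dd (Suc n) = dd n \<longleftrightarrow> msum (I (Suc n) 0) (I n 1) = I n 0"
proof
  assume eq: "dd (Suc n) = dd n"
  obtain m l where ml: "fdim K (I n 0) (msum (I (Suc n) 0) (I n 1)) m" "fdim K (msum (I (Suc n) 0) (I n 1)) (I n 1) l" "m + l = dd n"
    using fdim_mid[OF K dd subsp_I subsp_msum[OF subsp_I subsp_I] fdim_sub[OF K fdim_I_Suc] I_Suc_msum] by blast
  have "l = dd n" using fdim_unique[OF K fdim_I_Suc ml(2) subsp_I] eq by simp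
  then have "m = 0" using ml(3) by simp
  then show "msum (I (Suc n) 0) (I n 1) = I n 0" using ml(1) fdim_0_iff[OF K subsp_msum[OF subsp_I subsp_I]] by blast
next
  assume "msum (I (Suc n) 0) (I n 1) = I n 0"
  then show "dd (Suc n) = dd n" using fdim_I_Suc[of n] ddI by metis
qed

text \<open>The Frobenius of a residue field is only semilinear, but it sends the vectors of a flag
  to generators of the spans of \<open>p\<close>-th powers, so lengths cannot grow.\<close>

lemma fdim_T: "fdim K A B j \<Longrightarrow> subsp K B \<Longrightarrow> subsp K M \<Longrightarrow> \<exists>j'\<le>j. fdim K (msum (S 1 A) M) (msum (S 1 B) M) j'"
proof (induction rule: fdim.induct)
  case fdim_0
  then show ?case using fdim.fdim_0 by blast
next
  case (fdim_Suc x B j)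
  have eq: "msum (S 1 (adj K B x)) M = adj K (msum (S 1 B) M) (x ^ p)"
  proof -
    have "msum (adj K C y) M = adj K (msum C M) y" for C y
    proof
      show "msum (adj K C y) M \<subseteq> adj K (msum C M) y"
      proof
        fix z assume "z \<in> msum (adj K C y) M"
        then obtain b c d where "b \<in> C" "c \<in> K" "d \<in> M" "z = (b + c * y) + d" by (auto simp: adj_def msum_def)
        then have "z = (b + d) + c * y" "b + d \<in> msum C M" by (auto intro: msumI)
        then show "z \<in> adj K (msum C M) y" using \<open>c \<in> K\<close> by (auto intro: adjI)
      qed
      show "adj K (msum C M) y \<subseteq> msum (adj K C y) M"
      proof
        fix z assume "z \<in> adj K (msum C M) y"
        then obtain b c d where "b \<in> C" "c \<in> K" "d \<in> M" "z = (b + d) + c * y" by (auto simp: adj_def msum_def)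
        then have "z = (b + c * y) + d" "b + c * y \<in> adj K C y" by (auto intro: adjI)
        then show "z \<in> msum (adj K C y) M" using \<open>d \<in> M\<close> by (auto intro: msumI)
      qed
    qed
    then show ?thesis using S_adj[OF fdim_Suc(4), of 1 x] by simp
  qed
  obtain j' where j': "j' \<le> j" "fdim K (msum (S 1 A) M) (adj K (msum (S 1 B) M) (x ^ p)) j'"
    using fdim_Suc subsp_adj[OF K] unfolding eq by blast
  show ?case
  proof (cases "x ^ p \<in> msum (S 1 B) M")
    case True
    then show ?thesis using j' adj_absorb[OF K subsp_msum[OF subsp_S fdim_Suc(5)]] by (auto intro: le_SucI)
  next
    case False
    then show ?thesis using fdim.fdim_Suc[OF False j'(2)] j'(1) by blast
  qed
qed

text \<open>Mac Lane's criterion: \<open>K\<close>-independent residue classes have \<open>K\<close>-independent \<open>p\<close>-th powers.\<close>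

lemma maclane:
  assumes N: "sep_residue N" and B: "subsp K B" "I N 1 \<subseteq> B" "B \<subseteq> I N 0" and x: "x \<in> I N 0" "x \<notin> B"
  shows "x ^ p \<notin> msum (S 1 B) (I N 1)"
proof
  define T where "T C = msum (S 1 C) (I N 1)" for C
  assume "x ^ p \<in> msum (S 1 B) (I N 1)"
  then have xT: "x ^ p \<in> T B" by (simp add: T_def)
  have sT: "subsp K (T C)" for C unfolding T_def by (intro subsp_msum subsp_S subsp_I)
  obtain j l where jl: "fdim K (I N 0) B j" "fdim K B (I N 1) l" "j + l = dd N"
    using fdim_mid[OF K dd subsp_I B] by blast
  have j: "j > 0" "fdim K (I N 0) (adj K B x) (j - 1)" using fdim_step[OF K jl(1) B(1) x] by auto
  have "adj K B x \<subseteq> msum (adj K B x) (I N 1)" by (rule msum_sub1[OF I_0])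
  have "S 1 (adj K B x) = adj K (S 1 B) (x ^ p)" using S_adj[OF B(1), of 1 x] by simp
  moreover have "adj K (S 1 B) (x ^ p) \<subseteq> T B"
    by (rule adj_least[OF K sT _ xT]) (unfold T_def, rule msum_sub1[OF I_0])
  moreover have "I N 1 \<subseteq> T B" unfolding T_def using msum_sub2 subspD(1)[OF Kr subsp_S] by blast
  ultimately have "T (adj K B x) \<subseteq> T B" unfolding T_def[of "adj K B x"] by (intro msum_least[OF sT]) auto
  moreover have "T B \<subseteq> T (adj K B x)" unfolding T_def using S_mono[OF adj_sub[OF K, of B x], of 1] by (auto simp: msum_def)
  \<comment> \<open>Under \<open>T\<close> the step from \<open>B\<close> to
    \<open>adj K B x\<close> is lost, so the images have at most \<open>dd N - 1\<close> steps; yet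
    \<open>sep_residue N\<close> makes them reach all of \<open>I N 0\<close>.\<close>
  ultimately have eq: "T (adj K B x) = T B" by blast
  obtain j' where j': "j' \<le> j - 1" "fdim K (T (I N 0)) (T B) j'"
    using fdim_T[OF j(2) subsp_adj[OF K B(1)] subsp_I[of N 1]] eq unfolding T_def by metis
  obtain l' where l': "l' \<le> l" "fdim K (T B) (T (I N 1)) l'"
    using fdim_T[OF jl(2) subsp_I subsp_I[of N 1]] unfolding T_def by metis
  have "S 1 (I N 1) \<subseteq> I N 1" using S1_I(2)[of N] I_level[of N "Suc N" 1] by auto
  then have T1: "T (I N 1) = I N 1" unfolding T_def using msum_absorb[OF Kr subsp_I] subspD(1)[OF Kr subsp_S] by blast
  have "S 1 (I N 0) \<subseteq> I N 0" using S1_I(1)[of N] I_level[of N "Suc N" 0] by auto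
  then have "T (I N 0) \<subseteq> I N 0" unfolding T_def by (intro msum_least[OF subsp_I] I_mono) auto
  then have T0: "T (I N 0) = I N 0" using N unfolding T_def sep_residue_def by blast
  have "fdim K (I N 0) (I N 1) (j' + l')" using fdim_add[OF K l'(2) j'(2)] by (simp add: T0 T1)
  then show False using ddI[of N] j'(1) l'(1) jl(3) j(1) by force
qed

lemma gspan_I:
  assumes "I N 0 = gspan K (I N 1) w d" "n \<le> d"
  shows "subsp K (gspan K (I N 1) w n)" "I N 1 \<subseteq> gspan K (I N 1) w n" "gspan K (I N 1) w n \<subseteq> I N 0"
    "n < d \<Longrightarrow> w n \<in> I N 0"
proof -
  show "subsp K (gspan K (I N 1) w n)" by (rule subsp_gspan[OF K subsp_I])
  show "I N 1 \<subseteq> gspan K (I N 1) w n" by (rule gspan_base[OF K])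
  show "n < d \<Longrightarrow> w n \<in> I N 0" unfolding assms(1) by (rule gspan_gen[OF K subsp_I])
  show "gspan K (I N 1) w n \<subseteq> I N 0" unfolding assms(1) 
    by (intro gspan_sub[OF K] subsp_gspan[OF K subsp_I] gspan_base[OF K] gspan_gen[OF K subsp_I]) (use assms in auto)
qed

text \<open>A \<open>K\<close>-combination of \<open>p\<close>-th powers of a residue basis vanishes
  only trivially. The basis vectors are stripped off from the top, and \<open>maclane\<close> forces
  each coefficient to be 0.\<close>

lemma S1_inter: assumes N: "sep_residue N" and x: "x \<in> S 1 (I N 0)" "x \<in> I N 1" shows "x \<in> S 1 (I N 1)"
proof -
  obtain w where w: "I N 0 = gspan K (I N 1) w (dd N)" "\<forall>j<dd N. w j \<notin> gspan K (I N 1) w j"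
    using fdim_basis[OF K dd subsp_I] by blast
  have "x \<in> S 1 (gspan K (I N 1) w n) \<Longrightarrow> x \<in> S 1 (I N 1)" if "n \<le> dd N" for n
    using that
  proof (induction n)
    case (Suc n)
    have n: "n \<le> dd N" "n < dd N" using Suc by auto
    note g = gspan_I[OF w(1) n(1)]
    define B where "B = gspan K (I N 1) w n"
    have "x \<in> adj K (S 1 B) (w n ^ p)" using Suc S_adj[OF g(1), of 1 "w n"] by (simp add: gspan_Suc B_def)
    then obtain b c where bc: "x = b + c * w n ^ p" "b \<in> S 1 B" "c \<in> K" by (auto simp: adj_def)
    have "c = 0"
    proof (rule ccontr)
      assume "c \<noteq> 0"
      then have "w n ^ p = inverse c * (- b) + inverse c * x" using bc(1) by (simp add: field_simps)
      also have "\<dots> \<in> msum (S 1 B) (I N 1)"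
        using subspD(3,4)[OF Kr subsp_S] subspD(3)[OF Kr subsp_I] bc x subfieldD(6)[OF K] by (intro msumI) blast+
      finally show False using maclane[OF N g(1,2,3) g(4)[OF n(2)]] w(2) n(2) by (simp add: B_def)
    qed
    then show ?case using bc Suc n by (simp add: B_def)
  qed (simp add: gspan_0)
  then show ?thesis using x(1) w(1) by auto
qed

text \<open>The point is that \<open>k\<close> tensored with the residue field of
  \<open>\<pp>\<^sub>N\<close> is reduced. The stripping argument is run over \<open>k\<close>;
  \<open>descent\<close> returns the resulting dependence of \<open>p\<close>-th powers to
  \<open>K\<close>, where \<open>maclane\<close> excludes it.\<close>

lemma reduced1: assumes N: "sep_residue N" and x: "x \<in> ksp k (I N 0)" "x ^ p \<in> ksp k (I N 1)" shows "x \<in> ksp k (I N 1)"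
proof -
  obtain w where w: "I N 0 = gspan K (I N 1) w (dd N)" "\<forall>j<dd N. w j \<notin> gspan K (I N 1) w j"
    using fdim_basis[OF K dd subsp_I] by blast
  note kk = subspD[OF kr subsp_ksp[OF kr]]
  have "x \<in> ksp k (gspan K (I N 1) w n) \<Longrightarrow> x \<in> ksp k (I N 1)" if "n \<le> dd N" for n
    using that
  proof (induction n)
    case (Suc n)
    have n: "n \<le> dd N" "n < dd N" using Suc by auto
    note g = gspan_I[OF w(1) n(1)]
    define B where "B = gspan K (I N 1) w n"
    have "x \<in> adj k (ksp k B) (w n)" using Suc ksp_adj[OF g(1)] by (simp add: gspan_Suc B_def)
    then obtain b c where bc: "x = b + c * w n" "b \<in> ksp k B" "c \<in> k" by (auto simp: adj_def)
    have "c = 0"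
    proof (rule ccontr)
      assume c0: "c \<noteq> 0"
      define T where "T = msum (S 1 B) (I N 1)"
      have sT: "subsp K T" unfolding T_def by (intro subsp_msum subsp_S subsp_I)
      have T1: "S 1 B \<subseteq> T" "I N 1 \<subseteq> T" unfolding T_def using msum_sub1[OF I_0] msum_sub2 subspD(1)[OF Kr subsp_S] by blast+
      have "x ^ p = b ^ p + c ^ p * w n ^ p" using freshman[of b "c * w n" 1] bc(1) by (simp add: power_mult_distrib)
      then have "w n ^ p = inverse (c ^ p) * x ^ p - inverse (c ^ p) * b ^ p" using c0 by (simp add: field_simps)
      moreover have "x ^ p \<in> ksp k T" using x(2) ksp_mono[OF order_refl T1(2)] by blast
      moreover have "b ^ p \<in> ksp k T" using ksp_pow[OF bc(2), of 1] ksp_mono[OF order_refl T1(1)] by auto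
      ultimately have "w n ^ p \<in> ksp k T" using kk(3,5) bc(3) subfieldD(6,9)[OF kf] by metis
      moreover have "S 1 B \<subseteq> I 0 0" "I N 1 \<subseteq> I 0 0"
      proof -
        have "S 1 B \<subseteq> S 1 (I N 0)" unfolding B_def by (rule S_mono[OF g(3)])
        also have "\<dots> \<subseteq> I (Suc N) 0" by (rule S1_I)
        also have "\<dots> \<subseteq> I 0 0" by (rule I_level) simp
        finally show "S 1 B \<subseteq> I 0 0" .
        have "I N 1 \<subseteq> I 0 1" by (rule I_level) simp
        also have "\<dots> \<subseteq> I 0 0" by (rule I_mono) simp
        finally show "I N 1 \<subseteq> I 0 0" .
      qed
      then have "T \<subseteq> F" using msum_least[OF subsp_I[of 0 0]] I_sub(2)[of 0 0] unfolding T_def by blast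
      moreover have "w n ^ p \<in> F" using g(4)[OF n(2)] I_sub(2) f(9) by blast
      ultimately have "w n ^ p \<in> T" using descent[OF sT] by blast
      then show False using maclane[OF N g(1,2,3) g(4)[OF n(2)]] w(2) n(2) by (simp add: B_def T_def)
    qed
    then show ?case using bc Suc n by (simp add: B_def)
  qed (simp add: gspan_0)
  then show ?thesis using x(1) w(1) by auto
qed

text \<open>An element of \<open>Fn (Suc N)\<close> enters the span of \<open>p\<close>-th powers of
  \<open>I N 0\<close> after multiplication by a power of \<open>a ^ p\<close>. If it is integral,
  \<open>S1_inter\<close> lets these factors be cancelled one at a time. The same divisibility shows
  that \<open>a ^ p\<close> is a uniformizer of the next level.\<close>

lemma sep_residue_S: assumes N: "sep_residue N" shows "S 1 (I N 0) = I (Suc N) 0" and "E (Suc N) = int p * E N"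
proof -
  obtain a where a: "a \<in> Fn N" "a \<noteq> 0" "v a = E N" by (rule E_unif)
  have aF: "a \<in> F" using a Fn_sub by blast
  have mN: "I N 1 = (*) a ` I N 0" using I_times[OF a(1,2), of 0] a(3) I_round[of 1 N 0] I_round[of "E N" N 0] E_pos[of N] by simp
  have SmN: "S 1 (I N 1) = (*) (a ^ p) ` S 1 (I N 0)" unfolding mN using S_times[of 1 a] by simp
  have "I (Suc N) 0 \<subseteq> S 1 (I N 0)"
  proof
    fix x assume x: "x \<in> I (Suc N) 0"
    have "x \<in> S 1 (Fn N)" using x I_sub(1) S_Fn[of 1 N] by auto
    then have "\<exists>j. (a ^ p) ^ j * x \<in> S 1 (I N 0)" unfolding S_def[of 1 "Fn N"]
    proof (induction rule: ksp.induct)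
      case ksp_0
      show ?case using subspD(1)[OF Kr subsp_S] by simp
    next
      case (ksp_step y c b)
      then obtain j b' where j: "(a ^ p) ^ j * y \<in> S 1 (I N 0)" "b = b' ^ p" "b' \<in> Fn N" by auto
      have aI: "a \<in> I N 0" using a E_pos[of N] by (simp add: I_def)
      note sr = subringD[OF S_ring[OF I_ring]]
      have apS: "(a ^ p) ^ i \<in> S 1 (I N 0)" for i using sr(7) S_pow[OF aI, of 1] by simp
      have bi: "a ^ i * b' \<in> I N 0" if "int i * E N \<ge> - v b'" for i
        using that j(3) a fn v_mult[of "a ^ i" b'] v_power[OF aF a(2)] Fn_sub
        by (auto simp: I_def) (metis add.commute add_le_cancel_left f(9) aF diff_ge_0_iff_ge minus_le_iff neg_0_le_iff_le uminus_add_conv_diff subsetD)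
      \<comment> \<open>As \<open>E N \<ge> 1\<close>, this many factors \<open>a\<close> surely
        make \<open>b'\<close> integral.\<close>
      define i where "i = nat (- v b')"
      have "int i * E N \<ge> - v b'"
      proof (cases "v b' \<ge> 0")
        case True
        then show ?thesis using E_pos[of N] by (simp add: i_def)
      next
        case False
        then have "int i = - v b'" by (simp add: i_def)
        then show ?thesis using mult_left_mono[of 1 "E N" "int i"] E_pos[of N] by simp
      qed
      then have "(a ^ i * b') ^ p \<in> S 1 (I N 0)" using S_pow[OF bi, of i 1] by simp
      then have b2: "(a ^ p) ^ i * b \<in> S 1 (I N 0)" using j(2) by (simp add: power_mult_distrib power_mult[symmetric] mult.commute)
      have cS: "c \<in> S 1 (I N 0)" using K_sub_S[OF I_ring] ksp_step(2) by blast
      have "(a ^ p) ^ (j + i) * (y + c * b) = (a ^ p) ^ i * ((a ^ p) ^ j * y) + (a ^ p) ^ j * (c * ((a ^ p) ^ i * b))"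
        by (simp add: power_add algebra_simps)
      also have "\<dots> \<in> S 1 (I N 0)" by (intro sr(3) sr(4) apS j(1) b2 cS)
      finally show ?case by blast
    qed
    then obtain j where "(a ^ p) ^ j * x \<in> S 1 (I N 0)" by blast
    then show "x \<in> S 1 (I N 0)"
    proof (induction j)
      case (Suc j)
      have apF: "a ^ p \<in> F" "a ^ p \<noteq> 0" "v (a ^ p) > 0" using aF a f(9) v_power E_pos[of N] p_pos by auto
      have "(a ^ p) ^ Suc j * x \<in> I N 0" using Suc S1_I(1)[of N] I_level[of N "Suc N" 0] by auto
      moreover have "x = 0 \<or> v ((a ^ p) ^ Suc j * x) = int (Suc j) * v (a ^ p) + v x"
        using v_mult[of "(a ^ p) ^ Suc j" x] v_power[OF apF(1,2), of "Suc j"] x I_sub(2) f(9)[OF apF(1), of "Suc j"] apF(2) by auto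
      moreover have "int (Suc j) * v (a ^ p) \<ge> 1" using apF(3) by (metis int_one_le_iff_zero_less mult_pos_pos of_nat_0_less_iff zero_less_Suc)
      moreover have "x = 0 \<or> v x \<ge> 0" using x by (simp add: I_def)
      ultimately have "(a ^ p) ^ Suc j * x \<in> I N 1" by (auto simp: I_def)
      then have "(a ^ p) ^ Suc j * x \<in> (*) (a ^ p) ` S 1 (I N 0)" using S1_inter[OF N Suc(2)] SmN by blast
      then obtain y where "(a ^ p) ^ Suc j * x = a ^ p * y" "y \<in> S 1 (I N 0)" by blast
      then have "(a ^ p) ^ j * x \<in> S 1 (I N 0)" using a(2) by (simp add: mult.assoc)
      then show ?case by (rule Suc.IH)
    qed simp
  qed
  then show eq: "S 1 (I N 0) = I (Suc N) 0" using S1_I(1) by blast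
  have "int p * E N \<le> E (Suc N)"
  proof -
    obtain b where b: "b \<in> Fn (Suc N)" "b \<noteq> 0" "v b = E (Suc N)" by (rule E_unif)
    then have "b \<in> I (Suc N) 0" "b \<in> I N 1" using E_pos[of "Suc N"] Fn_Suc_sub[of N] by (auto simp: I_def)
    then have "b \<in> (*) (a ^ p) ` S 1 (I N 0)" using S1_inter[OF N] eq SmN by blast
    then obtain y where y: "b = a ^ p * y" "y \<in> I (Suc N) 0" using eq by blast
    have "v b = int p * E N + v y" using y b(2) v_mult[of "a ^ p" y] v_power[OF aF a(2), of p] a(3) f(9)[OF aF] I_sub(2) by auto
    then show ?thesis using b y by (auto simp: I_def)
  qed
  moreover have "1 * E N < int p * E N" using E_pos[of N] p_gt1 by (intro mult_strict_right_mono) auto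
  ultimately show "E (Suc N) = int p * E N" using E_Suc_cases[of N] by auto
qed

lemma sep_residue_dd: assumes N: "sep_residue N" shows "dd (Suc N) = dd N"
  using N sep_residue_S(1)[OF N] I_Suc_msum[of N] unfolding dd_Suc_eq_iff sep_residue_def by auto

lemma sep_residue_Suc: assumes N: "sep_residue N" shows "sep_residue (Suc N)"
proof -
  have "I (Suc N) 0 = S 1 (I N 0)" using sep_residue_S(1)[OF N] by simp
  also have "\<dots> \<subseteq> S 1 (msum (S 1 (I N 0)) (I N 1))" using N unfolding sep_residue_def by (rule S_mono)
  also have "\<dots> \<subseteq> msum (S 1 (S 1 (I N 0))) (S 1 (I N 1))" by (rule S_msum)
  also have "\<dots> \<subseteq> msum (S 1 (I (Suc N) 0)) (I (Suc N) 1)" using sep_residue_S(1)[OF N] S1_I(2)[of N] by (auto simp: msum_def)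
  finally show ?thesis unfolding sep_residue_def .
qed

lemma sep_residue_mono: "sep_residue N \<Longrightarrow> N \<le> M \<Longrightarrow> sep_residue M"
  by (induction M) (auto simp: le_Suc_eq sep_residue_Suc)

lemma sep_residue_SM: "sep_residue N \<Longrightarrow> S m (I N 0) = I (m + N) 0"
proof (induction m)
  case 0
  show ?case using S_0[OF subsp_I] by simp
next
  case (Suc m)
  have "S (Suc m) (I N 0) = S 1 (S m (I N 0))" by (simp add: S_S)
  then show ?case using Suc sep_residue_S(1)[OF sep_residue_mono[OF Suc(2), of "m + N"]] by simp
qed

text \<open>Two monotone sequences become stationary: the colengths of \<open>S n (I 0 0)\<close> in
  \<open>I n 0\<close>, bounded by \<open>bnd\<close>, and the residue degrees. Where both stand
  still, \<open>O\<^sub>n\<^sub>+\<^sub>1\<close> is spanned by the \<open>p\<close>-th powers of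
  \<open>O\<^sub>n\<close> and has the same residue field, which is
  \<open>sep_residue n\<close>.\<close>

lemma sep_residue_ex: "\<exists>N. sep_residue N"
proof -
  obtain h where h: "h \<in> I 0 0" "h \<noteq> 0" "\<And>n x. x \<in> I n 0 \<Longrightarrow> h ^ (p ^ n) * x \<in> S n (I 0 0)" using bnd by blast
  define h' where "h' = inverse h"
  have "h \<in> Fn 0" using h(1) I_sub(1) by blast
  then have h': "h' \<in> Fn 0" "h' \<noteq> 0" "v h' = - v h" using h(2) fn(6)[of h 0] v_inverse[OF FnF[of h 0]] by (auto simp: h'_def)
  define D where "D = nat (v h) * dd 0"
  have vh: "v h \<ge> 0" using h by (auto simp: I_def)
  have DD: "fdim K ((*) h' ` I 0 0) (I 0 0) D"
    using fdim_I[of 0 "- v h" "nat (v h)"] I_times[OF h'(1,2), of 0] h'(3) vh by (simp add: E_0 D_def)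
  have fi: "(*) h' ` I 0 0 \<subseteq> F" using I_times[OF h'(1,2), of 0] I_sub(2) by auto
  have SI: "S n (I 0 0) \<subseteq> I n 0" for n using S_I[of 0 0 n] by simp
  have IS: "I n 0 \<subseteq> S n ((*) h' ` I 0 0)" for n
  proof
    fix x assume "x \<in> I n 0"
    then have "h ^ (p ^ n) * x \<in> S n (I 0 0)" by (rule h(3))
    moreover have "x = h' ^ (p ^ n) * (h ^ (p ^ n) * x)" using h(2) by (simp add: h'_def power_inverse)
    ultimately show "x \<in> S n ((*) h' ` I 0 0)" unfolding S_times by blast
  qed
  have ex: "\<exists>s\<le>D. fdim K (I n 0) (S n (I 0 0)) s" for n
  proof -
    have "fdim K (S n ((*) h' ` I 0 0)) (S n (I 0 0)) D" by (rule fdim_S[OF DD subsp_I fi])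
    from fdim_mid[OF K this subsp_S subsp_I SI IS] obtain m l where "fdim K (I n 0) (S n (I 0 0)) l" "m + l = D" by blast
    then show ?thesis by (intro exI[of _ l]) auto
  qed
  then obtain s where s: "\<And>n. s n \<le> D" "\<And>n. fdim K (I n 0) (S n (I 0 0)) (s n)" by metis
  \<comment> \<open>\<open>S 1\<close> preserves the old colength, so the increase measures exactly
    how far \<open>S 1 (I n 0)\<close> is from \<open>I (Suc n) 0\<close>.\<close>
  have step: "\<exists>e. fdim K (I (Suc n) 0) (S 1 (I n 0)) e \<and> s (Suc n) = e + s n" for n
  proof -
    have a: "fdim K (S 1 (I n 0)) (S 1 (S n (I 0 0))) (s n)" by (rule fdim_S[OF s(2) subsp_S I_sub(2)])
    have b: "S 1 (S n (I 0 0)) = S (Suc n) (I 0 0)" by (simp add: S_S)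
    obtain e l where el: "fdim K (I (Suc n) 0) (S 1 (I n 0)) e" "fdim K (S 1 (I n 0)) (S (Suc n) (I 0 0)) l" "e + l = s (Suc n)"
      using fdim_mid[OF K s(2)[of "Suc n"] subsp_S subsp_S[of 1 "I n 0"]] fdim_sub[OF K a] S1_I(1)[of n] unfolding b by blast
    have "l = s n" using fdim_unique[OF K el(2) _ subsp_S] a b by simp
    then show ?thesis using el by auto
  qed
  have "s n \<le> s (Suc n)" for n using step[of n] by auto
  then have mono: "mono s" by (rule incseq_SucI)
  obtain n0 where n0: "\<And>n. s n \<le> s n0"
  proof -
    have fin: "finite (range s)" using s(1) by (intro finite_subset[of "range s" "{..D}"]) auto
    then have "Max (range s) \<in> range s" by (intro Max_in) auto
    then obtain n0 where "Max (range s) = s n0" by blast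
    then show ?thesis using that[of n0] Max_ge[OF fin] by (metis rangeI)
  qed
  have eqS: "S 1 (I n 0) = I (Suc n) 0" if "n \<ge> n0" for n
  proof -
    obtain e where e: "fdim K (I (Suc n) 0) (S 1 (I n 0)) e" "s (Suc n) = e + s n" using step by blast
    have "s n0 \<le> s n" using mono that by (simp add: monoD)
    then have "e = 0" using n0[of "Suc n"] e(2) by simp
    then show ?thesis using e(1) fdim_0_iff[OF K subsp_S] by blast
  qed
  have "\<exists>n\<ge>n0. dd (Suc n) = dd n"
  proof (rule ccontr)
    assume "\<not> ?thesis"
    then have lt: "dd (Suc n) < dd n" if "n \<ge> n0" for n using that dd_Suc_le[of n] by force
    have "dd (n0 + j) + j \<le> dd n0" for j
    proof (induction j)
      case (Suc j)
      have "dd (Suc (n0 + j)) < dd (n0 + j)" by (rule lt) simp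
      then show ?case using Suc by simp
    qed simp
    from this[of "Suc (dd n0)"] show False by simp
  qed
  then obtain n where n: "n \<ge> n0" "dd (Suc n) = dd n" by blast
  then have "sep_residue n" using dd_Suc_eq_iff[of n] unfolding sep_residue_def eqS[OF n(1)] by blast
  then show ?thesis ..
qed

end

section \<open>Colengths in the tower\<close>

lemma geometric_nat: "(p - 1) * (\<Sum>i<m. p ^ i) = p ^ m - (1::nat)" if "p \<ge> 1"
proof -
  obtain q where "p = Suc q" using \<open>p \<ge> 1\<close> by (cases p) auto
  moreover have "q * (\<Sum>i<m. Suc q ^ i) + 1 = Suc q ^ m" by (induction m) (auto simp: algebra_simps)
  ultimately show ?thesis by simp
qed

text \<open>In terms of the digits \<open>c i\<close>, let \<open>m\<close> be the first index with \<open>c m = 0\<close>. All digits below \<open>m\<close> are positive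
  multiples of \<open>p ^ r m\<close>, and from \<open>m\<close> on the exponents \<open>r\<close> drop by one at each step.\<close>

lemma digit_bound:
  fixes r c b :: "nat \<Rightarrow> nat"
  assumes p: "p \<ge> (2::nat)" and r: "\<And>i. r i = r (Suc i) \<or> r i = Suc (r (Suc i))"
    and c: "\<And>i. c i = c (Suc i) + b i * p ^ r (Suc i)" and cN: "\<And>i. i \<ge> N \<Longrightarrow> c i = 0"
    and sm: "\<And>i. c i = 0 \<Longrightarrow> r i > 0 \<Longrightarrow> r i = Suc (r (Suc i))"
    and W: "W = (\<Sum>i<N. c i * p ^ i)" "W > 0" and n: "r n > 0"
  shows "p ^ n \<le> W" and "(p - 1) * W < p ^ (n + 1) \<Longrightarrow> \<exists>j i. j \<le> i \<and> W = (\<Sum>k=j..i. p ^ k)"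
proof -
  define m where "m = (LEAST m. c m = 0)"
  have cm: "c m = 0" unfolding m_def by (rule LeastI[of _ N]) (simp add: cN)
  have cpos: "c i > 0" if "i < m" for i using not_less_Least[of i "\<lambda>m. c m = 0"] that unfolding m_def by simp
  have mN: "m \<le> N" unfolding m_def by (rule Least_le) (simp add: cN)
  have dec: "c (i + j) \<le> c i" for i j by (induction j) (use c[of "i + _"] in \<open>auto intro: order_trans\<close>)
  have rdec: "r (i + j) \<le> r i" for i j 
  proof (induction j)
    case (Suc j)
    then show ?case using r[of "i + j"] by auto
  qed simp
  have c0: "c i = 0" if "i \<ge> m" for i using dec[of m "i - m"] cm that by simp
  have m0: "m > 0"
  proof (rule ccontr)
    assume "\<not> m > 0"
    then have "W = 0" using c0 W(1) by simp
    then show False using W(2) by simp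
  qed
  have rdvd: "p ^ r m dvd p ^ r (Suc i)" if "i < m" for i
    using rdec[of "Suc i" "m - Suc i"] that by (intro le_imp_power_dvd) simp
  have dvd: "p ^ r m dvd c i" if "i \<le> m" for i
    using that
  proof (induction "m - i" arbitrary: i)
    case 0
    then show ?case using cm by simp
  next
    case (Suc d)
    then have "p ^ r m dvd c (Suc i)" by (intro Suc(1)) auto
    then show ?case using c[of i] rdvd[of i] Suc by simp
  qed
  have W': "W = (\<Sum>i<m. c i * p ^ i)" unfolding W(1)
    using mN c0 by (intro sum.mono_neutral_right) auto
  define e where "e i = c i div p ^ r m" for i
  have ce: "c i = e i * p ^ r m" if "i < m" for i using dvd[of i] that by (simp add: e_def)
  have e1: "e i \<ge> 1" if "i < m" for i using cpos[OF that] ce[OF that] by (cases "e i") auto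
  define V where "V = (\<Sum>i<m. e i * p ^ i)"
  have WV: "W = p ^ r m * V" unfolding W' V_def sum_distrib_left using ce by (intro sum.cong) auto
  have V1: "(\<Sum>i<m. p ^ i) \<le> V" unfolding V_def using e1 by (intro sum_mono) auto
  have rr: "r (m + j) = r m - j" if "j \<le> r m" for j using that
  proof (induction j)
    case (Suc j)
    then show ?case using sm[of "m + j"] c0[of "m + j"] by auto
  qed simp
  \<comment> \<open>From index \<open>m\<close> on the exponent drops at every step until it is 0,
    so it vanishes from \<open>m + r m\<close> on, while \<open>r n > 0\<close>.\<close>
  have nlt: "n < m + r m"
  proof (rule ccontr)
    assume "\<not> ?thesis"
    then have "r n \<le> r (m + r m)" using rdec[of "m + r m" "n - (m + r m)"] by simp
    then show False using rr[of "r m"] n by simp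
  qed
  have "p ^ n \<le> p ^ (r m + (m - 1))" using nlt m0 p by (intro power_increasing) auto
  also have "\<dots> = p ^ r m * p ^ (m - 1)" by (rule power_add)
  also have "\<dots> \<le> W" unfolding WV
  proof (intro mult_left_mono order_trans[OF _ V1])
    show "p ^ (m - 1) \<le> (\<Sum>i<m. p ^ i)" using m0 by (intro member_le_sum) auto
  qed simp
  finally show "p ^ n \<le> W" .
  \<comment> \<open>After division by \<open>p ^ r m\<close> this gives
    \<open>(p - 1) * V \<le> p ^ m - 1\<close>, the value belonging to digits
    \<open>e i = 1\<close>. Since all \<open>e i \<ge> 1\<close>, equality holds and
    \<open>V\<close> is the geometric sum.\<close>
  assume "(p - 1) * W < p ^ (n + 1)"
  also have "\<dots> \<le> p ^ (r m + m)" using nlt p by (intro power_increasing) auto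
  finally have "p ^ r m * ((p - 1) * V) < p ^ r m * p ^ m" unfolding WV by (simp add: power_add ac_simps)
  then have "(p - 1) * V < p ^ m" by simp
  then have "(p - 1) * V \<le> (p - 1) * (\<Sum>i<m. p ^ i)" using geometric_nat[of p m] p by linarith
  then have "V = (\<Sum>i<m. p ^ i)" using V1 p by simp
  then have "W = (\<Sum>i<m. p ^ (i + r m))" unfolding WV by (simp add: sum_distrib_left power_add mult.commute)
  also have "\<dots> = (\<Sum>k=r m..r m + m - 1. p ^ k)"
    by (rule sum.reindex_bij_witness[of _ "\<lambda>k. k - r m" "\<lambda>i. i + r m"]) (use m0 in auto)
  finally show "\<exists>j i. j \<le> i \<and> W = (\<Sum>k=j..i. p ^ k)" using m0 by (intro exI[of _ "r m"] exI[of _ "r m + m - 1"]) auto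
qed

text \<open>The terms for \<open>j\<close> and \<open>p - j\<close> add up to \<open>l - 1\<close>,
  since \<open>p\<close> does not divide \<open>j * l\<close>. The sum is the number of gaps of the
  numerical semigroup generated by \<open>p\<close> and \<open>l\<close>; the factor 2 in the final
  bounds comes from here.\<close>

lemma floor_sum:
  fixes l :: int
  assumes p: "prime p" and l: "l \<ge> 1" "\<not> int p dvd l"
  shows "2 * (\<Sum>j<p. int j * l div int p) = (int p - 1) * (l - 1)"
proof -
  have p0: "p > 0" using p prime_gt_0_nat by blast
  have pair: "int j * l div int p + int (p - j) * l div int p = l - 1" if "j \<in> {1..<p}" for j
  proof -
    have nd: "\<not> int p dvd int j * l"
    proof
      assume "int p dvd int j * l"
      then have "int p dvd int j" using l(2) p by (simp add: prime_dvd_mult_iff)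
      then show False using that by (auto dest: zdvd_imp_le)
    qed
    have "int (p - j) * l = l * int p - int j * l" using that by (simp add: of_nat_diff algebra_simps)
    then have "int (p - j) * l div int p = (- (int j * l)) div int p + l" using p0 by (metis div_mult_self1 add.commute diff_conv_add_uminus of_nat_0_eq_iff not_gr_zero)
    also have "(- (int j * l)) div int p = - (int j * l div int p) - 1" using nd p0 by (simp add: zdiv_zminus1_eq_if dvd_eq_mod_eq_0)
    finally show ?thesis by simp
  qed
  have "(\<Sum>j<p. int j * l div int p) = (\<Sum>j\<in>{1..<p}. int j * l div int p)"
    by (rule sum.mono_neutral_right) (auto simp: not_less_eq_eq)
  moreover have "(\<Sum>j\<in>{1..<p}. int j * l div int p) = (\<Sum>j\<in>{1..<p}. int (p - j) * l div int p)"
    by (rule sum.reindex_bij_witness[of _ "\<lambda>j. p - j" "\<lambda>j. p - j"]) auto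
  ultimately have "2 * (\<Sum>j<p. int j * l div int p) = (\<Sum>j\<in>{1..<p}. int j * l div int p + int (p - j) * l div int p)"
    by (simp add: sum.distrib)
  also have "\<dots> = (\<Sum>j\<in>{1..<p}. l - 1)" using pair by (intro sum.cong) auto
  also have "\<dots> = (int p - 1) * (l - 1)" using p0 by (simp add: of_nat_diff)
  finally show ?thesis .
qed

section \<open>Modules spanned by the powers of one element\<close>

lemma dsum_gspan: "dsum r (\<lambda>_. E) z = gspan E {0} (\<lambda>j. z ^ j) r"
  unfolding dsum_def gspan_def by auto

lemma dsum_poly:
  assumes "is_subring R"
  shows "x \<in> dsum r (\<lambda>_. R) y \<longleftrightarrow> (\<exists>g. poly_over R g \<and> (\<forall>i\<ge>r. coeff g i = 0) \<and> x = poly g y)"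
proof
  assume "x \<in> dsum r (\<lambda>_. R) y"
  then obtain a where a: "x = (\<Sum>j<r. a j * y ^ j)" "\<forall>j<r. a j \<in> R" by (rule dsumE)
  define g where "g = (\<Sum>j<r. monom (a j) j)"
  have cg: "coeff g i = (if i < r then a i else 0)" for i by (auto simp: g_def coeff_sum sum.delta cong: if_cong)
  then have "poly_over R g" "\<forall>i\<ge>r. coeff g i = 0" using a subringD(1)[OF assms] by (auto simp: poly_over_def)
  moreover have "x = poly g y" by (simp add: g_def a poly_sum poly_monom)
  ultimately show "\<exists>g. poly_over R g \<and> (\<forall>i\<ge>r. coeff g i = 0) \<and> x = poly g y" by blast
next
  assume "\<exists>g. poly_over R g \<and> (\<forall>i\<ge>r. coeff g i = 0) \<and> x = poly g y"
  then obtain g where g: "poly_over R g" "\<forall>i\<ge>r. coeff g i = 0" "x = poly g y" by blast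
  have "x = (\<Sum>j\<le>degree g. coeff g j * y ^ j)" by (simp add: g poly_altdef)
  also have "\<dots> = (\<Sum>j<max r (Suc (degree g)). coeff g j * y ^ j)"
    by (intro sum.mono_neutral_left) (auto simp: coeff_eq_0)
  also have "\<dots> = (\<Sum>j<r. coeff g j * y ^ j)"
    using g(2) by (intro sum.mono_neutral_right) auto
  finally show "x \<in> dsum r (\<lambda>_. R) y" using g(1) by (auto intro!: dsumI simp: poly_over_def)
qed

lemma coeff_pcompose_shift_0:
  assumes "\<forall>i\<ge>r. coeff g i = (0::'a::idom)" shows "\<forall>i\<ge>r. coeff (pcompose g [:b, 1:]) i = 0"
proof (cases "g = 0")
  case False
  then have "degree g < r" using assms by (metis leading_coeff_0_iff not_le)
  then show ?thesis by (auto intro!: coeff_eq_0 simp: degree_pcompose)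
qed simp

lemma dsum_shift: assumes R: "is_subring R" "b \<in> R" shows "dsum r (\<lambda>_. R) (u + b) = dsum r (\<lambda>_. R) u"
proof -
  have "dsum r (\<lambda>_. R) (u + b) \<subseteq> dsum r (\<lambda>_. R) u" if "b \<in> R" for u b
  proof
    fix x assume "x \<in> dsum r (\<lambda>_. R) (u + b)"
    then obtain g where g: "poly_over R g" "\<forall>i\<ge>r. coeff g i = 0" "x = poly g (u + b)" using dsum_poly[OF R(1)] by blast
    have "poly_over R (pcompose g [:b, 1:])"
      using that subringD[OF R(1)] by (intro poly_over_pcompose R(1) g(1)) (auto simp: poly_over_pCons poly_over_0 R(1))
    moreover have "x = poly (pcompose g [:b, 1:]) u" using g(3) by (simp add: poly_pcompose add.commute)
    ultimately show "x \<in> dsum r (\<lambda>_. R) u" using coeff_pcompose_shift_0[OF g(2)] dsum_poly[OF R(1)] by blast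
  qed
  from this[OF R(2), of u] this[OF subringD(5)[OF R], of "u + b"] show ?thesis by auto
qed

lemma dsum_times: "(*) a ` dsum r A z = dsum r (\<lambda>j. (*) a ` A j) z"
proof
  show "(*) a ` dsum r A z \<subseteq> dsum r (\<lambda>j. (*) a ` A j) z"
  proof
    fix y assume "y \<in> (*) a ` dsum r A z"
    then obtain c where "y = a * (\<Sum>j<r. c j * z ^ j)" "\<forall>j<r. c j \<in> A j" by (auto elim: dsumE)
    then have "y = (\<Sum>j<r. (a * c j) * z ^ j)" "\<forall>j<r. a * c j \<in> (*) a ` A j" by (auto simp: sum_distrib_left mult.assoc)
    then show "y \<in> dsum r (\<lambda>j. (*) a ` A j) z" by (auto intro: dsumI)
  qed
  show "dsum r (\<lambda>j. (*) a ` A j) z \<subseteq> (*) a ` dsum r A z"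
  proof
    fix y assume "y \<in> dsum r (\<lambda>j. (*) a ` A j) z"
    then obtain c where c: "y = (\<Sum>j<r. c j * z ^ j)" "\<forall>j<r. c j \<in> (*) a ` A j" by (rule dsumE)
    have "\<forall>j<r. \<exists>d. c j = a * d \<and> d \<in> A j" using c(2) by blast
    then obtain d where d: "\<forall>j<r. c j = a * d j \<and> d j \<in> A j" by metis
    then have "y = a * (\<Sum>j<r. d j * z ^ j)" using c(1) by (simp add: sum_distrib_left mult.assoc)
    moreover have "(\<Sum>j<r. d j * z ^ j) \<in> dsum r A z" using d by (intro dsumI) auto
    ultimately show "y \<in> (*) a ` dsum r A z" by blast
  qed
qed

lemma (in vfield) S_dsum:
  assumes "\<And>j. j < r \<Longrightarrow> subsp K (A j)"
  shows "S n (dsum r A z) = dsum r (\<lambda>j. S n (A j)) (z ^ (p ^ n))"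
proof
  show "S n (dsum r A z) \<subseteq> dsum r (\<lambda>j. S n (A j)) (z ^ (p ^ n))"
  proof (rule S_least)
    show "subsp K (dsum r (\<lambda>j. S n (A j)) (z ^ (p ^ n)))" by (intro subsp_dsum subsp_S)
    fix x assume "x \<in> dsum r A z"
    then obtain a where a: "x = (\<Sum>j<r. a j * z ^ j)" "\<forall>j<r. a j \<in> A j" by (rule dsumE)
    have "x ^ (p ^ n) = (\<Sum>j<r. a j ^ (p ^ n) * (z ^ (p ^ n)) ^ j)"
      unfolding a(1) frob_sum by (simp add: power_mult_distrib power_mult[symmetric] mult.commute)
    also have "\<dots> \<in> dsum r (\<lambda>j. S n (A j)) (z ^ (p ^ n))" using a(2) by (intro dsumI S_pow) auto
    finally show "x ^ (p ^ n) \<in> dsum r (\<lambda>j. S n (A j)) (z ^ (p ^ n))" .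
  qed
  show "dsum r (\<lambda>j. S n (A j)) (z ^ (p ^ n)) \<subseteq> S n (dsum r A z)"
  proof
    fix x assume "x \<in> dsum r (\<lambda>j. S n (A j)) (z ^ (p ^ n))"
    then obtain a where a: "x = (\<Sum>j<r. a j * (z ^ (p ^ n)) ^ j)" "\<forall>j<r. a j \<in> S n (A j)" by (rule dsumE)
    have "a j * (z ^ (p ^ n)) ^ j \<in> S n (dsum r A z)" if j: "j < r" for j
    proof -
      have sub: "(*) (z ^ j) ` A j \<subseteq> dsum r A z"
      proof
        fix y assume "y \<in> (*) (z ^ j) ` A j"
        then obtain b where b: "y = z ^ j * b" "b \<in> A j" by blast
        have "(\<Sum>i<r. (if i = j then b else 0) * z ^ i) = (\<Sum>i<r. if i = j then b * z ^ i else 0)" by (rule sum.cong) auto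
        then have "y = (\<Sum>i<r. (if i = j then b else 0) * z ^ i)" using j b by (simp add: mult.commute)
        also have "\<dots> \<in> dsum r A z" using b assms by (intro dsumI) (auto simp: subsp_def)
        finally show "y \<in> dsum r A z" .
      qed
      have "(z ^ j) ^ (p ^ n) * a j \<in> S n ((*) (z ^ j) ` A j)" unfolding S_times using a(2) j by blast
      then show ?thesis using S_mono[OF sub] by (auto simp: mult.commute power_mult[symmetric])
    qed
    then show "x \<in> S n (dsum r A z)" unfolding a(1) by (intro subspD(6)[OF Kr subsp_S]) auto
  qed
qed

section \<open>Values of sums over the powers of one element\<close>

context vfield
begin

lemma v_sum_distinct:
  assumes "finite J" "\<And>j. j \<in> J \<Longrightarrow> g j \<in> F" "inj_on (\<lambda>j. v (g j)) {j \<in> J. g j \<noteq> 0}" "\<exists>j\<in>J. g j \<noteq> 0"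
  shows "\<exists>j0\<in>J. g j0 \<noteq> 0 \<and> sum g J \<noteq> 0 \<and> v (sum g J) = v (g j0) \<and> (\<forall>j\<in>J. g j \<noteq> 0 \<longrightarrow> v (g j0) \<le> v (g j))"
  using assms
proof (induction J)
  case (insert x J)
  have sF: "sum g J \<in> F" using insert(4) by (intro subringD(9)[OF subfield_subring[OF F]]) auto
  show ?case
  proof (cases "\<exists>j\<in>J. g j \<noteq> 0")
    case False
    then have "sum g J = 0" by (intro sum.neutral) auto
    then show ?thesis using insert False by auto
  next
    case True
    have "inj_on (\<lambda>j. v (g j)) {j \<in> J. g j \<noteq> 0}" using insert(5) by (rule inj_on_subset) auto
    then obtain j0 where j0: "j0 \<in> J" "g j0 \<noteq> 0" "sum g J \<noteq> 0" "v (sum g J) = v (g j0)" "\<forall>j\<in>J. g j \<noteq> 0 \<longrightarrow> v (g j0) \<le> v (g j)"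
      using insert(3,4) True by blast
    show ?thesis
    proof (cases "g x = 0")
      case True
      then show ?thesis using j0 insert(1,2) by auto
    next
      case gx: False
      have "v (g x) \<noteq> v (g j0)" using insert(5) gx j0 insert(2) by (auto simp: inj_on_def)
      then consider "v (g x) < v (g j0)" | "v (g j0) < v (g x)" by linarith
      then show ?thesis
      proof cases
        case 1
        then have "g x + sum g J \<noteq> 0 \<and> v (g x + sum g J) = v (g x)" using v_add_lt[of "g x" "sum g J"] gx sF insert(4) j0 by auto
        then show ?thesis using 1 gx j0 insert(1,2) by (intro bexI[of _ x]) fastforce+
      next
        case 2
        then have "sum g J + g x \<noteq> 0 \<and> v (sum g J + g x) = v (sum g J)" using v_add_lt[of "sum g J" "g x"] gx sF insert(4) j0 by auto
        then show ?thesis using 2 gx j0 insert(1,2) by (intro bexI[of _ j0]) (auto simp: add.commute)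
      qed
    qed
  qed
qed simp

text \<open>As \<open>p\<close> does not divide \<open>l\<close>, the values of the nonzero terms
  \<open>c j * u ^ j\<close> lie in different classes modulo \<open>E (Suc i)\<close>. So there is
  no cancellation and the sum has the least of these values.\<close>

lemma v_sum_pow:
  assumes E: "E (Suc i) = int p * E i" and u: "u \<in> Fn i" "u \<noteq> 0" "v u = E i * l" "\<not> int p dvd l"
    and c: "\<And>j. j < p \<Longrightarrow> c j \<in> Fn (Suc i)" "ja < p" "c ja \<noteq> 0"
  shows "\<exists>j0<p. c j0 \<noteq> 0 \<and> (\<Sum>j<p. c j * u ^ j) \<noteq> 0 \<and> v (\<Sum>j<p. c j * u ^ j) = v (c j0) + int j0 * v u \<and>
    (\<forall>j<p. c j \<noteq> 0 \<longrightarrow> v (c j0) + int j0 * v u \<le> v (c j) + int j * v u)"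
proof -
  have uF: "u \<in> F" using u(1) FnF by blast
  have cF: "c j \<in> F" if "j < p" for j using c(1)[OF that] FnF by blast
  have vg: "v (c j * u ^ j) = v (c j) + int j * v u" if "j < p" "c j \<noteq> 0" for j
    using v_mult[OF cF[OF that(1)] f(9)[OF uF, of j] that(2)] u(2) v_power[OF uF u(2)] by simp
  have inj: "inj_on (\<lambda>j. v (c j * u ^ j)) {j \<in> {..<p}. c j * u ^ j \<noteq> 0}"
  proof (rule inj_onI)
    fix j j' assume *: "j \<in> {j \<in> {..<p}. c j * u ^ j \<noteq> 0}" "j' \<in> {j \<in> {..<p}. c j * u ^ j \<noteq> 0}" "v (c j * u ^ j) = v (c j' * u ^ j')"
    then have j: "j < p" "c j \<noteq> 0" "j' < p" "c j' \<noteq> 0" by auto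
    obtain a a' where a: "v (c j) = E (Suc i) * a" "v (c j') = E (Suc i) * a'"
      using E_dvd[OF c(1)[OF j(1)] j(2)] E_dvd[OF c(1)[OF j(3)] j(4)] by (auto simp: dvd_def)
    have "E i * (int p * a + int j * l) = E i * (int p * a' + int j' * l)"
      using *(3) vg[OF j(1,2)] vg[OF j(3,4)] a u(3) E by (simp add: algebra_simps)
    then have "int p * a + int j * l = int p * a' + int j' * l" using E_pos[of i] by simp
    then have "(int j - int j') * l = int p * (a' - a)" by (simp add: algebra_simps)
    then have "int p dvd (int j - int j') * l" by simp
    then have "int p dvd int j - int j'" using u(4) prime_p by (simp add: prime_dvd_mult_iff)
    then have "int j mod int p = int j' mod int p" by (simp add: mod_eq_dvd_iff)
    then show "j = j'" using j by (simp flip: of_nat_mod)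
  qed
  have ex: "\<exists>j\<in>{..<p}. c j * u ^ j \<noteq> 0" using c(2,3) u(2) by (intro bexI[of _ ja]) auto
  have "c j * u ^ j \<in> F" if "j \<in> {..<p}" for j using cF[of j] f(4,9) uF that by auto
  from v_sum_distinct[OF _ this inj ex] obtain j0 where j0: "j0 < p" "c j0 * u ^ j0 \<noteq> 0" "(\<Sum>j<p. c j * u ^ j) \<noteq> 0"
    "v (\<Sum>j<p. c j * u ^ j) = v (c j0 * u ^ j0)" "\<forall>j\<in>{..<p}. c j * u ^ j \<noteq> 0 \<longrightarrow> v (c j0 * u ^ j0) \<le> v (c j * u ^ j)"
    by auto
  then show ?thesis using vg u(2) by (intro exI[of _ j0]) auto
qed

lemma Fn_indep:
  assumes z: "z \<in> Fn i" "z \<notin> Fn (Suc i)" and c: "\<And>j. j < p \<Longrightarrow> c j \<in> Fn (Suc i)" "(\<Sum>j<p. c j * z ^ j) = 0" and j: "j < p"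
  shows "c j = 0"
proof -
  have "c j \<in> {0}"
  proof (rule insep_indep[OF Fn_ring[of i], of "{0}" "Fn (Suc i)" z])
    show "subsp (Fn i) {0}" by (simp add: subsp_def)
    show "{0} \<subseteq> Fn i" using fn(1) by simp
    show "\<exists>d\<in>Fn (Suc i). c * d - 1 \<in> {0}" if "c \<in> Fn (Suc i)" "c \<notin> {0}" for c
      using that fn(6) by (intro bexI[of _ "inverse c"]) auto
    show "z ^ p \<in> Fn (Suc i)" by (rule Fn_frob1[OF z(1)])
  qed (use z c j Fn_ring Fn_Suc_sub in auto)
  then show ?thesis by simp
qed

end

section \<open>Best approximations and indices on one level\<close>

context fftower
begin

lemma gen_i: "\<exists>t\<in>Fn i. Fn i \<subseteq> dsum p (\<lambda>_. Fn (Suc i)) t"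
proof -
  obtain t where t: "t \<in> F" "F \<subseteq> dsum p (\<lambda>_. Fn 1) t" using gen by blast
  have "Fn i = S i F" by (simp add: Fn_def)
  also have "\<dots> \<subseteq> S i (dsum p (\<lambda>_. Fn 1) t)" by (rule S_mono[OF t(2)])
  also have "\<dots> = dsum p (\<lambda>_. S i (Fn 1)) (t ^ p ^ i)" by (rule S_dsum) (rule subsp_subring[OF Kr Fn_ring K_Fn])
  finally have "Fn i \<subseteq> dsum p (\<lambda>_. Fn (Suc i)) (t ^ p ^ i)" by (simp add: S_Fn)
  moreover have "t ^ p ^ i \<in> Fn i" using Fn_frob[of t 0 i] t(1) by (simp add: Fn_0)
  ultimately show ?thesis by blast
qed

text \<open>The powers of \<open>z\<close> are independent over \<open>Fn (Suc i)\<close> and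
  \<open>gen\<close> bounds the degree by \<open>p\<close>, so any element outside
  \<open>Fn (Suc i)\<close> generates.\<close>

lemma Fn_dsum: assumes z: "z \<in> Fn i" "z \<notin> Fn (Suc i)" shows "Fn i = dsum p (\<lambda>_. Fn (Suc i)) z"
proof -
  define L where "L = Fn (Suc i)"
  have L: "is_subfield L" unfolding L_def by (rule Fn_field)
  have s0: "subsp L {0}" by (simp add: subsp_def)
  have sF: "subsp L (Fn i)" unfolding L_def by (rule subsp_subring[OF Fn_ring Fn_ring Fn_Suc_sub])
  have sub: "gspan L {0} (\<lambda>j. z ^ j) p \<subseteq> Fn i"
    by (rule gspan_sub[OF L sF]) (use fn(1) fn(9)[OF z(1)] in auto)
  have nin: "z ^ j \<notin> gspan L {0} (\<lambda>j. z ^ j) j" if j: "j < p" for j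
  proof
    assume "z ^ j \<in> gspan L {0} (\<lambda>j. z ^ j) j"
    then obtain c where c: "z ^ j = (\<Sum>i<j. c i * z ^ i)" "\<forall>i<j. c i \<in> L" by (auto elim!: gspanE)
    define d where "d i' = (if i' < j then c i' else if i' = j then - 1 else 0)" for i'
    have "(\<Sum>i<p. d i * z ^ i) = (\<Sum>i<Suc j. d i * z ^ i)" using j by (intro sum.mono_neutral_right) (auto simp: d_def)
    also have "\<dots> = 0" using c(1) by (simp add: d_def)
    finally have "(\<Sum>i<p. d i * z ^ i) = 0" .
    moreover have "d i' \<in> L" for i' using c(2) subfieldD[OF L] by (auto simp: d_def)
    ultimately have "d j = 0" using Fn_indep[OF z _ _ j, of d] by (simp add: L_def)
    then show False by (simp add: d_def)
  qed
  have g: "fdim L (gspan L {0} (\<lambda>j. z ^ j) p) {0} p" by (rule fdim_gspan_n[OF L s0 nin])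
  obtain t where t: "t \<in> Fn i" "Fn i \<subseteq> gspan L {0} (\<lambda>j. t ^ j) p" using gen_i by (auto simp: dsum_gspan L_def)
  moreover have "gspan L {0} (\<lambda>j. t ^ j) p \<subseteq> Fn i" by (rule gspan_sub[OF L sF]) (use fn(1) fn(9)[OF t(1)] in auto)
  ultimately obtain m where m: "m \<le> p" "fdim L (Fn i) {0} m" using fdim_gspan[OF L s0, where w = "\<lambda>j. t ^ j" and n = p] by (metis subset_antisym)
  obtain a b where ab: "fdim L (Fn i) (gspan L {0} (\<lambda>j. z ^ j) p) a" "fdim L (gspan L {0} (\<lambda>j. z ^ j) p) {0} b" "a + b = m"
    using fdim_mid[OF L m(2) s0 subsp_gspan[OF L s0] gspan_base[OF L] sub] by blast
  have "b = p" using fdim_unique[OF L ab(2) g s0] .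
  then have "a = 0" using ab(3) m(1) by simp
  then show ?thesis using ab(1) fdim_0_iff[OF L subsp_gspan[OF L s0]] by (auto simp: dsum_gspan L_def)
qed

text \<open>Equality would be carried by the Frobenius to a level with separable prime, where the
  ramification index grows by the factor \<open>p\<close>.\<close>

lemma Fn_strict: "Fn (Suc i) \<noteq> Fn i"
proof
  assume eq: "Fn (Suc i) = Fn i"
  obtain N where N: "sep_residue N" using sep_residue_ex by blast
  have "Fn (N + Suc i) = Fn (N + i)" using S_Fn[of N "Suc i"] S_Fn[of N i] eq by simp
  then have "E (Suc (N + i)) = E (N + i)" by (simp add: E_def)
  moreover have "E (Suc (N + i)) = int p * E (N + i)" using sep_residue_S(2)[OF sep_residue_mono[OF N, of "N + i"]] by simp
  ultimately show False using E_pos[of "N + i"] p_gt1 by simp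
qed

lemma frob_notin: "w \<in> Fn i \<Longrightarrow> w \<notin> Fn (Suc i) \<Longrightarrow> w ^ (p ^ n) \<notin> Fn (Suc (n + i))"
  using frob_descent[where B = "Fn (Suc i)" and x = w and n = n, OF subsp_subring[OF Kr Fn_ring K_Fn] Fn_sub FnF[of w i]]
  by (auto simp: S_Fn)

text \<open>By \<open>v_sum_pow\<close> a sum is integral iff each of its terms is; this determines
  the fractional ideal for each power of \<open>u\<close>.\<close>

lemma I_dsum:
  assumes E: "E (Suc i) = int p * E i" and u: "u \<in> Fn i" "u \<noteq> 0" "v u = E i * l" "\<not> int p dvd l"
  shows "I i 0 = dsum p (\<lambda>j. I (Suc i) (- int j * v u)) u" and "u \<notin> Fn (Suc i)"
proof -
  show un: "u \<notin> Fn (Suc i)"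
  proof
    assume "u \<in> Fn (Suc i)"
    then have "E i * int p dvd E i * l" using E_dvd[of u "Suc i"] u(2,3) E by (simp add: mult.commute)
    then show False using u(4) E_pos[of i] by simp
  qed
  have uF: "u \<in> F" using u(1) FnF by blast
  show "I i 0 = dsum p (\<lambda>j. I (Suc i) (- int j * v u)) u"
  proof
    show "I i 0 \<subseteq> dsum p (\<lambda>j. I (Suc i) (- int j * v u)) u"
    proof
      fix x assume x: "x \<in> I i 0"
      then have "x \<in> dsum p (\<lambda>_. Fn (Suc i)) u" using Fn_dsum[OF u(1) un] I_sub(1) by blast
      then obtain c where c: "x = (\<Sum>j<p. c j * u ^ j)" "\<forall>j<p. c j \<in> Fn (Suc i)" by (rule dsumE)
      have "c j \<in> I (Suc i) (- int j * v u)" if j: "j < p" for j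
      proof (cases "c j = 0")
        case False
        obtain j0 where j0: "x \<noteq> 0" "v x = v (c j0) + int j0 * v u" "\<forall>j<p. c j \<noteq> 0 \<longrightarrow> v (c j0) + int j0 * v u \<le> v (c j) + int j * v u"
          using v_sum_pow[OF E u, of c j] c j False by blast
        then have "0 \<le> v (c j) + int j * v u" using x j False by (auto simp: I_def)
        then show ?thesis using c(2) j by (simp add: I_def)
      qed (simp add: I_0)
      then show "x \<in> dsum p (\<lambda>j. I (Suc i) (- int j * v u)) u" unfolding c(1) by (rule dsumI)
    qed
    show "dsum p (\<lambda>j. I (Suc i) (- int j * v u)) u \<subseteq> I i 0"
    proof
      fix x assume "x \<in> dsum p (\<lambda>j. I (Suc i) (- int j * v u)) u"
      then obtain c where c: "x = (\<Sum>j<p. c j * u ^ j)" "\<forall>j<p. c j \<in> I (Suc i) (- int j * v u)" by (rule dsumE)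
      have "c j * u ^ j \<in> I i 0" if j: "j < p" for j
      proof -
        have "c j \<in> I i (- int j * v u)" using c(2) j I_level[of i "Suc i"] by auto
        moreover have "u ^ j \<in> I i (int j * v u)" using u fn(9) v_power[OF uF u(2)] by (simp add: I_def)
        ultimately show ?thesis using I_mult by fastforce
      qed
      then show "x \<in> I i 0" unfolding c(1) by (intro subringD(9)[OF I_ring]) auto
    qed
  qed
qed

lemma I_zero_range: "0 \<le> m \<Longrightarrow> m < E n \<Longrightarrow> I n (- m) = I n 0"
  using I_round[of "E n - m" n "-1"] by simp

text \<open>An approximation of \<open>y\<close> from \<open>Fn (Suc M)\<close> is best possible iff its order \<open>l\<close> is not a value on \<open>Fn (Suc M)\<close>,
  and there \<open>E (Suc M) = p * E M\<close>.\<close>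

definition lam :: "nat \<Rightarrow> 'a \<Rightarrow> int \<Rightarrow> bool" where
  "lam M y l \<longleftrightarrow> (\<exists>b\<in>Fn (Suc M). y \<noteq> b \<and> v (y - b) = E M * l \<and> \<not> int p dvd l)"

lemma lam_ex: assumes M: "sep_residue M" and y: "y \<in> Fn M" "y \<notin> Fn (Suc M)" shows "\<exists>l. lam M y l"
proof -
  obtain u where u: "u \<in> Fn M" "u \<noteq> 0" "v u = E M" by (rule E_unif)
  have u': "v u = E M * 1" "\<not> int p dvd 1" using u(3) p_gt1 by (auto simp: zdvd1_eq)
  have "y \<in> dsum p (\<lambda>_. Fn (Suc M)) u" using Fn_dsum[OF u(1) I_dsum(2)[OF sep_residue_S(2)[OF M] u(1,2) u']] y(1) by blast
  then obtain c where c: "y = (\<Sum>j<p. c j * u ^ j)" "\<forall>j<p. c j \<in> Fn (Suc M)" by (rule dsumE)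
  \<comment> \<open>The constant term \<open>c 0\<close> is the best approximation: after deleting
    it, the least value is attained at a positive power of \<open>u\<close> and is not a multiple of
    \<open>E (Suc M)\<close>.\<close>
  define d where "d j = (if j = 0 then 0 else c j)" for j
  obtain p' where p': "p = Suc p'" using p_pos gr0_conv_Suc by blast
  have yd: "y - c 0 = (\<Sum>j<p. d j * u ^ j)" unfolding c(1) p' sum.lessThan_Suc_shift by (simp add: d_def)
  have c0: "c 0 \<in> Fn (Suc M)" using c(2) p_pos by blast
  have "\<exists>j1<p. d j1 \<noteq> 0"
  proof (rule ccontr)
    assume "\<not> ?thesis"
    then have "y - c 0 = 0" unfolding yd by (intro sum.neutral) auto
    then show False using y(2) c0 by simp
  qed
  then obtain j1 where j1: "j1 < p" "d j1 \<noteq> 0" by blast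
  have "\<exists>j0<p. d j0 \<noteq> 0 \<and> (\<Sum>j<p. d j * u ^ j) \<noteq> 0 \<and> v (\<Sum>j<p. d j * u ^ j) = v (d j0) + int j0 * v u \<and>
    (\<forall>j<p. d j \<noteq> 0 \<longrightarrow> v (d j0) + int j0 * v u \<le> v (d j) + int j * v u)"
    using v_sum_pow[OF sep_residue_S(2)[OF M] u(1,2) u', of d j1] c(2) fn(1) j1 by (simp add: d_def)
  then obtain j0 where j0: "j0 < p" "d j0 \<noteq> 0" "y - c 0 \<noteq> 0" "v (y - c 0) = v (d j0) + int j0 * v u" unfolding yd by blast
  have j0': "j0 > 0" using j0(2) by (auto simp: d_def intro: gr0I)
  obtain a where a: "v (d j0) = E (Suc M) * a" using E_dvd[of "d j0" "Suc M"] j0 c(2) fn(1) by (auto simp: d_def dvd_def split: if_splits)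
  have "v (y - c 0) = E M * (int p * a + int j0)" unfolding j0(4) a u(3) sep_residue_S(2)[OF M] by (simp add: algebra_simps)
  moreover have "\<not> int p dvd (int p * a + int j0)"
    using j0(1) j0' by (auto simp: dvd_add_right_iff dest: nat_dvd_not_less)
  ultimately show ?thesis unfolding lam_def using c0 j0(3) by (intro exI[of _ "int p * a + int j0"] bexI[of _ "c 0"]) auto
qed

text \<open>Two approximations of different orders would differ by an element of
  \<open>Fn (Suc M)\<close> with the value of the worse one, which is not a value on that
  field.\<close>

lemma lam_unique: assumes M: "sep_residue M" and y: "y \<in> Fn M" and l: "lam M y l" "lam M y l'" shows "l = l'"
proof -
  have *: "\<not> l < l'" if ll: "lam M y l" "lam M y l'" for l l'
  proof
    assume lt: "l < l'"
    obtain b b' where b: "b \<in> Fn (Suc M)" "y \<noteq> b" "v (y - b) = E M * l" "\<not> int p dvd l"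
       "b' \<in> Fn (Suc M)" "y \<noteq> b'" "v (y - b') = E M * l'" using ll unfolding lam_def by blast
    have F: "y - b \<in> F" "- (y - b') \<in> F" "y - b' \<in> F" using b y FnF f(5,7) by blast+
    have "(y - b) + - (y - b') \<noteq> 0 \<and> v ((y - b) + - (y - b')) = v (y - b)"
      using F b lt E_pos[of M] v_uminus[OF F(3)] by (intro v_add_lt) auto
    then have "b' - b \<noteq> 0" "v (b' - b) = E M * l" using b(3) by auto
    then have "E (Suc M) dvd E M * l" using E_dvd[of "b' - b" "Suc M"] b fn(7) by metis
    then have "E M * int p dvd E M * l" using sep_residue_S(2)[OF M] by (simp add: mult.commute)
    then show False using b(4) E_pos[of M] by simp
  qed
  from *[OF l] *[OF l(2,1)] show ?thesis by simp
qed

text \<open>The trivial approximation 0 cannot beat the best one: otherwise \<open>b\<close> itself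
  would have the forbidden value \<open>E M * l\<close>.\<close>

lemma lam_ge: assumes M: "sep_residue M" and y: "y \<in> Fn M" "y \<noteq> 0" and l: "lam M y l" shows "v y \<le> E M * l"
proof (rule ccontr)
  assume lt: "\<not> ?thesis"
  obtain b where b: "b \<in> Fn (Suc M)" "y \<noteq> b" "v (y - b) = E M * l" "\<not> int p dvd l" using l unfolding lam_def by blast
  have F: "b - y \<in> F" "y \<in> F" "y - b \<in> F" using b y FnF f(7) by blast+
  have "v (b - y) = E M * l" using v_uminus[OF F(3)] b(3) by simp
  then have "(b - y) + y \<noteq> 0 \<and> v ((b - y) + y) = v (b - y)" using lt b(2) F by (intro v_add_lt) auto
  then have "b \<noteq> 0" "v b = E M * l" using \<open>v (b - y) = E M * l\<close> by auto
  then have "E M * int p dvd E M * l" using E_dvd[OF b(1)] sep_residue_S(2)[OF M] by (simp add: mult.commute)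
  then show False using b(4) E_pos[of M] by simp
qed

text \<open>Replacing \<open>y\<close> by \<open>u = y - b\<close> does not change the module
  spanned by the powers. Compared with the description of \<open>O\<^sub>M\<close> in
  \<open>I_dsum\<close>, the coefficients of \<open>u ^ j\<close> lose
  \<open>\<lfloor>j l / p\<rfloor>\<close> steps, each of dimension \<open>dd M\<close>.\<close>

lemma index_formula:
  assumes M: "sep_residue M" and y: "y \<in> I M 0" and l: "lam M y l"
  shows "l \<ge> 1" and "fdim K (I M 0) (dsum p (\<lambda>_. I (Suc M) 0) y) (\<Sum>j<p. nat (int j * l div int p) * dd M)"
proof -
  obtain b where b: "b \<in> Fn (Suc M)" "y \<noteq> b" "v (y - b) = E M * l" "\<not> int p dvd l" using l unfolding lam_def by blast
  note pE = sep_residue_S(2)[OF M]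
  have yM: "y \<in> Fn M" using y I_sub(1) by blast
  have l0: "l \<ge> 0"
  proof (cases "y = 0")
    case True
    then have "v b = E M * l" "b \<noteq> 0" using b v_uminus[OF FnF[OF b(1)]] by auto
    then have "E M * int p dvd E M * l" using E_dvd[OF b(1)] pE by (simp add: mult.commute)
    then show ?thesis using b(4) E_pos[of M] by simp
  next
    case False
    then have "0 \<le> E M * l" using lam_ge[OF M yM False l] y by (auto simp: I_def)
    then show ?thesis using E_pos[of M] by (simp add: zero_le_mult_iff)
  qed
  moreover have "l \<noteq> 0" using b(4) by auto
  ultimately show l1: "l \<ge> 1" by simp
  define u where "u = y - b"
  have bM: "b \<in> Fn M" using b(1) Fn_Suc_sub by blast
  have u: "u \<in> Fn M" "u \<noteq> 0" "v u = E M * l" using b yM bM fn(7) by (auto simp: u_def)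
  have "u \<in> I M 0" using u l1 E_pos[of M] by (simp add: I_def)
  then have "b \<in> I M 0" using subringD(6)[OF I_ring y] by (metis u_def diff_diff_eq2 add_diff_cancel_left')
  then have bI: "b \<in> I (Suc M) 0" using b(1) by (simp add: I_def)
  have D1: "dsum p (\<lambda>_. I (Suc M) 0) y = dsum p (\<lambda>_. I (Suc M) 0) u"
    using dsum_shift[OF I_ring bI, of p u] by (simp add: u_def)
  note D2 = I_dsum(1)[OF pE u b(4)] and un = I_dsum(2)[OF pE u b(4)]
  have fd: "fdim K (I (Suc M) (- int j * v u)) (I (Suc M) 0) (nat (int j * l div int p) * dd M)" for j
  proof -
    define d where "d = int j * l div int p"
    define r where "r = int j * l mod int p"
    have jl: "int j * l = int p * d + r" unfolding d_def r_def by simp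
    have r: "0 \<le> r" "r < int p" unfolding r_def using p_pos by auto
    have d0: "d \<ge> 0" unfolding d_def using l1 by (simp add: pos_imp_zdiv_nonneg_iff p_pos)
    have "- int j * v u = - (E M * (int j * l))" unfolding u(3) by (simp add: mult.left_commute)
    also have "\<dots> = E (Suc M) * (- d - 1) + E M * (int p - r)" unfolding jl pE by (simp add: algebra_simps)
    finally have "I (Suc M) (- int j * v u) = I (Suc M) (E (Suc M) * (- d - 1 + 1))"
      using I_round[of "E M * (int p - r)" "Suc M" "- d - 1"] r E_pos[of M] pE by (simp add: mult_left_mono mult.commute)
    moreover have "fdim K (I (Suc M) (E (Suc M) * (- d))) (I (Suc M) (E (Suc M) * (- d + int (nat d)))) (nat d * dd (Suc M))"
      by (rule fdim_I)
    ultimately show ?thesis using d0 sep_residue_dd[OF M] by (simp add: d_def)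
  qed
  show "fdim K (I M 0) (dsum p (\<lambda>_. I (Suc M) 0) y) (\<Sum>j<p. nat (int j * l div int p) * dd M)"
    unfolding D1 D2
    by (rule fdim_dsum[OF K Fn_ring[of "Suc M"] _ _ _ fd u(2)])
      (use Fn_indep[OF u(1) un] I_sub(1) subsp_I in blast)+
qed

end

lemma dsum_cong: "(\<And>j. j < r \<Longrightarrow> A j = B j) \<Longrightarrow> dsum r A y = dsum r B y"
  using dsum_mono[of r A B y] dsum_mono[of r B A y] by blast

lemma poly_sum_monoms:
  assumes "\<forall>i\<ge>r. coeff G i = (0::'a::comm_ring_1)" shows "G = (\<Sum>j<r. monom (coeff G j) j)"
  by (rule poly_eqI) (use assms in \<open>auto simp: coeff_sum sum.delta not_less cong: if_cong\<close>)

lemma poly_pderiv_sum: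
  assumes "\<forall>i\<ge>r. coeff G i = (0::'a::idom)" shows "poly (pderiv G) u = (\<Sum>j<r. of_nat j * coeff G j * u ^ (j - 1))"
proof -
  have "pderiv G = (\<Sum>j<r. monom (of_nat j * coeff G j) (j - 1))"
  proof -
    have "pderiv (\<Sum>j<r. h j) = (\<Sum>j<r. pderiv (h j))" for h :: "nat \<Rightarrow> 'a poly"
      by (induction r) (auto simp: pderiv_add)
    then show ?thesis by (subst poly_sum_monoms[OF assms]) (simp add: pderiv_monom)
  qed
  then show ?thesis by (simp add: poly_sum poly_monom)
qed

section \<open>Generators of the valuation rings, and the recursion for colengths\<close>

context fftower
begin

text \<open>A uniformizer works: for \<open>j < p\<close> the value of \<open>z ^ j\<close> is below
  \<open>E (Suc i)\<close>, so all fractional ideals in \<open>I_dsum\<close> equal the valuation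
  ring. Modulo \<open>I i 1\<close> only the constant term survives, so the residue field does not
  change.\<close>

lemma gen_step_ram:
  assumes E: "E (Suc i) = int p * E i"
  shows "\<exists>z\<in>I i 0. z \<notin> Fn (Suc i) \<and> I i 0 = dsum p (\<lambda>_. I (Suc i) 0) z \<and> dd (Suc i) = dd i \<and> v z = E i"
proof -
  obtain z where z: "z \<in> Fn i" "z \<noteq> 0" "v z = E i" by (rule E_unif)
  have z': "v z = E i * 1" "\<not> int p dvd 1" using z(3) p_gt1 by (auto simp: zdvd1_eq)
  note D = I_dsum[OF E z(1,2) z']
  have "I (Suc i) (- int j * v z) = I (Suc i) 0" if "j < p" for j
    using I_zero_range[of "int j * E i" "Suc i"] that E E_pos[of i] z(3) by simp
  then have eq: "I i 0 = dsum p (\<lambda>_. I (Suc i) 0) z" unfolding D(1) by (rule dsum_cong)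
  have zI: "z \<in> I i 0" using z E_pos[of i] by (simp add: I_def)
  have "I i 0 \<subseteq> msum (I (Suc i) 0) (I i 1)"
  proof
    fix x assume "x \<in> I i 0"
    then obtain c where c: "x = (\<Sum>j<p. c j * z ^ j)" "\<forall>j<p. c j \<in> I (Suc i) 0" unfolding eq by (rule dsumE)
    obtain p' where p': "p = Suc p'" using p_pos gr0_conv_Suc by blast
    have "x = c 0 + (\<Sum>j<p'. c (Suc j) * z ^ Suc j)" unfolding c(1) p' sum.lessThan_Suc_shift by simp
    moreover have "c (Suc j) * z ^ Suc j \<in> I i 1" if "j < p'" for j
    proof -
      have "c (Suc j) \<in> I i 0" using c(2) that p' I_level[of i "Suc i" 0] by auto
      moreover have "z ^ Suc j \<in> I i 1"
      proof -
        have "1 \<le> int (Suc j) * E i" using E_pos[of i] by (metis int_one_le_iff_zero_less mult_pos_pos of_nat_0_less_iff zero_less_Suc)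
        then show ?thesis using z fn(9)[OF z(1)] v_power[OF FnF[OF z(1)] z(2), of "Suc j"] by (simp add: I_def del: power_Suc)
      qed
      ultimately show ?thesis using I_mult by fastforce
    qed
    then have "(\<Sum>j<p'. c (Suc j) * z ^ Suc j) \<in> I i 1" by (intro subspD(6)[OF Kr subsp_I]) auto
    ultimately show "x \<in> msum (I (Suc i) 0) (I i 1)" using c(2) p_pos by (auto intro: msumI)
  qed
  then have "dd (Suc i) = dd i" using I_Suc_msum[of i] by (auto simp: dd_Suc_eq_iff)
  then show ?thesis using zI D(2) eq z by blast
qed

text \<open>There are no immediate extensions: otherwise elements of \<open>Fn i\<close> would be limits of elements of \<open>Fn (Suc i)\<close>,
  which is impossible after passing to a level with a separable prime.\<close>

lemma no_immediate:
  assumes E: "E (Suc i) = E i"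
  shows "\<exists>z\<in>I i 0. \<forall>s\<in>I (Suc i) 0. z - s \<notin> I i 1"
proof (rule ccontr)
  assume "\<not> ?thesis"
  then have im: "\<exists>s\<in>I (Suc i) 0. z - s \<in> I i 1" if "z \<in> I i 0" for z using that by blast
  obtain w where w: "w \<in> Fn i" "w \<notin> Fn (Suc i)" using Fn_strict[of i] Fn_Suc_sub[of i] by blast
  have w0: "w \<noteq> 0" using w(2) fn(1) by blast
  obtain a where a: "v w = E i * a" using E_dvd[OF w(1) w0] by (auto simp: dvd_def)
  \<comment> \<open>Without ramification and residue extension, each approximation can be improved
    by one step of \<open>E i\<close>, hence to any order.\<close>
  have app: "\<exists>y\<in>Fn (Suc i). w - y \<in> I i (E i * (a + int m))" for m
  proof (induction m)
    case 0
    show ?case using w a fn(1) by (intro bexI[of _ 0]) (auto simp: I_def)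
  next
    case (Suc m)
    then obtain y where y: "y \<in> Fn (Suc i)" "w - y \<in> I i (E i * (a + int m))" by blast
    obtain b where b: "b \<in> Fn (Suc i)" "b \<noteq> 0" "v b = E (Suc i) * (a + int m)" by (rule E_val)
    have bi: "b \<in> Fn i" using b(1) Fn_Suc_sub by blast
    have "(*) b ` I i 0 = I i (E i * (a + int m))" using I_times[OF bi b(2), of 0] b(3) E by simp
    then obtain x where x: "x \<in> I i 0" "w - y = b * x" using y(2) by blast
    obtain s where s: "s \<in> I (Suc i) 0" "x - s \<in> I i 1" using im[OF x(1)] by blast
    have "w - (y + b * s) = b * (x - s)" using x(2) by (simp add: algebra_simps)
    also have "\<dots> \<in> I i (1 + v b)" using I_times[OF bi b(2), of 1] s(2) by blast
    also have "I i (1 + v b) = I i (E i * (a + int (Suc m)))"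
      using I_round[of 1 i "a + int m"] E_pos[of i] b(3) E by (simp add: algebra_simps)
    finally show ?case using y(1) b(1) s(1) I_sub(1)[of "Suc i" 0] fn(3,4)[of _ "Suc i"] by (intro bexI[of _ "y + b * s"]) auto
  qed
  obtain N where "sep_residue N" using sep_residue_ex by blast
  define M where "M = N + i"
  have M: "sep_residue M" using sep_residue_mono[OF \<open>sep_residue N\<close>] by (simp add: M_def)
  define x where "x = w ^ (p ^ N)"
  have x: "x \<in> Fn M" "x \<notin> Fn (Suc M)" using Fn_frob[OF w(1), of N] frob_notin[OF w, of N] by (simp_all add: x_def M_def)
  obtain l where l: "lam M x l" using lam_ex[OF M x] by blast
  \<comment> \<open>After the Frobenius, no approximation from \<open>Fn (Suc M)\<close> has order
    above \<open>E M * l\<close>, which contradicts \<open>app\<close> for large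
    \<open>m\<close>.\<close>
  have bound: "v (x - y) \<le> E M * l" if y: "y \<in> Fn (Suc M)" for y
  proof -
    have yM: "y \<in> Fn M" using y Fn_Suc_sub by blast
    have ne: "x - y \<noteq> 0" using x(2) y by auto
    obtain b where b: "b \<in> Fn (Suc M)" "x \<noteq> b" "v (x - b) = E M * l" "\<not> int p dvd l" using l unfolding lam_def by blast
    have "lam M (x - y) l" unfolding lam_def using b fn(7)[OF b(1) y] by (intro bexI[of _ "b - y"]) auto
    then show ?thesis using lam_ge[OF M fn(7)[OF x(1) yM] ne] by blast
  qed
  define m where "m = nat (\<bar>a\<bar> + \<bar>E M * l\<bar> + 1)"
  obtain y where y: "y \<in> Fn (Suc i)" "w - y \<in> I i (E i * (a + int m))" using app by blast
  have ne: "w - y \<noteq> 0" using w y(1) by auto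
  have wF: "w - y \<in> F" using w y FnF f(7) by blast
  have "x - y ^ (p ^ N) = (w - y) ^ (p ^ N)" by (simp add: x_def frob_diff)
  then have "v (x - y ^ (p ^ N)) = int (p ^ N) * v (w - y)" using v_power[OF wF ne] by simp
  moreover have "a + int m \<ge> \<bar>E M * l\<bar> + 1" unfolding m_def by simp
  then have "v (w - y) \<ge> \<bar>E M * l\<bar> + 1"
  proof -
    have "v (w - y) \<ge> E i * (a + int m)" using y(2) ne by (simp add: I_def)
    moreover have "1 * (a + int m) \<le> E i * (a + int m)" using E_pos[of i] \<open>a + int m \<ge> \<bar>E M * l\<bar> + 1\<close> by (intro mult_right_mono) auto
    ultimately have "a + int m \<le> v (w - y)" by simp
    then show ?thesis using \<open>a + int m \<ge> \<bar>E M * l\<bar> + 1\<close> by simp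
  qed
  moreover have "int (p ^ N) * v (w - y) \<ge> 1 * v (w - y)"
    using \<open>v (w - y) \<ge> \<bar>E M * l\<bar> + 1\<close> p_pos by (intro mult_right_mono) (auto simp: int_one_le_iff_zero_less)
  moreover have "y ^ (p ^ N) \<in> Fn (Suc M)" using Fn_frob[OF y(1), of N] by (simp add: M_def)
  ultimately show False using bound[of "y ^ (p ^ N)"] by linarith
qed

text \<open>The residue of \<open>z\<close> is not in the residue field of the next level, but its
  \<open>p\<close>-th power is. By \<open>insep_indep\<close> modulo \<open>I i 1\<close> the powers
  of \<open>z\<close> are independent over that residue field, so an integral sum must have integral
  coefficients.\<close>

lemma gen_step_unram:
  assumes E: "E (Suc i) = E i"
  shows "\<exists>z\<in>I i 0. z \<notin> Fn (Suc i) \<and> I i 0 = dsum p (\<lambda>_. I (Suc i) 0) z \<and> dd i = p * dd (Suc i)"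
proof -
  obtain z where z: "z \<in> I i 0" "\<And>s. s \<in> I (Suc i) 0 \<Longrightarrow> z - s \<notin> I i 1" using no_immediate[OF E] by blast
  have zF: "z \<in> Fn i" using z(1) I_sub(1) by blast
  have zn: "z \<notin> Fn (Suc i)"
  proof
    assume "z \<in> Fn (Suc i)"
    then have "z \<in> I (Suc i) 0" using z(1) by (simp add: I_def)
    then show False using z(2)[of z] I_0[of i 1] by simp
  qed
  have zp: "z ^ p \<in> I (Suc i) 0" using S1_I(1)[of i] S_pow[OF z(1), of 1] by auto
  have ind: "c j \<in> I i 1" if "\<And>j. j < p \<Longrightarrow> c j \<in> I (Suc i) 0" "(\<Sum>j<p. c j * z ^ j) \<in> I i 1" "j < p" for c j
  proof (rule insep_indep[OF I_ring[of i] subsp_I_I I_mono one_notin I_prime I_ring[of "Suc i"] I_level _ z(1) zp z(2) that])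
    show "\<exists>d\<in>I (Suc i) 0. c * d - 1 \<in> I i 1" if c: "c \<in> I (Suc i) 0" "c \<notin> I i 1" for c
    proof -
      have "c \<notin> I (Suc i) 1" using c(2) I_level[of i "Suc i" 1] by auto
      then have "inverse c \<in> I (Suc i) 0" using I_inverse c(1) by blast
      moreover have "c \<noteq> 0" using c(2) I_0 by blast
      ultimately show ?thesis using I_0 by (intro bexI[of _ "inverse c"]) auto
    qed
  qed auto
  have eq: "I i 0 = dsum p (\<lambda>_. I (Suc i) 0) z"
  proof
    show "dsum p (\<lambda>_. I (Suc i) 0) z \<subseteq> I i 0"
    proof
      fix x assume "x \<in> dsum p (\<lambda>_. I (Suc i) 0) z"
      then obtain c where c: "x = (\<Sum>j<p. c j * z ^ j)" "\<forall>j<p. c j \<in> I (Suc i) 0" by (rule dsumE)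
      have "c j \<in> I i 0" if "j < p" for j using c(2) that I_level[of i "Suc i" 0] by auto
      then show "x \<in> I i 0" unfolding c(1) by (intro subringD(9)[OF I_ring] subringD(4)[OF I_ring] subringD(7)[OF I_ring z(1)]) auto
    qed
    show "I i 0 \<subseteq> dsum p (\<lambda>_. I (Suc i) 0) z"
    proof
      fix x assume x: "x \<in> I i 0"
      then have "x \<in> dsum p (\<lambda>_. Fn (Suc i)) z" using Fn_dsum[OF zF zn] I_sub(1) by blast
      then obtain c where c: "x = (\<Sum>j<p. c j * z ^ j)" "\<forall>j<p. c j \<in> Fn (Suc i)" by (rule dsumE)
      have "c j \<in> I (Suc i) 0" if j: "j < p" for j
      proof (rule ccontr)
        assume nj: "c j \<notin> I (Suc i) 0"
        define J where "J = {j. j < p \<and> c j \<noteq> 0}"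
        have J: "finite J" "j \<in> J" using j nj I_0[of "Suc i" 0] by (auto simp: J_def)
        \<comment> \<open>Scaling by the inverse of a coefficient of least, negative value gives a
          relation modulo \<open>I i 1\<close> in which one coefficient is 1.\<close>
        define j0 where "j0 = arg_min_on (\<lambda>j. v (c j)) J"
        have j0: "j0 \<in> J" "\<And>j. j \<in> J \<Longrightarrow> v (c j0) \<le> v (c j)"
          unfolding j0_def using J arg_min_if_finite[of J "\<lambda>j. v (c j)"] by (auto simp: not_less[symmetric])
        have j0': "j0 < p" "c j0 \<noteq> 0" "c j0 \<in> Fn (Suc i)" using j0(1) c(2) by (auto simp: J_def)
        have neg: "v (c j0) < 0" using j0(2)[OF J(2)] nj c(2) j by (auto simp: I_def)
        define b where "b = inverse (c j0)"
        have b: "b \<in> Fn (Suc i)" "b \<noteq> 0" "v b = - v (c j0)" using j0' fn(6) v_inverse[OF FnF[OF j0'(3)]] by (auto simp: b_def)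
        have bc: "b * c j \<in> I (Suc i) 0" if "j < p" for j
        proof (cases "c j = 0")
          case False
          then have "v (b * c j) = v b + v (c j)" using v_mult[OF FnF[OF b(1)] FnF, of "c j" "Suc i"] b(2) c(2) that by blast
          then show ?thesis using j0(2)[of j] b fn(4)[OF b(1)] c(2) that False by (auto simp: I_def J_def)
        qed (simp add: I_0)
        have bi: "b \<in> Fn i" using b(1) Fn_Suc_sub by blast
        have "(\<Sum>j<p. (b * c j) * z ^ j) = b * x" unfolding c(1) by (simp add: sum_distrib_left mult.assoc)
        also have "b * x \<in> I i (0 + v b)" using I_times[OF bi b(2), of 0] x by blast
        also have "I i (0 + v b) \<subseteq> I i 1" using b(3) neg by (intro I_mono) auto
        finally have "(\<Sum>j<p. (b * c j) * z ^ j) \<in> I i 1" .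
        then have "b * c j0 \<in> I i 1" using ind[of "\<lambda>j. b * c j" j0] bc j0'(1) by blast
        then show False using one_notin j0'(2) by (simp add: b_def)
      qed
      then show "x \<in> dsum p (\<lambda>_. I (Suc i) 0) z" unfolding c(1) by (rule dsumI)
    qed
  qed
  obtain a where a: "a \<in> Fn (Suc i)" "a \<noteq> 0" "v a = E (Suc i)" by (rule E_unif)
  have ai: "a \<in> Fn i" using a(1) Fn_Suc_sub by blast
  have m: "I n 1 = I n (E n)" for n using I_round[of 1 n 0] I_round[of "E n" n 0] E_pos[of n] by simp
  have "I i 1 = (*) a ` I i 0" unfolding m using I_times[OF ai a(2), of 0] a(3) E by simp
  also have "\<dots> = dsum p (\<lambda>_. (*) a ` I (Suc i) 0) z" unfolding eq dsum_times ..
  also have "(*) a ` I (Suc i) 0 = I (Suc i) 1" unfolding m using I_times[OF a(1,2), of 0] a(3) by simp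
  finally have eq1: "I i 1 = dsum p (\<lambda>_. I (Suc i) 1) z" .
  have "fdim K (I i 0) (I i 1) (\<Sum>j<p. dd (Suc i))" unfolding eq eq1
    by (rule fdim_dsum[OF K Fn_ring[of "Suc i"] _ I_sub(1) subsp_I dd]) (use Fn_indep[OF zF zn] zn fn(1) in blast)+
  then have "dd i = p * dd (Suc i)" using ddI by simp
  then show ?thesis using z(1) zn eq by blast
qed

lemma gen_step: "\<exists>z. z \<in> I i 0 \<and> z \<notin> Fn (Suc i) \<and> I i 0 = dsum p (\<lambda>_. I (Suc i) 0) z \<and>
    (E (Suc i) = int p * E i \<and> dd (Suc i) = dd i \<and> v z = E i \<or> E (Suc i) = E i \<and> dd i = p * dd (Suc i))"
  using E_Suc_cases[of i] gen_step_ram[of i] gen_step_unram[of i] by metis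

text \<open>The fundamental identity (ramification index times residue degree equals degree) for
  \<open>Fn i\<close> over \<open>Fn (i + n)\<close>, of degree \<open>p ^ n\<close>, written
  without quotients.\<close>

lemma E_dd: "E (i + n) * int (dd i) = int (p ^ n) * E i * int (dd (i + n))"
proof (induction n)
  case (Suc n)
  have "E (Suc (i + n)) * int (dd (i + n)) = int p * E (i + n) * int (dd (Suc (i + n)))" using gen_step[of "i + n"] by auto
  then have "E (Suc (i + n)) * int (dd i) * int (dd (i + n)) = int (p ^ Suc n) * E i * int (dd (Suc (i + n))) * int (dd (i + n))"
  proof -
    have "E (Suc (i + n)) * int (dd i) * int (dd (i + n)) = (E (Suc (i + n)) * int (dd (i + n))) * int (dd i)" by simp
    also have "\<dots> = int p * int (dd (Suc (i + n))) * (E (i + n) * int (dd i))"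
      unfolding \<open>E (Suc (i + n)) * int (dd (i + n)) = int p * E (i + n) * int (dd (Suc (i + n)))\<close> by simp
    also have "\<dots> = int p * int (dd (Suc (i + n))) * (int (p ^ n) * E i * int (dd (i + n)))" unfolding Suc ..
    finally show ?thesis by (simp only: power_Suc of_nat_mult ac_simps)
  qed
  moreover have "int (dd (i + n)) \<noteq> 0" using dd_pos[of "i + n"] by simp
  ultimately have "E (Suc (i + n)) * int (dd i) = int (p ^ Suc n) * E i * int (dd (Suc (i + n)))"
    using mult_right_cancel by blast
  then show ?case by simp
qed simp

lemma lam_frob: assumes M: "sep_residue M" and y: "y \<in> Fn M" and l: "lam M y l" shows "lam (Suc M) (y ^ p) l"
proof -
  obtain b where b: "b \<in> Fn (Suc M)" "y \<noteq> b" "v (y - b) = E M * l" "\<not> int p dvd l" using l unfolding lam_def by blast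
  have F: "y - b \<in> F" using b y FnF f(7) by blast
  have eq: "y ^ p - b ^ p = (y - b) ^ p" using frob_diff[of y b 1] by simp
  have "v (y ^ p - b ^ p) = E (Suc M) * l" unfolding eq using v_power[OF F, of p] b sep_residue_S(2)[OF M] by simp
  moreover have "y ^ p \<noteq> b ^ p" using frob_inj[of y 1 b] b(2) by simp
  ultimately show ?thesis unfolding lam_def using Fn_frob1[OF b(1)] b(4) by blast
qed

text \<open>Both sides are expanded in \<open>u = y - b\<close>. The nonconstant terms of
  \<open>poly H y\<close> and the terms of \<open>u * poly (pderiv H) y\<close> differ by the
  factors \<open>j\<close>, units of \<open>K\<close> for \<open>0 < j < p\<close>, so both sums
  have the same least value. For the first it is given by \<open>l'\<close>; the second exceeds the
  value of the derivative by that of \<open>u\<close>.\<close>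

lemma lam_poly:
  assumes M: "sep_residue M" and y: "y \<in> Fn M" and l: "lam M y l" and H: "poly_over (Fn (Suc M)) H" "\<forall>i\<ge>p. coeff H i = 0"
    and l': "lam M (poly H y) l'"
  shows "poly (pderiv H) y \<noteq> 0" "v (poly (pderiv H) y) = E M * (l' - l)"
proof -
  obtain b where b: "b \<in> Fn (Suc M)" "y \<noteq> b" "v (y - b) = E M * l" "\<not> int p dvd l" using l unfolding lam_def by blast
  note pE = sep_residue_S(2)[OF M]
  have bM: "b \<in> Fn M" using b(1) Fn_Suc_sub by blast
  define u where "u = y - b"
  have u: "u \<in> Fn M" "u \<noteq> 0" "v u = E M * l" using b y bM fn(7) by (auto simp: u_def)
  define G where "G = pcompose H [:b, 1:]"
  have G: "\<forall>i\<ge>p. coeff G i = 0" unfolding G_def by (rule coeff_pcompose_shift_0[OF H(2)])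
  have "poly_over (Fn (Suc M)) G" unfolding G_def
    by (rule poly_over_pcompose[OF Fn_ring H(1)]) (use b(1) fn(2) in \<open>simp add: poly_over_pCons poly_over_0 Fn_ring\<close>)
  then have GF: "coeff G j \<in> Fn (Suc M)" for j by (simp add: poly_over_def)
  have Hy: "poly H y = (\<Sum>j<p. coeff G j * u ^ j)"
  proof -
    have "poly H y = poly G u" by (simp add: G_def poly_pcompose u_def)
    also have "\<dots> = poly (\<Sum>j<p. monom (coeff G j) j) u" using poly_sum_monoms[OF G] by simp
    finally show ?thesis by (simp add: poly_sum poly_monom)
  qed
  have Hy': "u * poly (pderiv H) y = (\<Sum>j<p. (of_nat j * coeff G j) * u ^ j)"
  proof -
    have "poly (pderiv H) y = poly (pderiv G) u" by (simp add: G_def pderiv_pcompose poly_pcompose u_def pderiv_pCons)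
    also have "\<dots> = (\<Sum>j<p. of_nat j * coeff G j * u ^ (j - 1))" by (rule poly_pderiv_sum[OF G])
    finally have "u * poly (pderiv H) y = (\<Sum>j<p. u * (of_nat j * coeff G j * u ^ (j - 1)))" by (simp add: sum_distrib_left)
    also have "\<dots> = (\<Sum>j<p. (of_nat j * coeff G j) * u ^ j)"
    proof (rule sum.cong[OF refl])
      fix j show "u * (of_nat j * coeff G j * u ^ (j - 1)) = (of_nat j * coeff G j) * u ^ j"
        by (cases j) (simp_all add: algebra_simps)
    qed
    finally show ?thesis .
  qed
  define d where "d j = (if j = 0 then 0 else coeff G j)" for j
  define d' where "d' j = of_nat j * coeff G j" for j
  have vn: "of_nat j \<noteq> (0::'a) \<and> v (of_nat j) = 0" if "0 < j" "j < p" for j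
    using of_nat_nonzero[OF that] v_K[of "of_nat j"] subringD(8)[OF Kr] by blast
  have dd': "d' j = 0 \<longleftrightarrow> d j = 0" "d j \<noteq> 0 \<Longrightarrow> v (d' j) = v (d j)" if "j < p" for j
  proof -
    show "d' j = 0 \<longleftrightarrow> d j = 0" using vn[of j] that by (cases "j = 0") (auto simp: d_def d'_def)
    show "v (d' j) = v (d j)" if "d j \<noteq> 0"
    proof -
      have "j > 0" "coeff G j \<noteq> 0" using that by (auto simp: d_def split: if_splits)
      then show ?thesis using vn[of j] \<open>j < p\<close> v_mult[of "of_nat j" "coeff G j"] FnF[OF GF] subringD(8)[OF subfield_subring[OF F]]
        by (simp add: d_def d'_def)
    qed
  qed
  have dF: "d j \<in> Fn (Suc M)" "d' j \<in> Fn (Suc M)" for j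
    using GF fn(1,4) subringD(8)[OF Fn_ring] by (auto simp: d_def d'_def)
  obtain p' where p': "p = Suc p'" using p_pos gr0_conv_Suc by blast
  have Hd: "poly H y - coeff G 0 = (\<Sum>j<p. d j * u ^ j)" unfolding Hy p' sum.lessThan_Suc_shift by (simp add: d_def)
  obtain b' where b': "b' \<in> Fn (Suc M)" "poly H y \<noteq> b'" "v (poly H y - b') = E M * l'" "\<not> int p dvd l'" using l' unfolding lam_def by blast
  have "\<exists>ja<p. d ja \<noteq> 0"
  proof (rule ccontr)
    assume "\<not> ?thesis"
    then have "poly H y - coeff G 0 = 0" unfolding Hd by (intro sum.neutral) auto
    then have "poly H y - b' \<in> Fn (Suc M)" using GF b'(1) fn(7) by auto
    then have "E M * int p dvd E M * l'" using E_dvd[of "poly H y - b'" "Suc M"] b'(2,3) pE by (simp add: mult.commute)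
    then show False using b'(4) E_pos[of M] by simp
  qed
  then obtain ja where ja: "ja < p" "d ja \<noteq> 0" by blast
  obtain j0 where j0: "j0 < p" "d j0 \<noteq> 0" "poly H y - coeff G 0 \<noteq> 0" "v (poly H y - coeff G 0) = v (d j0) + int j0 * v u"
      "\<forall>j<p. d j \<noteq> 0 \<longrightarrow> v (d j0) + int j0 * v u \<le> v (d j) + int j * v u"
    using v_sum_pow[OF pE u b(4), of d ja] dF ja unfolding Hd by blast
  have "d' ja \<noteq> 0" using dd'(1) ja by blast
  then obtain j1 where j1: "j1 < p" "d' j1 \<noteq> 0" "u * poly (pderiv H) y \<noteq> 0" "v (u * poly (pderiv H) y) = v (d' j1) + int j1 * v u"
      "\<forall>j<p. d' j \<noteq> 0 \<longrightarrow> v (d' j1) + int j1 * v u \<le> v (d' j) + int j * v u"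
    using v_sum_pow[OF pE u b(4), of d' ja] dF ja(1) unfolding Hy' d'_def[symmetric] by blast
  have d1: "d j1 \<noteq> 0" "v (d' j1) = v (d j1)" and d0: "d' j0 \<noteq> 0" "v (d' j0) = v (d j0)"
    using dd'[OF j1(1)] dd'[OF j0(1)] j1(2) j0(2) by blast+
  have "v (u * poly (pderiv H) y) = v (poly H y - coeff G 0)"
    using j0(4) j1(4) j0(5)[rule_format, OF j1(1) d1(1)] j1(5)[rule_format, OF j0(1) d0(1)] d1(2) d0(2) by linarith
  moreover have "v (poly H y - coeff G 0) = E M * l'"
  proof -
    have j0': "j0 > 0" using j0(2) by (auto simp: d_def intro: gr0I)
    obtain a where a: "v (d j0) = E (Suc M) * a" using E_dvd[OF dF(1) j0(2)] by (auto simp: dvd_def)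
    have e: "v (poly H y - coeff G 0) = E M * (int p * a + int j0 * l)" unfolding j0(4) a u(3) pE by (simp add: algebra_simps)
    have nd: "\<not> int p dvd (int p * a + int j0 * l)"
    proof
      assume "int p dvd (int p * a + int j0 * l)"
      then have "int p dvd int j0 * l" by (simp add: dvd_add_right_iff)
      then have "int p dvd int j0" using b(4) prime_p by (simp add: prime_dvd_mult_iff)
      then show False using j0(1) j0' by (auto dest: nat_dvd_not_less)
    qed
    have "lam M (poly H y) (int p * a + int j0 * l)" unfolding lam_def using e nd GF[of 0] j0(3) by (intro bexI[of _ "coeff G 0"]) auto
    moreover have "poly H y \<in> Fn M" by (rule poly_over_eval[OF Fn_ring poly_over_mono[OF Fn_Suc_sub H(1)] y])
    ultimately show ?thesis using lam_unique[OF M _ _ l'] e by blast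
  qed
  moreover show nz: "poly (pderiv H) y \<noteq> 0" using j1(3) by auto
  moreover have "poly (pderiv H) y \<in> F"
    using poly_over_eval[OF Fn_ring poly_over_pderiv[OF Fn_ring poly_over_mono[OF Fn_Suc_sub H(1)]] y] FnF by blast
  then have "v (u * poly (pderiv H) y) = v u + v (poly (pderiv H) y)" using v_mult[OF FnF[OF u(1)]] u(2) nz by blast
  ultimately show "v (poly (pderiv H) y) = E M * (l' - l)" using u(3) by (simp add: algebra_simps)
qed

lemma frob_of_nat: "(of_nat j :: 'a) ^ (p ^ n) = of_nat j"
  by (induction j) (use p_pos in \<open>simp_all add: freshman power_0_left\<close>)

text \<open>The Frobenius carries \<open>z ^ p = poly G z'\<close> to level \<open>M\<close>, where
  \<open>lam_poly\<close> applies; it commutes with differentiation because it fixes the integers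
  \<open>j\<close>. Integrality of the derivative of \<open>G\<close> at \<open>z'\<close> gives the
  sign, and \<open>E_dd\<close> turns ramification indices into residue degrees.\<close>

lemma lam_diff:
  assumes N: "sep_residue N" and zi: "z \<in> I i 0" and z': "z' \<in> I (Suc i) 0" and gen: "I (Suc i) 0 = dsum p (\<lambda>_. I (Suc (Suc i)) 0) z'"
    and l: "lam (N + i) (z ^ (p ^ N)) l" and l': "lam (N + Suc i) (z' ^ (p ^ N)) l'"
  shows "\<exists>b::nat. int (dd N) * (l - l') = int (dd (Suc i)) * int b"
proof -
  define M where "M = N + Suc i"
  have Mi: "M = Suc (N + i)" by (simp add: M_def)
  have pM: "sep_residue M" "sep_residue (N + i)" using sep_residue_mono[OF N] by (simp_all add: M_def)
  have zp: "z ^ p \<in> I (Suc i) 0" using S1_I(1)[of i] S_pow[OF zi, of 1] by auto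
  obtain G where G: "poly_over (I (Suc (Suc i)) 0) G" "\<forall>i\<ge>p. coeff G i = 0" "z ^ p = poly G z'"
    using zp unfolding gen dsum_poly[OF I_ring] by blast
  define H where "H = (\<Sum>j<p. monom (coeff G j ^ (p ^ N)) j)"
  have cH: "coeff H j = (if j < p then coeff G j ^ (p ^ N) else 0)" for j by (auto simp: H_def coeff_sum sum.delta cong: if_cong)
  have HF: "poly_over (Fn (Suc M)) H"
  proof -
    have "coeff G j \<in> Fn (Suc (Suc i))" for j using G(1) I_sub(1) by (auto simp: poly_over_def)
    then have "coeff G j ^ (p ^ N) \<in> Fn (Suc M)" for j using Fn_frob[of "coeff G j" "Suc (Suc i)" N] by (simp add: M_def)
    then show ?thesis using fn(1) by (simp add: poly_over_def cH)
  qed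
  have "poly H (z' ^ (p ^ N)) = (\<Sum>j<p. (coeff G j * z' ^ j) ^ (p ^ N))"
    by (simp add: H_def poly_sum poly_monom power_mult_distrib power_mult[symmetric] mult.commute)
  also have "\<dots> = (poly G z') ^ (p ^ N)" by (subst (2) poly_sum_monoms[OF G(2)]) (simp add: poly_sum poly_monom frob_sum)
  also have "\<dots> = (z ^ (p ^ N)) ^ p" unfolding G(3)[symmetric] by (simp add: power_mult[symmetric] mult.commute)
  finally have Hy: "poly H (z' ^ (p ^ N)) = (z ^ (p ^ N)) ^ p" .
  have zM: "z ^ (p ^ N) \<in> Fn (N + i)" "z' ^ (p ^ N) \<in> Fn M" using Fn_frob zi z' I_sub(1) unfolding M_def by blast+
  have "lam M (poly H (z' ^ (p ^ N))) l" unfolding Hy Mi by (rule lam_frob[OF pM(2) zM(1) l])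
  from lam_poly[OF pM(1) zM(2) l'[folded M_def] HF _ this] have
    v': "poly (pderiv H) (z' ^ (p ^ N)) \<noteq> 0" "v (poly (pderiv H) (z' ^ (p ^ N))) = E M * (l - l')" by (auto simp: cH)
  have "poly (pderiv H) (z' ^ (p ^ N)) = (\<Sum>j<p. of_nat j * coeff G j ^ (p ^ N) * (z' ^ (p ^ N)) ^ (j - 1))"
    by (subst poly_pderiv_sum[of p]) (auto simp: cH)
  also have "\<dots> = (\<Sum>j<p. (of_nat j * coeff G j * z' ^ (j - 1)) ^ (p ^ N))"
    by (simp add: power_mult_distrib frob_of_nat power_mult[symmetric] mult.commute)
  also have "\<dots> = (poly (pderiv G) z') ^ (p ^ N)" by (simp add: poly_pderiv_sum[OF G(2)] frob_sum)
  finally have eq: "poly (pderiv H) (z' ^ (p ^ N)) = (poly (pderiv G) z') ^ (p ^ N)" .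
  define g where "g = poly (pderiv G) z'"
  have gI: "g \<in> I (Suc i) 0" unfolding g_def
    by (rule poly_over_eval[OF I_ring poly_over_pderiv[OF I_ring poly_over_mono[OF I_level G(1)]] z']) simp
  have g0: "g \<noteq> 0" using v'(1) eq p_pos by (auto simp: g_def power_0_left)
  obtain b where b: "v g = E (Suc i) * b" using E_dvd[of g "Suc i"] gI g0 I_sub(1) by (auto simp: dvd_def)
  have "0 \<le> E (Suc i) * b" using gI g0 b by (simp add: I_def)
  then have b0: "b \<ge> 0" using E_pos[of "Suc i"] by (simp add: zero_le_mult_iff)
  have vg: "E M * (l - l') = int (p ^ N) * (E (Suc i) * b)"
    using v'(2) v_power[of g "p ^ N"] gI g0 I_sub(2) unfolding eq g_def[symmetric] b by auto
  have sM: "dd M = dd N"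
  proof -
    have "dd (N + j) = dd N" for j
      by (induction j) (use sep_residue_dd sep_residue_mono[OF N] in \<open>auto simp: le_add1\<close>)
    then show ?thesis by (simp add: M_def del: add_Suc_right)
  qed
  have "E M * int (dd (Suc i)) = int (p ^ N) * E (Suc i) * int (dd N)"
    using E_dd[of "Suc i" N] sM by (simp add: M_def add.commute)
  then have "E M * (int (dd N) * (l - l')) = E M * (int (dd (Suc i)) * b)" 
  proof -
    have "E M * (int (dd N) * (l - l')) = int (dd N) * (E M * (l - l'))" by simp
    also have "\<dots> = (int (p ^ N) * E (Suc i) * int (dd N)) * b" unfolding vg by simp
    finally show ?thesis unfolding \<open>E M * int (dd (Suc i)) = int (p ^ N) * E (Suc i) * int (dd N)\<close>[symmetric] by simp
  qed
  then show ?thesis using b0 E_pos[of M] by (intro exI[of _ "nat b"]) simp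
qed

text \<open>With \<open>y = z ^ (p ^ N)\<close>, the powers of \<open>y\<close> over
  \<open>O\<^sub>N\<^sub>+\<^sub>i\<^sub>+\<^sub>1\<close> span an intermediate module. Below it the
  colength of the next level occurs once for each power of \<open>y\<close>; above it
  \<open>index_formula\<close> applies.\<close>

lemma delta_rec:
  assumes N: "sep_residue N" and zi: "z \<in> I i 0" "z \<notin> Fn (Suc i)" and gen: "I i 0 = dsum p (\<lambda>_. I (Suc i) 0) z"
    and l: "lam (N + i) (z ^ (p ^ N)) l" and D: "fdim K (I (N + Suc i) 0) (S N (I (Suc i) 0)) D"
  shows "l \<ge> 1" "fdim K (I (N + i) 0) (S N (I i 0)) (p * D + (\<Sum>j<p. nat (int j * l div int p) * dd (N + i)))"
proof -
  define M where "M = N + i"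
  have pM: "sep_residue M" using sep_residue_mono[OF N] by (simp add: M_def)
  define y where "y = z ^ (p ^ N)"
  have "y \<in> S N (I i 0)" unfolding y_def by (rule S_pow[OF zi(1)])
  then have yI: "y \<in> I M 0" using S_I[of 0 i N] by (auto simp: M_def)
  have zF: "z \<in> Fn i" using zi(1) I_sub(1) by blast
  have yF: "y \<in> Fn M" "y \<notin> Fn (Suc M)" using yI I_sub(1) frob_notin[OF zF zi(2), of N] by (auto simp: y_def M_def)
  have y0: "y \<noteq> 0" using yF fn(1) by blast
  note ix = index_formula[OF pM yI l[folded M_def y_def]]
  show "l \<ge> 1" by (rule ix(1))
  have e1: "S N (I i 0) = dsum p (\<lambda>_. S N (I (Suc i) 0)) y" unfolding gen y_def by (rule S_dsum) (rule subsp_I)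
  have "fdim K (dsum p (\<lambda>_. I (Suc M) 0) y) (dsum p (\<lambda>_. S N (I (Suc i) 0)) y) (\<Sum>j<p. D)"
    by (rule fdim_dsum[OF K Fn_ring[of "Suc M"] _ I_sub(1) subsp_S _ y0]) (use Fn_indep[OF yF] D in \<open>auto simp: M_def\<close>)
  from fdim_add[OF K this ix(2)]
  show "fdim K (I (N + i) 0) (S N (I i 0)) (p * D + (\<Sum>j<p. nat (int j * l div int p) * dd (N + i)))"
    by (simp add: e1 M_def add.commute)
qed

text \<open>All estimates stay in the integers:
  \<open>2 * \<delta> + dd N \<le> dd N * p ^ (n + 1)\<close> is the bound on \<open>n\<close> with
  the \<open>- 1\<close>, with logarithm and denominator cleared.\<close>

lemma degree_bound:
  assumes N: "sep_residue N"
  shows "\<exists>\<delta>. fdim K (I N 0) (S N (I 0 0)) \<delta> \<and> (\<delta> > 0 \<longrightarrow> (\<forall>n. dd n \<noteq> dd N \<longrightarrow> dd N * p ^ n \<le> 2 * \<delta> \<and>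
     (2 * \<delta> + dd N \<le> dd N * p ^ (n + 1) \<longrightarrow> (\<exists>j i. j \<le> i \<and> 2 * \<delta> = (p - 1) * dd N * (\<Sum>k=j..i. p ^ k)))))"
proof -
  define s where "s = dd N"
  have s0: "s > 0" unfolding s_def by (rule dd_pos)
  have sM: "dd (N + j) = s" for j
    unfolding s_def by (induction j) (use sep_residue_dd sep_residue_mono[OF N] in \<open>auto simp: le_add1\<close>)
  have sM': "dd i = s" if "i \<ge> N" for i using sM[of "i - N"] that by simp
  have pM: "sep_residue (N + i)" for i using sep_residue_mono[OF N] by simp
  obtain z where z: "\<And>i. z i \<in> I i 0" "\<And>i. z i \<notin> Fn (Suc i)" "\<And>i. I i 0 = dsum p (\<lambda>_. I (Suc i) 0) (z i)"
    "\<And>i. E (Suc i) = int p * E i \<and> dd (Suc i) = dd i \<and> v (z i) = E i \<or> E (Suc i) = E i \<and> dd i = p * dd (Suc i)"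
    using gen_step by metis
  have zF: "z i \<in> Fn i" for i using z(1) I_sub(1) by blast
  have "\<exists>l. lam (N + i) (z i ^ (p ^ N)) l" for i
    using lam_ex[OF pM Fn_frob[OF zF] frob_notin[OF zF z(2)]] .
  then obtain l where l: "\<And>i. lam (N + i) (z i ^ (p ^ N)) (l i)" by metis
  have D0: "fdim K (I (N + i) 0) (S N (I i 0)) 0" if "i \<ge> N" for i
    using sep_residue_SM[OF sep_residue_mono[OF N that], of N] fdim_0[of K] by simp
  have Dex: "\<exists>D. fdim K (I (N + i) 0) (S N (I i 0)) D" for i
  proof (induction "N - i" arbitrary: i)
    case 0
    then show ?case using D0 by auto
  next
    case (Suc n)
    have "n = N - Suc i" using Suc(2) by simp
    then obtain D where "fdim K (I (N + Suc i) 0) (S N (I (Suc i) 0)) D" using Suc(1) by blast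
    then show ?case using delta_rec(2)[OF N z(1,2,3) l] by blast
  qed
  then obtain D where D: "\<And>i. fdim K (I (N + i) 0) (S N (I i 0)) (D i)" by metis
  have l1: "l i \<ge> 1" for i using delta_rec(1)[OF N z(1,2,3) l D] .
  define c where "c i = nat (l i - 1)" for i
  have lc: "l i = int (c i) + 1" for i using l1[of i] by (simp add: c_def)
  have rec: "2 * D i = 2 * p * D (Suc i) + (p - 1) * s * c i" for i
  proof -
    have "D i = p * D (Suc i) + (\<Sum>j<p. nat (int j * l i div int p) * dd (N + i))"
      using fdim_unique[OF K D delta_rec(2)[OF N z(1,2,3) l D] subsp_S] .
    then have "int (D i) = int p * int (D (Suc i)) + (\<Sum>j<p. int j * l i div int p) * int s"
      using l1[of i] p_pos by (simp add: sM sum_distrib_right pos_imp_zdiv_nonneg_iff)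
    moreover obtain b where "lam (N + i) (z i ^ (p ^ N)) (l i)" "\<not> int p dvd l i" using l[of i] unfolding lam_def by blast
    then have "2 * (\<Sum>j<p. int j * l i div int p) = (int p - 1) * (l i - 1)" using floor_sum[OF prime_p l1] by blast
    moreover have "2 * (int p * int (D (Suc i)) + (\<Sum>j<p. int j * l i div int p) * int s)
        = 2 * int p * int (D (Suc i)) + (2 * (\<Sum>j<p. int j * l i div int p)) * int s" by (simp only: distrib_left mult.assoc)
    ultimately have "2 * int (D i) = 2 * int p * int (D (Suc i)) + (int p - 1) * (l i - 1) * int s" by metis
    moreover have "int p - 1 = int (p - 1)" using p_pos by simp
    moreover have "l i - 1 = int (c i)" using lc[of i] by simp
    ultimately have "2 * int (D i) = 2 * int p * int (D (Suc i)) + int (p - 1) * int (c i) * int s" by metis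
    moreover have "int (2 * p * D (Suc i) + (p - 1) * s * c i) = 2 * int p * int (D (Suc i)) + int (p - 1) * int (c i) * int s"
      by (simp only: of_nat_add of_nat_mult of_nat_numeral ac_simps)
    ultimately have "int (2 * D i) = int (2 * p * D (Suc i) + (p - 1) * s * c i)"
      by (simp only: of_nat_mult of_nat_numeral)
    then show ?thesis using of_nat_eq_iff by blast
  qed
  have Dz: "D i = 0" if "i \<ge> N" for i using fdim_unique[OF K D D0[OF that] subsp_S] .
  \<comment> \<open>From level \<open>N\<close> on both colengths in the recursion vanish, hence so
    does the digit.\<close>
  have cN: "c i = 0" if "i \<ge> N" for i using rec[of i] Dz[of i] Dz[of "Suc i"] that s0 p_gt1 by simp
  define W where "W = (\<Sum>i<N. c i * p ^ i)"
  have DW: "2 * D 0 = (p - 1) * s * W"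
  proof -
    have "2 * D 0 = 2 * p ^ n * D n + (p - 1) * s * (\<Sum>i<n. c i * p ^ i)" for n
    proof (induction n)
      case (Suc n)
      have "2 * p ^ n * D n = p ^ n * (2 * D n)" by simp
      also have "\<dots> = 2 * p ^ Suc n * D (Suc n) + (p - 1) * s * (c n * p ^ n)" unfolding rec[of n] by (simp add: algebra_simps)
      finally show ?case using Suc by (simp add: distrib_left)
    qed simp
    from this[of N] show ?thesis using Dz[of N] by (simp add: W_def)
  qed
  have "\<exists>r. dd i = s * p ^ r" for i
  proof (induction "N - i" arbitrary: i)
    case 0
    then show ?case using sM'[of i] by (intro exI[of _ 0]) auto
  next
    case (Suc n)
    have "n = N - Suc i" using Suc(2) by simp
    then obtain r where "dd (Suc i) = s * p ^ r" using Suc(1) by blast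
    moreover have "dd i = dd (Suc i) \<or> dd i = p * dd (Suc i)" using z(4)[of i] by auto
    ultimately have "dd i = s * p ^ r \<or> dd i = s * p ^ Suc r" by auto
    then show ?case by blast
  qed
  then obtain r where r: "\<And>i. dd i = s * p ^ r i" by metis
  have rinj: "a = b" if "s * p ^ a = s * p ^ b" for a b using that s0 p_gt1 by simp
  have r1: "r i = r (Suc i) \<or> r i = Suc (r (Suc i))" for i
  proof -
    have "dd i = dd (Suc i) \<or> dd i = p * dd (Suc i)" using z(4)[of i] by auto
    then have "s * p ^ r i = s * p ^ r (Suc i) \<or> s * p ^ r i = s * p ^ Suc (r (Suc i))" using r[of i] r[of "Suc i"] by auto
    then show ?thesis using rinj by blast
  qed
  have "\<exists>b. c i = c (Suc i) + b * p ^ r (Suc i)" for i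
  proof -
    obtain b where "int (dd N) * (l i - l (Suc i)) = int (dd (Suc i)) * int b"
      using lam_diff[OF N z(1) z(1) z(3) l l] by blast
    then have "int s * (l i - l (Suc i)) = int s * (int (p ^ r (Suc i)) * int b)" using r[of "Suc i"] by (simp add: s_def)
    then have "l i - l (Suc i) = int (p ^ r (Suc i)) * int b" using s0 by simp
    then have "int (c i) = int (c (Suc i) + b * p ^ r (Suc i))" unfolding lc by (simp add: mult.commute)
    then show ?thesis using of_nat_eq_iff by blast
  qed
  then obtain b where b: "\<And>i. c i = c (Suc i) + b i * p ^ r (Suc i)" by metis
  \<comment> \<open>If the step kept the residue degree, \<open>z i\<close> would be a uniformizer.
    With \<open>l i = 1\<close>, \<open>lam_ge\<close> then gives
    \<open>p ^ N * E i \<le> E (N + i)\<close>, so the ramification from level \<open>i\<close> on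
    is total and no inseparable residue degree is left, against \<open>r i > 0\<close>.\<close>
  have sm: "r i = Suc (r (Suc i))" if "c i = 0" "r i > 0" for i
  proof (rule ccontr)
    assume "r i \<noteq> Suc (r (Suc i))"
    then have "r i = r (Suc i)" using r1 by blast
    then have ddeq: "dd i = dd (Suc i)" using r by simp
    have vz: "v (z i) = E i"
    proof (rule ccontr)
      assume "v (z i) \<noteq> E i"
      then have "dd i = p * dd i" using z(4)[of i] ddeq by simp
      then show False using dd_pos[of i] p_gt1 by simp
    qed
    have z0: "z i \<noteq> 0" using z(2) fn(1) by metis
    have "v (z i ^ (p ^ N)) \<le> E (N + i) * l i" using lam_ge[OF pM Fn_frob[OF zF] _ l] z0 by simp
    then have "int (p ^ N) * E i \<le> E (N + i)" using v_power[OF FnF[OF zF] z0, of "p ^ N"] vz lc[of i] that(1) by simp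
    then have "int (p ^ N) * E i * int s \<le> E (N + i) * int s" by (intro mult_right_mono) auto
    then have "E (N + i) * int (dd i) \<le> E (N + i) * int s" using E_dd[of i N] sM[of i] by (simp add: add.commute)
    then have "dd i \<le> s" using E_pos[of "N + i"] by simp
    moreover have "s * p ^ 1 \<le> s * p ^ r i" using that(2) p_gt1 by (intro mult_left_mono power_increasing) auto
    ultimately have "s * p \<le> s * 1" unfolding r[of i] by (metis mult.right_neutral order_trans power_one_right)
    then show False using s0 p_gt1 nat_mult_le_cancel1[OF s0, of p 1] by simp
  qed
  have p2: "p \<ge> 2" using p_gt1 by simp
  have main: "s * p ^ n \<le> 2 * D 0 \<and> (2 * D 0 + s \<le> s * p ^ (n + 1) \<longrightarrow> (\<exists>j i. j \<le> i \<and> 2 * D 0 = (p - 1) * s * (\<Sum>k=j..i. p ^ k)))"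
    if D0: "D 0 > 0" and n: "dd n \<noteq> s" for n
  proof -
    have W0: "W > 0" using D0 DW by (intro gr0I) auto
    have rn: "r n > 0" using n r[of n] by (intro gr0I) auto
    note dg = digit_bound[OF p2 r1 b cN sm W_def W0 rn]
    have "s * p ^ n \<le> s * W" using dg(1) by simp
    also have "\<dots> \<le> (p - 1) * (s * W)" 
    proof -
      have "1 \<le> p - 1" using p2 by simp
      from mult_le_mono1[OF this, of "s * W"] show ?thesis by (simp only: mult_1)
    qed
    finally have 1: "s * p ^ n \<le> 2 * D 0" unfolding DW by (simp add: mult.assoc)
    have 2: "\<exists>j i. j \<le> i \<and> 2 * D 0 = (p - 1) * s * (\<Sum>k=j..i. p ^ k)" if le: "2 * D 0 + s \<le> s * p ^ (n + 1)"
    proof -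
      have "s * ((p - 1) * W + 1) \<le> s * p ^ (n + 1)" using le unfolding DW by (simp add: algebra_simps)
      then have "(p - 1) * W + 1 \<le> p ^ (n + 1)" using nat_mult_le_cancel1[OF s0] by blast
      then have "(p - 1) * W < p ^ (n + 1)" by simp
      then obtain j i where "j \<le> i" "W = (\<Sum>k=j..i. p ^ k)" using dg(2) by blast
      then show ?thesis unfolding DW by blast
    qed
    show ?thesis using 1 2 by blast
  qed
  show ?thesis using D[of 0] main unfolding s_def by (intro exI[of _ "D 0"]) auto
qed

end

section \<open>Function fields\<close>

lemma gen_field_subfield: "is_subfield (gen_field X)"
  unfolding gen_field_def is_subfield_def is_subring_def by blast

lemma gen_field_sub: "X \<subseteq> gen_field X"
  unfolding gen_field_def by blast

lemma gen_field_least: "is_subfield M \<Longrightarrow> X \<subseteq> M \<Longrightarrow> gen_field X \<subseteq> M"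
  unfolding gen_field_def by blast

lemma subsp_0: "subsp K {0}"
  by (simp add: subsp_def)

lemma fdim_algebraic:
  assumes E: "is_subfield E" and V: "fdim E V {0} n" and x: "\<And>i. x ^ i \<in> V"
  shows "\<exists>d c. (\<forall>i\<le>d. c i \<in> E) \<and> c d = 1 \<and> (\<Sum>i\<le>d. c i * x ^ i) = 0"
proof -
  have sV: "subsp E V" by (rule fdim_subsp[OF E V subsp_0])
  have "\<exists>j. x ^ j \<in> gspan E {0} (\<lambda>i. x ^ i) j"
  proof (rule ccontr)
    assume "\<not> ?thesis"
    then have g: "fdim E (gspan E {0} (\<lambda>i. x ^ i) (Suc n)) {0} (Suc n)"
      by (intro fdim_gspan_n[OF E subsp_0]) auto
    have "gspan E {0} (\<lambda>i. x ^ i) (Suc n) \<subseteq> V"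
      by (rule gspan_sub[OF E sV]) (use x subspD(1)[OF subfield_subring[OF E] sV] in auto)
    then obtain m l where "fdim E (gspan E {0} (\<lambda>i. x ^ i) (Suc n)) {0} l" "m + l = n"
      using fdim_mid[OF E V subsp_0 subsp_gspan[OF E subsp_0] gspan_base[OF E]] by blast
    then show False using fdim_unique[OF E g _ subsp_0] by fastforce
  qed
  then obtain j c where c: "x ^ j = (\<Sum>i<j. c i * x ^ i)" "\<forall>i<j. c i \<in> E" by (auto elim!: gspanE)
  define e where "e i = (if i < j then - c i else 1)" for i
  have "(\<Sum>i\<le>j. e i * x ^ i) = (\<Sum>i<j. e i * x ^ i) + x ^ j"
    unfolding lessThan_Suc_atMost[symmetric] by (simp add: e_def)
  also have "\<dots> = 0" unfolding c(1) by (simp add: e_def sum_negf)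
  finally show ?thesis using c(2) subfieldD(2,5)[OF E] by (intro exI[of _ j] exI[of _ e]) (auto simp: e_def)
qed

text \<open>Multiplication by a nonzero element preserves flag lengths, so its image is all of
  \<open>V\<close>.\<close>

lemma finite_dim_domain_field:
  assumes E: "is_subfield E" and V: "fdim E V {0} n" and R: "is_subring V" "E \<subseteq> V"
  shows "is_subfield V"
  unfolding is_subfield_def
proof (intro conjI ballI R(1))
  fix a assume a: "a \<in> V"
  show "inverse a \<in> V"
  proof (cases "a = 0")
    case False
    have "fdim E ((*) a ` V) ((*) a ` {0}) n" by (rule fdim_times[OF V False])
    then have g: "fdim E ((*) a ` V) {0} n" by simp
    have "(*) a ` V \<subseteq> V" using a subringD(4)[OF R(1)] by blast
    then obtain m l where ml: "fdim E V ((*) a ` V) m" "fdim E ((*) a ` V) {0} l" "m + l = n"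
      using fdim_mid[OF E V subsp_0 fdim_subsp[OF E g subsp_0] fdim_sub[OF E g]] by blast
    then have "m = 0" using fdim_unique[OF E g ml(2) subsp_0] by simp
    then have "V = (*) a ` V" using ml(1) fdim_0_iff[OF E fdim_subsp[OF E g subsp_0]] by blast
    then obtain b where b: "1 = a * b" "b \<in> V" using subringD(2)[OF R(1)] by blast
    then show ?thesis using inverse_unique[of a b] by simp
  qed (use a in simp)
qed

lemma simple_extension:
  assumes E: "is_subfield E" and f: "poly_over E f" "coeff f d = 1" "\<And>i. i > d \<Longrightarrow> coeff f i = 0" "poly f x = 0" and d: "d > 0"
  defines "V \<equiv> dsum d (\<lambda>_. E) x"
  shows "is_subfield V" "E \<subseteq> V" "x \<in> V" "\<exists>n. fdim E V {0} n" "\<And>R. is_subring R \<Longrightarrow> E \<subseteq> R \<Longrightarrow> x \<in> R \<Longrightarrow> V \<subseteq> R"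
proof -
  note Er = subfield_subring[OF E]
  have mem: "y \<in> V \<longleftrightarrow> (\<exists>g. poly_over E g \<and> y = poly g x)" for y
  proof
    assume "y \<in> V" then show "\<exists>g. poly_over E g \<and> y = poly g x" unfolding V_def dsum_poly[OF Er] by blast
  next
    assume "\<exists>g. poly_over E g \<and> y = poly g x"
    then obtain g where g: "poly_over E g" "y = poly g x" by blast
    obtain q s where q: "poly_over E s" "g = f * q + s" "\<forall>i\<ge>d. coeff s i = 0"
      using monic_div[OF Er f(1,2,3) g(1)] by blast
    then have "y = poly s x" using g(2) f(4) by simp
    then show "y \<in> V" unfolding V_def dsum_poly[OF Er] using q by blast
  qed
  have V: "is_subring V" unfolding is_subring_def
  proof (intro conjI ballI)
    show "0 \<in> V" unfolding mem using poly_over_0[OF Er] by (intro exI[of _ 0]) auto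
    show "1 \<in> V" unfolding mem using poly_over_1[OF Er] by (intro exI[of _ 1]) auto
  next
    fix a b assume "a \<in> V" "b \<in> V"
    then obtain g h where gh: "poly_over E g" "a = poly g x" "poly_over E h" "b = poly h x" unfolding mem by blast
    show "a + b \<in> V" unfolding mem using gh poly_over_add[OF Er] by (intro exI[of _ "g + h"]) auto
    show "a * b \<in> V" unfolding mem using gh poly_over_mult[OF Er] by (intro exI[of _ "g * h"]) auto
  next
    fix a assume "a \<in> V"
    then obtain g where gh: "poly_over E g" "a = poly g x" unfolding mem by blast
    show "- a \<in> V" unfolding mem using gh poly_over_diff[OF Er poly_over_0[OF Er]] by (intro exI[of _ "0 - g"]) auto
  qed
  show EV: "E \<subseteq> V"
  proof
    fix c assume "c \<in> E" then show "c \<in> V" unfolding mem by (intro exI[of _ "[:c:]"]) (auto simp: poly_over_pCons poly_over_0 Er)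
  qed
  show "x \<in> V" unfolding mem using subringD[OF Er] by (intro exI[of _ "[:0, 1:]"]) (auto simp: poly_over_pCons poly_over_0 Er)
  show fd: "\<exists>n. fdim E V {0} n" unfolding V_def dsum_gspan using fdim_gspan[OF E subsp_0] by blast
  show "is_subfield V" using finite_dim_domain_field[OF E _ V EV] fd by blast
  show "V \<subseteq> R" if R: "is_subring R" "E \<subseteq> R" "x \<in> R" for R
  proof
    fix y assume "y \<in> V"
    then obtain g where "poly_over E g" "y = poly g x" unfolding mem by blast
    then show "y \<in> R" using poly_over_eval[OF R(1) poly_over_mono[OF R(2)] R(3)] by blast
  qed
qed

lemma fdim_tower:
  assumes E: "is_subfield E" and E': "is_subfield E'" "E \<subseteq> E'" and m: "fdim E E' {0} m"
  shows "fdim E' V B n \<Longrightarrow> subsp E' B \<Longrightarrow> fdim E V B (m * n)"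
proof (induction rule: fdim.induct)
  case fdim_0
  show ?case by (simp add: fdim.fdim_0)
next
  case (fdim_Suc x B n)
  have sB: "subsp E B" using fdim_Suc(4) E'(2) by (auto simp: subsp_def)
  have int: "(*) x ` E' \<inter> B = {0}"
  proof
    show "(*) x ` E' \<inter> B \<subseteq> {0}"
    proof
      fix y assume "y \<in> (*) x ` E' \<inter> B"
      then obtain c where c: "y = x * c" "c \<in> E'" "y \<in> B" by blast
      show "y \<in> {0}"
      proof (rule ccontr)
        assume "y \<notin> {0}"
        then have "inverse c * y = x" using c by (auto simp: field_simps)
        moreover have "inverse c * y \<in> B" using subspD(3)[OF subfield_subring[OF E'(1)] fdim_Suc(4)] c subfieldD(6)[OF E'(1)] by blast
        ultimately show False using fdim_Suc(1) by simp
      qed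
    qed
    show "{0} \<subseteq> (*) x ` E' \<inter> B" using subfieldD(1)[OF E'(1)] fdim_Suc(4) by (auto simp: subsp_def image_iff)
  qed
  have x0: "x \<noteq> 0" using fdim_Suc(1,4) by (auto simp: subsp_def)
  have "fdim E ((*) x ` E') ((*) x ` {0}) m" by (rule fdim_times[OF m x0])
  then have "fdim E ((*) x ` E') {0} m" by simp
  from fdim_iso2[OF E this subsp_0 sB int] have "fdim E (msum ((*) x ` E') B) B m" .
  moreover have "msum ((*) x ` E') B = adj E' B x"
  proof
    show "msum ((*) x ` E') B \<subseteq> adj E' B x"
    proof
      fix y assume "y \<in> msum ((*) x ` E') B"
      then obtain c b where "y = x * c + b" "c \<in> E'" "b \<in> B" by (auto simp: msum_def)
      then have "y = b + c * x" "b \<in> B" "c \<in> E'" by (simp_all add: mult.commute)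
      then show "y \<in> adj E' B x" unfolding adj_def by blast
    qed
    show "adj E' B x \<subseteq> msum ((*) x ` E') B"
    proof
      fix y assume "y \<in> adj E' B x"
      then obtain c b where "y = b + c * x" "c \<in> E'" "b \<in> B" by (auto simp: adj_def)
      then have "y = x * c + b" "b \<in> B" "c \<in> E'" by (simp_all add: mult.commute)
      then show "y \<in> msum ((*) x ` E') B" unfolding msum_def by blast
    qed
  qed
  ultimately have 1: "fdim E (adj E' B x) B m" by simp
  have 2: "fdim E V (adj E' B x) (m * n)" using fdim_Suc(3) subsp_adj[OF E'(1) fdim_Suc(4)] by blast
  from fdim_add[OF E 1 2] show ?case by (simp add: add.commute)
qed

lemma algebraic_mono: "algebraic_over E x \<Longrightarrow> E \<subseteq> E' \<Longrightarrow> algebraic_over E' x"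
  unfolding algebraic_over_def using poly_over_mono by blast

text \<open>The last property is minimality among rings, not only among fields: it keeps the
  extension inside a span over \<open>k\<close>, which is known to be a ring before it is known to
  be a field.\<close>

lemma algebraic_ext:
  assumes E: "is_subfield E" and x: "algebraic_over E x"
  obtains V n where "is_subfield V" "E \<subseteq> V" "x \<in> V" "fdim E V {0} n" "\<And>R. is_subring R \<Longrightarrow> E \<subseteq> R \<Longrightarrow> x \<in> R \<Longrightarrow> V \<subseteq> R"
proof -
  obtain f where f: "f \<noteq> 0" "poly_over E f" "poly f x = 0" using x unfolding algebraic_over_def by blast
  define g where "g = smult (inverse (lead_coeff f)) f"
  have "poly_over E g" unfolding g_def using f subfieldD(6)[OF E]
    by (intro poly_over_smult subfield_subring E) (auto simp: poly_over_def)
  moreover have "coeff g (degree f) = 1" "\<And>i. i > degree f \<Longrightarrow> coeff g i = 0" "poly g x = 0"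
    using f by (auto simp: g_def coeff_eq_0)
  moreover have "degree f > 0"
  proof (rule ccontr)
    assume "\<not> ?thesis"
    then obtain c where "f = [:c:]" using degree_eq_zeroE by blast
    then show False using f by simp
  qed
  ultimately have s: "is_subfield (dsum (degree f) (\<lambda>_. E) x)" "E \<subseteq> dsum (degree f) (\<lambda>_. E) x" "x \<in> dsum (degree f) (\<lambda>_. E) x"
      "\<exists>n. fdim E (dsum (degree f) (\<lambda>_. E) x) {0} n"
      "\<And>R. is_subring R \<Longrightarrow> E \<subseteq> R \<Longrightarrow> x \<in> R \<Longrightarrow> dsum (degree f) (\<lambda>_. E) x \<subseteq> R"
    using simple_extension[OF E, of g "degree f" x] by blast+
  from s(4) obtain n where "fdim E (dsum (degree f) (\<lambda>_. E) x) {0} n" by blast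
  from that[OF s(1,2,3) this s(5)] show ?thesis .
qed

lemma finite_ext:
  assumes E: "is_subfield E" and X: "finite X" "\<And>x. x \<in> X \<Longrightarrow> algebraic_over E x"
  shows "\<exists>V n. is_subfield V \<and> E \<subseteq> V \<and> X \<subseteq> V \<and> fdim E V {0} n \<and> (\<forall>R. is_subring R \<longrightarrow> E \<subseteq> R \<longrightarrow> X \<subseteq> R \<longrightarrow> V \<subseteq> R)"
  using X
proof (induction X rule: finite_induct)
  case empty
  have "E = gspan E {0} (\<lambda>_. 1) 1"
    unfolding gspan_def by auto
  then obtain n where "fdim E E {0} n" using fdim_gspan[OF E subsp_0, where w = "\<lambda>_. 1" and n = 1] by metis
  then show ?case using E by (intro exI[of _ E] exI[of _ n]) auto
next
  case (insert x X)
  then obtain V n where V: "is_subfield V" "E \<subseteq> V" "X \<subseteq> V" "fdim E V {0} n" "\<And>R. is_subring R \<Longrightarrow> E \<subseteq> R \<Longrightarrow> X \<subseteq> R \<Longrightarrow> V \<subseteq> R"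
    by auto
  obtain V' m where V': "is_subfield V'" "V \<subseteq> V'" "x \<in> V'" "fdim V V' {0} m" "\<And>R. is_subring R \<Longrightarrow> V \<subseteq> R \<Longrightarrow> x \<in> R \<Longrightarrow> V' \<subseteq> R"
    by (rule algebraic_ext[OF V(1) algebraic_mono[OF insert(4)[of x] V(2)]]) auto
  have "fdim E V' {0} (n * m)" by (rule fdim_tower[OF E V(1,2,4) V'(4) subsp_0])
  then show ?case using V V' by (intro exI[of _ V'] exI[of _ "n * m"]) auto
qed

lemma gen_field_frac:
  assumes K: "is_subfield K" and x: "x \<in> gen_field (K \<union> {t})"
  obtains a b where "poly_over K a" "poly_over K b" "poly b t \<noteq> 0" "x = poly a t / poly b t"
proof -
  note Kr = subfield_subring[OF K]
  define M where "M = {x. \<exists>a b. poly_over K a \<and> poly_over K b \<and> poly b t \<noteq> 0 \<and> x = poly a t / poly b t}"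
  have MI: "poly a t / poly b t \<in> M" if "poly_over K a" "poly_over K b" "poly b t \<noteq> 0" for a b unfolding M_def using that by blast
  have "is_subfield M" unfolding is_subfield_def is_subring_def
  proof (intro conjI ballI)
    show "0 \<in> M" using MI[of 0 1] by (simp add: poly_over_0 poly_over_1 Kr)
    show "1 \<in> M" using MI[of 1 1] by (simp add: poly_over_0 poly_over_1 Kr)
  next
    fix x y assume "x \<in> M" "y \<in> M"
    then obtain a b c d where *: "x = poly a t / poly b t" "y = poly c t / poly d t" "poly_over K a" "poly_over K b" "poly b t \<noteq> 0"
      "poly_over K c" "poly_over K d" "poly d t \<noteq> 0" unfolding M_def by blast
    have "x + y = poly (a * d + c * b) t / poly (b * d) t" unfolding *(1,2) using *(5,8) by (simp add: field_simps)
    then show "x + y \<in> M" using MI[of "a * d + c * b" "b * d"] * by (simp add: poly_over_add poly_over_mult Kr)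
    have "x * y = poly (a * c) t / poly (b * d) t" unfolding *(1,2) by simp
    then show "x * y \<in> M" using MI[of "a * c" "b * d"] * by (simp add: poly_over_mult Kr)
  next
    fix x assume "x \<in> M"
    then obtain a b where *: "x = poly a t / poly b t" "poly_over K a" "poly_over K b" "poly b t \<noteq> 0" unfolding M_def by blast
    have "- x = poly (0 - a) t / poly b t" using * by simp
    then show "- x \<in> M" using MI[of "0 - a" b] * poly_over_diff[OF Kr poly_over_0[OF Kr]] by metis
    show "inverse x \<in> M"
    proof (cases "poly a t = 0")
      case True
      then show ?thesis using * \<open>x \<in> M\<close> by simp
    next
      case False
      then show ?thesis using MI[of b a] * by simp
    qed
  qed
  moreover have "K \<union> {t} \<subseteq> M"
  proof -
    have "c \<in> M" if "c \<in> K" for c using MI[of "[:c:]" 1] that by (simp add: poly_over_pCons poly_over_0 poly_over_1 Kr)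
    moreover have "t \<in> M" using MI[of "[:0, 1:]" 1] subringD[OF Kr] by (simp add: poly_over_pCons poly_over_0 poly_over_1 Kr)
    ultimately show ?thesis by auto
  qed
  ultimately have "x \<in> M" using gen_field_least x by blast
  then show ?thesis using that unfolding M_def by blast
qed

lemma gen_field_inverse: "gen_field (K \<union> {inverse t}) = gen_field (K \<union> {t})"
proof -
  have "gen_field (K \<union> {inverse t}) \<subseteq> gen_field (K \<union> {t})" for t
    using gen_field_sub[of "K \<union> {t}"] subfieldD(6)[OF gen_field_subfield] by (intro gen_field_least gen_field_subfield) auto
  from this[of t] this[of "inverse t"] show ?thesis by simp
qed

section \<open>The valuation of a prime\<close>

locale prime_of_field =
  fixes K F Op :: "'a::field set" and \<pi> :: 'a
  assumes F: "is_subfield F" and K: "is_subfield K"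
    and Op: "is_subring Op" "K \<subseteq> Op" "Op \<subseteq> F"
    and pi: "\<pi> \<in> Op" "inverse \<pi> \<notin> Op"
    and dec: "\<And>x. x \<in> F \<Longrightarrow> x \<noteq> 0 \<Longrightarrow> \<exists>u k. u \<in> Op \<and> inverse u \<in> Op \<and> x = u * \<pi> powi k"
begin

lemma pi0: "\<pi> \<noteq> 0" using pi by auto

lemmas o = subringD[OF Op(1)]

definition v :: "'a \<Rightarrow> int" where
  "v x = (SOME k. \<exists>u. u \<in> Op \<and> inverse u \<in> Op \<and> x = u * \<pi> powi k)"

lemma v_dec: assumes "x \<in> F" "x \<noteq> 0" obtains u where "u \<in> Op" "inverse u \<in> Op" "x = u * \<pi> powi (v x)"
proof -
  have "\<exists>k u. u \<in> Op \<and> inverse u \<in> Op \<and> x = u * \<pi> powi k" using dec[OF assms] by blast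
  then have "\<exists>u. u \<in> Op \<and> inverse u \<in> Op \<and> x = u * \<pi> powi (v x)" unfolding v_def by (rule someI_ex)
  then show ?thesis using that by blast
qed

lemma pi_powi: "0 \<le> k \<Longrightarrow> \<pi> powi k \<in> Op"
  using o(7)[OF pi(1)] by (simp add: power_int_def)

lemma pi_powi_neg: "\<pi> powi k \<in> Op \<Longrightarrow> k \<ge> 0"
proof (rule ccontr)
  assume *: "\<pi> powi k \<in> Op" "\<not> k \<ge> 0"
  have "inverse \<pi> = \<pi> powi k * \<pi> powi (- k - 1)"
    using pi0 by (simp add: power_int_add[symmetric])
  also have "\<dots> \<in> Op"
  proof -
    have "0 \<le> - k - 1" using *(2) by simp
    from o(4)[OF *(1) pi_powi[OF this]] show ?thesis .
  qed
  finally show False using pi(2) by simp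
qed

lemma Op_iff: assumes "x \<in> F" "x \<noteq> 0" shows "x \<in> Op \<longleftrightarrow> v x \<ge> 0"
proof -
  obtain u where u: "u \<in> Op" "inverse u \<in> Op" "x = u * \<pi> powi (v x)" by (rule v_dec[OF assms])
  have u0: "u \<noteq> 0" using u(3) assms(2) by auto
  define P where "P = \<pi> powi (v x)"
  have "x = u * P" using u(3) unfolding P_def .
  then have "P = inverse u * x" using u0 by simp
  then have "\<pi> powi (v x) = inverse u * x" unfolding P_def .
  then show ?thesis using u pi_powi[of "v x"] pi_powi_neg[of "v x"] o(4) by metis
qed

lemma v_eq: assumes "u \<in> Op" "inverse u \<in> Op" "u \<noteq> 0" shows "v (u * \<pi> powi k) = k"
proof -
  have piF: "\<pi> powi k \<in> F" using subfieldD(6,9)[OF F] pi(1) Op(3) by (auto simp: power_int_def)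
  define x where "x = u * \<pi> powi k"
  have xF: "x \<in> F" "x \<noteq> 0" using assms pi0 piF subfieldD(4)[OF F] Op(3) by (auto simp: x_def)
  obtain w where w: "w \<in> Op" "inverse w \<in> Op" "x = w * \<pi> powi (v x)" by (rule v_dec[OF xF])
  have w0: "w \<noteq> 0" using w(3) xF by auto
  have "\<pi> powi (k - v x) = inverse u * w" using w(3) assms(3) pi0 unfolding x_def by (simp add: power_int_diff field_simps)
  moreover have "\<pi> powi (v x - k) = inverse w * u" using w(3) w0 pi0 unfolding x_def by (simp add: power_int_diff field_simps)
  ultimately have "\<pi> powi (k - v x) \<in> Op" "\<pi> powi (v x - k) \<in> Op" using o(4) w assms by metis+
  then have "0 \<le> k - v x" "0 \<le> v x - k" using pi_powi_neg[of "k - v x"] pi_powi_neg[of "v x - k"] by simp_all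
  then show ?thesis unfolding x_def by simp
qed

lemma v_mult': assumes "x \<in> F" "y \<in> F" "x \<noteq> 0" "y \<noteq> 0" shows "v (x * y) = v x + v y"
proof -
  obtain u where u: "u \<in> Op" "inverse u \<in> Op" "x = u * \<pi> powi (v x)" by (rule v_dec[OF assms(1,3)])
  obtain w where w: "w \<in> Op" "inverse w \<in> Op" "y = w * \<pi> powi (v y)" by (rule v_dec[OF assms(2,4)])
  have "x * y = (u * w) * \<pi> powi (v x + v y)" using u(3) w(3) pi0 by (simp add: power_int_add) (metis mult.assoc mult.left_commute)
  moreover have "u * w \<in> Op" "inverse (u * w) \<in> Op" "u * w \<noteq> 0" using u w o(4) assms by auto
  ultimately show ?thesis using v_eq by metis
qed

lemma v_pi: "v \<pi> = 1"
  using v_eq[of 1 1] o(2) by simp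

lemma v_add': assumes "x \<in> F" "y \<in> F" "x \<noteq> 0" "y \<noteq> 0" "x + y \<noteq> 0" shows "min (v x) (v y) \<le> v (x + y)"
proof -
  have *: "v x \<le> v (x + y)" if xy: "x \<in> F" "y \<in> F" "x \<noteq> 0" "y \<noteq> 0" "x + y \<noteq> 0" "v x \<le> v y" for x y
  proof -
    note ff = subfieldD[OF F]
    define w where "w = inverse x * y"
    have w: "w \<in> F" "w \<noteq> 0" using xy ff by (auto simp: w_def)
    have "v (x * w) = v x + v w" using v_mult' xy w by blast
    moreover have "x * w = y" using xy by (simp add: w_def)
    ultimately have "v w \<ge> 0" using xy by simp
    then have "w \<in> Op" using Op_iff[OF w] by simp
    then have "1 + w \<in> Op" using o(2,3) by blast
    moreover have e: "x + y = x * (1 + w)" using xy by (simp add: w_def field_simps)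
    then have n: "1 + w \<noteq> 0" "1 + w \<in> F" using xy(5) ff w by auto
    ultimately have "v (1 + w) \<ge> 0" using Op_iff by blast
    then show ?thesis unfolding e using v_mult'[OF xy(1) n(2) xy(3) n(1)] by simp
  qed
  show ?thesis
  proof (cases "v x \<le> v y")
    case True
    then show ?thesis using *[of x y] assms by simp
  next
    case False
    then show ?thesis using *[of y x] assms by (simp add: add.commute)
  qed
qed

lemma v_K': assumes "c \<in> K" "c \<noteq> 0" shows "v c = 0"
  using v_eq[of c 0] assms Op(2) subfieldD(6)[OF K] by auto

end

section \<open>The assumptions of \<open>fftower\<close> for a prime of a function field\<close>

locale ffield = cfield p K k F for p :: nat and K k F :: "'a::field set" +
  fixes Op :: "'a set"
  assumes ff: "one_dim_sep_function_field K F" and pr: "is_prime_of K F Op"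
begin

lemma Op_ex: "\<exists>\<pi>. prime_of_field K F Op \<pi>"
  using pr F K unfolding is_prime_of_def prime_of_field_def by blast

definition \<pi> where "\<pi> = (SOME \<pi>. prime_of_field K F Op \<pi>)"

sublocale P: prime_of_field K F Op \<pi>
  unfolding \<pi>_def by (rule someI_ex[OF Op_ex])

sublocale vfield p K k F P.v
proof
  show "\<exists>x\<in>F. x \<noteq> 0 \<and> P.v x = 1" using P.pi(1) P.Op(3) P.pi0 P.v_pi by blast
qed (use P.v_mult' P.v_add' P.v_K' in auto)

lemma I00: "I 0 0 = Op"
  using P.Op_iff P.o(1) P.Op(3) F by (auto simp: I_def Fn_0 subfieldD)

text \<open>A separating element may be replaced by its inverse, which generates the same field over
  \<open>K\<close>; one of the two lies in the valuation ring.\<close>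

lemma t_ex: "\<exists>t\<in>Op. \<not> algebraic_over K t \<and> (\<forall>x\<in>F. separable_over (gen_field (K \<union> {t})) x)"
proof -
  obtain t where t: "t \<in> F" "\<not> algebraic_over K t" "\<forall>x\<in>F. separable_over (gen_field (K \<union> {t})) x"
    using ff unfolding one_dim_sep_function_field_def by blast
  show ?thesis
  proof (cases "t \<in> Op")
    case False
    have t0: "t \<noteq> 0" using False P.o(1) by blast
    have "inverse t \<in> Op" using False P.Op_iff[OF t(1) t0] P.Op_iff[of "inverse t"] v_inverse[OF t(1) t0] t0 f(6)[OF t(1)] by simp
    moreover have "\<not> algebraic_over K (inverse t)"
    proof
      assume "algebraic_over K (inverse t)"
      obtain V n where V: "is_subfield V" "K \<subseteq> V" "inverse t \<in> V" "fdim K V {0} n"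
        by (rule algebraic_ext[OF K \<open>algebraic_over K (inverse t)\<close>])
      then have "t ^ i \<in> V" for i using subfieldD(6,9)[OF V(1)] by (metis inverse_inverse_eq)
      from fdim_algebraic[OF K V(4) this] obtain d c where c: "\<forall>i\<le>d. c i \<in> K" "c d = 1" "(\<Sum>i\<le>d. c i * t ^ i) = 0" by blast
      define g where "g = (\<Sum>i\<le>d. monom (c i) i)"
      have cg: "coeff g i = (if i \<le> d then c i else 0)" for i by (auto simp: g_def coeff_sum sum.delta cong: if_cong)
      have "poly_over K g" using c(1) subfieldD(1)[OF K] by (auto simp: poly_over_def cg)
      moreover have "coeff g d = 1" using c(2) by (simp add: cg)
      then have "g \<noteq> 0" by auto
      moreover have "poly g t = 0" using c(3) by (simp add: g_def poly_sum poly_monom)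
      ultimately show False using t(2) unfolding algebraic_over_def by blast
    qed
    ultimately show ?thesis using t(3) gen_field_inverse[of K t] by auto
  qed (use t in blast)
qed

definition t where "t = (SOME t. t \<in> Op \<and> \<not> algebraic_over K t \<and> (\<forall>x\<in>F. separable_over (gen_field (K \<union> {t})) x))"

lemma t: "t \<in> Op" "\<not> algebraic_over K t" "x \<in> F \<Longrightarrow> separable_over (gen_field (K \<union> {t})) x"
  using someI_ex[of "\<lambda>t. t \<in> Op \<and> \<not> algebraic_over K t \<and> (\<forall>x\<in>F. separable_over (gen_field (K \<union> {t})) x)"] t_ex
  unfolding t_def by blast+

definition E0 where "E0 = gen_field (K \<union> {t})"

lemma E0: "is_subfield E0" "K \<subseteq> E0" "t \<in> E0" "E0 \<subseteq> F"
  using gen_field_subfield[of "K \<union> {t}"] gen_field_sub[of "K \<union> {t}"] gen_field_least[OF F, of "K \<union> {t}"] KF t(1) P.Op(3)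
  unfolding E0_def by auto

text \<open>After cancelling a common factor over \<open>K\<close>, numerator and denominator
  satisfy a Bezout relation. If the denominator vanished at the prime, integrality of
  \<open>y\<close> would make the numerator vanish too, and then 1.\<close>

lemma frac_form:
  assumes T: "T \<in> Op" and y: "y \<in> gen_field (K \<union> {T})" "y \<in> Op"
  obtains a b where "poly_over K a" "poly_over K b" "poly b T \<notin> I 0 1" "poly b T \<in> Op" "y = poly a T / poly b T"
proof -
  obtain a b where ab: "poly_over K a" "poly_over K b" "poly b T \<noteq> 0" "y = poly a T / poly b T"
    by (rule gen_field_frac[OF K y(1)])
  have b0: "b \<noteq> 0" using ab(3) by auto
  obtain e u w b1 a1 where e: "e \<noteq> 0" "poly_over K e" "poly_over K u" "poly_over K w" "poly_over K b1" "poly_over K a1"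
    "e = u * b + w * a" "b = e * b1" "a = e * a1" "u * b1 + w * a1 = 1"
    by (rule bezout_over[OF K ab(2) b0 ab(1)])
  have ev: "poly g T \<in> I 0 0" if "poly_over K g" for g
    using poly_over_eval[OF P.Op(1) poly_over_mono[OF P.Op(2) that] T] by (simp add: I00)
  have y': "y * poly b1 T = poly a1 T" using ab(3,4) e(8,9) by (simp add: field_simps)
  have b1: "poly b1 T \<noteq> 0" using ab(3) e(8) by auto
  have "poly b1 T \<notin> I 0 1"
  proof
    assume *: "poly b1 T \<in> I 0 1"
    have "poly a1 T \<in> I 0 1" using I_mult[of y 0 0 "poly b1 T" 1] y(2) * y' by (simp add: I00)
    then have "poly u T * poly b1 T + poly w T * poly a1 T \<in> I 0 1"
      using I_mult[OF ev[OF e(3)] *] I_mult[OF ev[OF e(4)], of "poly a1 T" 1] by (intro I_add) auto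
    moreover have "poly u T * poly b1 T + poly w T * poly a1 T = poly (u * b1 + w * a1) T" by simp
    ultimately show False unfolding e(10) using one_notin by simp
  qed
  then show ?thesis using that[OF e(6,5)] y' b1 ev[OF e(5)] by (simp add: I00 field_simps)
qed

text \<open>Each \<open>x\<close> is separable over \<open>E0\<close> and has its
  \<open>p\<close>-th power in the span, so \<open>separable_in\<close> with \<open>M = {0}\<close>
  puts it into the span. In this form separability of the function field enters the tower.\<close>

lemma F_span: "F \<subseteq> ksp E0 ((\<lambda>x. x ^ p) ` F)"
proof
  fix x assume x: "x \<in> F"
  define L where "L = ksp E0 ((\<lambda>x. x ^ p) ` F)"
  note Er = subfield_subring[OF E0(1)]
  have im: "is_subring ((\<lambda>x. x ^ p) ` F)" unfolding is_subring_def
  proof (intro conjI ballI)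
    show "0 \<in> (\<lambda>x. x ^ p) ` F" using f(1) p_pos by (intro image_eqI[of _ _ 0]) auto
    show "1 \<in> (\<lambda>x. x ^ p) ` F" using f(2) by (intro image_eqI[of _ _ 1]) auto
  next
    fix a b assume "a \<in> (\<lambda>x. x ^ p) ` F" "b \<in> (\<lambda>x. x ^ p) ` F"
    then obtain c d where cd: "a = c ^ p" "b = d ^ p" "c \<in> F" "d \<in> F" by blast
    show "a + b \<in> (\<lambda>x. x ^ p) ` F" using cd f(3) freshman[of c d 1] by (intro image_eqI[of _ _ "c + d"]) auto
    show "a * b \<in> (\<lambda>x. x ^ p) ` F" using cd f(4) by (intro image_eqI[of _ _ "c * d"]) (auto simp: power_mult_distrib)
  next
    fix a assume "a \<in> (\<lambda>x. x ^ p) ` F"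
    then obtain c where cd: "a = c ^ p" "c \<in> F" by blast
    show "- a \<in> (\<lambda>x. x ^ p) ` F" using cd f(5) frob_uminus[of c 1] by (intro image_eqI[of _ _ "- c"]) auto
  qed
  have L: "is_subring L" unfolding L_def by (rule subring_ksp[OF Er im])
  have powL: "y ^ p \<in> L" if "y \<in> F" for y unfolding L_def by (rule ksp_gen1[OF Er]) (use that in auto)
  have LF: "L \<subseteq> F" unfolding L_def by (rule ksp_least[OF subsp_subring[OF Er subfield_subring[OF F] E0(4)]]) (auto intro: f(9))
  have EL: "E0 \<subseteq> L"
  proof
    fix c assume "c \<in> E0"
    then have "c * 1 \<in> L" unfolding L_def by (rule ksp_gen) (use f(2) in force)
    then show "c \<in> L" by simp
  qed
  obtain g where g: "poly_over E0 g" "coprime g (pderiv g)" "poly g x = 0"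
    using t(3)[OF x] unfolding separable_over_def E0_def by blast
  have "\<exists>s\<in>L. x - s \<in> {0}"
  proof (rule separable_in[OF subfield_subring[OF F], of "{0}" L x E0 g])
    show "\<exists>d\<in>L. c * d - 1 \<in> {0}" if c: "c \<in> L" "c \<notin> {0}" for c
    \<comment> \<open>This witness is the inverse of \<open>c\<close>, written inside
      \<open>L\<close>: the second factor is a \<open>p\<close>-th power from
      \<open>F\<close>.\<close>
    proof (intro bexI[of _ "c ^ (p - 1) * (inverse c) ^ p"])
      obtain q where q: "p = Suc q" using p_pos gr0_conv_Suc by blast
      show "c * (c ^ (p - 1) * (inverse c) ^ p) - 1 \<in> {0}" using c(2) by (simp add: q field_simps)
      have "inverse c \<in> F" using c LF f(6) by blast
      then show "c ^ (p - 1) * (inverse c) ^ p \<in> L" using c by (intro subringD(4)[OF L] subringD(7)[OF L] powL)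
    qed
  qed (use x g L LF EL E0 powL f(1) in \<open>auto simp: subsp_0\<close>)
  then show "x \<in> ksp E0 ((\<lambda>x. x ^ p) ` F)" unfolding L_def by auto
qed

text \<open>\<open>Fn 1\<close> with \<open>t\<close> adjoined is a field containing
  \<open>E0\<close> and all \<open>p\<close>-th powers, hence \<open>F\<close> by
  \<open>F_span\<close>; \<open>t ^ p \<in> Fn 1\<close> limits the exponents.\<close>

lemma frobenius_generator: "F \<subseteq> dsum p (\<lambda>_. Fn 1) t"
proof -
  define V where "V = dsum p (\<lambda>_. Fn 1) t"
  have tF: "t \<in> F" using E0 by blast
  define g where "g = monom 1 p - [:t ^ p:]"
  have tp: "t ^ p \<in> Fn 1" using Fn_frob1[of t 0] tF by (simp add: Fn_0)
  have "poly_over (Fn 1) g" unfolding g_def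
    using tp fn(2) by (intro poly_over_diff poly_over_monom Fn_ring) (auto simp: poly_over_pCons poly_over_0 Fn_ring)
  moreover have "coeff g p = 1" "\<And>i. i > p \<Longrightarrow> coeff g i = 0" using p_pos by (auto simp: g_def coeff_pCons split: nat.splits)
  moreover have "poly g t = 0" by (simp add: g_def poly_monom)
  ultimately have V: "is_subfield V" "Fn 1 \<subseteq> V" "t \<in> V"
    unfolding V_def using simple_extension[OF Fn_field[of 1], of g p t] p_pos by blast+
  have "E0 \<subseteq> V" unfolding E0_def by (rule gen_field_least[OF V(1)]) (use V K_Fn[of 1] in auto)
  then have "subsp E0 V" using subsp_subring[OF subfield_subring[OF E0(1)] subfield_subring[OF V(1)]] by blast
  moreover have "(\<lambda>x. x ^ p) ` F \<subseteq> V" using V(2) Fn_frob1[of _ 0] by (auto simp: Fn_0)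
  ultimately have "ksp E0 ((\<lambda>x. x ^ p) ` F) \<subseteq> V" by (rule ksp_least)
  then show ?thesis using F_span unfolding V_def by blast
qed

lemma sep_alg: "separable_over LL x \<Longrightarrow> algebraic_over LL x"
proof -
  assume "separable_over LL x"
  then obtain g where g: "poly_over LL g" "coprime g (pderiv g)" "poly g x = 0" unfolding separable_over_def by blast
  then have "g \<noteq> 0" by auto
  then show ?thesis using g unfolding algebraic_over_def by blast
qed

lemma F_finite:
  assumes E: "is_subfield LL" "E0 \<subseteq> LL" "LL \<subseteq> F"
  shows "\<exists>n. fdim LL F {0} n"
proof -
  obtain X where X: "finite X" "X \<subseteq> F" "F = gen_field (K \<union> X)" using ff unfolding one_dim_sep_function_field_def by blast
  have alg: "algebraic_over LL x" if "x \<in> X" for x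
  proof -
    have "x \<in> F" using that X(2) by blast
    from algebraic_mono[OF sep_alg[OF t(3)[OF this]] E(2)[unfolded E0_def]] show ?thesis .
  qed
  have "\<exists>V n. is_subfield V \<and> LL \<subseteq> V \<and> X \<subseteq> V \<and> fdim LL V {0} n \<and> (\<forall>R. is_subring R \<longrightarrow> LL \<subseteq> R \<longrightarrow> X \<subseteq> R \<longrightarrow> V \<subseteq> R)"
    by (rule finite_ext[OF E(1) X(1) alg])
  then show ?thesis
  proof (elim exE conjE)
    fix V n
    assume V: "is_subfield V" "LL \<subseteq> V" "X \<subseteq> V" "fdim LL V {0} n"
      "\<forall>R. is_subring R \<longrightarrow> LL \<subseteq> R \<longrightarrow> X \<subseteq> R \<longrightarrow> V \<subseteq> R"
    have "F \<subseteq> V" unfolding X(3) by (rule gen_field_least[OF V(1)]) (use V(2,3) E(2) E0(2) in auto)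
    moreover have "V \<subseteq> F" using V(5) subfield_subring[OF F] E(3) X(2) by simp
    ultimately show ?thesis using V(4) by auto
  qed
qed

text \<open>Otherwise the valuation is trivial on \<open>E0\<close>. In an algebraic relation over
  \<open>E0\<close> for the inverse of a uniformizer the nonzero terms would then have distinct
  values and could not cancel.\<close>

lemma z_ex: "\<exists>g. poly_over K g \<and> poly g t \<in> I 0 1 \<and> poly g t \<noteq> 0"
proof (rule ccontr)
  assume "\<not> ?thesis"
  then have *: "poly g t \<in> Op \<and> inverse (poly g t) \<in> Op" if "poly_over K g" for g
    using that poly_over_eval[OF P.Op(1) poly_over_mono[OF P.Op(2) that] t(1)] I_inverse[of "poly g t" 0] P.o(1)
    by (cases "poly g t = 0") (auto simp: I00)
  have E0O: "E0 \<subseteq> Op"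
  proof
    fix x assume "x \<in> E0"
    then obtain a b where "poly_over K a" "poly_over K b" "x = poly a t / poly b t" unfolding E0_def by (rule gen_field_frac[OF K])
    then show "x \<in> Op" using * P.o(4) by (simp add: divide_inverse)
  qed
  have v0: "P.v c = 0" if "c \<in> E0" "c \<noteq> 0" for c
    using that E0O P.Op_iff[of c] P.Op_iff[of "inverse c"] v_inverse[of c] subfieldD(6)[OF E0(1)] E0(4) by fastforce
  obtain n where n: "fdim E0 F {0} n" using F_finite[OF E0(1) _ E0(4)] by blast
  define x where "x = inverse \<pi>"
  have piF: "\<pi> \<in> F" using P.pi(1) P.Op(3) by blast
  have x: "x \<in> F" "x \<noteq> 0" "P.v x = - 1" using piF P.pi0 f(6) v_inverse P.v_pi by (auto simp: x_def)
  obtain d c where c: "\<forall>i\<le>d. c i \<in> E0" "c d = 1" "(\<Sum>i\<le>d. c i * x ^ i) = 0"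
    using fdim_algebraic[OF E0(1) n f(9)[OF x(1)]] by blast
  have cx: "P.v (c i * x ^ i) = - int i" if "i \<le> d" "c i \<noteq> 0" for i
    using v_mult[of "c i" "x ^ i"] c(1) that E0(4) f(9)[OF x(1)] x(2) v0[of "c i"] v_power[OF x(1,2), of i] x(3) by auto
  have "inj_on (\<lambda>i. P.v (c i * x ^ i)) {i \<in> {..d}. c i * x ^ i \<noteq> 0}"
    by (rule inj_onI) (use cx in auto)
  moreover have "\<exists>i\<in>{..d}. c i * x ^ i \<noteq> 0" using c(2) x(2) by (intro bexI[of _ d]) auto
  moreover have "c i * x ^ i \<in> F" if "i \<in> {..d}" for i using that c(1) E0(4) f(4,9) x(1) by auto
  ultimately show False using v_sum_distinct[of "{..d}" "\<lambda>i. c i * x ^ i"] c(3) by auto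
qed

definition z where "z = (SOME z. \<exists>g. poly_over K g \<and> z = poly g t \<and> z \<in> I 0 1 \<and> z \<noteq> 0)"

lemma z: "z \<in> I 0 1" "z \<noteq> 0" "z \<in> E0" "z \<in> Op" "P.v z \<ge> 1" and z_poly: "\<exists>g. poly_over K g \<and> z = poly g t"
proof -
  have *: "\<exists>g. poly_over K g \<and> z = poly g t \<and> z \<in> I 0 1 \<and> z \<noteq> 0"
    unfolding z_def by (rule someI_ex) (use z_ex in blast)
  then show "z \<in> I 0 1" "z \<noteq> 0" "\<exists>g. poly_over K g \<and> z = poly g t" by blast+
  then obtain g where "poly_over K g" "z = poly g t" by blast
  then show "z \<in> E0" using poly_over_eval[OF subfield_subring[OF E0(1)] poly_over_mono[OF E0(2)] E0(3), of g] by simp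
  show "z \<in> Op" "P.v z \<ge> 1" using \<open>z \<in> I 0 1\<close> \<open>z \<noteq> 0\<close> I_mono[of 0 1 0] I00 by (auto simp: I_def)
qed

text \<open>\<open>F\<close> is finite over the field \<open>E1\<close> generated by
  \<open>z\<close>, whose residue field is \<open>K\<close>. Elements of the valuation ring with
  \<open>K\<close>-independent residues are independent over \<open>E1\<close>, so their number is
  bounded.\<close>

lemma residue_field_finite: "\<exists>d. fdim K (I 0 0) (I 0 1) d"
proof -
  define E1 where "E1 = gen_field (K \<union> {z})"
  have E1: "is_subfield E1" "K \<subseteq> E1" "z \<in> E1" "E1 \<subseteq> F"
    using gen_field_subfield[of "K \<union> {z}"] gen_field_sub[of "K \<union> {z}"] gen_field_least[OF F, of "K \<union> {z}"] KF z(3) E0(4)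
    unfolding E1_def by auto
  obtain g where g: "poly_over K g" "z = poly g t" using z_poly by blast
  have "algebraic_over E1 t" unfolding algebraic_over_def
  proof (intro exI[of _ "g - [:z:]"] conjI)
    show "poly_over E1 (g - [:z:])"
      using E1 poly_over_mono[OF E1(2) g(1)] by (intro poly_over_diff subfield_subring) (auto simp: poly_over_pCons poly_over_0 subfield_subring)
    show "poly (g - [:z:]) t = 0" using g(2) by simp
    show "g - [:z:] \<noteq> 0"
    proof
      assume "g - [:z:] = 0"
      then have "coeff g 0 = z" by simp
      then have "z \<in> K" using g(1) by (metis poly_over_def)
      then show False using v_K[of z] z(2,5) by simp
    qed
  qed
  then obtain E2 m where E2: "is_subfield E2" "E1 \<subseteq> E2" "t \<in> E2" "fdim E1 E2 {0} m" "\<And>R. is_subring R \<Longrightarrow> E1 \<subseteq> R \<Longrightarrow> t \<in> R \<Longrightarrow> E2 \<subseteq> R"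
    using algebraic_ext[OF E1(1)] by metis
  have "E0 \<subseteq> E2" unfolding E0_def by (rule gen_field_least[OF E2(1)]) (use E1 E2 in auto)
  moreover have "E2 \<subseteq> F" by (rule E2(5)[OF subfield_subring[OF F] E1(4)]) (use E0 in auto)
  ultimately obtain n where "fdim E2 F {0} n" using F_finite[OF E2(1)] by blast
  from fdim_tower[OF E1(1) E2(1,2,4) this subsp_0] have dim: "fdim E1 F {0} (m * n)" .
  have res: "\<exists>a\<in>K. c - a \<in> I 0 1" if c: "c \<in> E1" "c \<in> Op" for c
  proof -
    obtain a b where ab: "poly_over K a" "poly_over K b" "poly b z \<notin> I 0 1" "poly b z \<in> Op" "c = poly a z / poly b z"
      using frac_form[OF z(4) _ c(2)] c(1) unfolding E1_def by metis
    have cong: "poly h z - coeff h 0 \<in> I 0 1" if h: "poly_over K h" for h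
    proof -
      obtain h0 h' where h': "h = pCons h0 h'" by (cases h) auto
      have "poly h' z \<in> I 0 0" using poly_over_eval[OF P.Op(1) poly_over_mono[OF P.Op(2), of h'] z(4)] h h' by (simp add: poly_over_pCons I00)
      from I_mult[OF z(1) this] show ?thesis by (simp add: h')
    qed
    have cK: "coeff a 0 \<in> K" "coeff b 0 \<in> K" using ab by (auto simp: poly_over_def)
    have b0: "coeff b 0 \<noteq> 0" using cong[OF ab(2)] ab(3) by auto
    have bz0: "poly b z \<noteq> 0" using ab(3) I_0 by metis
    define a0 where "a0 = coeff a 0 / coeff b 0"
    have a0K: "a0 \<in> K" unfolding a0_def using cK subfieldD(8)[OF K] by blast
    have "c - a0 = inverse (poly b z) * ((poly a z - coeff a 0) - a0 * (poly b z - coeff b 0))"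
      unfolding ab(5) a0_def using b0 bz0 by (simp add: field_simps)
    also have "\<dots> \<in> I 0 1"
    proof -
      have "inverse (poly b z) \<in> I 0 0" using I_inverse ab(3,4) I00 by blast
      moreover have "a0 * (poly b z - coeff b 0) \<in> I 0 1" using subspD(3)[OF Kr subsp_I a0K cong[OF ab(2)]] .
      then have "(poly a z - coeff a 0) - a0 * (poly b z - coeff b 0) \<in> I 0 1" by (intro subspD(5)[OF Kr subsp_I] cong[OF ab(1)])
      ultimately show ?thesis using I_mult by fastforce
    qed
    finally show ?thesis using a0K by blast
  qed
  have "\<exists>d\<le>m * n. fdim K (I 0 0) (I 0 1) d"
  proof (rule fdim_bound_ex[OF K subsp_I subsp_I])
    show "I 0 1 \<subseteq> I 0 0" by (rule I_mono) simp
    fix C l assume C: "subsp K C" "C \<subseteq> I 0 0" "fdim K C (I 0 1) l"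
    obtain w where w: "C = gspan K (I 0 1) w l" "\<forall>j<l. w j \<notin> gspan K (I 0 1) w j"
      using fdim_basis[OF K C(3) subsp_I] by blast
    have wO: "w j \<in> I 0 0" if "j < l" for j using gspan_gen[OF K subsp_I[of 0 1] that, of w] w(1) C(2) by blast
    \<comment> \<open>If the last coefficient were not integral, dividing by it would express
      \<open>w j\<close> modulo \<open>I 0 1\<close> by its predecessors.\<close>
    have inv: "j \<le> l \<Longrightarrow> gspan E1 {0} w j \<inter> I 0 0 \<subseteq> gspan K (I 0 1) w j" for j
    proof (induction j)
      case 0
      show ?case by (auto simp: gspan_0 I_0)
    next
      case (Suc j)
      define B where "B = gspan K (I 0 1) w j"
      define V where "V = gspan E1 {0} w j"
      have sB: "subsp K B" unfolding B_def by (rule subsp_gspan[OF K subsp_I])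
      have mB: "I 0 1 \<subseteq> B" unfolding B_def by (rule gspan_base[OF K])
      have sV: "subsp E1 V" unfolding V_def by (rule subsp_gspan[OF E1(1) subsp_0])
      have IH: "V \<inter> I 0 0 \<subseteq> B" using Suc unfolding V_def B_def by auto
      have wj: "w j \<in> I 0 0" "w j \<notin> B" using wO w(2) Suc by (auto simp: B_def)
      note bb = subspD[OF Kr sB]
      show ?case
      proof
        fix y assume "y \<in> gspan E1 {0} w (Suc j) \<inter> I 0 0"
        then obtain b c where y: "y = b + c * w j" "b \<in> V" "c \<in> E1" "y \<in> I 0 0" by (auto simp: gspan_Suc adj_def V_def)
        show "y \<in> gspan K (I 0 1) w (Suc j)"
        proof (cases "c \<in> Op")
          case True
          then obtain a where a: "a \<in> K" "c - a \<in> I 0 1" using res y(3) by blast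
          have "c * w j \<in> I 0 0" using I_mult[of c 0 0 "w j" 0] True wj(1) by (simp add: I00)
          then have "y - c * w j \<in> I 0 0" by (rule subspD(5)[OF Kr subsp_I y(4)])
          then have "b \<in> I 0 0" using y(1) by simp
          then have "b \<in> B" using IH y(2) by blast
          moreover have "(c - a) * w j \<in> I 0 1" using I_mult[OF a(2) wj(1)] by simp
          ultimately have "b + (c - a) * w j \<in> B" using mB bb(2) by blast
          moreover have "y = (b + (c - a) * w j) + a * w j" using y(1) by (simp add: algebra_simps)
          ultimately show ?thesis using a(1) by (auto simp: gspan_Suc B_def[symmetric] intro: adjI)
        next
          case False
          then have c0: "c \<noteq> 0" and cF: "c \<in> F" using P.o(1) y(3) E1(4) by auto
          have "P.v c < 0" using False P.Op_iff[OF cF c0] by simp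
          then have ic: "inverse c \<in> I 0 1" using v_inverse[OF cF c0] f(6)[OF cF] by (simp add: I_def Fn_0)
          have e1: "inverse c * y \<in> I 0 1" using I_mult[OF ic y(4)] by simp
          have "inverse c * b = inverse c * y - w j" using y(1) c0 by (simp add: field_simps)
          moreover have "inverse c * y \<in> I 0 0" using e1 I_mono[of 0 1 0] by auto
          ultimately have "inverse c * b \<in> I 0 0" using subspD(5)[OF Kr subsp_I _ wj(1)] by simp
          moreover have "inverse c * b \<in> V" using subspD(3)[OF subfield_subring[OF E1(1)] sV] y(2,3) subfieldD(6)[OF E1(1)] by blast
          ultimately have "inverse c * b \<in> B" using IH by blast
          then have "inverse c * y - inverse c * b \<in> B" using e1 mB bb(5) by blast
          moreover have "inverse c * y - inverse c * b = w j" using y(1) c0 by (simp add: field_simps)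
          ultimately show ?thesis using wj(2) by simp
        qed
      qed
    qed
    have "w j \<notin> gspan E1 {0} w j" if "j < l" for j
      using inv[of j] wO[OF that] w(2) that by auto
    then have g: "fdim E1 (gspan E1 {0} w l) {0} l" by (intro fdim_gspan_n[OF E1(1) subsp_0])
    have "gspan E1 {0} w l \<subseteq> F"
      by (rule gspan_sub[OF E1(1) subsp_subring[OF subfield_subring[OF E1(1)] subfield_subring[OF F] E1(4)]])
        (use wO in \<open>auto intro: f(1) subsetD[OF I_sub(2)[of 0 0]]\<close>)
    then obtain m' l' where "fdim E1 (gspan E1 {0} w l) {0} l'" "m' + l' = m * n"
      using fdim_mid[OF E1(1) dim subsp_0 subsp_gspan[OF E1(1) subsp_0] gspan_base[OF E1(1)]] by blast
    then show "l \<le> m * n" using fdim_unique[OF E1(1) g _ subsp_0] by fastforce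
  qed
  then show ?thesis by blast
qed

lemma clear_denominators:
  assumes "finite A" "A \<subseteq> F" shows "\<exists>M. \<forall>a\<in>A. \<forall>m\<ge>M. z ^ m * a \<in> Op"
  using assms
proof (induction A)
  case (insert a A)
  then obtain M where M: "\<forall>a\<in>A. \<forall>m\<ge>M. z ^ m * a \<in> Op" by auto
  have zF: "z \<in> F" using z(3) E0(4) by blast
  have "z ^ m * a \<in> Op" if m: "m \<ge> nat (- P.v a)" for m
  proof (cases "a = 0")
    case False
    have aF: "a \<in> F" using insert by simp
    have "P.v (z ^ m * a) = int m * P.v z + P.v a"
      using v_mult[OF f(9)[OF zF, of m] aF _ False] z(2) v_power[OF zF z(2)] by simp
    moreover have "int m * 1 \<le> int m * P.v z" using z(5) by (intro mult_left_mono) auto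
    ultimately have "P.v (z ^ m * a) \<ge> 0" using m by simp
    then show ?thesis using P.Op_iff[of "z ^ m * a"] False z(2) f(4)[OF f(9)[OF zF] aF] by simp
  qed (simp add: P.o(1))
  then show ?case using M by (intro exI[of _ "max M (nat (- P.v a))"]) auto
qed simp

definition Lam where "Lam = E0 \<inter> Op"

lemma Lam_ring: "is_subring Lam"
  using subringD(1-5)[OF subfield_subring[OF E0(1)]] P.o(1-5) unfolding Lam_def is_subring_def by simp

lemma Lam_clear: assumes "finite A" "A \<subseteq> E0" shows "\<exists>m. \<forall>a\<in>A. z ^ m * a \<in> Lam"
proof -
  obtain M where "\<forall>a\<in>A. \<forall>m\<ge>M. z ^ m * a \<in> Op" using clear_denominators[OF assms(1)] assms(2) E0(4) by blast
  then show ?thesis using assms(2) subfieldD(4,9)[OF E0(1)] z(3) unfolding Lam_def by (intro exI[of _ M]) auto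
qed

lemma basis_ex: "\<exists>n w. fdim E0 F {0} n \<and> (\<forall>j<n. w j \<in> Op) \<and> gspan E0 {0} w n = F"
proof -
  obtain n where n: "fdim E0 F {0} n" using F_finite[OF E0(1) _ E0(4)] by blast
  obtain w where "F = gspan E0 {0} w n" using fdim_basis[OF E0(1) n subsp_0] by metis
  note w = this[symmetric]
  have wF: "w j \<in> F" if "j < n" for j using gspan_gen[OF E0(1) subsp_0 that, of w] unfolding w .
  obtain M where M: "\<forall>a\<in>w ` {..<n}. \<forall>m\<ge>M. z ^ m * a \<in> Op" using clear_denominators[of "w ` {..<n}"] wF by blast
  define w' where "w' j = z ^ M * w j" for j
  have w'O: "w' j \<in> Op" if "j < n" for j using M that by (auto simp: w'_def)
  have "F \<subseteq> gspan E0 {0} w' n"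
  proof
    fix x assume "x \<in> F"
    then have "x \<in> gspan E0 {0} w n" unfolding w .
    then obtain c where c: "x = (\<Sum>i<n. c i * w i)" "\<forall>i<n. c i \<in> E0" by (auto elim: gspanE)
    have "x = 0 + (\<Sum>i<n. (c i * inverse (z ^ M)) * w' i)" unfolding c(1) w'_def using z(2) by (simp add: field_simps)
    also have "\<dots> \<in> gspan E0 {0} w' n" using c(2) subfieldD(4,6,9)[OF E0(1)] z(3) by (intro gspanI) auto
    finally show "x \<in> gspan E0 {0} w' n" .
  qed
  moreover have "gspan E0 {0} w' n \<subseteq> F"
    by (rule gspan_sub[OF E0(1) subsp_subring[OF subfield_subring[OF E0(1)] subfield_subring[OF F] E0(4)]])
      (use w'O P.Op(3) f(1) in auto)
  ultimately have "gspan E0 {0} w' n = F" by (intro subset_antisym)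
  then show ?thesis using n w'O by blast
qed

lemma S_E0_frac: "S N E0 \<subseteq> gen_field (K \<union> {t ^ (p ^ N)})"
proof (rule S_least)
  define G where "G = gen_field (K \<union> {t ^ (p ^ N)})"
  have G: "is_subfield G" "K \<subseteq> G" "t ^ (p ^ N) \<in> G"
    using gen_field_subfield gen_field_sub[of "K \<union> {t ^ (p ^ N)}"] unfolding G_def by auto
  show "subsp K (gen_field (K \<union> {t ^ (p ^ N)}))"
    using subsp_subring[OF Kr subfield_subring[OF G(1)] G(2)] by (simp add: G_def)
  have ev: "poly a t ^ (p ^ N) \<in> G" if "poly_over K a" for a
  proof -
    have "poly a t ^ (p ^ N) = (\<Sum>i\<le>degree a. coeff a i ^ (p ^ N) * (t ^ (p ^ N)) ^ i)"
      unfolding poly_altdef frob_sum by (simp add: power_mult_distrib power_mult[symmetric] mult.commute)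
    also have "\<dots> \<in> G"
    proof (rule subringD(9)[OF subfield_subring[OF G(1)]])
      fix i
      have "coeff a i \<in> G" using that G(2) by (auto simp: poly_over_def)
      then show "coeff a i ^ (p ^ N) * (t ^ (p ^ N)) ^ i \<in> G"
        by (intro subfieldD(4)[OF G(1)] subfieldD(9)[OF G(1)] G(3))
    qed
    finally show ?thesis .
  qed
  fix x assume "x \<in> E0"
  then obtain a b where ab: "poly_over K a" "poly_over K b" "x = poly a t / poly b t"
    unfolding E0_def by (rule gen_field_frac[OF K])
  have "x ^ (p ^ N) = poly a t ^ (p ^ N) / poly b t ^ (p ^ N)" by (simp add: ab(3) power_divide)
  then have "x ^ (p ^ N) \<in> G" using ev[OF ab(1)] ev[OF ab(2)] subfieldD(8)[OF G(1)] by simp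
  then show "x ^ (p ^ N) \<in> gen_field (K \<union> {t ^ (p ^ N)})" by (simp add: G_def)
qed

text \<open>On the rational function field no denominators arise: \<open>y\<close> is a fraction in
  \<open>t ^ (p ^ N)\<close> whose denominator is a unit at the prime, and
  \<open>t ^ (p ^ N)\<close> lies in \<open>S N Op\<close>.\<close>

lemma S_E0_Op: assumes y: "y \<in> S N E0" "y \<in> Op" shows "y \<in> S N Op"
proof -
  have T: "t ^ (p ^ N) \<in> Op" "t ^ (p ^ N) \<in> S N Op" using P.o(7)[OF t(1)] S_pow[OF t(1)] by auto
  have yG: "y \<in> gen_field (K \<union> {t ^ (p ^ N)})" using S_E0_frac y(1) by blast
  obtain a b where ab: "poly_over K a" "poly_over K b" "poly b (t ^ (p ^ N)) \<notin> I 0 1" "poly b (t ^ (p ^ N)) \<in> Op"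
      "y = poly a (t ^ (p ^ N)) / poly b (t ^ (p ^ N))"
    by (rule frac_form[OF T(1) yG y(2)])
  have SO: "is_subring (S N Op)" by (rule S_ring[OF P.Op(1)])
  have ev: "poly g (t ^ (p ^ N)) \<in> S N Op" if "poly_over K g" for g
    by (rule poly_over_eval[OF SO poly_over_mono[OF K_sub_S[OF P.Op(1)] that] T(2)])
  have "inverse (poly b (t ^ (p ^ N))) \<in> S N Op"
    using S_inverse[OF P.Op(1,2) ev[OF ab(2)]] I_inverse[of _ 0] ab(3,4) I00 by blast
  then show ?thesis unfolding ab(5) divide_inverse by (intro subringD(4)[OF SO] ev[OF ab(1)])
qed

text \<open>The denominators \<open>h ^ (p ^ N)\<close> come from comparing the \<open>E0\<close>-bases \<open>w\<close> and \<open>w ^ p\<close> of \<open>F\<close>; separability of \<open>F\<close>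
  is what makes the latter a basis. Elements almost integral over \<open>Lam\<close> then have coordinates which are
  almost integral, hence integral. This replaces the usual discriminant argument.\<close>

lemma bounded_denominators: "\<exists>h. h \<in> I 0 0 \<and> h \<noteq> 0 \<and> (\<forall>N. \<forall>x\<in>I N 0. h ^ (p ^ N) * x \<in> S N (I 0 0))"
proof -
  note Er = subfield_subring[OF E0(1)]
  note e0 = subfieldD[OF E0(1)] and lr = subringD[OF Lam_ring]
  obtain n w where nw: "fdim E0 F {0} n" "\<forall>j<n. w j \<in> Op" "gspan E0 {0} w n = F" using basis_ex by metis
  have wF: "w j ^ i \<in> F" if "j < n" for i j using nw(2) that P.Op(3) f(9) by blast
  have sF: "subsp E0 F" by (rule subsp_subring[OF Er subfield_subring[OF F] E0(4)])
  have span: "gspan E0 {0} (\<lambda>j. w j ^ (p ^ m)) n = F" for m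
  proof (induction m)
    case 0
    show ?case using nw(3) by simp
  next
    case (Suc m)
    have "x ^ p \<in> gspan E0 {0} (\<lambda>j. w j ^ (p ^ Suc m)) n" if "x \<in> F" for x
    proof -
      have "x \<in> gspan E0 {0} (\<lambda>j. w j ^ (p ^ m)) n" using that unfolding Suc .
      then obtain c where c: "x = (\<Sum>i<n. c i * w i ^ (p ^ m))" "\<forall>i<n. c i \<in> E0" by (auto elim: gspanE)
      have "x ^ p = 0 + (\<Sum>i<n. c i ^ p * w i ^ (p ^ Suc m))"
        unfolding c(1) using frob_sum[of "\<lambda>i. c i * w i ^ (p ^ m)" "{..<n}" 1]
        by (simp add: power_mult_distrib power_mult[symmetric] mult.commute)
      also have "\<dots> \<in> gspan E0 {0} (\<lambda>j. w j ^ (p ^ Suc m)) n" using c(2) e0(9) by (intro gspanI) auto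
      finally show ?thesis .
    qed
    then have "ksp E0 ((\<lambda>x. x ^ p) ` F) \<subseteq> gspan E0 {0} (\<lambda>j. w j ^ (p ^ Suc m)) n"
      by (intro ksp_least subsp_gspan[OF E0(1) subsp_0]) auto
    moreover have "gspan E0 {0} (\<lambda>j. w j ^ (p ^ Suc m)) n \<subseteq> F"
      by (rule gspan_sub[OF E0(1) sF]) (use wF f(1) in auto)
    ultimately show ?case using F_span by (meson order_trans subset_antisym)
  qed
  have uniq: "c j = d j" if cd: "\<forall>i<n. c i \<in> E0" "\<forall>i<n. d i \<in> E0" "(\<Sum>i<n. c i * w i ^ (p ^ m)) = (\<Sum>i<n. d i * w i ^ (p ^ m))" "j < n" for c d m j
  proof -
    have "fdim E0 (gspan E0 {0} (\<lambda>j. w j ^ (p ^ m)) n) {0} n" unfolding span by (rule nw(1))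
    from fdim_gspan_indep[OF E0(1) subsp_0 this]
    have "\<And>j. j < n \<Longrightarrow> w j ^ (p ^ m) \<notin> gspan E0 {0} (\<lambda>j. w j ^ (p ^ m)) j" .
    moreover have "(\<Sum>i<n. (c i - d i) * w i ^ (p ^ m)) \<in> {0}" using cd(3) by (simp add: left_diff_distrib sum_subtractf)
    ultimately have "c j - d j = 0"
      using gspan_indepD[OF E0(1) subsp_0, of n "\<lambda>j. w j ^ (p ^ m)" "\<lambda>i. c i - d i" j] cd(1,2,4) e0(7) by blast
    then show ?thesis by simp
  qed
  have "\<exists>c. (\<forall>j<n. c j \<in> E0) \<and> w i = (\<Sum>j<n. c j * w j ^ p)" if "i < n" for i
  proof -
    have "w i \<in> gspan E0 {0} (\<lambda>j. w j ^ (p ^ 1)) n" unfolding span using wF[OF that, of 1] by simp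
    then show ?thesis by (auto elim!: gspanE)
  qed
  then have "\<forall>i. \<exists>c. i < n \<longrightarrow> (\<forall>j<n. c j \<in> E0) \<and> w i = (\<Sum>j<n. c j * w j ^ p)" by blast
  from choice[OF this] obtain A where "\<forall>i. i < n \<longrightarrow> (\<forall>j<n. A i j \<in> E0) \<and> w i = (\<Sum>j<n. A i j * w j ^ p)" ..
  then have A: "\<And>i j. i < n \<Longrightarrow> j < n \<Longrightarrow> A i j \<in> E0" "\<And>i. i < n \<Longrightarrow> w i = (\<Sum>j<n. A i j * w j ^ p)"
    by simp_all
  obtain M where M: "\<forall>a\<in>(\<lambda>(i, j). A i j) ` ({..<n} \<times> {..<n}). z ^ M * a \<in> Lam"
    using Lam_clear[of "(\<lambda>(i, j). A i j) ` ({..<n} \<times> {..<n})"] A(1) by fastforce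
  define h where "h = z ^ M"
  have zL: "z ^ i \<in> Lam" for i using e0(9)[OF z(3)] P.o(7)[OF z(4)] by (simp add: Lam_def)
  have h: "h \<in> Lam" "h \<noteq> 0" using zL z(2) by (simp_all add: h_def)
  have hE: "h \<in> E0" "h \<in> F" "h \<in> Op" using h(1) E0(4) by (auto simp: Lam_def)
  have hA: "h * A i j \<in> Lam" if "i < n" "j < n" for i j using M that by (auto simp: h_def)
  have hw: "h * w i = (\<Sum>j<n. (h * A i j) * w j ^ p)" if "i < n" for i
    by (subst A(2)[OF that]) (simp add: sum_distrib_left mult.assoc)
  have hW1: "\<exists>l. (\<forall>j<n. l j \<in> Lam) \<and> h ^ (p ^ m) * w i = (\<Sum>j<n. l j * w j ^ (p ^ m))" if "i < n" for i m
  proof (induction m)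
    case 0
    have "(\<Sum>j<n. (if j = i then h else 0) * w j ^ (p ^ 0)) = (\<Sum>j<n. if j = i then h * w i else 0)" by (rule sum.cong) auto
    then show ?case using that h(1) lr(1) by (intro exI[of _ "\<lambda>j. if j = i then h else 0"]) auto
  next
    case (Suc m)
    then obtain l where l: "\<forall>j<n. l j \<in> Lam" "h ^ (p ^ m) * w i = (\<Sum>j<n. l j * w j ^ (p ^ m))" by blast
    \<comment> \<open>The induction hypothesis and the \<open>p ^ m\<close>-th powers of the entries
      of \<open>A\<close> each use up a factor \<open>h ^ (p ^ m)\<close>. As
      \<open>p \<ge> 2\<close>, the exponent \<open>p ^ Suc m\<close> suffices for both and leaves
      \<open>e\<close>.\<close>
    define e where "e = p ^ Suc m - 2 * p ^ m"
    have "2 * p ^ m \<le> p * p ^ m" using p_gt1 by (intro mult_le_mono1) simp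
    then have "2 * p ^ m \<le> p ^ Suc m" by (simp only: power_Suc)
    then have "p ^ Suc m = e + 2 * p ^ m" unfolding e_def by (simp only: le_add_diff_inverse2)
    then have pe: "p ^ Suc m = e + p ^ m + p ^ m" by (simp only: mult_2 add.assoc)
    define T where "T k = (\<Sum>j<n. l j * (h * A j k) ^ (p ^ m))" for k
    define l' where "l' k = h ^ e * T k" for k
    have "h ^ (p ^ Suc m) * w i = h ^ e * (h ^ (p ^ m) * (h ^ (p ^ m) * w i))" unfolding pe by (simp add: power_add mult.assoc)
    also have "h ^ (p ^ m) * (h ^ (p ^ m) * w i) = (\<Sum>j<n. l j * (h * w j) ^ (p ^ m))"
      unfolding l(2) by (simp add: sum_distrib_left power_mult_distrib mult_ac)
    also have "\<dots> = (\<Sum>j<n. l j * (\<Sum>k<n. (h * A j k) ^ (p ^ m) * w k ^ (p ^ Suc m)))"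
    proof (rule sum.cong[OF refl])
      fix j assume "j \<in> {..<n}"
      then show "l j * (h * w j) ^ (p ^ m) = l j * (\<Sum>k<n. (h * A j k) ^ (p ^ m) * w k ^ (p ^ Suc m))"
        by (subst hw) (auto simp: frob_sum power_mult_distrib power_mult[symmetric] mult.commute)
    qed
    also have "\<dots> = (\<Sum>k<n. T k * w k ^ (p ^ Suc m))"
      unfolding T_def sum_distrib_left sum_distrib_right by (subst sum.swap) (simp add: mult_ac)
    finally have "h ^ (p ^ Suc m) * w i = (\<Sum>k<n. l' k * w k ^ (p ^ Suc m))"
      by (simp add: l'_def sum_distrib_left mult.assoc)
    moreover have "l' k \<in> Lam" if "k < n" for k
    proof -
      have "T k \<in> Lam" unfolding T_def by (rule lr(9), rule lr(4)) (use l(1) lr(7) hA that in auto)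
      then show ?thesis unfolding l'_def by (intro lr(4) lr(7) h(1))
    qed
    ultimately show ?case by blast
  qed
  have hW: "\<exists>l. (\<forall>j<n. l j \<in> Lam) \<and> h ^ (p ^ m) * (\<Sum>i<n. \<mu> i * w i) = (\<Sum>j<n. l j * w j ^ (p ^ m))"
    if mu: "\<forall>i<n. \<mu> i \<in> Lam" for \<mu> m
  proof -
    have "\<forall>i. \<exists>l. i < n \<longrightarrow> (\<forall>j<n. l j \<in> Lam) \<and> h ^ (p ^ m) * w i = (\<Sum>j<n. l j * w j ^ (p ^ m))" using hW1 by blast
    then obtain l where l: "\<And>i j. i < n \<Longrightarrow> j < n \<Longrightarrow> l i j \<in> Lam" "\<And>i. i < n \<Longrightarrow> h ^ (p ^ m) * w i = (\<Sum>j<n. l i j * w j ^ (p ^ m))"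
      by metis
    have "h ^ (p ^ m) * (\<Sum>i<n. \<mu> i * w i) = (\<Sum>i<n. \<mu> i * (h ^ (p ^ m) * w i))" by (simp add: sum_distrib_left mult_ac)
    also have "\<dots> = (\<Sum>i<n. \<mu> i * (\<Sum>j<n. l i j * w j ^ (p ^ m)))" using l(2) by (intro sum.cong) auto
    also have "\<dots> = (\<Sum>j<n. (\<Sum>i<n. \<mu> i * l i j) * w j ^ (p ^ m))"
      unfolding sum_distrib_left sum_distrib_right by (subst sum.swap) (simp add: mult_ac)
    finally show ?thesis using mu l(1) by (intro exI[of _ "\<lambda>j. \<Sum>i<n. \<mu> i * l i j"]) (auto intro!: lr(4) lr(9))
  qed
  have main: "h ^ (p ^ N) * x \<in> S N Op" if x: "x \<in> I N 0" for N x
  proof -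
    define EN where "EN = S N E0"
    have EN: "is_subfield EN" "EN \<subseteq> E0" "K \<subseteq> EN" unfolding EN_def
      using S_field[OF E0(1,2)] S_sub[OF Er E0(2)] K_sub_S[OF Er] by auto
    note en = subfieldD[OF EN(1)]
    have EF: "EN \<subseteq> Fn N" unfolding EN_def Fn_def by (rule S_mono[OF E0(4)])
    have FnE: "Fn N = gspan EN {0} (\<lambda>j. w j ^ (p ^ N)) n"
    proof
      show "Fn N \<subseteq> gspan EN {0} (\<lambda>j. w j ^ (p ^ N)) n" unfolding Fn_def
      proof (rule S_least)
        show "subsp K (gspan EN {0} (\<lambda>j. w j ^ (p ^ N)) n)"
          using subsp_gspan[OF EN(1) subsp_0] EN(3) by (fastforce simp: subsp_def)
        fix y assume "y \<in> F"
        then have "y \<in> gspan E0 {0} w n" unfolding nw(3) .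
        then obtain c where c: "y = (\<Sum>i<n. c i * w i)" "\<forall>i<n. c i \<in> E0" by (auto elim: gspanE)
        have "y ^ (p ^ N) = 0 + (\<Sum>i<n. c i ^ (p ^ N) * w i ^ (p ^ N))" unfolding c(1) frob_sum by (simp add: power_mult_distrib)
        also have "\<dots> \<in> gspan EN {0} (\<lambda>j. w j ^ (p ^ N)) n" using c(2) by (intro gspanI) (auto simp: EN_def intro: S_pow)
        finally show "y ^ (p ^ N) \<in> gspan EN {0} (\<lambda>j. w j ^ (p ^ N)) n" .
      qed
      show "gspan EN {0} (\<lambda>j. w j ^ (p ^ N)) n \<subseteq> Fn N"
        by (rule gspan_sub[OF EN(1) subsp_subring[OF subfield_subring[OF EN(1)] Fn_ring EF]])
          (use Fn_frob[of _ 0 N] wF[of _ 1] fn(1) in \<open>auto simp: Fn_0\<close>)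
    qed
    obtain m where "fdim EN (gspan EN {0} (\<lambda>j. w j ^ (p ^ N)) n) {0} m" using fdim_gspan[OF EN(1) subsp_0] by metis
    then have fm: "fdim EN (Fn N) {0} m" by (simp only: FnE)
    have xN: "x \<in> Fn N" "x \<in> I 0 0" "x \<in> Op" using x I_sub(1) I_level[of 0 N 0] I00 by auto
    obtain d c where c: "\<forall>i\<le>d. c i \<in> EN" "c d = 1" "(\<Sum>i\<le>d. c i * x ^ i) = 0"
      using fdim_algebraic[OF EN(1) fm fn(9)[OF xN(1)]] by blast
    define J where "J = {i. i \<le> d \<and> c i \<noteq> 0}"
    have J: "finite J" "d \<in> J" using c(2) by (auto simp: J_def)
    \<comment> \<open>Scaling by the inverse of a coefficient of least value makes all coefficients
      integral and one of them 1.\<close>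
    define i0 where "i0 = arg_min_on (\<lambda>i. P.v (c i)) J"
    have i0: "i0 \<in> J" "\<And>i. i \<in> J \<Longrightarrow> P.v (c i0) \<le> P.v (c i)"
      unfolding i0_def using J arg_min_if_finite[of J "\<lambda>i. P.v (c i)"] by (auto simp: not_less[symmetric])
    have i0': "i0 \<le> d" "c i0 \<noteq> 0" "c i0 \<in> EN" using i0(1) c(1) by (auto simp: J_def)
    define c' where "c' i = inverse (c i0) * c i" for i
    have cEN: "c' i \<in> EN" if "i \<le> d" for i using that c(1) i0'(3) en(4,6) by (auto simp: c'_def)
    have cO: "c' i \<in> Op" if "i \<le> d" for i
    proof (cases "c i = 0")
      case False
      have F': "c i \<in> F" "c i0 \<in> F" "inverse (c i0) \<in> F" using c(1) that i0'(3) EN(2) E0(4) f(6) by auto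
      have "P.v (c' i) = - P.v (c i0) + P.v (c i)"
        unfolding c'_def using v_mult[OF F'(3,1)] v_inverse[OF F'(2) i0'(2)] False i0'(2) by simp
      then have "P.v (c' i) \<ge> 0" using i0(2)[of i] False that by (auto simp: J_def)
      then show ?thesis using P.Op_iff[of "c' i"] F' f(4) False i0'(2) by (simp add: c'_def)
    qed (simp add: c'_def P.o(1))
    have cL: "c' i \<in> Lam" if "i \<le> d" for i using cEN[OF that] cO[OF that] EN(2) by (auto simp: Lam_def)
    have c1: "c' i0 = 1" using i0'(2) by (simp add: c'_def)
    have "(\<Sum>i\<le>d. c' i * x ^ i) = inverse (c i0) * (\<Sum>i\<le>d. c i * x ^ i)" by (simp add: c'_def sum_distrib_left mult.assoc)
    then have rel: "(\<Sum>i\<le>d. c' i * x ^ i) = 0" using c(3) by simp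
    \<comment> \<open>Tails of the relation, as in Horner's scheme. Multiplication by a tail, and by
      \<open>x\<close> times a tail, will map the module \<open>Mo\<close> into itself; since one
      coefficient is 1, some tail is a unit.\<close>
    define b where "b j = (\<Sum>i=j..d. c' i * x ^ (i - j))" for j
    have b0: "b 0 = 0" using rel by (simp add: b_def atMost_atLeast0)
    have bS: "b j = c' j + x * b (Suc j)" if "j \<le> d" for j
    proof -
      have "b j = c' j + (\<Sum>i=Suc j..d. c' i * x ^ (i - j))" unfolding b_def using that by (simp add: sum.atLeast_Suc_atMost)
      also have "(\<Sum>i=Suc j..d. c' i * x ^ (i - j)) = (\<Sum>i=Suc j..d. x * (c' i * x ^ (i - Suc j)))"
      proof (rule sum.cong[OF refl])
        fix i assume "i \<in> {Suc j..d}"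
        then have "i - j = Suc (i - Suc j)" by auto
        then show "c' i * x ^ (i - j) = x * (c' i * x ^ (i - Suc j))" by simp
      qed
      finally show ?thesis by (simp add: b_def sum_distrib_left)
    qed
    have bO: "b j \<in> I 0 0" for j unfolding b_def I00 using cO xN(3) by (auto intro!: P.o(9) P.o(4) P.o(7))
    have bN: "b j \<in> Fn N" for j unfolding b_def using cEN EF xN(1)
      by (intro subringD(9)[OF Fn_ring]) (auto intro!: fn(4) fn(9))
    have "\<exists>j\<le>d. b (Suc j) \<notin> I 0 1"
    proof (rule ccontr)
      assume "\<not> ?thesis"
      then have bm: "b (Suc j) \<in> I 0 1" if "j \<le> d" for j using that by blast
      have bm': "b j \<in> I 0 1" if "j \<le> d" for j using bm[of "j - 1"] b0 I_0 that by (cases j) auto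
      have "x * b (Suc i0) \<in> I 0 1" using I_mult[OF xN(2) bm[OF i0'(1)]] by simp
      then have "b i0 - x * b (Suc i0) \<in> I 0 1" by (intro subspD(5)[OF Kr subsp_I] bm'[OF i0'(1)])
      then show False using bS[OF i0'(1)] c1 one_notin by simp
    qed
    then obtain j where j: "j \<le> d" "b (Suc j) \<notin> I 0 1" by blast
    define B where "B = b (Suc j)"
    have B0: "B \<noteq> 0" using j(2) I_0 by (auto simp: B_def)
    have d1: "d \<ge> 1"
    proof (rule ccontr)
      assume "\<not> d \<ge> 1"
      then have "B = 0" using j(1) by (simp add: B_def b_def)
      then show False using B0 by simp
    qed
    define Mo where "Mo = dsum d (\<lambda>_. Lam) x"
    have sM: "subsp Lam Mo" unfolding Mo_def
      by (rule subsp_dsum) (rule subsp_subring[OF Lam_ring Lam_ring order_refl])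
    have Mx: "x ^ i \<in> Mo" if "i < d" for i
    proof -
      have "(\<Sum>k<d. (if k = i then 1 else 0) * x ^ k) = (\<Sum>k<d. if k = i then x ^ i else 0)" by (rule sum.cong) auto
      then have "x ^ i = (\<Sum>k<d. (if k = i then 1 else 0) * x ^ k)" using that by simp
      also have "\<dots> \<in> Mo" unfolding Mo_def by (rule dsumI) (use lr(1,2) in auto)
      finally show ?thesis .
    qed
    note ms = subspD[OF Lam_ring sM]
    have bx: "b k * x ^ i \<in> Mo" if i: "i < d" for k i
    proof (cases "i < k")
      case True
      have "b k * x ^ i = (\<Sum>l=k..d. c' l * x ^ (l - k + i))" unfolding b_def sum_distrib_right by (simp only: power_add mult.assoc)
      also have "\<dots> \<in> Mo" using True cL i by (intro ms(6) ms(3) Mx) auto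
      finally show ?thesis .
    next
      case False
      then have ki: "k \<le> i" "k \<le> d" using i by auto
      have "b k * x ^ k = (\<Sum>l=k..d. c' l * x ^ l)" unfolding b_def sum_distrib_right
        by (rule sum.cong) (auto simp: mult.assoc power_add[symmetric])
      moreover have "(\<Sum>l\<le>d. c' l * x ^ l) = (\<Sum>l<k. c' l * x ^ l) + (\<Sum>l=k..d. c' l * x ^ l)"
      proof -
        have "{..d} = {..<k} \<union> {k..d}" using ki by auto
        then show ?thesis by (simp add: sum.union_disjoint ivl_disj_int)
      qed
      ultimately have bk: "b k * x ^ k = - (\<Sum>l<k. c' l * x ^ l)" using rel by (simp add: eq_neg_iff_add_eq_0 add.commute)
      have "b k * x ^ i = (b k * x ^ k) * x ^ (i - k)" using ki by (simp add: mult.assoc power_add[symmetric])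
      also have "\<dots> = - (\<Sum>l<k. c' l * x ^ (l + (i - k)))" unfolding bk by (simp add: sum_distrib_right power_add mult.assoc)
      also have "\<dots> \<in> Mo" using ki cL i by (intro ms(4) ms(6) ms(3) Mx) auto
      finally show ?thesis .
    qed
    have bM: "b k * y \<in> Mo" if yM: "y \<in> Mo" for k y
    proof -
      obtain a where a: "y = (\<Sum>i<d. a i * x ^ i)" "\<forall>i<d. a i \<in> Lam" using yM unfolding Mo_def by (rule dsumE)
      have "b k * y = (\<Sum>i<d. a i * (b k * x ^ i))" by (simp add: a(1) sum_distrib_left mult_ac)
      also have "\<dots> \<in> Mo"
      proof (rule ms(6))
        fix i assume "i \<in> {..<d}"
        then show "a i * (b k * x ^ i) \<in> Mo" using a(2) by (intro ms(3) bx) auto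
      qed
      finally show ?thesis .
    qed
    have BM: "B ^ i * y \<in> Mo" if "y \<in> Mo" for i y
      using that by (induction i) (auto simp: B_def mult.assoc bM)
    have xBM: "x * B * y \<in> Mo" if "y \<in> Mo" for y
    proof -
      have "x * B * y = b j * y - c' j * y" using bS[OF j(1)] by (simp add: B_def algebra_simps)
      also have "\<dots> \<in> Mo" by (rule ms(5)[OF bM[OF that] ms(3)[OF cL[OF j(1)] that]])
      finally show ?thesis .
    qed
    \<comment> \<open>One factor \<open>B\<close> absorbs the \<open>x\<close>, so all powers of
      \<open>r\<close> stay in \<open>Mo\<close> and have a common denominator. The exponent
      \<open>p ^ N\<close> makes the inserted unit invertible in \<open>S N Op\<close>.\<close>
    define r where "r = x * B ^ (p ^ N)"
    have rM: "r * y \<in> Mo" if "y \<in> Mo" for y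
    proof -
      obtain q where q: "p ^ N = Suc q" using p_pos by (metis gr0_conv_Suc zero_less_power)
      have e: "r * y = x * B * (B ^ q * y)" by (simp add: r_def q mult_ac)
      show ?thesis unfolding e by (rule xBM[OF BM[OF that]])
    qed
    have rpow: "r ^ i \<in> Mo" for i
    proof (induction i)
      case 0
      show ?case using Mx[of 0] d1 by simp
    next
      case (Suc i)
      then show ?case using rM by simp
    qed
    have "\<exists>a. (\<forall>k<n. a k \<in> E0) \<and> x ^ i = (\<Sum>k<n. a k * w k)" for i
    proof -
      have "x ^ i \<in> gspan E0 {0} w n" using f(9)[OF FnF[OF xN(1)], of i] unfolding nw(3) .
      then show ?thesis by (auto elim!: gspanE)
    qed
    then obtain a where a: "\<And>i k. k < n \<Longrightarrow> a i k \<in> E0" "\<And>i. x ^ i = (\<Sum>k<n. a i k * w k)" by metis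
    obtain M0 where M0: "\<forall>a'\<in>(\<lambda>(i, k). a i k) ` ({..<d} \<times> {..<n}). z ^ M0 * a' \<in> Lam"
      using Lam_clear[of "(\<lambda>(i, k). a i k) ` ({..<d} \<times> {..<n})"] a(1) by fastforce
    define c0 where "c0 = z ^ M0"
    have c0: "c0 \<in> Lam" "c0 \<noteq> 0" "c0 \<in> F" "c0 \<in> E0" using zL z(2) E0(4) by (auto simp: c0_def Lam_def)
    have MW: "\<exists>\<mu>. (\<forall>k<n. \<mu> k \<in> Lam) \<and> c0 * y = (\<Sum>k<n. \<mu> k * w k)" if yM: "y \<in> Mo" for y
    proof -
      obtain e where e: "y = (\<Sum>i<d. e i * x ^ i)" "\<forall>i<d. e i \<in> Lam" using yM unfolding Mo_def by (rule dsumE)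
      have "c0 * y = (\<Sum>i<d. e i * (\<Sum>k<n. (c0 * a i k) * w k))" unfolding e(1) a(2) by (simp add: sum_distrib_left mult_ac)
      also have "\<dots> = (\<Sum>k<n. (\<Sum>i<d. e i * (c0 * a i k)) * w k)"
        unfolding sum_distrib_left sum_distrib_right by (subst sum.swap) (simp add: mult_ac)
      moreover have "c0 * a i k \<in> Lam" if "i < d" "k < n" for i k using M0 that by (auto simp: c0_def)
      then have "(\<Sum>i<d. e i * (c0 * a i k)) \<in> Lam" if "k < n" for k using that e(2) by (intro lr(9)) (auto intro: lr(4))
      ultimately show ?thesis by (intro exI[of _ "\<lambda>k. \<Sum>i<d. e i * (c0 * a i k)"]) auto
    qed
    have "r \<in> Fn N" unfolding r_def B_def using xN(1) bN fn(4,9) by blast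
    then have "r \<in> gspan EN {0} (\<lambda>j. w j ^ (p ^ N)) n" by (simp only: FnE)
    then obtain \<gamma> where g: "r = (\<Sum>k<n. \<gamma> k * w k ^ (p ^ N))" "\<forall>k<n. \<gamma> k \<in> EN" by (auto elim: gspanE)
    \<comment> \<open>The denominator \<open>c0\<close> does not depend on \<open>m\<close>. Hence
      the value of \<open>h ^ (p ^ N) * \<gamma> k\<close>, multiplied by any \<open>p ^ m\<close>,
      stays above a fixed bound and cannot be negative.\<close>
    have gL: "h ^ (p ^ (N + m)) * c0 * \<gamma> k ^ (p ^ m) \<in> Lam" if k: "k < n" for k m
    proof -
      obtain \<mu> where mu: "\<forall>k<n. \<mu> k \<in> Lam" "c0 * r ^ (p ^ m) = (\<Sum>k<n. \<mu> k * w k)" using MW[OF rpow] by blast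
      obtain l where l: "\<forall>j<n. l j \<in> Lam" "h ^ (p ^ (N + m)) * (\<Sum>i<n. \<mu> i * w i) = (\<Sum>j<n. l j * w j ^ (p ^ (N + m)))"
        using hW[OF mu(1)] by blast
      have "r ^ (p ^ m) = (\<Sum>k<n. \<gamma> k ^ (p ^ m) * w k ^ (p ^ (N + m)))"
        unfolding g(1) frob_sum by (simp add: power_mult_distrib power_mult[symmetric] power_add)
      then have "(\<Sum>k<n. (h ^ (p ^ (N + m)) * c0 * \<gamma> k ^ (p ^ m)) * w k ^ (p ^ (N + m))) = h ^ (p ^ (N + m)) * (c0 * r ^ (p ^ m))"
        by (simp add: sum_distrib_left mult_ac)
      also have "\<dots> = (\<Sum>j<n. l j * w j ^ (p ^ (N + m)))" unfolding mu(2) l(2) ..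
      finally have eq: "(\<Sum>k<n. (h ^ (p ^ (N + m)) * c0 * \<gamma> k ^ (p ^ m)) * w k ^ (p ^ (N + m))) = (\<Sum>j<n. l j * w j ^ (p ^ (N + m)))" .
      have "\<forall>k<n. h ^ (p ^ (N + m)) * c0 * \<gamma> k ^ (p ^ m) \<in> E0"
        using g(2) EN(2) hE(1) c0(4) by (auto intro!: e0(4) e0(9))
      moreover have "\<forall>k<n. l k \<in> E0" using l(1) by (auto simp: Lam_def)
      ultimately have "h ^ (p ^ (N + m)) * c0 * \<gamma> k ^ (p ^ m) = l k" using uniq[OF _ _ eq k] by blast
      then show ?thesis using l(1) k by simp
    qed
    have hg: "h ^ (p ^ N) * \<gamma> k \<in> S N Op" if k: "k < n" for k
    proof -
      have gF: "\<gamma> k \<in> F" using g(2) k EN(2) E0(4) by blast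
      define y where "y = h ^ (p ^ N) * \<gamma> k"
      have yF: "y \<in> F" unfolding y_def using gF hE(2) f(4,9) by blast
      have "y \<in> Op"
      proof (cases "y = 0")
        case False
        have "P.v c0 + int (p ^ m) * P.v y \<ge> 0" for m
        proof -
          have e: "h ^ (p ^ (N + m)) * c0 * \<gamma> k ^ (p ^ m) = c0 * y ^ (p ^ m)"
            by (simp add: y_def power_mult_distrib power_add power_mult[symmetric] mult_ac)
          have "c0 * y ^ (p ^ m) \<in> Op" using gL[OF k, of m] unfolding e by (simp add: Lam_def)
          moreover have "c0 * y ^ (p ^ m) \<noteq> 0" "c0 * y ^ (p ^ m) \<in> F" using False c0 f(4,9) yF by auto
          ultimately have "P.v (c0 * y ^ (p ^ m)) \<ge> 0" using P.Op_iff by blast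
          then show ?thesis using v_mult[OF c0(3) f(9)[OF yF], of "p ^ m"] c0(2) False v_power[OF yF False] by simp
        qed
        from this[of "nat (P.v c0)"] have *: "P.v c0 + int (p ^ nat (P.v c0)) * P.v y \<ge> 0" .
        have "P.v y \<ge> 0"
        proof (rule ccontr)
          assume "\<not> P.v y \<ge> 0"
          then have "int (p ^ nat (P.v c0)) * P.v y \<le> int (p ^ nat (P.v c0)) * (- 1)" by (intro mult_left_mono) auto
          moreover have "nat (P.v c0) < p ^ nat (P.v c0)" using p_gt1 by (intro power_gt_expt) simp
          ultimately show False using * by linarith
        qed
        then show ?thesis using P.Op_iff[OF yF False] by simp
      qed (simp add: P.o(1))
      moreover have "y \<in> S N E0" unfolding y_def using g(2) k S_pow[OF hE(1), of N] en(4) by (auto simp: EN_def)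
      ultimately show ?thesis using S_E0_Op unfolding y_def by blast
    qed
    have SO: "is_subring (S N Op)" by (rule S_ring[OF P.Op(1)])
    have "h ^ (p ^ N) * r = (\<Sum>k<n. (h ^ (p ^ N) * \<gamma> k) * w k ^ (p ^ N))" by (simp add: g(1) sum_distrib_left mult.assoc)
    also have "\<dots> \<in> S N Op"
    proof (rule subringD(9)[OF SO])
      fix k assume "k \<in> {..<n}"
      then show "(h ^ (p ^ N) * \<gamma> k) * w k ^ (p ^ N) \<in> S N Op" using nw(2) by (intro subringD(4)[OF SO hg S_pow]) auto
    qed
    finally have hr: "h ^ (p ^ N) * r \<in> S N Op" .
    have "inverse B \<in> Op" using I_inverse[OF bO] j(2) I00 by (simp add: B_def)
    then have iB: "(inverse B) ^ (p ^ N) \<in> S N Op" by (rule S_pow)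
    have "h ^ (p ^ N) * x = (h ^ (p ^ N) * r) * (inverse B) ^ (p ^ N)" using B0 by (simp add: r_def power_inverse)
    also have "\<dots> \<in> S N Op" by (rule subringD(4)[OF SO hr iB])
    finally show ?thesis .
  qed
  show ?thesis using main hE(3) h(2) by (intro exI[of _ h]) (auto simp: I00)
qed

sublocale fftower p K k F P.v
proof
  show "\<exists>d. fdim K (I 0 0) (I 0 1) d" by (rule residue_field_finite)
  show "\<exists>t. t \<in> F \<and> F \<subseteq> dsum p (\<lambda>_. Fn 1) t" using frobenius_generator E0(3,4) by blast
  show "\<exists>h. h \<in> I 0 0 \<and> h \<noteq> 0 \<and> (\<forall>n. \<forall>x\<in>I n 0. h ^ (p ^ n) * x \<in> S n (I 0 0))" by (rule bounded_denominators)
qed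

end

section \<open>Separable degree and geometric singularity degree\<close>

lemma poly_cong:
  assumes R: "is_subring R" and M: "subsp R M" and f: "poly_over R f" and a: "a \<in> R" "b \<in> R" "a - b \<in> M"
  shows "poly f a - poly f b \<in> M"
  using f
proof (induction f)
  case 0
  then show ?case using subspD(1)[OF R M] by simp
next
  case (pCons c f)
  then have IH: "poly f a - poly f b \<in> M" and fR: "poly_over R f" by (auto simp: poly_over_pCons)
  have "poly (pCons c f) a - poly (pCons c f) b = a * (poly f a - poly f b) + poly f b * (a - b)" by (simp add: algebra_simps)
  also have "\<dots> \<in> M" by (intro subspD(2)[OF R M] subspD(3)[OF R M] a IH poly_over_eval[OF R fR])
  finally show ?case .
qed

section \<open>Tensor products with the closure as spans\<close>

context cfield
begin

lemma ksp_gspan: assumes "subsp K B" shows "ksp k (gspan K B w n) = gspan k (ksp k B) w n"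
  by (induction n) (simp_all add: gspan_0 gspan_Suc ksp_adj subsp_gspan[OF K assms])

lemma ksp_ring: "is_subring R \<Longrightarrow> is_subring (ksp k R)"
  by (rule subring_ksp[OF kr])

lemma k_ksp: "is_subring R \<Longrightarrow> k \<subseteq> ksp k R"
proof
  fix c assume "is_subring R" "c \<in> k"
  then have "c * 1 \<in> ksp k R" by (intro ksp_gen subringD(2))
  then show "c \<in> ksp k R" by simp
qed

lemma gen_ring_ksp: assumes R: "is_subring R" shows "gen_ring (k \<union> R) = ksp k R"
proof
  have "is_subring (ksp k R)" "k \<union> R \<subseteq> ksp k R" using ksp_ring[OF R] k_ksp[OF R] ksp_gen1[OF kr, of _ R] by auto
  then show "gen_ring (k \<union> R) \<subseteq> ksp k R" unfolding gen_ring_def by blast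
  have "ksp k R \<subseteq> T" if T: "is_subring T" "k \<union> R \<subseteq> T" for T
    by (rule ksp_least) (use T subsp_subring[OF kr T(1)] in auto)
  then show "ksp k R \<subseteq> gen_ring (k \<union> R)" unfolding gen_ring_def by blast
qed

text \<open>An element of the span involves finitely many elements of \<open>k\<close>. These are
  algebraic over \<open>G\<close> and generate with it a finite extension field inside the
  span.\<close>

lemma ksp_field: assumes G: "is_subfield G" "K \<subseteq> G" shows "is_subfield (ksp k G)"
  unfolding is_subfield_def
proof (intro conjI ballI)
  show R: "is_subring (ksp k G)" by (rule ksp_ring[OF subfield_subring[OF G(1)]])
  fix x assume x: "x \<in> ksp k G"
  have "\<exists>X. finite X \<and> X \<subseteq> k \<and> (\<forall>R. is_subring R \<longrightarrow> G \<subseteq> R \<longrightarrow> X \<subseteq> R \<longrightarrow> x \<in> R)"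
    using x
  proof (induction rule: ksp.induct)
    case ksp_0
    show ?case by (intro exI[of _ "{}"]) (auto intro: subringD)
  next
    case (ksp_step a c b)
    then obtain X where X: "finite X" "X \<subseteq> k" "\<And>R. is_subring R \<Longrightarrow> G \<subseteq> R \<Longrightarrow> X \<subseteq> R \<Longrightarrow> a \<in> R" by blast
    have "a + c * b \<in> R" if R: "is_subring R" "G \<subseteq> R" "insert c X \<subseteq> R" for R
    proof -
      have "a \<in> R" "c \<in> R" "b \<in> R" using X(3)[OF R(1,2)] R ksp_step by auto
      then show ?thesis by (intro subringD(3,4)[OF R(1)])
    qed
    then show ?case using X ksp_step by (intro exI[of _ "insert c X"]) auto
  qed
  then obtain X where X: "finite X" "X \<subseteq> k" "\<And>R. is_subring R \<Longrightarrow> G \<subseteq> R \<Longrightarrow> X \<subseteq> R \<Longrightarrow> x \<in> R" by blast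
  have alg: "algebraic_over G c" if "c \<in> X" for c
  proof -
    have "c \<in> k" using that X(2) by blast
    then have "algebraic_over K c" using ac unfolding is_alg_closure_in_def by blast
    then show ?thesis by (rule algebraic_mono[OF _ G(2)])
  qed
  have "\<exists>V n. is_subfield V \<and> G \<subseteq> V \<and> X \<subseteq> V \<and> fdim G V {0} n \<and> (\<forall>R. is_subring R \<longrightarrow> G \<subseteq> R \<longrightarrow> X \<subseteq> R \<longrightarrow> V \<subseteq> R)"
    by (rule finite_ext[OF G(1) X(1) alg])
  then show "inverse x \<in> ksp k G"
  proof (elim exE conjE)
    fix V n assume V: "is_subfield V" "G \<subseteq> V" "X \<subseteq> V" "\<forall>R. is_subring R \<longrightarrow> G \<subseteq> R \<longrightarrow> X \<subseteq> R \<longrightarrow> V \<subseteq> R"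
    have "x \<in> V" by (rule X(3)[OF subfield_subring[OF V(1)] V(2,3)])
    then have "inverse x \<in> V" by (rule subfieldD(6)[OF V(1)])
    moreover have "V \<subseteq> ksp k G" using V(4) R ksp_gen1[OF kr, of _ G] k_ksp[OF subfield_subring[OF G(1)]] X(2) by blast
    ultimately show ?thesis by blast
  qed
qed

lemma gen_field_ksp: "gen_field (k \<union> F) = ksp k F"
proof
  show "gen_field (k \<union> F) \<subseteq> ksp k F"
    by (rule gen_field_least[OF ksp_field[OF F KF]]) (use ksp_gen1[OF kr, of _ F] k_ksp[OF subfield_subring[OF F]] in auto)
  show "ksp k F \<subseteq> gen_field (k \<union> F)"
    by (rule ksp_least) (use gen_field_sub[of "k \<union> F"] subsp_subring[OF kr subfield_subring[OF gen_field_subfield]] in auto)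
qed

lemma ksp_S_root: "x \<in> ksp k (S n A) \<Longrightarrow> \<exists>y\<in>ksp k A. y ^ (p ^ n) = x"
proof (induction rule: ksp.induct)
  case ksp_0
  show ?case using ksp.ksp_0 p_pos by (intro bexI[of _ 0]) (auto simp: power_0_left)
next
  case (ksp_step a c b)
  then obtain y where y: "y \<in> ksp k A" "y ^ (p ^ n) = a" by blast
  obtain u where u: "u \<in> ksp k A" "u ^ (p ^ n) = b" using S_root[OF ksp_step(3)] by blast
  obtain d where d: "d \<in> k" "d ^ (p ^ n) = c" using k_root[OF ksp_step(2)] by blast
  have "(y + d * u) ^ (p ^ n) = a + c * b" using y u d by (simp add: freshman power_mult_distrib)
  moreover have "y + d * u \<in> ksp k A" using ksp_add[OF ksp_scale[OF u(1) kr d(1)] y(1)] .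
  ultimately show ?case by blast
qed

end

section \<open>Separable residue classes\<close>

context fftower
begin

lemma pmax_I: "pmax (I n 0) = I n 1"
proof -
  have "x \<in> I n 1 \<longleftrightarrow> x \<in> pmax (I n 0)" for x
  proof (cases "x = 0 \<or> x \<notin> Fn n")
    case True
    then show ?thesis using I_0 I_sub(1) by (auto simp: pmax_def I_def)
  next
    case False
    then have "inverse x \<in> I n 0 \<longleftrightarrow> - v x \<ge> 0" using fn(6)[of x n] v_inverse[OF FnF[of x n]] by (auto simp: I_def)
    then show ?thesis using False by (auto simp: pmax_def I_def)
  qed
  then show ?thesis by blast
qed

lemma prime_deg_I: "prime_deg K (I n 0) = dd n"
  unfolding prime_deg_def pmax_I by (rule qdim_eq[OF K subsp_I dd])

text \<open>\<open>f\<close> lifts the minimal polynomial of the residue class. If its derivative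
  were 0, it would be a polynomial in \<open>X ^ p\<close> and \<open>p\<close>-th powers of
  independent classes would be dependent, against \<open>maclane\<close>. A nontrivial common factor
  with the nonzero derivative would contradict minimality.\<close>

lemma minimal_poly:
  assumes N: "sep_residue N" and x: "x \<in> I N 0"
  shows "\<exists>f j. poly_over K f \<and> degree f = j \<and> lead_coeff f = 1 \<and> coprime f (pderiv f) \<and> poly f x \<in> I N 1 \<and>
    (\<forall>l<j. x ^ l \<notin> gspan K (I N 1) (\<lambda>i. x ^ i) l)"
proof -
  define w where "w i = x ^ i" for i :: nat
  have wI: "w i \<in> I N 0" for i unfolding w_def by (rule subringD(7)[OF I_ring x])
  have m0: "I N 1 \<subseteq> I N 0" by (rule I_mono) simp
  have "\<exists>j. w j \<in> gspan K (I N 1) w j"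
  proof (rule ccontr)
    assume "\<not> ?thesis"
    then have g: "fdim K (gspan K (I N 1) w (Suc (dd N))) (I N 1) (Suc (dd N))"
      by (intro fdim_gspan_n[OF K subsp_I]) auto
    have "gspan K (I N 1) w (Suc (dd N)) \<subseteq> I N 0" by (rule gspan_sub[OF K subsp_I m0 wI])
    then obtain a l where "fdim K (gspan K (I N 1) w (Suc (dd N))) (I N 1) l" "a + l = dd N"
      using fdim_mid[OF K dd subsp_I subsp_gspan[OF K subsp_I] gspan_base[OF K]] by blast
    then show False using fdim_unique[OF K g _ subsp_I] by fastforce
  qed
  then have Lj: "w (LEAST j. w j \<in> gspan K (I N 1) w j) \<in> gspan K (I N 1) w (LEAST j. w j \<in> gspan K (I N 1) w j)" by (rule LeastI_ex)
  define j where "j = (LEAST j. w j \<in> gspan K (I N 1) w j)"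
  have wj: "w j \<in> gspan K (I N 1) w j" using Lj unfolding j_def .
  have min: "w l \<notin> gspan K (I N 1) w l" if "l < j" for l using that not_less_Least unfolding j_def by blast
  obtain b c where bc: "w j = b + (\<Sum>i<j. c i * w i)" "b \<in> I N 1" "\<forall>i<j. c i \<in> K" using wj by (rule gspanE)
  define f where "f = monom 1 j - (\<Sum>i<j. monom (c i) i)"
  have cf: "coeff f i = (if i = j then 1 else if i < j then - c i else 0)" for i
    by (auto simp: f_def coeff_sum sum.delta cong: if_cong)
  have fK: "poly_over K f" using bc(3) subfieldD[OF K] by (auto simp: poly_over_def cf)
  have df: "degree f = j"
    by (rule antisym) (auto intro!: degree_le le_degree simp: cf)
  have lf: "lead_coeff f = 1" by (simp add: df cf)
  have fx: "poly f x = b" using bc(1) by (simp add: f_def poly_sum poly_monom w_def)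
  have f0: "f \<noteq> 0" using lf by auto
  have j0: "j > 0"
  proof (rule ccontr)
    assume "\<not> j > 0"
    then have "w 0 \<in> I N 1" using wj by (simp add: gspan_0)
    then show False using one_notin by (simp add: w_def)
  qed
  have low: "g = 0" if g: "poly_over K g" "degree g < j" "poly g x \<in> I N 1" for g
  proof -
    have "poly g x = (\<Sum>i\<le>degree g. coeff g i * w i)" by (simp add: poly_altdef w_def)
    also have "\<dots> = (\<Sum>i<j. coeff g i * w i)" using g(2) by (intro sum.mono_neutral_left) (auto simp: coeff_eq_0)
    finally have "(\<Sum>i<j. coeff g i * w i) \<in> I N 1" using g(3) by simp
    then have "coeff g i = 0" if "i < j" for i
      using gspan_indepD[OF K subsp_I, of j w N 1 "coeff g" i] min g(1) that by (auto simp: poly_over_def)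
    then show ?thesis using g(2) by (metis leading_coeff_0_iff)
  qed
  have fp: "pderiv f \<noteq> 0"
  proof
    assume d0: "pderiv f = 0"
    have cz: "coeff f i = 0" if "\<not> p dvd i" for i
    proof -
      have "i > 0" using that by (intro gr0I) auto
      then obtain i' where i': "i = Suc i'" using gr0_conv_Suc by blast
      have "of_nat i * coeff f i = 0" using d0 coeff_pderiv[of f i'] by (simp add: i')
      moreover have "of_nat i \<noteq> (0::'a)" using that by (simp add: of_nat_eq_0_iff_char_dvd CHAR_p)
      ultimately show ?thesis by simp
    qed
    have "p dvd j" using cz[of j] by (auto simp: cf)
    then obtain l where l: "j = p * l" by (auto simp: dvd_def)
    have lj: "l < j" using j0 l p_gt1 by (cases "l = 0") auto
    define B where "B = gspan K (I N 1) w l"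
    have sB: "subsp K B" unfolding B_def by (rule subsp_gspan[OF K subsp_I])
    have "poly f x = (\<Sum>i\<le>j. coeff f i * x ^ i)" by (simp add: poly_altdef df)
    also have "\<dots> = (\<Sum>i\<in>(\<lambda>i. p * i) ` {..l}. coeff f i * x ^ i)"
    proof (rule sum.mono_neutral_right)
      show "(\<lambda>i. p * i) ` {..l} \<subseteq> {..j}" using l by auto
      show "\<forall>i\<in>{..j} - (\<lambda>i. p * i) ` {..l}. coeff f i * x ^ i = 0"
      proof
        fix i assume i: "i \<in> {..j} - (\<lambda>i. p * i) ` {..l}"
        have "\<not> p dvd i"
        proof
          assume "p dvd i"
          then obtain i' where "i = p * i'" by (auto simp: dvd_def)
          moreover from this have "i' \<le> l" using i l p_pos by auto
          ultimately show False using i by auto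
        qed
        then show "coeff f i * x ^ i = 0" by (simp add: cz)
      qed
    qed simp
    also have "\<dots> = (\<Sum>i\<le>l. coeff f (p * i) * x ^ (p * i))"
      using p_pos by (subst sum.reindex) (auto simp: inj_on_def)
    also have "\<dots> = (\<Sum>i<l. coeff f (p * i) * (w i) ^ p) + (w l) ^ p"
      unfolding lessThan_Suc_atMost[symmetric] using l by (simp add: cf w_def power_mult[symmetric] mult.commute)
    finally have "(w l) ^ p = (\<Sum>i<l. - coeff f (p * i) * (w i) ^ p) + b" by (simp add: fx sum_negf)
    also have "\<dots> \<in> msum (S 1 B) (I N 1)"
    proof (rule msumI[OF _ bc(2)])
      have "- coeff f (p * i) * (w i) ^ p \<in> S 1 B" if "i < l" for i
      proof -
        have "w i \<in> B" unfolding B_def by (rule gspan_gen[OF K subsp_I that])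
        then have "w i ^ p \<in> S 1 B" using S_pow[of "w i" B 1] by simp
        moreover have "- coeff f (p * i) \<in> K" using fK subfieldD(5)[OF K] by (auto simp: poly_over_def)
        ultimately show ?thesis using subspD(3)[OF Kr subsp_S] by blast
      qed
      then show "(\<Sum>i<l. - coeff f (p * i) * (w i) ^ p) \<in> S 1 B" by (intro subspD(6)[OF Kr subsp_S]) auto
    qed
    finally have "w l ^ p \<in> msum (S 1 B) (I N 1)" .
    moreover have "I N 1 \<subseteq> B" "B \<subseteq> I N 0" unfolding B_def by (rule gspan_base[OF K], rule gspan_sub[OF K subsp_I m0 wI])
    ultimately show False using maclane[OF N sB _ _ wI] min[OF lj] by (simp add: B_def)
  qed
  have cop: "coprime f (pderiv f)"
  proof -
    obtain e u w' f1 g1 where e: "e \<noteq> 0" "poly_over K e" "poly_over K u" "poly_over K w'" "poly_over K f1" "poly_over K g1"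
      "e = u * f + w' * pderiv f" "f = e * f1" "pderiv f = e * g1" "u * f1 + w' * g1 = 1"
      by (rule bezout_over[OF K fK f0 poly_over_pderiv[OF Kr fK]])
    have f10: "f1 \<noteq> 0" "g1 \<noteq> 0" using e(8,9) f0 fp by auto
    have "degree e \<le> degree (pderiv f)" unfolding e(9) using f10 e(1) by (simp add: degree_mult_eq)
    also have "degree (pderiv f) < j"
    proof -
      have "degree (pderiv f) \<le> j - 1" by (rule degree_le) (auto simp: coeff_pderiv cf)
      then show ?thesis using j0 by simp
    qed
    finally have de: "degree e < j" .
    have ev: "poly g x \<in> I N 0" if "poly_over K g" for g
      by (rule poly_over_eval[OF I_ring poly_over_mono[OF K_I that] x])
    have "poly e x * poly f1 x \<in> I N 1" using fx bc(2) e(8) by (metis poly_mult)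
    then have "poly f1 x \<in> I N 1" using I_prime[OF ev[OF e(2)] ev[OF e(5)]] low[OF e(2) de] e(1) by blast
    then have "\<not> degree f1 < j" using low[OF e(5)] f10(1) by blast
    moreover have "degree e + degree f1 = j" using df e(1) f10 e(8) degree_mult_eq[of e f1] by simp
    ultimately have "degree e = 0" by simp
    then have "is_unit e" using e(1) is_unit_iff_degree by blast
    show ?thesis
    proof (rule coprimeI)
      fix d assume "d dvd f" "d dvd pderiv f"
      then have "d dvd e" unfolding e(7) by (intro dvd_add dvd_mult)
      then show "is_unit d" using \<open>is_unit e\<close> by (rule dvd_trans)
    qed
  qed
  show ?thesis using fK df lf cop fx bc(2) min unfolding w_def by (intro exI[of _ f] exI[of _ j]) simp
qed

lemma sep_lift:
  assumes N: "sep_residue N" and x: "x \<in> msum (I N 0) (I n 1)" and n: "n \<le> N"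
  shows "x \<in> sep_part K (I n 0)"
proof -
  obtain a b where ab: "x = a + b" "a \<in> I N 0" "b \<in> I n 1" using x by (rule msumE)
  have aI: "a \<in> I n 0" "b \<in> I n 0" using ab I_level[OF n, of 0] I_mono[of 0 1 n] by auto
  have xI: "x \<in> I n 0" unfolding ab(1) by (intro I_add aI)
  obtain g where g: "poly_over K g" "coprime g (pderiv g)" "poly g a \<in> I N 1" using minimal_poly[OF N ab(2)] by blast
  have "poly g x - poly g a \<in> I n 1"
    by (rule poly_cong[OF I_ring subsp_I_I poly_over_mono[OF K_I g(1)] xI aI(1)]) (use ab in simp_all)
  moreover have "poly g a \<in> I n 1" using g(3) I_level[OF n, of 1] by blast
  ultimately have "(poly g x - poly g a) + poly g a \<in> I n 1" by (rule I_add)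
  then have "poly g x \<in> I n 1" by simp
  then show ?thesis unfolding sep_part_def pmax_I using xI g by blast
qed

text \<open>A separable class lies in the part of the residue field spanned by \<open>p\<close>-th
  powers, so \<open>separable_in\<close> pushes a representative down one level at a time.\<close>

lemma sep_descend:
  assumes x: "x \<in> sep_part K (I 0 0)" shows "x \<in> msum (I n 0) (I 0 1)"
proof -
  obtain g where g: "poly_over K g" "coprime g (pderiv g)" "poly g x \<in> I 0 1" and xI: "x \<in> I 0 0"
    using x unfolding sep_part_def pmax_I by blast
  have "\<exists>y. y \<in> I n 0 \<and> x - y \<in> I 0 1 \<and> poly g y \<in> I n 1"
  proof (induction n)
    case 0
    show ?case using xI g(3) I_0 by (intro exI[of _ x]) auto
  next
    case (Suc n)
    then obtain y where y: "y \<in> I n 0" "x - y \<in> I 0 1" "poly g y \<in> I n 1" by blast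
    have Sring: "is_subring (S 1 (I n 0))" by (rule S_ring[OF I_ring])
    have SI: "S 1 (I n 0) \<subseteq> I n 0" by (rule S_sub[OF I_ring K_I])
    have "\<exists>s\<in>S 1 (I n 0). y - s \<in> I n 1"
    proof (rule separable_in[OF I_ring[of n] subsp_I_I I_mono one_notin I_prime Sring SI _ y(1) _ K _ g(1,2) y(3)])
      show "y ^ p \<in> S 1 (I n 0)" using S_pow[OF y(1), of 1] by simp
      show "K \<subseteq> S 1 (I n 0)" by (rule K_sub_S[OF I_ring])
      show "\<exists>d\<in>S 1 (I n 0). c * d - 1 \<in> I n 1" if c: "c \<in> S 1 (I n 0)" "c \<notin> I n 1" for c
      proof -
        have "inverse c \<in> I n 0" using c SI I_inverse by blast
        then have "inverse c \<in> S 1 (I n 0)" by (rule S_inverse[OF I_ring K_I c(1)])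
        moreover have "c \<noteq> 0" using c(2) I_0 by blast
        ultimately show ?thesis using I_0 by (intro bexI[of _ "inverse c"]) auto
      qed
    qed auto
    then obtain s where s: "s \<in> S 1 (I n 0)" "y - s \<in> I n 1" by blast
    have sI: "s \<in> I (Suc n) 0" using s(1) S1_I(1) by blast
    have "(x - y) + (y - s) \<in> I 0 1" using y(2) s(2) I_level[of 0 n 1] by (intro I_add) auto
    then have "x - s \<in> I 0 1" by simp
    moreover have "poly g s \<in> I (Suc n) 1"
    proof -
      have "poly g s \<in> I (Suc n) 0" by (rule poly_over_eval[OF I_ring poly_over_mono[OF K_I g(1)] sI])
      moreover have "poly g y - poly g s \<in> I n 1"
        by (rule poly_cong[OF I_ring subsp_I_I poly_over_mono[OF K_I g(1)] y(1) _ s(2)]) (use s(1) SI in auto)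
      then have "poly g y - (poly g y - poly g s) \<in> I n 1" by (rule subspD(5)[OF Kr subsp_I y(3)])
      then have "poly g s \<in> I n 1" by simp
      ultimately show ?thesis using I_Suc_inter by blast
    qed
    ultimately show ?case using sI by blast
  qed
  then obtain y where "y \<in> I n 0" "x - y \<in> I 0 1" by blast
  then have "y + (x - y) \<in> msum (I n 0) (I 0 1)" by (rule msumI)
  then show ?thesis by simp
qed

lemma I_inter_1: "n \<le> N \<Longrightarrow> I N 0 \<inter> I n 1 = I N 1"
  using I_level[of n N 1] I_mono[of 0 1 N] by (auto simp: I_def)

text \<open>By \<open>sep_lift\<close> and \<open>sep_descend\<close> the residue field of
  \<open>\<pp>\<^sub>N\<close> is the separable closure of \<open>K\<close> in that of
  \<open>\<pp>\<close>.\<close>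

lemma sep_deg_eq: assumes N: "sep_residue N" shows "sep_deg K (I 0 0) = dd N"
proof -
  have "sep_part K (I 0 0) = msum (I N 0) (I 0 1)" using sep_lift[OF N, of _ 0] sep_descend by blast
  then show ?thesis unfolding sep_deg_def pmax_I
    using qdim_eq[OF K subsp_I fdim_iso2[OF K dd subsp_I subsp_I I_inter_1[of 0 N]]] by simp
qed

text \<open>For \<open>n \<le> N\<close> equal degrees force the residue fields of
  \<open>\<pp>\<^sub>n\<close> and \<open>\<pp>\<^sub>N\<close> to agree, so every class has a
  representative on level \<open>N\<close>.\<close>

lemma separable_prime_I: assumes N: "sep_residue N" and n: "dd n = dd N" shows "separable_prime K (I n 0)"
proof -
  have "I n 0 \<subseteq> sep_part K (I n 0)"
  proof (cases "n \<ge> N")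
    case True
    have "I n 0 \<subseteq> msum (I n 0) (I n 1)" by (rule msum_sub1[OF I_0])
    then show ?thesis using sep_lift[OF sep_residue_mono[OF N True], of _ n] by auto
  next
    case False
    then have nN: "n \<le> N" by simp
    have g: "fdim K (msum (I N 0) (I n 1)) (I n 1) (dd N)" by (rule fdim_iso2[OF K dd subsp_I subsp_I I_inter_1[OF nN]])
    have sub: "msum (I N 0) (I n 1) \<subseteq> I n 0" by (intro msum_least[OF subsp_I] I_level[OF nN] I_mono) simp
    obtain m l where ml: "fdim K (I n 0) (msum (I N 0) (I n 1)) m" "fdim K (msum (I N 0) (I n 1)) (I n 1) l" "m + l = dd n"
      using fdim_mid[OF K dd subsp_I subsp_msum[OF subsp_I subsp_I] fdim_sub[OF K g] sub] by blast
    then have "m = 0" using fdim_unique[OF K g ml(2) subsp_I] n by simp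
    then have "I n 0 = msum (I N 0) (I n 1)" using ml(1) fdim_0_iff[OF K subsp_msum[OF subsp_I subsp_I]] by blast
    then show ?thesis using sep_lift[OF N _ nN] by blast
  qed
  moreover have "sep_part K (I n 0) \<subseteq> I n 0" unfolding sep_part_def by blast
  ultimately show ?thesis unfolding separable_prime_def by blast
qed

section \<open>Normality of the base change at a separable level\<close>

lemma kI_mult: "x \<in> ksp k (I n a) \<Longrightarrow> y \<in> ksp k (I n b) \<Longrightarrow> x * y \<in> ksp k (I n (a + b))"
  by (rule ksp_mult[OF kr I_mult])

lemma reduced_pow: assumes N: "sep_residue N" and x: "x \<in> ksp k (I N 0)" "x ^ d \<in> ksp k (I N 1)" shows "x \<in> ksp k (I N 1)"
proof -
  note B = subringD[OF ksp_ring[OF I_ring[of N]]]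
  have "d < p ^ d" using p_gt1 by (intro power_gt_expt) simp
  then have "x ^ (p ^ d) = x ^ (p ^ d - d) * x ^ d" by (simp add: power_add[symmetric])
  also have "\<dots> \<in> ksp k (I N 1)" using kI_mult[OF B(7)[OF x(1)] x(2)] by simp
  finally have "x ^ (p ^ d) \<in> ksp k (I N 1)" .
  then show ?thesis
  proof (induction d)
    case (Suc d)
    have "(x ^ (p ^ d)) ^ p \<in> ksp k (I N 1)" using Suc(2) by (simp add: power_mult[symmetric] mult.commute)
    then show ?case using Suc(1) reduced1[OF N B(7)[OF x(1)]] by blast
  qed simp
qed

lemma ksp_times: "ksp k ((*) a ` A) = (*) a ` ksp k A"
proof
  show "ksp k ((*) a ` A) \<subseteq> (*) a ` ksp k A"
    by (rule ksp_least[OF subsp_times[OF subsp_ksp[OF kr]]]) (use ksp_gen1[OF kr, of _ A] in auto)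
  show "(*) a ` ksp k A \<subseteq> ksp k ((*) a ` A)"
  proof
    fix y assume "y \<in> (*) a ` ksp k A"
    then obtain x where x: "x \<in> ksp k A" "y = a * x" by blast
    from x(1) have "a * x \<in> ksp k ((*) a ` A)"
    proof (induction rule: ksp.induct)
      case (ksp_step b c d)
      have "a * b + c * (a * d) \<in> ksp k ((*) a ` A)" using ksp_step by (intro ksp.ksp_step) auto
      then show ?case by (simp add: algebra_simps)
    qed (simp add: ksp.ksp_0)
    then show "y \<in> ksp k ((*) a ` A)" using x(2) by simp
  qed
qed

lemma kI_unif: assumes a: "a \<in> Fn N" "a \<noteq> 0" "v a = E N"
  shows "ksp k (I N 1) = (*) a ` ksp k (I N 0)" and "x \<in> ksp k (Fn N) \<Longrightarrow> \<exists>m. a ^ m * x \<in> ksp k (I N 0)"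
proof -
  have "I N 1 = (*) a ` I N 0" using I_times[OF a(1,2), of 0] a(3) I_round[of 1 N 0] I_round[of "E N" N 0] E_pos[of N] by simp
  then show "ksp k (I N 1) = (*) a ` ksp k (I N 0)" by (simp add: ksp_times)
  note B = subringD[OF ksp_ring[OF I_ring[of N]]]
  have aI: "a \<in> I N 0" using a E_pos[of N] by (simp add: I_def)
  have aB: "a ^ i \<in> ksp k (I N 0)" for i using B(7) ksp_gen1[OF kr aI] by blast
  show "\<exists>m. a ^ m * x \<in> ksp k (I N 0)" if "x \<in> ksp k (Fn N)"
    using that
  proof (induction rule: ksp.induct)
    case ksp_0
    show ?case using ksp.ksp_0 by simp
  next
    case (ksp_step y c b)
    then obtain m where m: "a ^ m * y \<in> ksp k (I N 0)" by blast
    define i where "i = nat (- v b)"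
    have "a ^ i * b \<in> I N 0"
    proof (cases "b = 0")
      case False
      have "v (a ^ i * b) = int i * E N + v b"
        using v_mult[OF FnF[OF fn(9)[OF a(1), of i]] FnF[OF ksp_step(3)] _ False] v_power[OF FnF[OF a(1)] a(2), of i] a(2,3) by simp
      moreover have "int i * 1 \<le> int i * E N" using E_pos[of N] by (intro mult_left_mono) auto
      moreover have "int i \<ge> - v b" unfolding i_def by simp
      ultimately have "v (a ^ i * b) \<ge> 0" by linarith
      then show ?thesis using fn(4)[OF fn(9)[OF a(1)] ksp_step(3)] by (simp add: I_def)
    qed (simp add: I_0)
    then have ib: "c * (a ^ i * b) \<in> ksp k (I N 0)" using ksp_step(2) by (intro ksp_gen)
    have "a ^ (m + i) * (y + c * b) = a ^ i * (a ^ m * y) + a ^ m * (c * (a ^ i * b))" by (simp add: power_add algebra_simps)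
    also have "\<dots> \<in> ksp k (I N 0)" by (intro B(3) B(4) aB m ib)
    finally show ?case by blast
  qed
qed

text \<open>The ideal generated by the uniformizer \<open>a\<close> is radical
  (\<open>reduced_pow\<close>). Multiplying the integral equation of \<open>x\<close> by a power of
  \<open>a ^ Suc m\<close> shows that a power of \<open>a ^ Suc m * x\<close> is divisible by
  \<open>a\<close>. Hence so is the element itself, and the exponent drops.\<close>

lemma kI_normal:
  assumes N: "sep_residue N" and x: "x \<in> ksp k (Fn N)" and g: "lead_coeff g = 1" "poly_over (ksp k (I N 0)) g" "poly g x = 0"
  shows "x \<in> ksp k (I N 0)"
proof -
  note B = subringD[OF ksp_ring[OF I_ring[of N]]]
  obtain a where a: "a \<in> Fn N" "a \<noteq> 0" "v a = E N" by (rule E_unif)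
  note u = kI_unif[OF a]
  have a1: "a \<in> ksp k (I N 1)" using ksp_gen1[OF kr, of a "I N 1"] a E_pos[of N] by (auto simp: I_def)
  have a0: "a \<in> ksp k (I N 0)" using ksp_gen1[OF kr, of a "I N 0"] a E_pos[of N] by (auto simp: I_def)
  obtain m where "a ^ m * x \<in> ksp k (I N 0)" using u(2)[OF x] by blast
  then show ?thesis
  proof (induction m)
    case (Suc m)
    define y where "y = a ^ Suc m * x"
    have yB: "y \<in> ksp k (I N 0)" using Suc(2) by (simp add: y_def)
    define d where "d = degree g"
    have "0 = (a ^ Suc m) ^ d * poly g x" using g(3) by simp
    also have "\<dots> = (\<Sum>i\<le>d. coeff g i * (a ^ Suc m) ^ (d - i) * y ^ i)"
      unfolding poly_altdef d_def[symmetric] sum_distrib_left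
    proof (rule sum.cong[OF refl])
      fix i assume "i \<in> {..d}"
      then have "(a ^ Suc m) ^ d = (a ^ Suc m) ^ (d - i) * (a ^ Suc m) ^ i" by (simp only: power_add[symmetric] le_add_diff_inverse2 atMost_iff)
      then show "(a ^ Suc m) ^ d * (coeff g i * x ^ i) = coeff g i * (a ^ Suc m) ^ (d - i) * y ^ i"
        by (simp only: y_def power_mult_distrib ac_simps)
    qed
    also have "\<dots> = (\<Sum>i<d. coeff g i * (a ^ Suc m) ^ (d - i) * y ^ i) + y ^ d"
      unfolding lessThan_Suc_atMost[symmetric] using g(1) by (simp add: d_def)
    finally have "y ^ d = (\<Sum>i<d. - coeff g i * (a ^ Suc m) ^ (d - i) * y ^ i)"
      by (simp add: sum_negf eq_neg_iff_add_eq_0 add.commute)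
    also have "\<dots> \<in> ksp k (I N 1)"
    proof (rule subspD(6)[OF kr subsp_ksp[OF kr]])
      fix i assume i: "i \<in> {..<d}"
      then obtain e where e: "d - i = Suc e" by (metis Suc_diff_Suc lessThan_iff)
      have "- coeff g i * (a ^ m * (a ^ Suc m) ^ e * y ^ i) \<in> ksp k (I N 0)"
        using g(2) by (intro B(4) B(5) B(7) a0 yB) (auto simp: poly_over_def)
      from kI_mult[OF this a1] have "(- coeff g i * (a ^ m * (a ^ Suc m) ^ e * y ^ i)) * a \<in> ksp k (I N 1)" by simp
      then show "- coeff g i * (a ^ Suc m) ^ (d - i) * y ^ i \<in> ksp k (I N 1)" by (simp add: e mult_ac)
    qed
    finally have "y \<in> ksp k (I N 1)" by (rule reduced_pow[OF N yB])
    then obtain b where b: "y = a * b" "b \<in> ksp k (I N 0)" unfolding u(1) by blast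
    then have "a ^ m * x = b" using a(2) by (simp add: y_def mult.assoc)
    then show ?case using Suc(1) b(2) by simp
  qed simp
qed

text \<open>The roots are taken of a whole flag: as \<open>k\<close> is perfect, a step by a vector
  over \<open>K\<close> becomes a step by its \<open>q\<close>-th root over \<open>k\<close>.
  \<open>kI_normal\<close> identifies the top of the new flag as the integral closure.\<close>

lemma sing_deg_eq:
  assumes N: "sep_residue N" and d: "fdim K (I N 0) (S N (I 0 0)) \<delta>"
  shows "sing_deg k F (I 0 0) = \<delta>"
proof -
  define L where "L = ksp k F"
  define Psi where "Psi B = {y \<in> L. y ^ (p ^ N) \<in> ksp k B}" for B
  have Lf: "is_subfield L" unfolding L_def by (rule ksp_field[OF F KF])
  have kL: "k \<subseteq> L" unfolding L_def by (rule k_ksp[OF subfield_subring[OF F]])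
  note l = subfieldD[OF Lf]
  have step: "Psi (adj K B (y ^ (p ^ N))) = adj k (Psi B) y" if B: "subsp K B" and y: "y \<in> L" for B y
  proof
    show "Psi (adj K B (y ^ (p ^ N))) \<subseteq> adj k (Psi B) y"
    proof
      fix u assume "u \<in> Psi (adj K B (y ^ (p ^ N)))"
      then have u: "u \<in> L" "u ^ (p ^ N) \<in> adj k (ksp k B) (y ^ (p ^ N))" unfolding Psi_def ksp_adj[OF B] by auto
      then obtain b c where bc: "u ^ (p ^ N) = b + c * y ^ (p ^ N)" "b \<in> ksp k B" "c \<in> k" by (auto simp: adj_def)
      obtain e where e: "e \<in> k" "e ^ (p ^ N) = c" using k_root[OF bc(3)] by blast
      have "(u - e * y) ^ (p ^ N) = b" using bc(1) e(2) by (simp add: frob_diff power_mult_distrib)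
      moreover have "u - e * y \<in> L" using u(1) y e(1) kL l(4,7) by blast
      ultimately have "u - e * y \<in> Psi B" using bc(2) by (simp add: Psi_def)
      from adjI[OF this e(1), of y] show "u \<in> adj k (Psi B) y" by simp
    qed
    show "adj k (Psi B) y \<subseteq> Psi (adj K B (y ^ (p ^ N)))"
    proof
      fix u assume "u \<in> adj k (Psi B) y"
      then obtain b c where bc: "u = b + c * y" "b \<in> Psi B" "c \<in> k" by (auto simp: adj_def)
      have "u ^ (p ^ N) = b ^ (p ^ N) + c ^ (p ^ N) * y ^ (p ^ N)" unfolding bc(1) by (simp add: freshman power_mult_distrib)
      also have "\<dots> \<in> adj k (ksp k B) (y ^ (p ^ N))" using bc(2,3) subfieldD(9)[OF kf] by (intro adjI) (auto simp: Psi_def)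
      finally have "u ^ (p ^ N) \<in> ksp k (adj K B (y ^ (p ^ N)))" unfolding ksp_adj[OF B] .
      moreover have "u \<in> L" using bc y kL l(3,4) by (auto simp: Psi_def)
      ultimately show "u \<in> Psi (adj K B (y ^ (p ^ N)))" by (simp add: Psi_def)
    qed
  qed
  have "fdim K A B n \<Longrightarrow> subsp K B \<Longrightarrow> A \<subseteq> Fn N \<Longrightarrow> fdim k (Psi A) (Psi B) n" for A B n
  proof (induction rule: fdim.induct)
    case (fdim_Suc x B n)
    have BA: "B \<subseteq> A" "x \<in> A"
      using fdim_sub[OF K fdim_Suc(2)] adj_sub[OF K, of B x] adj_self[OF K fdim_Suc(4), of x] by blast+
    then have "x \<in> S N F" using fdim_Suc(5) by (auto simp: Fn_def)
    then obtain y where y: "y \<in> L" "y ^ (p ^ N) = x" using S_root unfolding L_def by blast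
    have "x \<notin> ksp k B" using descent[OF fdim_Suc(4) _ FnF, of x N] BA fdim_Suc(1,5) Fn_sub by blast
    then have "y \<notin> Psi B" using y(2) by (simp add: Psi_def)
    moreover have "fdim k (Psi A) (adj k (Psi B) y) n"
      using fdim_Suc(3)[OF subsp_adj[OF K fdim_Suc(4)] fdim_Suc(5)] step[OF fdim_Suc(4) y(1)] y(2) by simp
    ultimately show ?case by (rule fdim.fdim_Suc)
  qed (rule fdim_0)
  from this[OF d subsp_S I_sub(1)] have fd: "fdim k (Psi (I N 0)) (Psi (S N (I 0 0))) \<delta>" .
  have P0: "Psi (S N (I 0 0)) = ksp k (I 0 0)"
  proof
    show "Psi (S N (I 0 0)) \<subseteq> ksp k (I 0 0)"
    proof
      fix x assume "x \<in> Psi (S N (I 0 0))"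
      then obtain y where "y \<in> ksp k (I 0 0)" "y ^ (p ^ N) = x ^ (p ^ N)" unfolding Psi_def using ksp_S_root by blast
      then show "x \<in> ksp k (I 0 0)" by (simp add: frob_inj)
    qed
    show "ksp k (I 0 0) \<subseteq> Psi (S N (I 0 0))"
      unfolding Psi_def L_def using ksp_pow[of _ "I 0 0" N] ksp_mono[OF order_refl I_sub(2)[of 0 0]] by auto
  qed
  have SNI: "S N (I 0 0) \<subseteq> I N 0" using S_I[of 0 0 N] by simp
  have P1: "Psi (I N 0) = {x \<in> gen_field (k \<union> F). integral_over (gen_ring (k \<union> I 0 0)) x}"
    unfolding gen_field_ksp gen_ring_ksp[OF I_ring] L_def[symmetric]
  proof
    show "Psi (I N 0) \<subseteq> {x \<in> L. integral_over (ksp k (I 0 0)) x}"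
    proof
      fix y assume y: "y \<in> Psi (I N 0)"
      have R: "is_subring (ksp k (I 0 0))" by (rule ksp_ring[OF I_ring])
      have yR: "y ^ (p ^ N) \<in> ksp k (I 0 0)" using y ksp_mono[OF order_refl I_level[of 0 N 0]] by (auto simp: Psi_def)
      define g where "g = monom 1 (p ^ N) - [:y ^ (p ^ N):]"
      have q0: "0 < p ^ N" using p_pos by simp
      have dg: "degree g = p ^ N" unfolding g_def using q0
        by (subst diff_conv_add_uminus, subst degree_add_eq_left) (auto simp: degree_monom_eq)
      have "lead_coeff g = 1" unfolding dg using q0 by (auto simp: g_def coeff_pCons split: nat.splits)
      moreover have "poly_over (ksp k (I 0 0)) g" unfolding g_def
        using yR subringD(2)[OF R] by (intro poly_over_diff poly_over_monom R) (auto simp: poly_over_pCons poly_over_0 R)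
      moreover have "poly g y = 0" by (simp add: g_def poly_monom)
      ultimately show "y \<in> {x \<in> L. integral_over (ksp k (I 0 0)) x}" using y unfolding integral_over_def Psi_def by blast
    qed
    show "{x \<in> L. integral_over (ksp k (I 0 0)) x} \<subseteq> Psi (I N 0)"
    proof
      fix y assume "y \<in> {x \<in> L. integral_over (ksp k (I 0 0)) x}"
      then obtain g where y: "y \<in> L" and g: "lead_coeff g = 1" "poly_over (ksp k (I 0 0)) g" "poly g y = 0"
        unfolding integral_over_def by blast
      \<comment> \<open>Raising the coefficients to \<open>q\<close>-th powers gives an integral
        equation for \<open>y ^ (p ^ N)\<close> over the normal ring of level
        \<open>N\<close>.\<close>
      define h where "h = (\<Sum>i\<le>degree g. monom (coeff g i ^ (p ^ N)) i)"
      have ch: "coeff h i = (if i \<le> degree g then coeff g i ^ (p ^ N) else 0)" for i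
        by (auto simp: h_def coeff_sum sum.delta cong: if_cong)
      have dh: "degree h = degree g"
      proof (rule antisym)
        show "degree h \<le> degree g" by (rule degree_le) (simp add: ch)
        show "degree g \<le> degree h" by (rule le_degree) (simp add: ch g(1))
      qed
      have 1: "lead_coeff h = 1" by (simp add: dh ch g(1))
      have "coeff g i ^ (p ^ N) \<in> ksp k (I N 0)" for i
        using ksp_pow[of "coeff g i" "I 0 0" N] g(2) ksp_mono[OF order_refl SNI] by (auto simp: poly_over_def)
      then have 2: "poly_over (ksp k (I N 0)) h" using ksp_0 by (auto simp: poly_over_def ch)
      have "poly h (y ^ (p ^ N)) = (poly g y) ^ (p ^ N)"
        unfolding poly_altdef[of g] frob_sum
        by (simp add: h_def poly_sum poly_monom power_mult_distrib power_mult[symmetric] mult.commute)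
      then have 3: "poly h (y ^ (p ^ N)) = 0" using g(3) p_pos by (simp add: power_0_left)
      have "y ^ (p ^ N) \<in> ksp k (Fn N)" using ksp_pow[of y F N] y unfolding L_def Fn_def by blast
      from kI_normal[OF N this 1 2 3] show "y \<in> Psi (I N 0)" using y by (simp add: Psi_def)
    qed
  qed
  have "qdim k (Psi (I N 0)) (Psi (S N (I 0 0))) = \<delta>"
    by (rule qdim_eq[OF kf _ fd]) (unfold P0, rule subsp_ksp[OF kr])
  then show ?thesis unfolding sing_deg_def P1 P0 gen_ring_ksp[OF I_ring] .
qed

end

section \<open>Primes over a non-decomposed prime\<close>

text \<open>The elements annihilating a class \<open>\<epsilon>\<close> modulo \<open>a B\<close> form a prime \<open>Q\<close>; since \<open>\<epsilon> \<notin> Q\<close>, multiplying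
  by \<open>\<epsilon>\<close> trades an element of \<open>Q\<close> for a factor \<open>a\<close>, so that \<open>a\<close> is a uniformizer of the localization at \<open>Q\<close>.\<close>
lemma localization_unit_part:
  assumes B: "is_subring B" and a: "a \<noteq> 0"
    and Q: "Q = {u\<in>B. \<exists>b\<in>B. u * \<epsilon> = a * b}" "\<epsilon> \<in> B" "\<epsilon> \<notin> Q" "1 \<notin> Q"
    and prm: "\<And>u w. u \<in> B \<Longrightarrow> w \<in> B \<Longrightarrow> u * w \<in> Q \<Longrightarrow> u \<in> Q \<or> w \<in> Q"
  shows "\<eta> \<in> B \<Longrightarrow> \<zeta> \<in> B \<Longrightarrow> e \<in> B - Q \<Longrightarrow> \<eta> * \<zeta> = a ^ J * e \<Longrightarrow>
    \<exists>i u b. u \<in> B - Q \<and> b \<in> B - Q \<and> \<eta> * b = a ^ i * u"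
proof (induction J arbitrary: \<eta> e)
  case 0
  have "\<eta> \<notin> Q"
  proof
    assume "\<eta> \<in> Q"
    then obtain b where b: "b \<in> B" "\<eta> * \<epsilon> = a * b" unfolding Q(1) by blast
    have "e * \<epsilon> = (\<eta> * \<epsilon>) * \<zeta>" using 0(4) by (simp add: mult_ac)
    then have "e * \<epsilon> = a * (b * \<zeta>)" unfolding b(2) by (simp only: mult.assoc)
    moreover have "b * \<zeta> \<in> B" by (rule subringD(4)[OF B b(1) 0(2)])
    ultimately have "e \<in> Q" unfolding Q(1) using 0(3) by blast
    then show False using 0(3) by blast
  qed
  then show ?case using 0(1) Q(4) subringD(2)[OF B] by (intro exI[of _ 0] exI[of _ \<eta>] exI[of _ 1]) auto
next
  case (Suc J)
  show ?case
  proof (cases "\<eta> \<in> Q")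
    case False
    then show ?thesis using Suc.prems(1) Q(4) subringD(2)[OF B] by (intro exI[of _ 0] exI[of _ \<eta>] exI[of _ 1]) auto
  next
    case True
    then obtain b where b: "b \<in> B" "\<eta> * \<epsilon> = a * b" unfolding Q(1) by blast
    have e': "e * \<epsilon> \<in> B - Q" using Suc.prems(3) Q(2,3) prm subringD(4)[OF B] by blast
    have "a * (b * \<zeta>) = (\<eta> * \<epsilon>) * \<zeta>" unfolding b(2) by (simp only: mult.assoc)
    also have "\<dots> = (\<eta> * \<zeta>) * \<epsilon>" by (simp only: mult_ac)
    also have "\<dots> = a * (a ^ J * (e * \<epsilon>))" unfolding Suc.prems(4) by (simp only: mult.assoc power_Suc)
    finally have "b * \<zeta> = a ^ J * (e * \<epsilon>)" using a by simp
    from Suc.IH[OF b(1) Suc.prems(2) e' this] obtain i u c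
      where c: "u \<in> B - Q" "c \<in> B - Q" "b * c = a ^ i * u" by blast
    have "\<eta> * (\<epsilon> * c) = a * (b * c)" by (metis b(2) mult.assoc)
    also have "\<dots> = a ^ Suc i * u" using c(3) by (simp add: mult_ac)
    finally have "\<eta> * (\<epsilon> * c) = a ^ Suc i * u" .
    moreover have "\<epsilon> * c \<in> B - Q" using c(2) Q(2,3) prm subringD(4)[OF B] by blast
    ultimately show ?thesis using c(1) by blast
  qed
qed

text \<open>\<open>pmax\<close> is defined by non-units, so its closure under differences must be
  derived: of two nonzero elements one divides the other in \<open>V\<close>, and a unit difference
  would make the divisor a unit.\<close>

lemma pmax_diff_not_unit:
  assumes L: "is_subfield L" and O: "is_prime_of k L V" and x: "x \<in> pmax V" "y \<in> pmax V" and d: "inverse (x - y) \<in> V"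
  shows "x = y"
proof (rule ccontr)
  assume ne: "x \<noteq> y"
  have V: "is_subring V" "V \<subseteq> L" using O unfolding is_prime_of_def by auto
  note r = subringD[OF V(1)]
  have unit: "z = 0 \<or> inverse z \<notin> V" "z \<in> V" if "z \<in> pmax V" for z using that by (auto simp: pmax_def)
  have key: "False" if z: "z \<in> pmax V" "w \<in> pmax V" "w \<noteq> 0" "z / w \<in> V" "inverse (z - w) \<in> V" "z \<noteq> w" for z w
  proof -
    have "z - w = (z / w - 1) * w" using z(3) by (simp add: field_simps)
    then have "inverse w = inverse (z - w) * (z / w - 1)" using z(3,6) by (simp add: field_simps)
    also have "\<dots> \<in> V" using z(4,5) by (intro r(4) r(6) r(2))
    finally show False using unit(1)[OF z(2)] z(3) by blast
  qed
  have d': "inverse (y - x) \<in> V" using r(5)[OF d] by (simp add: inverse_minus_eq[symmetric] del: inverse_minus_eq)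
  show False
  proof (cases "x = 0 \<or> y = 0")
    case True
    then show False using ne key[OF x _ _ d ne] key[OF x(2,1) _ _ d'] r(1) by force
  next
    case False
    then have "x / y \<in> L" "x / y \<noteq> 0" using subfieldD(8)[OF L, of x y] subsetD[OF V(2) unit(2)[OF x(1)]] subsetD[OF V(2) unit(2)[OF x(2)]] by auto
    then obtain t u n where t: "t \<in> V" "u \<in> V" "inverse u \<in> V" "x / y = u * t powi n"
      using O unfolding is_prime_of_def by blast
    have "x / y \<in> V \<or> y / x \<in> V"
    proof (cases "n \<ge> 0")
      case True
      then have "t powi n \<in> V" using r(7)[OF t(1)] by (simp add: power_int_def)
      then show ?thesis unfolding t(4) using r(4) t(2) by blast
    next
      case nn: False
      have "y / x = inverse (x / y)" by simp
      also have "\<dots> = inverse u * t ^ nat (- n)" unfolding t(4) using nn by (simp add: power_int_def power_inverse)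
      also have "\<dots> \<in> V" by (intro r(4) r(7) t)
      finally show ?thesis ..
    qed
    then show False using key[OF x _ _ d ne] key[OF x(2,1) _ _ d'] False ne by blast
  qed
qed

section \<open>Two primes from two roots\<close>

context fftower
begin

text \<open>Modulo \<open>M\<close> the ring \<open>B\<close> is a finite-dimensional reduced
  \<open>k\<close>-algebra. A multiple \<epsilon> of \<eta> generating a minimal ideal there has a
  prime annihilator \<open>Q\<close>; the localization of \<open>B\<close> at \<open>Q\<close>,
  pulled back by \<open>q\<close>-th powers, is a valuation ring over \<open>\<pp>\<close>. Elements
  whose \<open>q\<close>-th power lies in \<open>B\<close> and annihilates \<eta> modulo
  \<open>M\<close> are non-units in it.\<close>

lemma prime_above:
  assumes N: "sep_residue N" and \<eta>: "\<eta> \<in> ksp k (I N 0)" "\<eta> \<notin> ksp k (I N 1)"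
  shows "\<exists>V. is_prime_of k (gen_field (k \<union> F)) V \<and> V \<inter> F = I 0 0 \<and>
    (\<forall>y\<in>ksp k F. y ^ (p ^ N) \<in> ksp k (I N 0) \<and> y ^ (p ^ N) * \<eta> \<in> ksp k (I N 1) \<longrightarrow> y \<in> pmax V)"
proof -
  define B where "B = ksp k (I N 0)"
  define M where "M = ksp k (I N 1)"
  define L where "L = ksp k F"
  define q where "q = p ^ N"
  have q0: "q > 0" unfolding q_def using p_pos by simp
  have Br: "is_subring B" unfolding B_def by (rule ksp_ring[OF I_ring])
  note b = subringD[OF Br]
  have Lf: "is_subfield L" unfolding L_def by (rule ksp_field[OF F KF])
  note l = subfieldD[OF Lf]
  have LNf: "is_subfield (ksp k (Fn N))" by (rule ksp_field[OF Fn_field K_Fn])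
  have kL: "k \<subseteq> L" unfolding L_def by (rule k_ksp[OF subfield_subring[OF F]])
  have kB: "k \<subseteq> B" unfolding B_def by (rule k_ksp[OF I_ring])
  have FL: "F \<subseteq> L" unfolding L_def using ksp_gen1[OF kr, of _ F] by blast
  have Bk: "subsp k B" and Mk: "subsp k M" unfolding B_def M_def by (rule subsp_ksp[OF kr])+
  have MB: "M \<subseteq> B" unfolding M_def B_def by (intro ksp_mono I_mono) auto
  have BM: "u * w \<in> M" if "u \<in> B" "w \<in> M" for u w using kI_mult[of u N 0 w 1] that by (simp add: B_def M_def)
  obtain a where a: "a \<in> Fn N" "a \<noteq> 0" "v a = E N" by (rule E_unif)
  have Ma: "M = (*) a ` B" unfolding M_def B_def by (rule kI_unif(1)[OF a])
  have aI: "a \<in> I N 0" "a \<in> I N 1" using a E_pos[of N] by (auto simp: I_def)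
  have aB: "a \<in> B" unfolding B_def by (rule ksp_gen1[OF kr aI(1)])
  have aM: "a \<in> M" unfolding M_def by (rule ksp_gen1[OF kr aI(2)])
  have frq: "(x + y) ^ q = x ^ q + y ^ q" for x y :: 'a unfolding q_def by (rule freshman)
  have Lq: "x ^ q \<in> ksp k (Fn N)" if "x \<in> L" for x
    using ksp_pow[of x F N] that by (simp add: L_def q_def Fn_def)
  \<comment> \<open>Candidates for a generator of a minimal ideal of \<open>B / M\<close> below that
    of \<eta>; minimality is read off from the dimension.\<close>
  define P where "P \<epsilon> n \<longleftrightarrow> \<epsilon> \<in> B \<and> \<epsilon> \<notin> M \<and> (\<exists>c\<in>B. \<epsilon> = \<eta> * c) \<and> fdim k (msum ((*) \<epsilon> ` B) M) M n" for \<epsilon> n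
  have sm: "subsp k (msum ((*) \<epsilon> ` B) M)" "M \<subseteq> msum ((*) \<epsilon> ` B) M" for \<epsilon>
  proof -
    have "0 \<in> (*) \<epsilon> ` B" using b(1) by (intro image_eqI[of _ _ 0]) auto
    then show "M \<subseteq> msum ((*) \<epsilon> ` B) M" by (rule msum_sub2)
  qed (rule subsp_msum[OF subsp_times[OF Bk] Mk])
  have sB: "msum ((*) \<epsilon> ` B) M \<subseteq> B" if "\<epsilon> \<in> B" for \<epsilon>
    using that MB b(4) by (intro msum_least[OF Bk]) auto
  have fdB: "fdim k B M (dd N)" unfolding B_def M_def by (rule fdim_ksp[OF dd subsp_I I_sub(2)])
  have ex: "\<exists>n. fdim k (msum ((*) \<epsilon> ` B) M) M n" if "\<epsilon> \<in> B" for \<epsilon>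
    using fdim_mid[OF kf fdB Mk sm sB[OF that]] by blast
  have \<eta>': "\<eta> \<in> B" "\<eta> \<notin> M" using \<eta> by (simp_all add: B_def M_def)
  have "\<exists>c\<in>B. \<eta> = \<eta> * c" using b(2) by (intro bexI[of _ 1]) auto
  then have "\<exists>n \<epsilon>. P \<epsilon> n" unfolding P_def using \<eta>' ex[OF \<eta>'(1)] by blast
  then have "\<exists>\<epsilon>. P \<epsilon> (LEAST n. \<exists>\<epsilon>. P \<epsilon> n)" by (rule LeastI_ex)
  then obtain \<epsilon> where "P \<epsilon> (LEAST n. \<exists>\<epsilon>. P \<epsilon> n)" ..
  define n0 where "n0 = (LEAST n. \<exists>\<epsilon>. P \<epsilon> n)"
  have "P \<epsilon> n0" unfolding n0_def by fact
  then have e: "\<epsilon> \<in> B" "\<epsilon> \<notin> M" "\<exists>c\<in>B. \<epsilon> = \<eta> * c" "fdim k (msum ((*) \<epsilon> ` B) M) M n0" by (auto simp: P_def)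
  have min: "n0 \<le> n" if "P \<epsilon>' n" for \<epsilon>' n unfolding n0_def using that by (intro Least_le) blast
  have minimal: "\<exists>c\<in>B. \<epsilon> - \<epsilon> * u * c \<in> M" if u: "u \<in> B" "\<epsilon> * u \<notin> M" for u
  proof -
    have eu: "\<epsilon> * u \<in> B" by (rule b(4)[OF e(1) u(1)])
    obtain c where c: "c \<in> B" "\<epsilon> = \<eta> * c" using e(3) by blast
    obtain n where n: "fdim k (msum ((*) (\<epsilon> * u) ` B) M) M n" using ex[OF eu] by blast
    have "\<epsilon> * u = \<eta> * (c * u)" by (simp add: c(2) mult.assoc)
    then have "P (\<epsilon> * u) n" unfolding P_def using eu u(2) n b(4)[OF c(1) u(1)] by blast
    then have nn: "n0 \<le> n" by (rule min)
    have "\<epsilon> * u * d \<in> msum ((*) \<epsilon> ` B) M" if "d \<in> B" for d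
      using msum_sub1[OF subspD(1)[OF kr Mk], of "(*) \<epsilon> ` B"] b(4)[OF u(1) that] by (auto simp: mult.assoc)
    then have "msum ((*) (\<epsilon> * u) ` B) M \<subseteq> msum ((*) \<epsilon> ` B) M" by (intro msum_least[OF sm(1) _ sm(2)]) auto
    then obtain m n' where m: "fdim k (msum ((*) \<epsilon> ` B) M) (msum ((*) (\<epsilon> * u) ` B) M) m"
      "fdim k (msum ((*) (\<epsilon> * u) ` B) M) M n'" "m + n' = n0" using fdim_mid[OF kf e(4) Mk sm] by blast
    then have "m = 0" using fdim_unique[OF kf n m(2) Mk] nn by simp
    then have eq: "msum ((*) \<epsilon> ` B) M = msum ((*) (\<epsilon> * u) ` B) M" using m(1) fdim_0_iff[OF kf sm(1)] by blast
    have "\<epsilon> * 1 + 0 \<in> msum ((*) \<epsilon> ` B) M" using b(2) subspD(1)[OF kr Mk] by (intro msumI) auto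
    then have "\<epsilon> \<in> msum ((*) (\<epsilon> * u) ` B) M" unfolding eq by simp
    then obtain z m' where z: "\<epsilon> = z + m'" "z \<in> (*) (\<epsilon> * u) ` B" "m' \<in> M" by (rule msumE)
    obtain d where d: "z = \<epsilon> * u * d" "d \<in> B" using z(2) by blast
    have dm: "\<epsilon> = \<epsilon> * u * d + m'" using z(1) unfolding d(1) .
    have "\<epsilon> - \<epsilon> * u * d = m'" by (subst dm) simp
    then show ?thesis using d(2) z(3) by metis
  qed
  define Q where "Q = {u\<in>B. u * \<epsilon> \<in> M}"
  have Q': "Q = {u\<in>B. \<exists>b\<in>B. u * \<epsilon> = a * b}" unfolding Q_def Ma by blast
  have MQ: "u \<in> M \<Longrightarrow> u \<in> Q" for u using BM[OF e(1), of u] MB by (auto simp: Q_def mult.commute)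
  have oneQ: "1 \<notin> Q" using e(2) by (simp add: Q_def)
  have zQ: "0 \<in> Q" by (rule MQ[OF subspD(1)[OF kr Mk]])
  \<comment> \<open>Reducedness of \<open>B / M\<close>: a nonzero class does not annihilate
    itself.\<close>
  have eQ: "\<epsilon> \<notin> Q"
  proof
    assume "\<epsilon> \<in> Q"
    then have "\<epsilon> ^ 2 \<in> M" by (simp add: Q_def power2_eq_square)
    then show False using reduced_pow[OF N] e(1,2) by (simp add: B_def M_def)
  qed
  have BQ: "u * w \<in> Q" if "u \<in> B" "w \<in> Q" for u w
    using that BM[of u "w * \<epsilon>"] b(4)[of u w] by (auto simp: Q_def mult.assoc)
  have prm: "u \<in> Q \<or> w \<in> Q" if uw: "u \<in> B" "w \<in> B" "u * w \<in> Q" for u w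
  proof (cases "u \<in> Q")
    case False
    then have "\<epsilon> * u \<notin> M" using uw(1) by (simp add: Q_def mult.commute)
    from minimal[OF uw(1) this] obtain c where c: "c \<in> B" "\<epsilon> - \<epsilon> * u * c \<in> M" by blast
    have "w * (\<epsilon> - \<epsilon> * u * c) + c * (u * w * \<epsilon>) \<in> M"
      using BM[OF uw(2) c(2)] BM[OF c(1), of "u * w * \<epsilon>"] uw(3) by (intro subspD(2)[OF kr Mk]) (auto simp: Q_def)
    moreover have "w * (\<epsilon> - \<epsilon> * u * c) + c * (u * w * \<epsilon>) = w * \<epsilon>" by (simp add: algebra_simps)
    ultimately show ?thesis using uw(2) by (simp add: Q_def)
  qed simp
  define U where "U = B - Q"
  have Um: "u * w \<in> U" if "u \<in> U" "w \<in> U" for u w using that prm b(4) by (auto simp: U_def)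
  have UB: "u \<in> B" "u \<noteq> 0" "u \<notin> Q" if "u \<in> U" for u using that zQ by (auto simp: U_def)
  have U1: "1 \<in> U" using b(2) oneQ by (simp add: U_def)
  \<comment> \<open>Membership of \<open>y ^ q\<close> in the localization, written without forming
    fractions.\<close>
  define V where "V = {y\<in>L. \<exists>w\<in>U. y ^ q * w \<in> B}"
  have VI: "y \<in> V" if "y \<in> L" "w \<in> U" "y ^ q * w \<in> B" for y w using that by (auto simp: V_def)
  have inv: "inverse y \<notin> V" if y: "y ^ q * u = w" "w \<in> Q" "u \<in> U" "y \<noteq> 0" for y u w
  proof
    assume "inverse y \<in> V"
    then obtain d where d: "d \<in> U" "inverse y ^ q * d \<in> B" by (auto simp: V_def)
    have "(inverse y ^ q * d) * (y ^ q * u) = u * d" using y(4) by (simp add: power_inverse field_simps)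
    then have "u * d \<in> Q" using BQ[OF d(2) y(2)] unfolding y(1) by metis
    then show False using UB(3)[OF Um[OF y(3) d(1)]] by blast
  qed
  have Vr: "is_subring V"
    unfolding is_subring_def
  proof (intro conjI ballI)
    show "0 \<in> V" using l(1) b(1) U1 q0 by (intro VI[of _ 1]) (auto simp: power_0_left)
    show "1 \<in> V" using l(2) b(2) U1 by (intro VI[of _ 1]) auto
    fix x assume "x \<in> V"
    then obtain d where d: "x \<in> L" "d \<in> U" "x ^ q * d \<in> B" by (auto simp: V_def)
    have "(- x) ^ q * d = - (x ^ q * d)" unfolding q_def frob_uminus by simp
    then show "- x \<in> V" using d l(5) b(5) by (intro VI[of _ d]) auto
    fix y assume "y \<in> V"
    then obtain g where g: "y \<in> L" "g \<in> U" "y ^ q * g \<in> B" by (auto simp: V_def)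
    have "(x + y) ^ q * (d * g) = g * (x ^ q * d) + d * (y ^ q * g)" unfolding frq by (simp add: algebra_simps)
    also have "\<dots> \<in> B" by (intro b(3) b(4)[OF UB(1)[OF g(2)] d(3)] b(4)[OF UB(1)[OF d(2)] g(3)])
    finally show "x + y \<in> V" by (rule VI[OF l(3)[OF d(1) g(1)] Um[OF d(2) g(2)]])
    have "(x * y) ^ q * (d * g) = (x ^ q * d) * (y ^ q * g)" by (simp add: power_mult_distrib mult_ac)
    also have "\<dots> \<in> B" by (rule b(4)[OF d(3) g(3)])
    finally show "x * y \<in> V" by (rule VI[OF l(4)[OF d(1) g(1)] Um[OF d(2) g(2)]])
  qed
  have kV: "k \<subseteq> V"
  proof
    fix c assume c: "c \<in> k"
    then have "c ^ q \<in> B" using kB b(7) by blast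
    then show "c \<in> V" using c kL U1 by (intro VI[of _ 1]) auto
  qed
  have "a \<in> S N F" using a(1) by (simp add: Fn_def)
  \<comment> \<open>A \<open>q\<close>-th root of the uniformizer \<open>a\<close> of level
    \<open>N\<close> is a uniformizer of \<open>V\<close>.\<close>
  then obtain \<tau> where \<tau>: "\<tau> \<in> L" "\<tau> ^ q = a" using S_root unfolding L_def q_def by blast
  have \<tau>0: "\<tau> \<noteq> 0" using \<tau>(2) a(2) q0 by (auto simp: power_0_left)
  have \<tau>V: "\<tau> \<in> V" using \<tau> aB U1 by (intro VI[of _ 1]) auto
  have \<tau>i: "inverse \<tau> \<notin> V" using \<tau>(2) MQ[OF aM] U1 \<tau>0 by (intro inv[of \<tau> 1 a]) auto
  have dec: "\<exists>u n. u \<in> V \<and> inverse u \<in> V \<and> x = u * \<tau> powi n" if x: "x \<in> L" "x \<noteq> 0" for x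
  proof -
    have x0: "x ^ q \<noteq> 0" using x(2) by simp
    have "x ^ q \<in> ksp k (Fn N)" "inverse (x ^ q) \<in> ksp k (Fn N)" using Lq[OF x(1)] subfieldD(6)[OF LNf] by auto
    then obtain m m' where m: "a ^ m * x ^ q \<in> B" "a ^ m' * inverse (x ^ q) \<in> B"
      unfolding B_def using kI_unif(2)[OF a] by blast
    have "(a ^ m * x ^ q) * (a ^ m' * inverse (x ^ q)) = a ^ (m + m') * 1" using x0 by (simp add: power_add)
    \<comment> \<open>Both \<open>x ^ q\<close> and its inverse have powers of \<open>a\<close> as
      denominators, which is the product hypothesis with \<open>e = 1\<close>.\<close>
    from localization_unit_part[OF Br a(2) Q' e(1) eQ oneQ prm m U1[unfolded U_def] this]
    obtain i u c where c: "u \<in> U" "c \<in> U" "a ^ m * x ^ q * c = a ^ i * u" by (auto simp: U_def)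
    define n where "n = int i - int m"
    define y where "y = x * \<tau> ^ m * inverse (\<tau> ^ i)"
    have y0: "y \<noteq> 0" using x(2) \<tau>0 by (simp add: y_def)
    have yL: "y \<in> L" unfolding y_def by (intro l(4) l(6) l(9) x \<tau>)
    have at: "(\<tau> ^ j) ^ q = a ^ j" for j by (metis \<tau>(2) power_mult mult.commute)
    have "y ^ q * c = (a ^ m * x ^ q * c) * inverse (a ^ i)"
      by (simp add: y_def power_mult_distrib at power_inverse mult_ac)
    also have "\<dots> = u" unfolding c(3) using a(2) by simp
    finally have yc: "y ^ q * c = u" .
    have "y \<in> V" using yc UB(1)[OF c(1)] by (intro VI[OF yL c(2)]) simp
    moreover have "inverse y ^ q * u = c" unfolding yc[symmetric] using y0 by (simp add: power_inverse)
    then have "inverse y \<in> V" using UB(1)[OF c(2)] by (intro VI[OF l(6)[OF yL] c(1)]) simp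
    moreover have "x = y * \<tau> powi n"
      using \<tau>0 by (simp add: y_def n_def power_int_diff)
    ultimately show ?thesis by blast
  qed
  have VF: "V \<inter> F = I 0 0"
  proof
    show "I 0 0 \<subseteq> V \<inter> F"
    proof
      fix y assume y: "y \<in> I 0 0"
      have "S N (I 0 0) \<subseteq> I N 0" using S_I[of 0 0 N] by simp
      then have "y ^ q \<in> I N 0" using S_pow[OF y, of N] unfolding q_def by blast
      then have "y ^ q \<in> B" unfolding B_def by (rule ksp_gen1[OF kr])
      then show "y \<in> V \<inter> F" using y I_sub(2)[of 0 0] FL U1 by (intro IntI VI[of _ 1]) auto
    qed
    show "V \<inter> F \<subseteq> I 0 0"
    proof
      fix y assume y: "y \<in> V \<inter> F"
      show "y \<in> I 0 0"
      proof (rule ccontr)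
        assume n: "y \<notin> I 0 0"
        then have y0: "y \<noteq> 0" and vy: "v y < 0" using y by (auto simp: I_def Fn_0)
        have iF: "inverse y \<in> F" using y subfieldD(6)[OF F] by blast
        have "inverse y ^ q \<in> Fn N" using Fn_frob[of "inverse y" 0 N] iF by (simp add: Fn_0 q_def)
        moreover have "v (inverse y ^ q) = int q * (- v y)" using v_power[OF iF, of q] v_inverse[of y] y y0 by simp
        then have "v (inverse y ^ q) \<ge> 1" using vy q0 by (metis add_0 int_one_le_iff_zero_less minus_le_iff neg_0_less_iff_less of_nat_0_less_iff zero_less_mult_iff)
        ultimately have "inverse y ^ q \<in> I N 1" by (simp add: I_def)
        then have "inverse y ^ q \<in> Q" unfolding M_def[symmetric] by (intro MQ) (simp add: M_def ksp_gen1[OF kr])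
        then have "inverse (inverse y) \<notin> V" using y0 U1 by (intro inv[of "inverse y" 1 "inverse y ^ q"]) auto
        then show False using y by simp
      qed
    qed
  qed
  have "is_prime_of k L V" unfolding is_prime_of_def using Vr kV \<tau>V \<tau>i dec by (auto simp: V_def)
  moreover have "y \<in> pmax V" if y: "y \<in> L" "y ^ q \<in> B" "y ^ q * \<eta> \<in> M" for y
  proof -
    obtain c where c: "c \<in> B" "\<epsilon> = \<eta> * c" using e(3) by blast
    have "y ^ q * \<epsilon> = c * (y ^ q * \<eta>)" by (simp add: c(2) mult_ac)
    then have "y ^ q * \<epsilon> \<in> M" using BM[OF c(1) y(3)] by metis
    then have "y ^ q \<in> Q" using y(2) by (simp add: Q_def)
    then have "y = 0 \<or> inverse y \<notin> V" using U1 inv[of y 1 "y ^ q"] by auto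
    moreover have "y \<in> V" using y(1,2) U1 by (intro VI[of _ 1]) auto
    ultimately show ?thesis by (simp add: pmax_def)
  qed
  ultimately show ?thesis using VF unfolding gen_field_ksp L_def q_def B_def M_def by blast
qed

text \<open>The powers of \<open>x\<close> below \<open>j\<close> stay independent over
  \<open>k\<close> by \<open>descent\<close>, and the cofactor \<open>g\<close> has degree below
  \<open>j\<close>, so it does not vanish modulo the span of \<open>I N 1\<close>. Being annihilated
  by \<open>x - \<beta>\<close> when \<open>f\<close> vanishes at \<open>x\<close>, it serves as
  \<eta> in \<open>prime_above\<close>.\<close>

lemma residue_factor:
  assumes f: "poly_over k f" "degree f = j" "lead_coeff f = 1" and j: "j > 0" and x: "x \<in> I N 0"
    and ind: "\<And>l. l < j \<Longrightarrow> x ^ l \<notin> gspan K (I N 1) (\<lambda>i. x ^ i) l" and r: "\<beta> \<in> k" "poly f \<beta> = 0"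
  obtains g where "poly_over k g" "degree g = j - 1" "f = [:- \<beta>, 1:] * g" "poly g x \<in> ksp k (I N 0)" "poly g x \<notin> ksp k (I N 1)"
proof -
  have "poly_over k [:- \<beta>, 1:]" using r(1) subfieldD[OF kf] by (auto simp: poly_over_pCons poly_over_0[OF kr])
  then have "\<exists>g s. poly_over k g \<and> poly_over k s \<and> f = [:- \<beta>, 1:] * g + s \<and> (\<forall>i\<ge>1. coeff s i = 0)"
    by (intro monic_div[OF kr]) (use f(1) in \<open>auto simp: coeff_pCons split: nat.splits\<close>)
  then obtain g s where g: "poly_over k g" "f = [:- \<beta>, 1:] * g + s" "\<forall>i\<ge>1. coeff s i = 0" by blast
  have "degree s = 0" using g(3) by (intro le_antisym degree_le) auto
  then obtain c where c: "s = [:c:]" by (rule degree_eq_zeroE)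
  then have "c = 0" using r(2) g(2) by simp
  then have fg: "f = [:- \<beta>, 1:] * g" using g(2) c by simp
  have "g \<noteq> 0" using f(3) fg by auto
  then have dg: "degree g = j - 1" using f(2) fg degree_mult_eq[of "[:- \<beta>, 1:]" g] by simp
  have lg: "lead_coeff g = 1" using f(3) fg lead_coeff_mult[of "[:- \<beta>, 1:]" g] by simp
  have xB: "x \<in> ksp k (I N 0)" by (rule ksp_gen1[OF kr x])
  have B: "poly g x \<in> ksp k (I N 0)"
    by (rule poly_over_eval[OF ksp_ring[OF I_ring] poly_over_mono[OF k_ksp[OF I_ring] g(1)] xB])
  have "poly g x \<notin> ksp k (I N 1)"
  proof
    assume M: "poly g x \<in> ksp k (I N 1)"
    have "{..degree g} = {..<j}" using dg j by auto
    then have "(\<Sum>i<j. coeff g i * x ^ i) \<in> ksp k (I N 1)" using M by (simp add: poly_altdef)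
    moreover have "x ^ l \<notin> gspan k (ksp k (I N 1)) (\<lambda>i. x ^ i) l" if "l < j" for l
    proof
      assume "x ^ l \<in> gspan k (ksp k (I N 1)) (\<lambda>i. x ^ i) l"
      then have "x ^ l \<in> ksp k (gspan K (I N 1) (\<lambda>i. x ^ i) l)" unfolding ksp_gspan[OF subsp_I] .
      moreover have xF: "x ^ i \<in> F" for i using subfieldD(9)[OF F] x I_sub(2) by blast
      moreover have "gspan K (I N 1) (\<lambda>i. x ^ i) l \<subseteq> F"
        by (rule gspan_sub[OF K subsp_subring[OF Kr subfield_subring[OF F] KF] I_sub(2) xF])
      ultimately have "x ^ l \<in> gspan K (I N 1) (\<lambda>i. x ^ i) l" by (intro descent[OF subsp_gspan[OF K subsp_I]])
      then show False using ind[OF that] by blast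
    qed
    ultimately have "coeff g (degree g) = 0"
      using gspan_indepD[OF kf subsp_ksp[OF kr], of j "\<lambda>i. x ^ i" "I N 1" "coeff g"] g(1) j dg by (auto simp: poly_over_def)
    then show False using lg by simp
  qed
  then show thesis using that g(1) dg fg B by blast
qed

text \<open>A residue class outside \<open>K\<close> has a separable minimal polynomial of degree at
  least 2, hence two distinct roots in \<open>k\<close>. Each root gives a prime whose maximal ideal
  contains a \<open>q\<close>-th root of \<open>x\<close> minus that root. If the primes agreed, a
  nonzero constant of \<open>k\<close> would be a difference of two non-units.\<close>

lemma non_decomposed_dd:
  assumes N: "sep_residue N" and nd: "non_decomposed k F (I 0 0)"
  shows "dd N = 1"
proof (rule ccontr)
  assume d1: "dd N \<noteq> 1"
  have "I N 0 \<noteq> adj K (I N 1) 1"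
  proof
    assume "I N 0 = adj K (I N 1) 1"
    then have "fdim K (I N 0) (I N 1) (Suc 0)" using fdim_1[OF K one_notin] by simp
    then show False using fdim_unique[OF K dd _ subsp_I] d1 by fastforce
  qed
  moreover have "adj K (I N 1) 1 \<subseteq> I N 0"
    by (rule adj_least[OF K subsp_I I_mono subringD(2)[OF I_ring]]) simp
  ultimately obtain x where x: "x \<in> I N 0" "x \<notin> adj K (I N 1) 1" by blast
  obtain f j where f: "poly_over K f" "degree f = j" "lead_coeff f = 1" "coprime f (pderiv f)" "poly f x \<in> I N 1"
    and ind: "\<And>l. l < j \<Longrightarrow> x ^ l \<notin> gspan K (I N 1) (\<lambda>i. x ^ i) l"
    using minimal_poly[OF N x(1)] by blast
  have fk: "poly_over k f" by (rule poly_over_mono[OF Kk f(1)])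
  have j0: "j \<noteq> 0"
  proof
    assume "j = 0"
    then obtain c where "f = [:c:]" using f(2) degree_eq_zeroE by blast
    then show False using f(3,5) one_notin by simp
  qed
  have j1: "j \<noteq> 1"
  proof
    assume "j = 1"
    then obtain c d where cd: "f = [:c, d:]" using f(2) degree1_coeffs by blast
    then have "d = 1" using f(2,3) \<open>j = 1\<close> by (auto split: if_splits)
    then have "x + c \<in> I N 1" using f(5) cd by (simp add: add.commute)
    moreover have "- c \<in> K" using f(1) cd subfieldD(5)[OF K] by (simp add: poly_over_pCons)
    ultimately have "(x + c) + (- c) * 1 \<in> adj K (I N 1) 1" by (rule adjI)
    then show False using x(2) by simp
  qed
  have root: "\<exists>\<beta>\<in>k. poly g \<beta> = 0" if "poly_over k g" "degree g > 0" for g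
    using ac that unfolding is_alg_closure_in_def by blast
  obtain \<beta> where \<beta>: "\<beta> \<in> k" "poly f \<beta> = 0" using root[OF fk] f(2) j0 by auto
  have jp: "j > 0" using j0 by simp
  obtain g where g: "poly_over k g" "degree g = j - 1" "f = [:- \<beta>, 1:] * g" "poly g x \<in> ksp k (I N 0)" "poly g x \<notin> ksp k (I N 1)"
    using residue_factor[OF fk f(2,3) jp x(1) ind \<beta>] by metis
  obtain \<gamma> where \<gamma>: "\<gamma> \<in> k" "poly g \<gamma> = 0" using root[OF g(1)] g(2) j0 j1 by auto
  have f\<gamma>: "poly f \<gamma> = 0" unfolding g(3) using \<gamma>(2) by simp
  obtain h where h: "f = [:- \<gamma>, 1:] * h" "poly h x \<in> ksp k (I N 0)" "poly h x \<notin> ksp k (I N 1)"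
    using residue_factor[OF fk f(2,3) jp x(1) ind \<gamma>(1) f\<gamma>] by metis
  have ne: "\<beta> \<noteq> \<gamma>"
  proof
    assume eq: "\<beta> = \<gamma>"
    have "[:- \<gamma>, 1:] dvd f" unfolding h(1) by (rule dvd_triv_left)
    moreover have "[:- \<gamma>, 1:] dvd pderiv f"
    proof -
      have "poly (pderiv f) \<gamma> = 0" unfolding g(3) pderiv_mult using \<gamma>(2) eq by (simp add: pderiv_pCons)
      then show ?thesis by (simp add: poly_eq_0_iff_dvd)
    qed
    ultimately have "is_unit [:- \<gamma>, 1:]" using f(4) not_coprimeI by blast
    then show False by (simp add: is_unit_iff_degree)
  qed
  have xS: "x \<in> Fn N" using x(1) I_sub(1) by blast
  have kLN: "k \<subseteq> ksp k (Fn N)" by (rule k_ksp[OF Fn_ring])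
  have y: "\<exists>y\<in>ksp k F. y ^ (p ^ N) = x - c" if "c \<in> k" for c
  proof (rule ksp_S_root)
    have "x - c \<in> ksp k (Fn N)"
      using ksp_gen1[OF kr xS] kLN that subringD(6)[OF ksp_ring[OF Fn_ring]] by blast
    then show "x - c \<in> ksp k (S N F)" by (simp add: Fn_def)
  qed
  obtain y where y1: "y \<in> ksp k F" "y ^ (p ^ N) = x - \<beta>" using y[OF \<beta>(1)] by blast
  obtain z where z1: "z \<in> ksp k F" "z ^ (p ^ N) = x - \<gamma>" using y[OF \<gamma>(1)] by blast
  have fM: "poly f x \<in> ksp k (I N 1)" by (rule ksp_gen1[OF kr f(5)])
  have xc: "x - c \<in> ksp k (I N 0)" if "c \<in> k" for c
    using ksp_gen1[OF kr x(1)] k_ksp[OF I_ring] that subringD(6)[OF ksp_ring[OF I_ring]] by blast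
  obtain V where V: "is_prime_of k (gen_field (k \<union> F)) V" "V \<inter> F = I 0 0"
    "\<And>y. y \<in> ksp k F \<Longrightarrow> y ^ (p ^ N) \<in> ksp k (I N 0) \<Longrightarrow> y ^ (p ^ N) * poly g x \<in> ksp k (I N 1) \<Longrightarrow> y \<in> pmax V"
    using prime_above[OF N g(4,5)] by blast
  obtain W where W: "is_prime_of k (gen_field (k \<union> F)) W" "W \<inter> F = I 0 0"
    "\<And>y. y \<in> ksp k F \<Longrightarrow> y ^ (p ^ N) \<in> ksp k (I N 0) \<Longrightarrow> y ^ (p ^ N) * poly h x \<in> ksp k (I N 1) \<Longrightarrow> y \<in> pmax W"
    using prime_above[OF N h(2,3)] by blast
  have "poly f x = (x - \<beta>) * poly g x" "poly f x = (x - \<gamma>) * poly h x"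
    by (subst g(3), simp add: algebra_simps) (subst h(1), simp add: algebra_simps)
  then have "y \<in> pmax V" "z \<in> pmax W"
    using fM xc \<beta>(1) \<gamma>(1) by (auto intro!: V(3)[OF y1(1)] W(3)[OF z1(1)] simp: y1(2) z1(2))
  moreover have "V = W" using nd V(1,2) W(1,2) unfolding non_decomposed_def by blast
  ultimately have yz: "y \<in> pmax V" "z \<in> pmax V" by auto
  have "(y - z) ^ (p ^ N) = \<gamma> - \<beta>" by (simp add: frob_diff y1 z1)
  moreover obtain d where "d \<in> k" "d ^ (p ^ N) = \<gamma> - \<beta>" using k_root[OF subfieldD(7)[OF kf \<gamma>(1) \<beta>(1)]] by blast
  ultimately have "y - z \<in> k" using frob_inj[of "y - z" N d] by simp
  then have "inverse (y - z) \<in> V" using subfieldD(6)[OF kf] V(1) unfolding is_prime_of_def by blast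
  then have "y = z" by (rule pmax_diff_not_unit[OF gen_field_subfield V(1) yz])
  then show False using ne y1(2) z1(2) by simp
qed

end

section \<open>From integers to the logarithmic bounds\<close>

lemma log_bound_imp:
  assumes "p > 1" "s > 0" and "log (real p) (2 * real \<delta> / real s + 1) \<le> real m"
  shows "2 * \<delta> + s \<le> s * p ^ m"
proof -
  have "2 * real \<delta> / real s + 1 > 0" by (simp add: add_nonneg_pos)
  then have "2 * real \<delta> / real s + 1 \<le> real p powr real m" using assms by (subst (asm) log_le_iff) auto
  then have "2 * real \<delta> / real s + 1 \<le> real p ^ m" using assms(1) by (simp add: powr_realpow)
  then have "2 * real \<delta> + real s \<le> real s * real p ^ m" using assms(2) by (simp add: field_simps)
  then have "real (2 * \<delta> + s) \<le> real (s * p ^ m)" by simp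
  then show ?thesis by (simp only: of_nat_le_iff)
qed

lemma cons_pow_sumI:
  assumes "p > 1" "s > 0" "j \<le> i" "2 * \<delta> = (p - 1) * s * (\<Sum>k=j..i. p ^ k)"
  shows "cons_pow_sum p (2 / (real p - 1) * (real \<delta> / real s))"
proof -
  have "2 * real \<delta> = real (2 * \<delta>)" by simp
  also have "\<dots> = (real p - 1) * real s * (\<Sum>k=j..i. real p ^ k)"
    unfolding assms(4) using assms(1) by (simp add: of_nat_diff)
  finally have "2 / (real p - 1) * (real \<delta> / real s) = (\<Sum>k=j..i. real p ^ k)"
    using assms(1,2) by (simp add: field_simps)
  then show ?thesis unfolding cons_pow_sum_def using assms(3) by blast
qed

theorem theorem2p21:
  fixes K F Kbar Op :: "'a::field set" and p :: nat
  assumes char: "prime p" "of_nat p = (0::'a)"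
    and ff: "one_dim_sep_function_field K F"
    and cl: "is_alg_closure_in K Kbar" "lin_disjoint K Kbar F"
    and pr: "is_prime_of K F Op"
    and sing: "sing_deg Kbar F Op > 0"
  shows
    "(\<forall>n::nat. real n \<ge> log (real p) (2 * real (sing_deg Kbar F Op) / real (sep_deg K Op) + 1)
        \<longrightarrow> separable_prime K (Op \<inter> frob_pullback p K F n))
     \<and> (\<not> cons_pow_sum p (2 / (real p - 1) * (real (sing_deg Kbar F Op) / real (sep_deg K Op)))
        \<longrightarrow> (\<forall>n::nat. real n \<ge> log (real p) (2 * real (sing_deg Kbar F Op) / real (sep_deg K Op) + 1) - 1
              \<longrightarrow> separable_prime K (Op \<inter> frob_pullback p K F n)))
     \<and> (non_decomposed Kbar F Op \<longrightarrow>
          (\<forall>n::nat. real n \<ge> log (real p) (2 * real (sing_deg Kbar F Op) + 1)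
             \<longrightarrow> rational_prime K (Op \<inter> frob_pullback p K F n))
        \<and> (\<not> cons_pow_sum p (2 / (real p - 1) * real (sing_deg Kbar F Op))
             \<longrightarrow> (\<forall>n::nat. real n \<ge> log (real p) (2 * real (sing_deg Kbar F Op) + 1) - 1
                   \<longrightarrow> rational_prime K (Op \<inter> frob_pullback p K F n))))"
proof -
  interpret T: ffield p K Kbar F Op
    using char ff cl pr by unfold_locales (auto simp: one_dim_sep_function_field_def)
  obtain N where N: "T.sep_residue N" using T.sep_residue_ex by blast
  obtain \<delta> where \<delta>: "fdim K (T.I N 0) (T.S N (T.I 0 0)) \<delta>" and main: "\<delta> > 0 \<Longrightarrow> T.dd n \<noteq> T.dd N \<Longrightarrow>
      T.dd N * p ^ n \<le> 2 * \<delta> \<and> (2 * \<delta> + T.dd N \<le> T.dd N * p ^ (n + 1) \<longrightarrow>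
        (\<exists>j i. j \<le> i \<and> 2 * \<delta> = (p - 1) * T.dd N * (\<Sum>k=j..i. p ^ k)))" for n
    using T.degree_bound[OF N] by blast
  define s where "s = T.dd N"
  have s0: "s > 0" unfolding s_def by (rule T.dd_pos)
  have sd: "sing_deg Kbar F Op = \<delta>" using T.sing_deg_eq[OF N \<delta>] by (simp add: T.I00)
  have sp: "sep_deg K Op = s" using T.sep_deg_eq[OF N] by (simp add: T.I00 s_def)
  have \<delta>0: "\<delta> > 0" using sing sd by simp
  have pn: "Op \<inter> frob_pullback p K F n = T.I n 0" for n
    using T.I_inter[of 0 n 0] by (simp add: T.frob_pullback_eq T.Fn_def T.I00)
  have 1: "T.dd n = s" if "real n \<ge> log (real p) (2 * real \<delta> / real s + 1)" for n
  proof (rule ccontr)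
    assume "T.dd n \<noteq> s"
    then have "s * p ^ n \<le> 2 * \<delta>" using main[OF \<delta>0, of n] by (simp add: s_def)
    then show False using log_bound_imp[OF T.p_gt1 s0 that] s0 by simp
  qed
  \<comment> \<open>The bound with \<open>- 1\<close> is the first bound for \<open>n + 1\<close>;
    there \<open>degree_bound\<close> leaves only sums of consecutive powers as exceptions.\<close>
  have 2: "T.dd n = s" if "\<not> cons_pow_sum p (2 / (real p - 1) * (real \<delta> / real s))"
      "real n \<ge> log (real p) (2 * real \<delta> / real s + 1) - 1" for n
  proof (rule ccontr)
    assume "T.dd n \<noteq> s"
    moreover have "log (real p) (2 * real \<delta> / real s + 1) \<le> real (n + 1)" using that(2) by simp
    then have "2 * \<delta> + s \<le> s * p ^ (n + 1)" by (rule log_bound_imp[OF T.p_gt1 s0])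
    ultimately obtain j i where "j \<le> i" "2 * \<delta> = (p - 1) * s * (\<Sum>k=j..i. p ^ k)"
      using main[OF \<delta>0, of n] unfolding s_def by blast
    then show False using cons_pow_sumI[OF T.p_gt1 s0] that(1) by blast
  qed
  have sep: "separable_prime K (T.I n 0)" if "T.dd n = s" for n
    by (rule T.separable_prime_I[OF N]) (use that in \<open>simp add: s_def\<close>)
  have rat: "rational_prime K (T.I n 0)" if "T.dd n = 1" for n
    unfolding rational_prime_def T.prime_deg_I by (rule that)
  \<comment> \<open>With \<open>s = 1\<close> the bounds of (ii) become those of (i), and degree
    equal to the separable degree means degree 1.\<close>
  have s1: "s = 1" if "non_decomposed Kbar F Op"
    using T.non_decomposed_dd[OF N] that by (simp add: T.I00 s_def)
  show ?thesis unfolding sd sp pn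
  proof (intro conjI allI impI)
    assume nd: "non_decomposed Kbar F Op"
    show "rational_prime K (T.I n 0)" if "real n \<ge> log (real p) (2 * real \<delta> + 1)" for n
      using 1[of n] that s1[OF nd] by (intro rat) simp
    show "rational_prime K (T.I n 0)" if "\<not> cons_pow_sum p (2 / (real p - 1) * real \<delta>)"
      "real n \<ge> log (real p) (2 * real \<delta> + 1) - 1" for n
      using 2[of n] that s1[OF nd] by (intro rat) simp
  qed (use 1 2 sep in blast)+
qed

end
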